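(* Let $m\ge 2$, let $\mathcal N(\sigma_1,\ldots,\sigma_m)$ be a Nikishin system with $\operatorname{Co}(\operatorname{supp}\sigma_j)=\Delta_j$, and let $r_k=v_k/t_k$, $k=1,\ldots,m$, be rational functions with real coefficients, $\deg v_k<\deg t_k$, $v_k,t_k$ coprime. Let $T=\operatorname{lcm}(t_1,\ldots,t_m)$ and $D=\deg T$. For each $n\in\mathbb N$ let $a_{n,0},a_{n,1},\ldots,a_{n,m}$ be multi-level Hermite-Padé polynomials associated with $\mathcal N(\sigma_1,\ldots,\sigma_m)$ and $(r_1,\ldots,r_m)$. Set $$f:=\widehat s_{m,1}-\sum_{k=1}^{m-1}(-1)^k\,\widehat s_{m,k+1}\,r_k-(-1)^m r_m .$$ Assume that the zeros of $T$ lie in the complement of $\Delta_1\cup\Delta_m$ and that $f$ has exactly $D$ poles (counting multiplicities) in $\mathbb C\setminus\Delta_m$. Suppose that either the sequence of moments of $\sigma_m$ satisfies Carleman's condition or $\Delta_{m-1}$ is a bounded interval. Then $$\lim_{n\to\infty}\frac{a_{n,j}}{a_{n,m}}=\widehat s_{m,j+1},\qquad j=1,\ldots,m-1,\qquad\text{and}\qquad \lim_{n\to\infty}\frac{a_{n,0}}{a_{n,m}}=f,$$ uniformly on each compact subset of $\mathbb C\setminus(\Delta_m\cup\{z:T(z)=0\})$. Moreover, for all sufficiently large $n$, $\deg a_{n,m}=n$, and $a_{n,m}$ has exactly $n-D$ simple zeros in the interior of $\Delta_m$ and $D$ zeros in $\mathbb C\setminus\Delta_m$, which converge to the poles of $f$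 in this region according to their order. For each $j=1,\ldots,m-1$ and all sufficiently large $n$, the polynomial $a_{n,j}$ has at least $n-D-m+j$ sign changes in $\Delta_m$ and at least $D$ zeros in $\mathbb C\setminus\Delta_m$, of which $D$ converge to the zeros of $T$ according to their multiplicity, and the remaining ones accumulate on $\Delta_m\cup\{\infty\}$.
   Context: Measures. For an interval $\Delta\subset\mathbb R$, $\mathcal M(\Delta)$ is the class of Borel measures $s$ on $\mathbb R$ of constant sign, with infinite support, with all moments $c_n=\int x^n\,ds(x)$, $n\ge 0$, finite, and such that the smallest interval containing $\operatorname{supp}s$ (its convex hull $\operatorname{Co}(\operatorname{supp} s)$) is $\Delta$; supports and intervals may be unbounded. The Cauchy transform is $\widehat s(z)=\int\frac{ds(x)}{z-x}$, holomorphic in $\mathbb C\setminus\Delta$. The measure $s$ satisfies Carleman's condition if $\sum_{n}|c_n|^{-1/(2n)}=\infty$, the sum being over $n\ge1$ with $c_n\ne0$. Products and Nikishin systems. For measures $\sigma_\alpha\in\mathcal M(\Delta_\alpha)$, $\sigma_\beta\in\mathcal M(\Delta_\beta)$ on disjoint intervals with $\widehat\sigma_\beta\in L_1(\sigma_\alpha)$, $\langle\sigma_\alpha,\sigma_\beta\rangle$ is the measure $d\langle\sigma_\alpha,\sigma_\beta\rangle(x)=\widehat\sigma_\beta(x)\,d\sigma_\alpha(x)$. Iterated products are defined by $\langle\sigma_\alpha,\sigma_\beta,\sigma_\gamma\rangle=\langle\sigma_\alpha,\langle\sigma_\beta,\sigma_\gamma\rangle\rangle$, etc. (the integrability needed and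 finiteness of moments being assumed). Let $\Delta_1,\ldots,\Delta_m$ be intervals with $\Delta_j\cap\Delta_{j+1}=\emptyset$, $j=1,\ldots,m-1$, and $\sigma_j\in\mathcal M(\Delta_j)$ with $\operatorname{Co}(\operatorname{supp}\sigma_j)=\Delta_j$. For $1\le j\le k\le m$ put $s_{j,k}=\langle\sigma_j,\sigma_{j+1},\ldots,\sigma_k\rangle$ and $s_{k,j}=\langle\sigma_k,\sigma_{k-1},\ldots,\sigma_j\rangle$ (so $s_{j,j}=\sigma_j$). Then $(s_{1,1},\ldots,s_{1,m})=\mathcal N(\sigma_1,\ldots,\sigma_m)$ is the Nikishin system generated by $(\sigma_1,\ldots,\sigma_m)$. Multi-level Hermite-Padé polynomials. For $n\in\mathbb N$, these are polynomials $a_{n,0},\ldots,a_{n,m}$ with real coefficients, not all identically zero, with $\deg a_{n,j}\le n-1$ for $j=0,\ldots,m-1$ and $\deg a_{n,m}\le n$, such that $$\mathcal A_{n,0}:=a_{n,0}+\sum_{k=1}^m(-1)^k a_{n,k}(\widehat s_{1,k}+r_k)=\mathcal O(1/z^{n+1}),$$ $$\mathcal A_{n,j}:=(-1)^j a_{n,j}+\sum_{k=j+1}^m(-1)^k a_{n,k}\widehat s_{j+1,k}=\mathcal O(1/z),\qquad j=1,\ldots,m-1,$$ where $\mathcal O(\cdot)$ is as $z\to\infty$ along paths non-tangential to the supports of the measures involved. Such polynomials always exist but need not be unique. If $r_k\equiv0$ take $v_k=0$, $t_k=1$. Zeros of $a_{n,m}$ "converge to the poles of $f$ according to their order" means: if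 $\zeta\in\mathbb C\setminus\Delta_m$ is a pole of $f$ of order $\tau$, then for each sufficiently small $\varepsilon>0$ and all sufficiently large $n$, $a_{n,m}$ has exactly $\tau$ zeros (with multiplicity) in $\{|z-\zeta|<\varepsilon\}$; analogously for zeros of $a_{n,j}$ converging to zeros of $T$ according to multiplicity. *)

theory Defs
  imports
    "HOL-Complex_Analysis.Complex_Analysis"
    "HOL-Computational_Algebra.Field_as_Ring"
    "HOL-Computational_Algebra.Polynomial_Factorial"
    "HOL-Library.Landau_Symbols"
begin

section \<open>Measures of constant sign\<close>

text \<open>A measure of constant sign is represented by its sign (\<open>1\<close> or \<open>-1\<close>) together
  with its total variation: the pair \<open>(e, M)\<close> stands for the measure \<open>e M\<close>.\<close>

type_synonym smeasure = "real \<times> real measure"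

definition msupp :: "smeasure \<Rightarrow> real set" where
  "msupp s = {x. \<forall>U. open U \<and> x \<in> U \<longrightarrow> emeasure (snd s) U \<noteq> 0}"

definition moment :: "smeasure \<Rightarrow> nat \<Rightarrow> real" where
  "moment s n = fst s * (\<integral>x. x ^ n \<partial>snd s)"

definition finite_moments :: "smeasure \<Rightarrow> bool" where
  "finite_moments s \<longleftrightarrow> (\<forall>n::nat. integrable (snd s) (\<lambda>x. x ^ n))"

definition meas_class :: "real set \<Rightarrow> smeasure set" where
  "meas_class \<Delta> = {s. fst s \<in> {1, -1} \<and> sets (snd s) = sets borel \<and>
     infinite (msupp s) \<and> finite_moments s \<and> convex hull (msupp s) = \<Delta>}"

definition cauchy :: "smeasure \<Rightarrow> complex \<Rightarrow> complex" where
  "cauchy s z = of_real (fst s) * (\<integral>x. 1 / (z - of_real x) \<partial>snd s)"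

definition carleman :: "smeasure \<Rightarrow> bool" where
  "carleman s \<longleftrightarrow> \<not> summable (\<lambda>n::nat. if n \<ge> 1 \<and> moment s n \<noteq> 0
     then \<bar>moment s n\<bar> powr (- 1 / (2 * real n)) else 0)"

section \<open>Products and Nikishin systems\<close>

text \<open>The Cauchy transform of \<open>b\<close> is real on the real line off the support of \<open>b\<close>, and of
  constant sign on an interval disjoint from the convex hull of that support. When \<open>a\<close>
  lives on such an interval, the measure with density \<open>cauchy b\<close> with respect to \<open>a\<close> is
  therefore of constant sign; its sign and its total variation are the two components below
  (lemma \<open>integral_mprod\<close>).\<close>

definition mprod :: "smeasure \<Rightarrow> smeasure \<Rightarrow> smeasure" where
  "mprod a b =
     (fst a * (if AE x in snd a. 0 \<le> Re (cauchy b (of_real x)) then 1 else -1),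
      density (snd a) (\<lambda>x. ennreal \<bar>Re (cauchy b (of_real x))\<bar>))"

lemma integral_mprod:
  fixes g :: "real \<Rightarrow> real"
  assumes "(AE x in snd a. 0 \<le> Re (cauchy b (of_real x))) \<or>
           (AE x in snd a. Re (cauchy b (of_real x)) \<le> 0)"
    and [measurable]: "(\<lambda>x. Re (cauchy b (of_real x))) \<in> borel_measurable (snd a)"
    and [measurable]: "g \<in> borel_measurable (snd a)"
  shows "fst (mprod a b) * (\<integral>x. g x \<partial>snd (mprod a b)) =
         fst a * (\<integral>x. g x * Re (cauchy b (of_real x)) \<partial>snd a)"
proof -
  let ?h = "\<lambda>x. Re (cauchy b (of_real x))"
  have dens: "(\<integral>x. g x \<partial>snd (mprod a b)) = (\<integral>x. \<bar>?h x\<bar> * g x \<partial>snd a)"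
    unfolding mprod_def by (simp add: integral_density)
  show ?thesis
  proof (cases "AE x in snd a. 0 \<le> ?h x")
    case True
    have "(\<integral>x. \<bar>?h x\<bar> * g x \<partial>snd a) = (\<integral>x. g x * ?h x \<partial>snd a)"
      by (rule integral_cong_AE) (use True in auto)
    then show ?thesis using True dens by (simp add: mprod_def)
  next
    case False
    then have neg: "AE x in snd a. ?h x \<le> 0" using assms(1) by blast
    have "(\<integral>x. \<bar>?h x\<bar> * g x \<partial>snd a) = (\<integral>x. - (g x * ?h x) \<partial>snd a)"
      by (rule integral_cong_AE) (use neg in auto)
    then show ?thesis using False dens by (simp add: mprod_def)
  qed
qed

fun iter_mprod :: "smeasure list \<Rightarrow> smeasure" where
  "iter_mprod [s] = s"
| "iter_mprod (s # s' # ss) = mprod s (iter_mprod (s' # ss))"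

definition nik :: "(nat \<Rightarrow> smeasure) \<Rightarrow> nat \<Rightarrow> nat \<Rightarrow> smeasure" where
  "nik \<sigma> j k = iter_mprod (map \<sigma> (if j \<le> k then [j..<Suc k] else rev [k..<Suc j]))"

text \<open>Finiteness of the zeroth moment of \<open>mprod a b\<close> says that \<open>cauchy b\<close> is integrable
  with respect to \<open>a\<close>, so the last clause comprises the integrability of all Cauchy
  transforms used in forming the products.\<close>

definition nikishin_generators ::
    "nat \<Rightarrow> (nat \<Rightarrow> smeasure) \<Rightarrow> (nat \<Rightarrow> real set) \<Rightarrow> bool" where
  "nikishin_generators m \<sigma> \<Delta> \<longleftrightarrow>
     (\<forall>j\<in>{1..m}. \<sigma> j \<in> meas_class (\<Delta> j)) \<and>
     (\<forall>j\<in>{1..<m}. \<Delta> j \<inter> \<Delta> (Suc j) = {}) \<and>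
     (\<forall>j\<in>{1..m}. \<forall>k\<in>{1..m}. finite_moments (nik \<sigma> j k))"

section \<open>Multi-level Hermite-Pade polynomials\<close>

abbreviation cpoly :: "real poly \<Rightarrow> complex poly" where
  "cpoly \<equiv> map_poly of_real"

definition ratfun :: "real poly \<Rightarrow> real poly \<Rightarrow> complex \<Rightarrow> complex" where
  "ratfun v t z = poly (cpoly v) z / poly (cpoly t) z"

text \<open>The zero polynomial has degree \<open>-\<infinity>\<close> in the condition \<open>deg v < deg t\<close>, but degree
  \<open>0\<close> in the library; hence the separate case.\<close>

definition rational_data :: "real poly \<Rightarrow> real poly \<Rightarrow> bool" where
  "rational_data v t \<longleftrightarrow> (v = 0 \<and> t = 1) \<or> (degree v < degree t \<and> coprime v t)"

text \<open>Non-tangential approach to infinity with respect to \<open>S\<close>: every path tending to infinity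
  non-tangentially to \<open>S\<close> eventually stays in one of the regions
  \<open>{z. dist z S \<ge> \<delta> |z|}\<close>, \<open>\<delta> > 0\<close>. For bounded \<open>S\<close> and \<open>\<delta> < 1\<close> this is unrestricted
  convergence to infinity.\<close>

definition nontangential :: "real set \<Rightarrow> real \<Rightarrow> complex filter" where
  "nontangential S \<delta> = inf at_infinity
     (principal {z. \<delta> * cmod z \<le> infdist z (of_real ` S)})"

definition order_at_infinity :: "real set \<Rightarrow> nat \<Rightarrow> (complex \<Rightarrow> complex) \<Rightarrow> bool" where
  "order_at_infinity S N A \<longleftrightarrow> (\<forall>\<delta>>0. A \<in> O[nontangential S \<delta>](\<lambda>z. 1 / z ^ N))"

definition form_zero :: "nat \<Rightarrow> (nat \<Rightarrow> smeasure) \<Rightarrow> (nat \<Rightarrow> real poly) \<Rightarrow> (nat \<Rightarrow> real poly)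
    \<Rightarrow> (nat \<Rightarrow> real poly) \<Rightarrow> complex \<Rightarrow> complex" where
  "form_zero m \<sigma> v t p z = poly (cpoly (p 0)) z +
     (\<Sum>k=1..m. (-1) ^ k * poly (cpoly (p k)) z *
        (cauchy (nik \<sigma> 1 k) z + ratfun (v k) (t k) z))"

definition form_level :: "nat \<Rightarrow> (nat \<Rightarrow> smeasure) \<Rightarrow> (nat \<Rightarrow> real poly) \<Rightarrow> nat
    \<Rightarrow> complex \<Rightarrow> complex" where
  "form_level m \<sigma> p j z = (-1) ^ j * poly (cpoly (p j)) z +
     (\<Sum>k=Suc j..m. (-1) ^ k * poly (cpoly (p k)) z * cauchy (nik \<sigma> (Suc j) k) z)"

text \<open>All the measures \<open>nik \<sigma> j k\<close>, \<open>k \<ge> j\<close>, occurring in one form have the support of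
  \<open>\<sigma> j\<close>.\<close>

definition mlhp :: "nat \<Rightarrow> (nat \<Rightarrow> smeasure) \<Rightarrow> (nat \<Rightarrow> real poly) \<Rightarrow> (nat \<Rightarrow> real poly)
    \<Rightarrow> nat \<Rightarrow> (nat \<Rightarrow> real poly) \<Rightarrow> bool" where
  "mlhp m \<sigma> v t n p \<longleftrightarrow>
     (\<exists>j\<in>{0..m}. p j \<noteq> 0) \<and>
     (\<forall>j\<in>{0..<m}. degree (p j) \<le> n - 1) \<and> degree (p m) \<le> n \<and>
     order_at_infinity (msupp (\<sigma> 1)) (n + 1) (form_zero m \<sigma> v t p) \<and>
     (\<forall>j\<in>{1..<m}. order_at_infinity (msupp (\<sigma> (Suc j))) 1 (form_level m \<sigma> p j))"

definition limit_fun :: "nat \<Rightarrow> (nat \<Rightarrow> smeasure) \<Rightarrow> (nat \<Rightarrow> real poly) \<Rightarrow> (nat \<Rightarrow> real poly)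
    \<Rightarrow> complex \<Rightarrow> complex" where
  "limit_fun m \<sigma> v t z = cauchy (nik \<sigma> m 1) z
     - (\<Sum>k=1..<m. (-1) ^ k * cauchy (nik \<sigma> m (Suc k)) z * ratfun (v k) (t k) z)
     - (-1) ^ m * ratfun (v m) (t m) z"

section \<open>Zeros, poles, sign changes and convergence\<close>

text \<open>Number of zeros in \<open>S\<close> with multiplicity; it is meaningful for nonzero polynomials
  (a sum over an infinite set is \<open>0\<close>).\<close>

definition zero_count :: "complex poly \<Rightarrow> complex set \<Rightarrow> nat" where
  "zero_count p S = (\<Sum>z | z \<in> S \<and> poly p z = 0. order z p)"

definition pole_order :: "(complex \<Rightarrow> complex) \<Rightarrow> complex \<Rightarrow> nat" where
  "pole_order f z = nat (- zorder f z)"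

definition pole_set :: "(complex \<Rightarrow> complex) \<Rightarrow> complex set \<Rightarrow> complex set" where
  "pole_set f S = {z \<in> S. is_pole f z}"

definition attracts_zeros :: "(nat \<Rightarrow> complex poly) \<Rightarrow> complex \<Rightarrow> nat \<Rightarrow> bool" where
  "attracts_zeros p \<zeta> \<tau> \<longleftrightarrow> (\<exists>\<epsilon>0>0. \<forall>\<epsilon>. 0 < \<epsilon> \<and> \<epsilon> < \<epsilon>0 \<longrightarrow>
     (\<forall>\<^sub>F n in sequentially. zero_count (p n) (ball \<zeta> \<epsilon>) = \<tau>))"

definition sign_changes_at_least :: "real poly \<Rightarrow> real set \<Rightarrow> nat \<Rightarrow> bool" where
  "sign_changes_at_least p S N \<longleftrightarrow> (\<exists>x :: nat \<Rightarrow> real. (\<forall>i\<le>N. x i \<in> S) \<and>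
     (\<forall>i<N. x i < x (Suc i) \<and> poly p (x i) * poly p (x (Suc i)) < 0))"

text \<open>Uniform convergence of the quotients on \<open>K\<close>, including that the quotients are defined
  on \<open>K\<close> from some index on (division by zero yields \<open>0\<close> in the library).\<close>

definition quotient_converges_on :: "complex set \<Rightarrow> (nat \<Rightarrow> complex poly) \<Rightarrow> (nat \<Rightarrow> complex poly)
    \<Rightarrow> (complex \<Rightarrow> complex) \<Rightarrow> bool" where
  "quotient_converges_on K p q g \<longleftrightarrow>
     (\<forall>\<^sub>F n in sequentially. \<forall>z\<in>K. poly (q n) z \<noteq> 0) \<and>
     uniform_limit K (\<lambda>n z. poly (p n) z / poly (q n) z) g sequentially"

text \<open>The zeros of \<open>p n\<close>, apart from those near \<open>Z\<close>, accumulate only on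
  \<open>\<Delta> \<union> {\<infinity>}\<close>.\<close>

definition other_zeros_accumulate ::
    "(nat \<Rightarrow> complex poly) \<Rightarrow> complex set \<Rightarrow> complex set \<Rightarrow> bool" where
  "other_zeros_accumulate p Z \<Delta> \<longleftrightarrow> (\<forall>\<epsilon>>0. \<forall>\<^sub>F n in sequentially. \<forall>z.
     poly (p n) z = 0 \<longrightarrow>
       (\<exists>\<zeta>\<in>Z. dist z \<zeta> < \<epsilon>) \<or> infdist z \<Delta> < \<epsilon> \<or> cmod z > 1 / \<epsilon>)"

end

theory Submission
 imports Defs "HOL-Computational_Algebra.Fundamental_Theorem_Algebra"
begin

text \<open>
Write \<open>B\<^sub>i\<close> for the forms of level \<open>i\<close>, so that \<open>B\<^sub>m = \<plusminus> a\<^sub>m\<close>. Each \<open>B\<^sub>i\<close> is the Cauchy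
transform of \<open>B\<^sub>i\<^sub>+\<^sub>1\<close> against \<open>\<sigma>\<^sub>i\<^sub>+\<^sub>1\<close>; the decay at infinity gives orthogonality, hence
zeros, and passing upwards \<open>a\<^sub>m\<close> keeps \<open>n - D\<close> sign changes on \<open>\<Delta>\<^sub>m\<close>. Eliminating the
intermediate measures one at a time turns the forms into linear forms in the inverted system; every
step costs a bounded number of sign changes, because the new form takes at the old zeros the values
of the weights of a quadrature rule, and these are almost all positive. In the end the remainder
of \<open>a\<^sub>j / a\<^sub>m\<close> (or of \<open>a\<^sub>0 / a\<^sub>m\<close>, after multiplication by \<open>T\<close>) vanishes at \<open>n - O(1)\<close>
points of \<open>\<Delta>\<^sub>m\<^sub>-\<^sub>1\<close>, so \<open>a\<^sub>m\<close> is orthogonal on \<open>\<Delta>\<^sub>m\<close> with respect to a varying weight.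

Split off the sign-changing nodes, \<open>a\<^sub>m = W\<^sub>n u\<^sub>n\<close> with \<open>u\<^sub>n \<ge> 0\<close> of degree at most \<open>D\<close> and
normalized. After multiplication by the square of a polynomial \<open>h\<close> of bounded degree that kills
the nodes with nonpositive weight, the remainder is the difference of the transforms of two positive
measures with \<open>n - O(1)\<close> equal moments, so it forms a normal family. Its limits vanish: for bounded
\<open>\<Delta>\<^sub>m\<^sub>-\<^sub>1\<close> because they have \<open>n - O(1)\<close> zeros in a fixed compact set, and under Carleman's condition because the cosine
transform of the difference has many vanishing derivatives at \<open>0\<close> and Bang's argument applies
quantitatively.

Thus \<open>T a\<^sub>0 / W\<^sub>n - u\<^sub>n T f\<close> tends to \<open>0\<close>. Since \<open>f\<close> has \<open>D\<close> poles, they are the zeros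
of \<open>T\<close>, and \<open>T f\<close> does not vanish there; so every limit of \<open>u\<^sub>n\<close> is divisible by \<open>T\<close>, which
forces \<open>u\<^sub>n\<close> to converge to a multiple of \<open>T\<close>. The statements about zeros follow by the
argument principle.
\<close>

text \<open>The orthogonality relations fall short of the number of nodes by a bounded amount: a
  rule with \<open>card Y\<close> nodes is exact below degree \<open>card Y + N\<close> with
  \<open>card Y - N\<close> bounded but in general not zero. Testing it with the square of the
  polynomial that vanishes at the nodes of positive weight gives \<open>card_bad\<close>: at most
  half of this defect is lost to nonpositive weights. The number \<open>c\<close> in
  \<open>pade_seq\<close> bounds such defects independently of \<open>n\<close>. Two obstacles
  decide the form of the rest. Interpolation points and bad nodes may escape to infinity with
  \<open>n\<close>, so \<open>h\<close> is normalized by factors \<open>1 + abs y\<close>, and a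
  count of zeros decides nothing when the interval that carries them is unbounded. Moreover the
  measures compared change with \<open>n\<close>, so determinacy of a single moment problem does not
  apply; what serves is an estimate that depends only on a common bound for the moments. The
  multiple of \<open>T\<close> in the limit of \<open>u_n\<close> is then pinned down by the
  normalization and by the sign on the last interval.\<close>

abbreviation (input) cx :: "real \<Rightarrow> complex" where "cx \<equiv> of_real"
abbreviation (input) pc :: "real poly \<Rightarrow> complex \<Rightarrow> complex" where "pc p \<equiv> poly (cpoly p)"
abbreviation (input) iv :: "real \<Rightarrow> complex" where "iv y \<equiv> \<i> * of_real y"
abbreviation (input) bm :: "('a::topological_space \<Rightarrow> 'b::topological_space) set" where "bm \<equiv> borel_measurable borel"
abbreviation (input) evn :: "(nat \<Rightarrow> bool) \<Rightarrow> bool" (binder \<open>EVN \<close> 10) where "evn P \<equiv> eventually P sequentially"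
abbreviation (input) evt :: "(real \<Rightarrow> bool) \<Rightarrow> bool" (binder \<open>EVT \<close> 10) where "evt P \<equiv> eventually P at_top"
abbreviation (input) qk :: "real \<Rightarrow> real \<Rightarrow> real" where "qk a t \<equiv> 1 / (a^2 + t^2)"
notation (input) LIMSEQ (infix \<open>---->\<close> 60) and tendsto (infixr \<open>--->\<close> 55)

section \<open>Quadrature rules and sign changes\<close>

definition nodal :: "real set => real poly" where
 "nodal Y = (\<Prod>y\<in>Y. [:- y, 1:])"

lemma poly_nodal: "poly (nodal Y) x = (\<Prod>y\<in>Y. x - y)"
 unfolding nodal_def by (simp add: poly_prod)

lemma poly_nodal_eq_0_iff: "finite Y ==> poly (nodal Y) x = 0 \<longleftrightarrow> x : Y"
 by (auto simp: poly_nodal)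

lemma nodal_nonzero [simp]: "nodal Y ~= 0" unfolding nodal_def by (cases "finite Y") auto

lemma degree_nodal [simp]: "degree (nodal Y) = card Y"
proof -
 have "degree (\<Prod>y\<in>Y. [:- y, 1::real:]) = (SUM y:Y. degree [:- y, 1::real:])"
  by (rule degree_prod_eq_sum_degree) auto
 thus ?thesis by (simp add: nodal_def)
qed

lemma nodal_remove: "finite Y ==> y : Y ==> nodal Y = [:- y, 1:] * nodal (Y - {y})"
 unfolding nodal_def by (simp add: prod.remove)

lemma nodal_dvd:
 assumes "finite X" "!!x. x : X ==> poly p x = 0"
 shows "nodal X dvd p" using assms
proof (induction X arbitrary: p)
 case (insert x X)
 obtain q where q: "p = [:- x, 1:] * q" using insert.prems[of x] by (auto simp: poly_eq_0_iff_dvd)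
 have "poly q y = 0" if "y : X" for y using insert.prems[of y] that insert.hyps by (auto simp: q)
 hence "nodal X dvd q" by (rule insert.IH)
 thus ?case using nodal_remove[of "insert x X" x] insert.hyps
  by (auto simp: q intro!: mult_dvd_mono simp del: mult_pCons_left)
qed (simp add: nodal_def)

lemma poly_eq_0_of_roots:
 fixes p :: "real poly"
 assumes "finite Y" "!!y. y : Y ==> poly p y = 0" "degree p < card Y"
 shows "p = 0"
proof (rule ccontr)
 assume "p ~= 0"
 hence "card {x. poly p x = 0} <= degree p" by (rule card_poly_roots_bound)
 moreover have "card Y <= card {x. poly p x = 0}"
  using assms `p ~= 0` by (intro card_mono poly_roots_finite) auto
 ultimately show False using assms(3) by linarith
qed

lemma lagrange_interpolation:
 assumes Y: "finite Y" and d: "degree p < card Y"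
 shows "p = (SUM y:Y. smult (poly p y / poly (nodal (Y - {y})) y) (nodal (Y - {y})))" (is "p = ?r")
proof -
 have cY: "card Y > 0" using d by simp
 have "degree ?r < card Y"
 proof (rule degree_sum_less[OF _ cY])
  fix y assume "y : Y"
  hence "card (Y - {y}) < card Y" using Y by (intro card_Diff1_less)
  moreover have "degree (smult (poly p y / poly (nodal (Y - {y})) y) (nodal (Y - {y}))) <= card (Y - {y})"
   by (rule order_trans[OF degree_smult_le]) simp
  ultimately show "degree (smult (poly p y / poly (nodal (Y - {y})) y) (nodal (Y - {y}))) < card Y"
   by linarith
 qed
 hence "degree (p - ?r) < card Y" using d by (intro degree_diff_less)
 moreover have "poly (p - ?r) z = 0" if "z : Y" for z
 proof -
  have "poly ?r z = (SUM y:Y. poly p y / poly (nodal (Y - {y})) y * poly (nodal (Y - {y})) z)"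
   by (simp add: poly_sum)
  also have "... = (SUM y:{z}. poly p y / poly (nodal (Y - {y})) y * poly (nodal (Y - {y})) z)"
   using Y that by (intro sum.mono_neutral_right) (auto simp: poly_nodal_eq_0_iff)
  also have "... = poly p z" using Y by (simp add: poly_nodal_eq_0_iff)
  finally show ?thesis by simp
 qed
 ultimately have "p - ?r = 0" using Y by (intro poly_eq_0_of_roots)
 thus ?thesis by simp
qed

text \<open>For \<open>N = card Y\<close> this is the setting of Gauss quadrature. A smaller
  \<open>N\<close> leaves room for some weights of the wrong sign, whose number
  \<open>card_bad\<close> limits by half of \<open>card Y - N\<close>.\<close>

locale quadrature =
 fixes L :: "real poly => real" and Y :: "real set" and N :: nat
 assumes L_add: "!!p q. L (p + q) = L p + L q" and L_smult: "!!c p. L (smult c p) = c * L p"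
  and L_pos: "!!p. p ~= 0 ==> L (p ^ 2) > 0" and L_orth: "!!p. degree p < N ==> L (nodal Y * p) = 0"
  and finite_Y: "finite Y"
begin

definition weight :: "real => real" where
 "weight y = L (nodal (Y - {y})) / poly (nodal (Y - {y})) y"

lemma L_sum: "L (SUM i:I. f i) = (SUM i:I. L (f i))"
proof -
 have "L 0 = 0" using L_smult[of 0 0] by simp
 thus ?thesis by (induction I rule: infinite_finite_induct) (simp_all add: L_add)
qed

text \<open>As for Gauss quadrature: division by \<open>nodal Y\<close> leaves a quotient of degree
  below \<open>N\<close>, which \<open>L\<close> annihilates after multiplication by
  \<open>nodal Y\<close>, and a remainder that Lagrange interpolation recovers from its values at
  the nodes.\<close>

lemma exact:
 assumes d: "degree p < card Y + N"
 shows "L p = (SUM y:Y. weight y * poly p y)"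
proof -
 let ?q = "p div nodal Y" and ?r = "p mod nodal Y"
 have p: "p = nodal Y * ?q + ?r" by simp
 have py: "poly p y = poly ?r y" if "y : Y" for y
  proof -
  have "poly p y = poly (nodal Y * ?q + ?r) y" by simp
  also have "... = poly (nodal Y) y * poly ?q y + poly ?r y" by (simp only: poly_add poly_mult)
  finally show ?thesis using that finite_Y poly_nodal_eq_0_iff[of Y y] by simp
 qed
 have *: "L (nodal Y * ?q) = 0"
 proof (cases "?q = 0")
  case False
  have "degree (nodal Y * ?q) = card Y + degree ?q" using False by (simp add: degree_mult_eq)
  moreover have "degree (nodal Y * ?q) <= degree p"
  proof (cases "card Y = 0")
   case True
   hence "Y = {}" using finite_Y by simp
   thus ?thesis by (simp add: nodal_def)
  next
   case False
   have "degree ?r < card Y" using degree_mod_less[of "nodal Y" p] False by auto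
   moreover have "nodal Y * ?q = p - ?r" by (simp add: minus_mod_eq_mult_div)
   ultimately show ?thesis using `degree (nodal Y * ?q) = card Y + degree ?q`
    by (metis add_leE degree_diff_le_max leD le_add1 less_le_trans max.absorb1 max_def nle_le order_le_less_trans)
  qed
  ultimately have "degree ?q < N" using d by linarith
  thus ?thesis by (rule L_orth)
 qed (use L_smult[of 0 0] in simp)
 have "L ?r = (SUM y:Y. weight y * poly ?r y)"
 proof (cases "card Y = 0")
  case True
  hence "Y = {}" using finite_Y by simp
  hence "?r = 0" by (simp add: nodal_def)
  thus ?thesis using `Y = {}` L_smult[of 0 0] by simp
 next
  case False
  hence "degree ?r < card Y" using degree_mod_less[of "nodal Y" p] by auto
  from lagrange_interpolation[OF finite_Y this]
  have "L ?r = L (SUM y:Y. smult (poly ?r y / poly (nodal (Y - {y})) y) (nodal (Y - {y})))" by simp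
  thus ?thesis by (simp add: L_sum L_smult weight_def field_simps)
 qed
 thus ?thesis using * p py L_add by (metis (no_types, lifting) add_0 sum.cong)
qed

definition bad :: "real set" where "bad = {y : Y. weight y <= 0}"

text \<open>If the nodes of positive weight were fewer than \<open>(card Y + N) / 2\<close>, the
  square of their nodal polynomial would have a degree at which the rule is exact, and the rule
  would give it a nonpositive value.\<close>

lemma card_bad: "2 * card bad + N <= card Y"
proof -
 let ?g = "Y - bad"
 let ?p = "nodal ?g"
 have fb: "finite bad" "bad <= Y" using finite_Y by (auto simp: bad_def)
 have c: "card ?g + card bad = card Y"
  using fb finite_Y by (metis card_mono add.commute card_Diff_subset le_add_diff_inverse)
 have "\<not> 2 * card ?g < card Y + N"
 proof
  assume "2 * card ?g < card Y + N"
  hence "L (?p ^ 2) = (SUM y:Y. weight y * poly (?p ^ 2) y)"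
   by (intro exact) (simp add: degree_power_eq)
  also have "... <= 0"
  proof (rule sum_nonpos)
   fix y assume "y : Y"
   show "weight y * poly (?p ^ 2) y <= 0"
   proof (cases "y : bad")
    case True
    thus ?thesis by (simp add: bad_def mult_nonpos_nonneg)
   next
    case False
    hence "poly ?p y = 0" using `y : Y` finite_Y by (simp add: poly_nodal_eq_0_iff)
    thus ?thesis by simp
   qed
  qed
  finally show False using L_pos[of ?p] by simp
 qed
 thus ?thesis using c by linarith
qed

end

section \<open>Alternation of signs, at nodes and on intervals\<close>

definition alternates :: "(real => real) => real set => nat => bool" where
 "alternates g S N \<longleftrightarrow> (\<exists>x :: nat => real. (ALL i<=N. x i : S) &
   (ALL i<N. x i < x (Suc i) & g (x i) * g (x (Suc i)) < 0))"

lemma alternates_mono: "alternates g S N ==> S <= S' ==> M <= N ==> alternates g S' M"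
 unfolding alternates_def
proof (elim exE conjE)
 fix x :: "nat => real" assume S: "S <= S'" and M: "M <= N"
  and x: "ALL i<=N. x i : S" "ALL i<N. x i < x (Suc i) & g (x i) * g (x (Suc i)) < 0"
 have 1: "x i : S'" if "i <= M" for i using x(1) S M that order_trans[of i M N] by blast
 have 2: "x i < x (Suc i) & g (x i) * g (x (Suc i)) < 0" if "i < M" for i
  using x(2) less_le_trans[OF that M] by blast
 show "EX x. (ALL i<=M. x i : S') & (ALL i<M. x i < x (Suc i) & g (x i) * g (x (Suc i)) < 0)"
  by (rule exI[of _ x]) (use 1 2 in blast)
qed

lemma ivt_zero:
 fixes f :: "real => real"
 assumes "continuous_on {a..b} f" "a < b" "f a * f b < 0"
 obtains x where "a < x" "x < b" "f x = 0"
proof -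
 have "EX x>=a. x <= b & f x = 0"
 proof (cases "f a < 0")
  case True
  hence "f b > 0" using assms(3) by (simp add: mult_less_0_iff)
  thus ?thesis using IVT'[of f a 0 b] True assms by auto
 next
  case False
  hence "f b < 0" "f a > 0" using assms(3) by (auto simp: mult_less_0_iff)
  thus ?thesis using IVT2'[of f b 0 a] assms by auto
 qed
 then obtain x where x: "x >= a" "x <= b" "f x = 0" by blast
 moreover have "x ~= a" "x ~= b" using x assms(3) by auto
 ultimately show ?thesis using that[of x] by linarith
qed

lemma convex_Icc_subset:
 fixes I :: "real set"
 assumes "convex I" "a : I" "b : I"
 shows "{a..b} <= I"
 using closed_segment_subset[OF assms(2,3,1)] by (auto simp: closed_segment_eq_real_ivl split: if_splits)

lemma alternates_zeros:
 assumes alt: "alternates f S N" and cont: "continuous_on S f" and conv: "convex S"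
 obtains X where "finite X" "card X = N" "X <= S" "!!x. x : X ==> f x = 0"
proof -
 obtain x where x: "!!i. i <= N ==> x i : S"
  and x': "!!i. i < N ==> x i < x (Suc i) & f (x i) * f (x (Suc i)) < 0"
  using alt unfolding alternates_def by blast
 have "EX z. x i < z & z < x (Suc i) & f z = 0" if "i < N" for i
 proof -
  have "{x i..x (Suc i)} <= S" using x that conv by (intro convex_Icc_subset) auto
  hence "continuous_on {x i..x (Suc i)} f" using cont continuous_on_subset by blast
  thus ?thesis using ivt_zero[of "x i" "x (Suc i)" f] x'[OF that] by metis
 qed
 then obtain z where z: "!!i. i < N ==> x i < z i & z i < x (Suc i) & f (z i) = 0" by metis
 have xm: "x i <= x j" if "i <= j" "j <= N" for i j using that
 proof (induction j rule: dec_induct)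
  case (step j)
  thus ?case using x'[of j] by force
 qed simp
 have zm: "z i < z j" if "i < j" "j < N" for i j
  using z[of i] z[of j] xm[of "Suc i" j] that by force
 have "inj_on z {..<N}" by (rule inj_onI) (metis zm lessThan_iff linorder_neq_iff)
 hence "card (z ` {..<N}) = N" by (simp add: card_image)
 moreover have "z ` {..<N} <= S"
 proof safe
  fix i assume "i < N"
  moreover have "{x i..x (Suc i)} <= S" using x `i < N` conv by (intro convex_Icc_subset) auto
  ultimately show "z i : S" using z[of i] by auto
 qed
 ultimately show ?thesis using that[of "z ` {..<N}"] z by blast
qed

text \<open>The polynomial value is the derivative of \<open>nodal Y\<close> at \<open>y\<close>.
  Its negative factors come from the nodes to the right of \<open>y\<close>, so its sign alternates
  from node to node.\<close>

lemma nodal_deriv_sign: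
 assumes "finite Y" "y : Y"
 shows "(- 1) ^ card {z : Y. y < z} * poly (nodal (Y - {y})) y > 0"
proof -
 have Y: "Y - {y} = {z : Y. y < z} Un {z : Y. z < y}" by auto
 have "poly (nodal (Y - {y})) y = (\<Prod>z\<in>{z : Y. y < z}. y - z) * (\<Prod>z\<in>{z : Y. z < y}. y - z)"
  unfolding poly_nodal Y using assms by (intro prod.union_disjoint) auto
 moreover have "(\<Prod>z\<in>{z : Y. y < z}. y - z) = (- 1) ^ card {z : Y. y < z} * (\<Prod>z\<in>{z : Y. y < z}. z - y)"
  by (subst prod_constant[symmetric], subst prod.distrib[symmetric]) simp
 moreover have "(\<Prod>z\<in>{z : Y. y < z}. z - y) > 0" by (rule prod_pos) auto
 moreover have "(\<Prod>z\<in>{z : Y. z < y}. y - z) > 0" by (rule prod_pos) auto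
 moreover have "(- 1) ^ k * ((- 1) ^ k * a * b) = a * (b::real)" for k a b by (cases "even k") auto
 ultimately show ?thesis by (simp only: mult_pos_pos)
qed

text \<open>Greedy choice of the points; \<open>c\<close> counts the nodes of \<open>B\<close> after the last chosen one.\<close>

lemma alternation_greedy:
 fixes G :: "real => real" and e :: real
 assumes "finite Y" "!!y. y : Y - B ==> e * (- 1) ^ card {z : Y. z < y} * G y > 0"
 shows "EX x l c. (ALL i<l. x i : Y) &
  (ALL i. Suc i < l --> x i < x (Suc i) & G (x i) * G (x (Suc i)) < 0) &
  card Y + c <= l + 2 * card (Y Int B) &
  (l > 0 --> e * (- 1) ^ (card Y + 1 + c) * G (x (l - 1)) > 0)" using assms
proof (induction Y rule: finite_linorder_max_induct)
 case empty
 show ?case by (rule exI[of _ "%_. 0"], rule exI[of _ 0], rule exI[of _ 0]) simp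
next
 case (insert b Y)
 have nb: "b ~: Y" using insert.hyps by auto
 have less: "{z : insert b Y. z < y} = {z : Y. z < y}" if "y : insert b Y" for y
  using insert.hyps that by auto
 have lessb: "{z : insert b Y. z < b} = Y" using insert.hyps by auto
 have "e * (- 1) ^ card {z : Y. z < y} * G y > 0" if "y : Y - B" for y
  using insert.prems[of y] less[of y] that by auto
 from insert.IH[OF this] obtain x l c where x: "!!i. i < l ==> x i : Y"
  and alt: "!!i. Suc i < l ==> x i < x (Suc i) & G (x i) * G (x (Suc i)) < 0"
  and card: "card Y + c <= l + 2 * card (Y Int B)"
  and last: "l > 0 ==> e * (- 1) ^ (card Y + 1 + c) * G (x (l - 1)) > 0" by blast
 have cI: "card (insert b Y) = Suc (card Y)" using nb insert.hyps by simp
 show ?case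
 proof (cases "b : B")
  case True
  hence "card (insert b Y Int B) = Suc (card (Y Int B))" using nb insert.hyps by simp
  thus ?thesis using x alt card last cI by (intro exI[of _ x] exI[of _ l] exI[of _ "Suc c"]) auto
 next
  case False
  hence cB: "card (insert b Y Int B) = card (Y Int B)" by simp
  have Gb: "e * (- 1) ^ card Y * G b > 0" using insert.prems[of b] False lessb by auto
  \<comment> \<open>With \<open>c\<close> even the sign at \<open>b\<close> is opposite to that at
    the last chosen point, and \<open>b\<close> is appended. With \<open>c\<close> odd the signs
    agree: \<open>b\<close> is passed over, and one of the \<open>c\<close> skipped nodes pays for
    it, which is why each node of \<open>B\<close> costs two.\<close>
  consider "l = 0" | "l > 0" "even c" | "l > 0" "odd c" by blast
  thus ?thesis
  proof cases
   case 1
   thus ?thesis using card cI cB Gb by (intro exI[of _ "%_. b"] exI[of _ 1] exI[of _ 0]) auto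
  next
   case 2
   let ?x = "x(l := b)"
   have 1: "e * (- 1) ^ card Y * G (x (l - 1)) < 0" using last[OF 2(1)] 2(2)
    by (simp add: power_add)
   have "(e * (- 1) ^ card Y * G (x (l - 1))) * (e * (- 1) ^ card Y * G b) < 0"
    by (rule mult_neg_pos[OF 1 Gb])
   hence "(e * (- 1) ^ card Y)^2 * (G (x (l - 1)) * G b) < 0"
    by (simp add: power2_eq_square algebra_simps)
   hence 3: "G (x (l - 1)) * G b < 0" by (simp add: mult_less_0_iff)
   have "x (l - 1) < b" using x[of "l - 1"] 2 insert.hyps by auto
   hence "?x i < ?x (Suc i) & G (?x i) * G (?x (Suc i)) < 0" if "Suc i < Suc l" for i
    using alt[of i] 3 that by (cases "Suc i = l") auto
   moreover have "?x i : insert b Y" if "i < Suc l" for i using x[of i] that by auto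
   ultimately show ?thesis using card cI cB Gb
    by (intro exI[of _ ?x] exI[of _ "Suc l"] exI[of _ 0]) auto
  next
   case 3
   hence "Suc (card Y) <= l + 2 * card (Y Int B)" using card by (cases c) auto
   moreover have "e * (- 1) ^ (Suc (card Y) + 1 + 0) * G (x (l - 1)) > 0"
    using last[OF 3(1)] 3(2) by (simp add: power_add)
   ultimately show ?thesis using x alt unfolding cI cB
    by (intro exI[of _ x] exI[of _ l] exI[of _ 0] conjI allI impI) auto
  qed
 qed
qed

text \<open>The derivatives of \<open>nodal Y\<close> at consecutive nodes alternate in sign, so a
  function whose product with them has a fixed sign alternates too. Each exceptional node in
  \<open>B\<close> can destroy two of the \<open>card Y - 1\<close> changes.\<close>

lemma alternates_nodes:
 fixes G :: "real => real" and e :: real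
 assumes Y: "finite Y" and B: "B <= Y" "2 * card B + Suc N <= card Y"
  and G: "!!y. y : Y - B ==> e * poly (nodal (Y - {y})) y * G y > 0"
 shows "alternates G Y N"
proof -
 \<comment> \<open>\<open>nodal_deriv_sign\<close> counts the nodes to the right of
   \<open>y\<close>, while the greedy choice counts those to the left; the two parities differ by
   that of \<open>card Y - 1\<close>.\<close>
 define e' where "e' = e * (- 1) ^ (card Y - 1)"
 have "e' * (- 1) ^ card {z : Y. z < y} * G y > 0" if "y : Y - B" for y
 proof -
  let ?l = "card {z : Y. z < y}" and ?g = "card {z : Y. y < z}"
  have "Y - {y} = {z : Y. z < y} Un {z : Y. y < z}" by auto
  moreover have "card ({z : Y. z < y} Un {z : Y. y < z}) = ?l + ?g"
   using Y by (intro card_Un_disjoint) auto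
  moreover have "card (Y - {y}) = card Y - 1" using that by (intro card_Diff_singleton) auto
  ultimately have "card Y - 1 = ?l + ?g" by metis
  hence s: "(- 1) ^ (card Y - 1) * (- 1) ^ ?l = (- 1 :: real) ^ ?g"
   by (cases "even ?l"; cases "even ?g") (auto simp: power_add)
  have "(- 1) ^ ?g * poly (nodal (Y - {y})) y > 0" using nodal_deriv_sign[OF Y] that by auto
  hence "((- 1) ^ ?g * poly (nodal (Y - {y})) y) * (e * poly (nodal (Y - {y})) y * G y) > 0"
   using G[OF that] by (rule mult_pos_pos)
  hence "(poly (nodal (Y - {y})) y)^2 * (e * (- 1) ^ ?g * G y) > 0"
   by (simp add: power2_eq_square algebra_simps)
  hence "e * (- 1) ^ ?g * G y > 0" by (simp add: zero_less_mult_iff)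
  thus ?thesis unfolding e'_def mult.assoc s[symmetric] by (simp only: mult.assoc)
 qed
 from alternation_greedy[OF Y this] obtain x l c where x: "!!i. i < l ==> x i : Y"
  and alt: "!!i. Suc i < l ==> x i < x (Suc i) & G (x i) * G (x (Suc i)) < 0"
  and card: "card Y + c <= l + 2 * card (Y Int B)" by blast
 have "Y Int B = B" using B by blast
 hence "Suc N <= l" using card B(2) by simp
 thus ?thesis unfolding alternates_def using x alt by (intro exI[of _ x]) auto
qed

lemma no_zero_sign:
 fixes f :: "real => real"
 assumes "convex I" "continuous_on I f" "!!x. x : I ==> f x ~= 0"
 obtains e :: real where "e = 1 | e = -1" "!!x. x : I ==> e * f x > 0"
proof -
 have *: "f x * f y > 0" if "x : I" "y : I" "x <= y" for x y
 proof (rule ccontr)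
  assume "\<not> f x * f y > 0"
  hence n: "f x * f y < 0" using assms(3)[OF that(1)] assms(3)[OF that(2)]
   by (simp add: not_less order_less_le)
  hence "x ~= y" using not_square_less_zero by blast
  hence "x < y" using that by simp
  moreover have "{x..y} <= I" using assms that by (intro convex_Icc_subset) auto
  moreover have "continuous_on {x..y} f" using assms calculation continuous_on_subset by blast
  ultimately obtain z where "x < z" "z < y" "f z = 0" using ivt_zero[of x y f] n by metis
  hence "z : I" "f z = 0" using `{x..y} <= I` by auto
  thus False using assms by blast
 qed
 show ?thesis
 proof (cases "I = {}")
  case True thus ?thesis using that[of 1] by simp
 next
  case False
  then obtain a where a: "a : I" by blast
  have **: "f a * f x > 0" if "x : I" for x
   using *[of a x] *[of x a] a that mult.commute[of "f a" "f x"] linear[of a x] by metis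
  show ?thesis
  proof (cases "f a > 0")
   case True
   thus ?thesis using that[of 1] ** by (auto simp: zero_less_mult_iff)
  next
   case False
   thus ?thesis using that[of "-1"] ** by (auto simp: zero_less_mult_iff)
  qed
 qed
qed

text \<open>\<open>Y\<close> collects the zeros at which \<open>f\<close> changes sign, so that
  \<open>nodal Y\<close> has the sign of \<open>f\<close> up to \<open>e\<close>. The zeros are
  added from left to right, and a new one joins \<open>Y\<close> exactly if the signs on its two
  sides differ. An end point of \<open>I\<close> has only one side, hence \<open>Y\<close> lies in
  the interior.\<close>

lemma sign_structure:
 fixes f :: "real => real"
 assumes "finite Z" "convex I" "continuous_on I f" "{x : I. f x = 0} = Z"
 shows "EX Y e. Y <= Z Int interior I & (e = 1 | e = -1) &
      (ALL x:I - Z. e * f x * poly (nodal Y) x > 0)" using assms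
proof (induction Z arbitrary: I rule: finite_linorder_max_induct)
 case empty
 then obtain e where "e = 1 | e = -1" "!!x. x : I ==> e * f x > 0"
  using no_zero_sign[of I f] by blast
 thus ?case by (intro exI[of _ "{}"] exI[of _ e]) (auto simp: nodal_def)
next
 case (insert z Z)
 let ?A = "{x : I. x < z}" and ?B = "{x : I. z < x}"
 have A: "?A = I Int {..<z}" and B: "?B = I Int {z<..}" by auto
 have cA: "convex ?A" "convex ?B" unfolding A B
  by (intro convex_Int insert.prems convex_real_interval)+
 have conA: "continuous_on ?A f" "continuous_on ?B f"
  using insert.prems(2) by (auto intro: continuous_on_subset)
 have zA: "{x : ?A. f x = 0} = Z" using insert.prems insert.hyps by auto
 from insert.IH[OF cA(1) conA(1) zA] obtain Y e where Y: "Y <= Z Int interior ?A"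
  and e: "e = 1 | e = -1" and Ye: "!!x. x : ?A - Z ==> e * f x * poly (nodal Y) x > 0" by blast
 have "f x ~= 0" if "x : ?B" for x using insert.prems(3) insert.hyps that by force
 from no_zero_sign[OF cA(2) conA(2) this] obtain e' where e': "e' = 1 | e' = -1"
  "!!x. x : ?B ==> e' * f x > 0" by blast
 have Yi: "Y <= interior I" "Y <= Z" using Y interior_mono[of ?A I] by auto
 have finY: "finite Y" using Yi insert.hyps finite_subset by blast
 have Yz: "y < z" if "y : Y" for y using Yi that insert.hyps by auto
 have YB: "poly (nodal Y) x > 0" if "x : ?B" for x
  unfolding poly_nodal using Yz that by (intro prod_pos) force
 consider "?A = {}" | "?A ~= {}" "?B = {} | e' = e" | "?A ~= {}" "?B ~= {}" "e' = - e"
  using e e'(1) by fastforce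
 thus ?case
 proof cases
  case 1
  hence "Y <= interior {}" using Y by (metis Int_subset_iff)
  hence "Y = {}" by simp
  moreover have "x : ?B" if "x : I - insert z Z" for x
   using 1 that by (metis (mono_tags, lifting) Diff_iff empty_iff insertCI linorder_neqE mem_Collect_eq)
  ultimately show ?thesis using e' by (intro exI[of _ "{}"] exI[of _ e']) (auto simp: nodal_def)
 next
  case 2
  have "e * f x * poly (nodal Y) x > 0" if "x : I - insert z Z" for x
   using that 2 Ye[of x] YB[of x] e'(2)[of x] by (cases "x < z") auto
  thus ?thesis using Yi e by (intro exI[of _ Y] exI[of _ e]) auto
 next
  case 3
  then obtain x1 x2 where x12: "x1 : I" "x1 < z" "x2 : I" "z < x2" by blast
  hence "{x1<..<x2} <= I" using convex_Icc_subset[of I x1 x2] insert.prems by force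
  hence zi: "z : interior I" using x12 by (intro interiorI[of "{x1<..<x2}"]) auto
  have pI: "poly (nodal (insert z Y)) x = (x - z) * poly (nodal Y) x" for x
   using Yz[of z] finY by (subst poly_nodal, subst prod.insert) (auto simp: poly_nodal)
  have "e' * f x * poly (nodal (insert z Y)) x > 0" if x: "x : I - insert z Z" for x
  proof (cases "x < z")
   case True
   hence "(z - x) * (e * f x * poly (nodal Y) x) > 0" using Ye[of x] x by auto
   thus ?thesis unfolding pI using 3 by (simp add: algebra_simps)
  next
   case False
   hence "x : ?B" using x by auto
   hence "(x - z) * (e' * f x) * poly (nodal Y) x > 0" using YB[of x] e'(2)[of x] by auto
   thus ?thesis unfolding pI by (simp add: algebra_simps)
  qed
  thus ?thesis using e' Yi zi by (intro exI[of _ "insert z Y"] exI[of _ e']) auto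
 qed
qed

section \<open>Cauchy transforms of measures with finite moments\<close>

text \<open>What integration sees of membership in \<open>meas_class\<close>: the measure is
  concentrated on the closed interval \<open>Dl\<close> but on no finite set. In this form the
  property passes to the products \<open>mprod\<close> without any statement about their
  supports.\<close>

definition gmeas :: "real set => smeasure => bool" where
 "gmeas Dl s \<longleftrightarrow> (fst s = 1 | fst s = -1) & sets (snd s) = sets borel & finite_moments s &
   closed Dl & convex Dl & Dl ~= {} & (AE x in snd s. x : Dl) &
   (ALL X. finite X --> \<not> (AE x in snd s. x : X))"

text \<open>The class of integrands: polynomial growth on \<open>Dl\<close> gives integrability from
  the finite moments, continuity on \<open>Dl\<close> allows sign arguments, and measurability is
  required on all of the line because the integrals extend over it.\<close>

definition tame :: "real set => (real => complex) => bool" where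
 "tame Dl g \<longleftrightarrow> g : bm & continuous_on Dl g &
   (EX C k. ALL x:Dl. norm (g x) <= C * (1 + abs x) ^ k)"

definition sint :: "smeasure => (real => complex) => complex" where
 "sint s F = cx (fst s) * (LINT x|snd s. F x)"

definition ctr :: "smeasure => (real => complex) => complex => complex" where
 "ctr s F z = sint s (%x. F x / (z - cx x))"

lemma cauchy_eq_ctr: "cauchy s z = ctr s (%_. 1) z" by (simp add: cauchy_def ctr_def sint_def)

lemma tame_bound:
 assumes "tame Dl g"
 obtains C k where "C >= 0" "!!x. x : Dl ==> norm (g x) <= C * (1 + abs x) ^ k"
proof -
 obtain C k where *: "!!x. x : Dl ==> norm (g x) <= C * (1 + abs x) ^ k"
  using assms unfolding tame_def by blast
 have "norm (g x) <= abs C * (1 + abs x) ^ k" if "x : Dl" for x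
  using *[OF that] by (rule order_trans) (intro mult_right_mono, auto)
 thus ?thesis using that[of "abs C" k] by simp
qed

lemma tame_bounded:
 assumes "g : bm" "continuous_on Dl g" "!!x. x : Dl ==> norm (g x) <= C"
 shows "tame Dl g" unfolding tame_def using assms by (intro conjI exI[of _ C] exI[of _ 0]) auto

lemma tame_const [simp]: "tame Dl (%_. c)" by (rule tame_bounded[of _ _ "norm c"]) auto

lemma tame_id [simp]: "tame Dl (%x. cx x)"
proof -
 have "norm (cx x) <= 1 * (1 + abs x) ^ 1" for x by simp
 thus ?thesis unfolding tame_def by (intro conjI exI[of _ 1] ballI) (auto intro!: continuous_intros)
qed

lemma tame_mult [simp]:
 assumes "tame Dl f" "tame Dl g"
 shows "tame Dl (%x. f x * g x)"
proof -
 obtain C k where f: "C >= 0" "!!x. x : Dl ==> norm (f x) <= C * (1 + abs x) ^ k"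
  using tame_bound[OF assms(1)] by blast
 obtain C' k' where g: "C' >= 0" "!!x. x : Dl ==> norm (g x) <= C' * (1 + abs x) ^ k'"
  using tame_bound[OF assms(2)] by blast
 have "norm (f x * g x) <= (C * C') * (1 + abs x) ^ (k + k')" if "x : Dl" for x
  using mult_mono[OF f(2)[OF that] g(2)[OF that]] f(1)
  by (simp add: norm_mult power_add algebra_simps)
 thus ?thesis using assms unfolding tame_def
  by (auto intro!: continuous_intros exI[of _ "C * C'"] exI[of _ "k + k'"])
qed

lemma tame_add [simp]:
 assumes "tame Dl f" "tame Dl g"
 shows "tame Dl (%x. f x + g x)"
proof -
 obtain C k where f: "C >= 0" "!!x. x : Dl ==> norm (f x) <= C * (1 + abs x) ^ k"
  using tame_bound[OF assms(1)] by blast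
 obtain C' k' where g: "C' >= 0" "!!x. x : Dl ==> norm (g x) <= C' * (1 + abs x) ^ k'"
  using tame_bound[OF assms(2)] by blast
 have "norm (f x + g x) <= (C + C') * (1 + abs x) ^ (k + k')" if "x : Dl" for x
 proof -
  have "(1 + abs x) ^ k <= (1 + abs x) ^ (k + k')" "(1 + abs x) ^ k' <= (1 + abs x) ^ (k + k')"
   by (rule power_increasing; simp)+
  hence "C * (1 + abs x) ^ k <= C * (1 + abs x) ^ (k + k')"
   "C' * (1 + abs x) ^ k' <= C' * (1 + abs x) ^ (k + k')"
   using f(1) g(1) by (auto intro: mult_left_mono)
  thus ?thesis using f(2)[OF that] g(2)[OF that] norm_triangle_ineq[of "f x" "g x"]
   by (simp add: distrib_right)
 qed
 thus ?thesis using assms unfolding tame_def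
  by (auto intro!: continuous_intros exI[of _ "C + C'"] exI[of _ "k + k'"])
qed

lemma tame_cmult: "tame Dl f ==> tame Dl (%x. c * f x)" by simp

lemma tame_minus [simp]: "tame Dl f ==> tame Dl (%x. - f x)" using tame_cmult[of Dl f "-1"] by simp

lemma tame_diff [simp]: "tame Dl f ==> tame Dl g ==> tame Dl (%x. f x - g x)"
 using tame_add[of Dl f "%x. - g x"] by simp

lemma tame_sum [simp]: "(!!i. i : I ==> tame Dl (f i)) ==> tame Dl (%x. SUM i:I. f i x)"
 by (induction I rule: infinite_finite_induct) auto

lemma tame_poly [simp]: "tame Dl (%x. poly p (cx x))" by (induction p) auto

lemma tame_mult_bounded:
 assumes "tame Dl f" "g : bm" "continuous_on Dl g"
  "!!x. x : Dl ==> norm (g x) <= C"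
 shows "tame Dl (%x. f x * g x)" using assms by (intro tame_mult tame_bounded[of g _ C])

lemma off_closed_dist:
 assumes "closed Dl" "z ~: cx ` Dl"
 obtains d where "d > 0" "!!x. x : Dl ==> d <= norm (z - cx x)"
proof -
 have "closed (cx ` Dl)"
  by (intro closed_injective_linear_image assms bounded_linear.linear bounded_linear_of_real injI) auto
 from separate_point_closed[OF this assms(2)] show ?thesis using that by (auto simp: dist_norm)
qed

lemma closed_of_real_image: "closed Dl ==> closed (cx ` Dl)"
 by (intro closed_injective_linear_image bounded_linear.linear bounded_linear_of_real injI) auto

lemma tame_cauchy_kernel:
 assumes "closed Dl" "z ~: cx ` Dl" "tame Dl F"
 shows "tame Dl (%x. F x / (z - cx x))"
proof -
 obtain d where d: "d > 0" "!!x. x : Dl ==> d <= norm (z - cx x)"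
  using off_closed_dist[OF assms(1,2)] by blast
 have "tame Dl (%x. F x * inverse (z - cx x))"
 proof (rule tame_mult_bounded[OF assms(3)])
  show "continuous_on Dl (%x. inverse (z - cx x))"
   using assms(2) by (auto intro!: continuous_intros)
  show "norm (inverse (z - cx x)) <= inverse d" if "x : Dl" for x
   using d(2)[OF that] d(1) by (auto simp: norm_inverse intro!: le_imp_inverse_le)
 qed auto
 thus ?thesis by (simp add: divide_inverse)
qed

lemma difference_quotient_identity:
 fixes a b c :: complex
 assumes "a ~= 0" "b ~= 0" "a ~= b"
 shows "inverse (a - b) * (c / a - c / b) + c / b^2 = c * (a - b) / (a * b^2)"
proof -
 have "c / a - c / b = - (c * (a - b)) / (a * b)" using assms by (simp add: field_simps)
 hence "inverse (a - b) * (c / a - c / b) = - c / (a * b)" using assms by simp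
 moreover have "- c / (a * b) + c / b^2 = c * (a - b) / (a * b^2)"
  using assms by (simp add: field_simps power2_eq_square)
 ultimately show ?thesis by simp
qed

lemma kernel_shift_identity:
 fixes u x :: complex
 shows "u ~= 0 ==> (a + x * p) * f / u = a * (f / u) + ((x + u) * (p * f / u) - p * f)"
 by (simp add: field_simps)

context
 fixes Dl s assumes g: "gmeas Dl s"
begin

lemma gmeasD:
 shows "fst s = 1 | fst s = -1" "sets (snd s) = sets borel" "closed Dl" "convex Dl" "Dl ~= {}"
  "AE x in snd s. x : Dl" "!!n::nat. integrable (snd s) (%x. x ^ n)"
  "!!X. finite X ==> \<not> (AE x in snd s. x : X)"
 using g unfolding gmeas_def finite_moments_def by auto

lemma gmeas_borel: "f : bm ==> f : borel_measurable (snd s)"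
 using measurable_cong_sets[OF gmeasD(2) refl] by auto

lemma gmeas_finite: "finite_measure (snd s)"
proof
 have "integrable (snd s) (%x. x ^ 0 :: real)" by (rule gmeasD)
 hence "integrable (snd s) (%x. indicator (space (snd s)) x :: real)"
  by (rule Bochner_Integration.integrable_cong[THEN iffD1, rotated -1]) auto
 thus "emeasure (snd s) (space (snd s)) ~= \<infinity>"
  by (simp add: integrable_indicator_iff top.not_eq_extremum)
qed

lemma tame_integrable:
 assumes "tame Dl F"
 shows "integrable (snd s) F"
proof -
 obtain C k where C: "C >= 0" "!!x. x : Dl ==> norm (F x) <= C * (1 + abs x) ^ k"
  using tame_bound[OF assms] by blast
 have *: "(1 + abs x) ^ k <= 2 ^ k * (1 + x ^ (2 * k))" for x :: real
 proof (cases "abs x <= 1")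
  case True
  hence "(1 + abs x) ^ k <= 2 ^ k" by (intro power_mono) auto
  moreover have "0 <= x ^ (2 * k)" by (simp add: power_mult)
  ultimately show ?thesis by (smt (verit) mult_le_cancel_left1 zero_le_power)
 next
  case False
  hence "(1 + abs x) ^ k <= (2 * abs x) ^ k" by (intro power_mono) auto
  also have "... = 2 ^ k * abs x ^ k" by (simp add: power_mult_distrib)
  also have "abs x ^ k <= abs x ^ (2 * k)" using False by (intro power_increasing) auto
  also have "abs x ^ (2 * k) = x ^ (2 * k)" by (simp add: power_mult)
  finally have "(1 + abs x) ^ k <= 2 ^ k * x ^ (2 * k)" by simp
  thus ?thesis by (simp add: distrib_left add_increasing)
 qed
 show ?thesis
 proof (rule Bochner_Integration.integrable_bound)
  show "integrable (snd s) (%x. C * (2 ^ k * (x ^ 0 + x ^ (2 * k))))"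
   by (intro Bochner_Integration.integrable_mult_right Bochner_Integration.integrable_add gmeasD)
  show "F : borel_measurable (snd s)" using assms gmeas_borel by (auto simp: tame_def)
  show "AE x in snd s. norm (F x) <= norm (C * (2 ^ k * (x ^ 0 + x ^ (2 * k))))" using gmeasD(6)
  proof eventually_elim
   case (elim x)
   have "norm (F x) <= C * (1 + abs x) ^ k" using C elim by blast
   also have "... <= C * (2 ^ k * (x ^ 0 + x ^ (2 * k)))"
    using *[of x] C(1) by (intro mult_left_mono) auto
   finally show ?case by (metis abs_ge_self order_trans real_norm_def)
  qed
 qed
qed

lemma sint_add: "tame Dl F ==> tame Dl G ==> sint s (%x. F x + G x) = sint s F + sint s G"
 unfolding sint_def by (simp add: tame_integrable distrib_left)

lemma sint_diff: "tame Dl F ==> tame Dl G ==> sint s (%x. F x - G x) = sint s F - sint s G"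
 unfolding sint_def by (simp add: tame_integrable right_diff_distrib)

lemma sint_cmult: "sint s (%x. c * F x) = c * sint s F"
 unfolding sint_def by (simp add: algebra_simps)

lemma sint_sum:
 "(!!i. i : I ==> tame Dl (F i)) ==> sint s (%x. SUM i:I. F i x) = (SUM i:I. sint s (F i))"
 unfolding sint_def by (simp add: tame_integrable sum_distrib_left)

lemma sint_cong:
 assumes "tame Dl F" "tame Dl G" "!!x. x : Dl ==> F x = G x"
 shows "sint s F = sint s G"
proof -
 have "(LINT x|snd s. F x) = (LINT x|snd s. G x)"
  using assms gmeasD(6) gmeas_borel by (intro integral_cong_AE) (auto simp: tame_def)
 thus ?thesis by (simp add: sint_def)
qed

lemma norm_sint_le:
 assumes "tame Dl F" "integrable (snd s) h" "!!x. x : Dl ==> norm (F x) <= h x"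
 shows "norm (sint s F) <= (LINT x|snd s. h x)"
proof -
 have "norm (sint s F) = norm (LINT x|snd s. F x)"
  using gmeasD(1) by (auto simp: sint_def norm_mult)
 also have "... <= (LINT x|snd s. norm (F x))" by (rule integral_norm_bound)
 also have "... <= (LINT x|snd s. h x)" using gmeasD(6) assms tame_integrable[OF assms(1)]
  by (intro integral_mono_AE integrable_norm) (auto elim: eventually_mono)
 finally show ?thesis .
qed

lemma ctr_add: "z ~: cx ` Dl ==> tame Dl F ==> tame Dl G ==>
  ctr s (%x. F x + G x) z = ctr s F z + ctr s G z"
 unfolding ctr_def add_divide_distrib by (intro sint_add tame_cauchy_kernel gmeasD)

lemma ctr_diff: "z ~: cx ` Dl ==> tame Dl F ==> tame Dl G ==>
  ctr s (%x. F x - G x) z = ctr s F z - ctr s G z"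
 unfolding ctr_def diff_divide_distrib by (intro sint_diff tame_cauchy_kernel gmeasD)

lemma ctr_cmult: "ctr s (%x. c * F x) z = c * ctr s F z"
 unfolding ctr_def times_divide_eq_right[symmetric] by (rule sint_cmult)

lemma ctr_sum: "z ~: cx ` Dl ==> (!!i. i : I ==> tame Dl (F i)) ==>
  ctr s (%x. SUM i:I. F i x) z = (SUM i:I. ctr s (F i) z)"
 unfolding ctr_def sum_divide_distrib by (intro sint_sum tame_cauchy_kernel gmeasD)

lemma ctr_cong: "z ~: cx ` Dl ==> tame Dl F ==> tame Dl G ==>
  (!!x. x : Dl ==> F x = G x) ==> ctr s F z = ctr s G z"
 unfolding ctr_def by (intro sint_cong tame_cauchy_kernel gmeasD) auto

lemma ctr_bound_dist:
 assumes "tame Dl F" "d > 0" "!!x. x : Dl ==> d <= norm (z - cx x)"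
 shows "norm (ctr s F z) <= (LINT x|snd s. norm (F x)) / d"
proof -
 have z: "z ~: cx ` Dl" using assms(2,3) by force
 have "norm (ctr s F z) <= (LINT x|snd s. norm (F x) / d)" unfolding ctr_def
 proof (rule norm_sint_le)
  show "tame Dl (%x. F x / (z - cx x))" by (intro tame_cauchy_kernel gmeasD z assms)
  show "integrable (snd s) (%x. norm (F x) / d)" using tame_integrable[OF assms(1)] by simp
  show "norm (F x / (z - cx x)) <= norm (F x) / d" if "x : Dl" for x
   using assms(2) assms(3)[OF that] by (simp add: norm_divide frac_le)
 qed
 thus ?thesis by simp
qed

lemma ctr_imag_axis:
 assumes "tame Dl F"
 obtains C where "!!y. y > 0 ==> norm (ctr s F (iv y)) <= C / y"
proof -
 have "norm (ctr s F (iv y)) <= (LINT x|snd s. norm (F x)) / y" if "y > 0" for y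
 proof (rule ctr_bound_dist[OF assms that])
  show "y <= norm (\<i> * cx y - cx x)" for x
   using abs_Im_le_cmod[of "\<i> * cx y - cx x"] that by simp
 qed
 thus ?thesis using that by blast
qed

lemma ctr_has_field_derivative:
 assumes F: "tame Dl F" and z: "z ~: cx ` Dl"
 shows "(ctr s F has_field_derivative - sint s (%x. F x / (z - cx x)^2)) (at z)"
proof -
 obtain d where d: "d > 0" "!!x. x : Dl ==> d <= norm (z - cx x)"
  using off_closed_dist[OF gmeasD(3) z] by blast
 \<comment> \<open>For \<open>norm (w - z) < d / 2\<close> every point of \<open>Dl\<close> is still
   at distance at least \<open>d / 2\<close> from \<open>w\<close>, so the kernel of the error term
   is at most \<open>norm (w - z)\<close> times \<open>2 / d^3\<close>.\<close>
 define K where "K = (LINT x|snd s. norm (F x)) * (2 / d ^ 3)"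
 have t2: "tame Dl (%x. F x / (z - cx x)^2)"
  using tame_cauchy_kernel[OF gmeasD(3) z tame_cauchy_kernel[OF gmeasD(3) z F]]
  by (simp add: power2_eq_square)
 let ?D = "- sint s (%x. F x / (z - cx x)^2)"
 have key: "norm ((ctr s F w - ctr s F z) / (w - z) - ?D) <= K * norm (w - z)"
  if w: "w ~= z" "norm (w - z) < d / 2" for w
 proof -
  have dw: "d / 2 <= norm (w - cx x)" if "x : Dl" for x
  proof -
   have "norm (z - cx x) <= norm (z - w) + norm (w - cx x)"
    by (metis diff_add_cancel add.commute add_diff_eq norm_triangle_ineq)
   thus ?thesis using d(2)[OF that] w by (simp add: norm_minus_commute)
  qed
  hence wn: "w ~: cx ` Dl" using d(1) by force
  have t: "tame Dl (%x. F x / (w - cx x))" "tame Dl (%x. F x / (z - cx x))"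
   by (intro tame_cauchy_kernel gmeasD z wn F)+
  have t3: "tame Dl (%x. inverse (w - z) * (F x / (w - cx x) - F x / (z - cx x)) + F x / (z - cx x)^2)"
   by (intro tame_add tame_mult tame_diff t t2 tame_const)
  have "(ctr s F w - ctr s F z) / (w - z) - ?D
    = sint s (%x. inverse (w - z) * (F x / (w - cx x) - F x / (z - cx x)) + F x / (z - cx x)^2)"
  proof -
   have "sint s (%x. inverse (w - z) * (F x / (w - cx x) - F x / (z - cx x)) + F x / (z - cx x)^2)
    = sint s (%x. inverse (w - z) * (F x / (w - cx x) - F x / (z - cx x))) + sint s (%x. F x / (z - cx x)^2)"
    by (rule sint_add) (intro tame_mult tame_diff t t2 tame_const)+
   also have "... = inverse (w - z) * (ctr s F w - ctr s F z) - ?D"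
    unfolding sint_cmult sint_diff[OF t] by (simp add: ctr_def)
   finally show ?thesis by (simp only: divide_inverse mult.commute)
  qed
  also have "norm ... <= (LINT x|snd s. norm (F x) * (2 / d ^ 3 * norm (w - z)))"
  proof (rule norm_sint_le[OF t3])
   show "integrable (snd s) (%x. norm (F x) * (2 / d ^ 3 * norm (w - z)))"
    using tame_integrable[OF F] by simp
   fix x assume x: "x : Dl"
   let ?a = "w - cx x" and ?b = "z - cx x"
   have n: "?a ~= 0" "?b ~= 0" using dw[OF x] d(1) d(2)[OF x] by auto
   have "inverse (w - z) * (F x / ?a - F x / ?b) + F x / ?b^2 = F x * (w - z) / (?a * ?b^2)"
    using difference_quotient_identity[of ?a ?b "F x"] n w by simp
   also have "norm ... = norm (F x) * (norm (w - z) / (norm ?a * (norm ?b)^2))"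
    by (simp add: norm_mult norm_divide norm_power)
   also have "... <= norm (F x) * (norm (w - z) / (d / 2 * d^2))" using dw[OF x] d(1) d(2)[OF x]
    by (intro mult_left_mono divide_left_mono mult_mono power_mono mult_pos_pos) auto
   also have "... = norm (F x) * (2 / d ^ 3 * norm (w - z))"
    using d(1) by (simp add: field_simps power2_eq_square power3_eq_cube)
   finally show "norm (inverse (w - z) * (F x / ?a - F x / ?b) + F x / ?b^2) <= norm (F x) * (2 / d ^ 3 * norm (w - z))" .
  qed
  also have "... = K * norm (w - z)" by (simp add: K_def)
  finally show ?thesis .
 qed
 have "((%w. (ctr s F w - ctr s F z) / (w - z) - ?D) ---> 0) (at z)"
 proof (rule Lim_null_comparison)
  show "\<forall>\<^sub>F w in at z. norm ((ctr s F w - ctr s F z) / (w - z) - ?D) <= K * norm (w - z)"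
   unfolding eventually_at using key d(1) by (intro exI[of _ "d / 2"]) (auto simp: dist_norm)
  have "((%w. K * norm (w - z)) ---> K * norm (z - z)) (at z)" by (intro tendsto_intros)
  thus "((%w. K * norm (w - z)) ---> 0) (at z)" by simp
 qed
 thus ?thesis unfolding has_field_derivative_iff by (subst Lim_null)
qed

lemma ctr_holomorphic: "tame Dl F ==> ctr s F holomorphic_on - cx ` Dl"
 using ctr_has_field_derivative
 by (subst holomorphic_on_open) (auto simp: open_Compl closed_of_real_image gmeasD)

text \<open>Since \<open>(p(z) - p(x)) / (z - x)\<close> is a polynomial in \<open>z\<close>, moving
  a polynomial factor under the Cauchy integral changes the transform by a polynomial only.\<close>

lemma ctr_poly_mult:
 assumes "tame Dl F"
 shows "EX d. degree d <= degree p & (ALL z. z ~: cx ` Dl -->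
   poly p z * ctr s F z - ctr s (%x. poly p (cx x) * F x) z = poly d z)"
proof (induction p)
 case 0
 show ?case by (rule exI[of _ 0]) (simp add: ctr_def sint_def)
next
 case (pCons a p)
 let ?G = "%x. poly p (cx x) * F x"
 have G: "tame Dl ?G" using assms by simp
 have eq: "ctr s (%x. poly (pCons a p) (cx x) * F x) z = a * ctr s F z + z * ctr s ?G z - sint s ?G"
  if z: "z ~: cx ` Dl" for z
 proof -
  have t: "tame Dl (%x. F x / (z - cx x))" "tame Dl (%x. ?G x / (z - cx x))"
   by (intro tame_cauchy_kernel gmeasD z assms G)+
  have "ctr s (%x. poly (pCons a p) (cx x) * F x) z
   = sint s (%x. a * (F x / (z - cx x)) + (z * (?G x / (z - cx x)) - ?G x))" unfolding ctr_def
  proof (rule sint_cong)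
   show "tame Dl (%x. poly (pCons a p) (cx x) * F x / (z - cx x))"
    by (intro tame_cauchy_kernel gmeasD z tame_mult tame_poly assms)
   show "tame Dl (%x. a * (F x / (z - cx x)) + (z * (?G x / (z - cx x)) - ?G x))"
    by (intro tame_add tame_diff tame_mult[OF tame_const] t G)
   fix x assume "x : Dl"
   hence "z - cx x ~= 0" using z by auto
   thus "poly (pCons a p) (cx x) * F x / (z - cx x) =
     a * (F x / (z - cx x)) + (z * (?G x / (z - cx x)) - ?G x)"
    using kernel_shift_identity[of "z - cx x" a "cx x" "poly p (cx x)" "F x"] by simp
  qed
  also have "... = a * ctr s F z + (z * ctr s ?G z - sint s ?G)" unfolding ctr_def
   by (subst sint_add, intro tame_mult tame_const t, intro tame_mult tame_diff tame_const t G,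
     subst sint_diff, intro tame_mult tame_const t, rule G) (simp only: sint_cmult)
  finally show ?thesis by simp
 qed
 show ?case
 proof (cases "p = 0")
  case True
  have "sint s ?G = 0" unfolding True by (simp add: sint_def)
  moreover have "ctr s ?G z = 0" for z unfolding True by (simp add: ctr_def sint_def)
  ultimately show ?thesis using eq True by (intro exI[of _ 0]) simp
 next
  case False
  obtain d where d: "degree d <= degree p"
   "!!z. z ~: cx ` Dl ==> poly p z * ctr s F z - ctr s ?G z = poly d z" using pCons.IH by blast
  have "degree (pCons (sint s ?G) d) <= degree (pCons a p)"
   using d(1) False degree_pCons_le[of "sint s ?G" d] by simp
  moreover have "poly (pCons a p) z * ctr s F z - ctr s (%x. poly (pCons a p) (cx x) * F x) z
   = poly (pCons (sint s ?G) d) z" if "z ~: cx ` Dl" for z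
   unfolding eq[OF that] using d(2)[OF that] by (simp add: algebra_simps)
  ultimately show ?thesis by blast
 qed
qed

end

lemma filterlim_imag_axis: "filterlim (%y::real. \<i> * cx y) at_infinity at_top"
 unfolding filterlim_at_infinity_conv_norm_at_top
 by (simp add: norm_mult filterlim_abs_real)

text \<open>The positive imaginary axis serves throughout as the path to infinity: it avoids all
  intervals, its distance from them is comparable to the modulus, and decay along it is enough to
  rule out a nonzero polynomial.\<close>

lemma poly_imag_axis_zero:
 assumes "((%y::real. poly p (iv y)) ---> 0) at_top"
 shows "p = (0 :: complex poly)"
proof (cases "degree p = 0")
 case True
 then obtain c where p: "p = [:c:]" by (metis degree_eq_zeroE)
 have "((%y::real. c) ---> 0) (at_top :: real filter)" using assms by (simp add: p)
 hence "c = 0" by (simp add: tendsto_const_iff)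
 thus ?thesis by (simp add: p)
next
 case False
 hence "filterlim (poly p) at_infinity at_infinity" by (intro filterlim_poly_at_infinity) auto
 from filterlim_compose[OF this filterlim_imag_axis]
 have "filterlim (%y::real. poly p (iv y)) at_infinity at_top" .
 thus ?thesis using assms not_tendsto_and_filterlim_at_infinity
  by (metis trivial_limit_at_top_linorder)
qed

lemma decay_tendsto_0: "((%y::real. C / y) ---> 0) at_top"
 by (rule tendsto_divide_0[OF tendsto_const filterlim_at_top_imp_at_infinity[OF filterlim_ident]])

lemma imag_axis_off: "y ~= 0 ==> \<i> * cx y ~: cx ` Dl" by (auto simp: complex_eq_iff)

lemma convex_Int_lessThan_sep:
 fixes A B :: "real set"
 assumes "convex A" "convex B" "A Int B = {}"
 shows "(ALL x:A. ALL t:B. x < t) | (ALL x:A. ALL t:B. t < x)"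
proof (rule ccontr)
 assume "\<not> ?thesis"
 then obtain x t x' t' where *: "x : A" "t : B" "t <= x" "x' : A" "t' : B" "x' <= t'"
  by (meson not_less)
 have A: "{min x x'..max x x'} <= A"
  by (rule convex_Icc_subset[OF assms(1)]) (use * in \<open>auto simp: min_def max_def\<close>)
 have B: "{min t t'..max t t'} <= B"
  by (rule convex_Icc_subset[OF assms(2)]) (use * in \<open>auto simp: min_def max_def\<close>)
 have "{min x x'..max x x'} Int {min t t'..max t t'} ~= {}"
 proof -
  have "max (min x x') (min t t') <= min (max x x') (max t t')" using * by (auto simp: min_def max_def)
  hence "max (min x x') (min t t') : {min x x'..max x x'} Int {min t t'..max t t'}" by auto
  thus ?thesis by blast
 qed
 thus False using A B assms(3) by blast
qed

text \<open>On the line even unbounded disjoint closed intervals have positive distance, because the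
  two ends that face each other are finite and belong to the sets.\<close>

lemma sep_closed_intervals:
 fixes A B :: "real set"
 assumes "convex A" "convex B" "A Int B = {}" "closed A" "closed B"
 obtains d where "d > 0" "!!x t. x : A ==> t : B ==> d <= abs (x - t)"
proof -
 have main: "\<exists>d>0. ALL x:A. ALL t:B. d <= t - x"
  if ne: "A ~= {}" "B ~= {}" and lt: "ALL x:A. ALL t:B. x < t" and c: "closed A" "closed B" for A B :: "real set"
 proof -
  obtain a b where ab: "a : A" "b : B" using ne by blast
  have bA: "bdd_above A" using lt ab(2) by (meson bdd_aboveI less_imp_le)
  have bB: "bdd_below B" using lt ab(1) by (meson bdd_belowI less_imp_le)
  have "Sup A : A" using closed_contains_Sup[OF ne(1) bA c(1)] .
  moreover have "Inf B : B" using closed_contains_Inf[OF ne(2) bB c(2)] .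
  ultimately have "Inf B - Sup A > 0" using lt by auto
  moreover have "Inf B - Sup A <= t - x" if "x : A" "t : B" for x t
   using cSup_upper[OF that(1) bA] cInf_lower[OF that(2) bB] by linarith
  ultimately show ?thesis by blast
 qed
 show ?thesis
 proof (cases "A = {} | B = {}")
  case True thus ?thesis using that[of 1] by auto
 next
  case False
  from convex_Int_lessThan_sep[OF assms(1-3)] show ?thesis
  proof
   assume "ALL x:A. ALL t:B. x < t"
   from main[OF _ _ this] False assms obtain d where "d > 0" "ALL x:A. ALL t:B. d <= t - x" by blast
   thus ?thesis using that[of d] by (metis abs_ge_self abs_minus_commute order_trans)
  next
   assume "ALL x:A. ALL t:B. t < x"
   hence "ALL x:B. ALL t:A. x < t" by blast
   from main[OF _ _ this] False assms obtain d where "d > 0" "ALL x:B. ALL t:A. d <= t - x" by blast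
   thus ?thesis using that[of d] by (metis abs_ge_self order_trans)
  qed
 qed
qed

context
 fixes Dl s assumes g: "gmeas Dl s"
begin

lemma ctr_tendsto_0:
 assumes "tame Dl F"
 shows "((%y::real. ctr s F (iv y)) ---> 0) at_top"
proof -
 obtain C where C: "!!y. y > 0 ==> norm (ctr s F (iv y)) <= C / y"
  using ctr_imag_axis[OF g assms] by blast
 show ?thesis by (rule Lim_null_comparison[OF _ decay_tendsto_0[of C]])
   (use C in \<open>auto intro: eventually_mono[OF eventually_gt_at_top[of 0]]\<close>)
qed

lemma ctr_times_z:
 assumes F: "tame Dl F" and z: "z ~: cx ` Dl"
 shows "z * ctr s F z = ctr s (%x. cx x * F x) z + sint s F"
proof -
 have t: "tame Dl (%x. cx x * F x / (z - cx x))"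
  by (intro tame_cauchy_kernel gmeasD[OF g] z tame_mult tame_id F)
 have "z * ctr s F z = sint s (%x. z * (F x / (z - cx x)))" unfolding ctr_def sint_cmult[OF g] ..
 also have "... = sint s (%x. cx x * F x / (z - cx x) + F x)"
 proof (rule sint_cong[OF g])
  show "tame Dl (%x. z * (F x / (z - cx x)))"
   by (intro tame_mult tame_const tame_cauchy_kernel gmeasD[OF g] z F)
  show "tame Dl (%x. cx x * F x / (z - cx x) + F x)" by (intro tame_add t F)
  fix x assume "x : Dl"
  hence "z - cx x ~= 0" using z by auto
  thus "z * (F x / (z - cx x)) = cx x * F x / (z - cx x) + F x"
   using kernel_shift_identity[of "z - cx x" 0 1 1 "F x"] by (simp add: field_simps)
 qed
 also have "... = ctr s (%x. cx x * F x) z + sint s F"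
  unfolding ctr_def by (rule sint_add[OF g t F])
 finally show ?thesis .
qed

text \<open>While the moments below \<open>k\<close> vanish, \<open>z^k\<close> times the transform
  of \<open>F\<close> is the transform of \<open>x^k F\<close>. One more factor \<open>z\<close>
  adds the \<open>k\<close>-th moment, which is therefore the limit of a quantity that tends to
  \<open>0\<close>. No expansion at infinity is used, so \<open>Dl\<close> may be unbounded.\<close>

lemma moments_vanish:
 assumes F: "tame Dl F" and dec: "EVT y. norm (ctr s F (iv y)) <= C / y ^ (M + 1)" and k: "k < M"
 shows "sint s (%x. cx x ^ k * F x) = 0" using k
proof (induction k rule: less_induct)
 case (less k)
 have T: "tame Dl (%x. cx x ^ j * F x)" for j
  using tame_mult[OF tame_poly[of Dl "monom 1 j"] F] by (simp add: poly_monom)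
 have pw: "z ^ j * ctr s F z = ctr s (%x. cx x ^ j * F x) z"
  if "j <= k" "z ~: cx ` Dl" for j z using that(1)
 proof (induction j)
  case (Suc j)
  have "z ^ j * ctr s F z = ctr s (%x. cx x ^ j * F x) z"
   by (rule Suc.IH) (use Suc.prems in linarith)
  hence "z ^ Suc j * ctr s F z = z * ctr s (%x. cx x ^ j * F x) z"
   by (simp only: power_Suc mult.assoc)
  also have "... = ctr s (%x. cx x * (cx x ^ j * F x)) z + sint s (%x. cx x ^ j * F x)"
   by (rule ctr_times_z[OF T that(2)])
  also have "sint s (%x. cx x ^ j * F x) = 0" by (rule less.IH) (use Suc.prems less.prems in auto)
  finally show ?case by (simp only: power_Suc mult.assoc add_0_right)
 qed simp
 have eq: "sint s (%x. cx x ^ k * F x) = z ^ Suc k * ctr s F z - ctr s (%x. cx x ^ Suc k * F x) z"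
  if "z ~: cx ` Dl" for z
 proof -
  have "z ^ Suc k * ctr s F z = z * (z ^ k * ctr s F z)" by (simp only: power_Suc mult.assoc)
  also have "... = ctr s (%x. cx x * (cx x ^ k * F x)) z + sint s (%x. cx x ^ k * F x)"
   unfolding pw[OF order_refl that] by (rule ctr_times_z[OF T that])
  finally show ?thesis by (simp only: power_Suc mult.assoc add_diff_cancel_left')
 qed
 have "((%y. (iv y) ^ Suc k * ctr s F (iv y)) ---> 0) at_top"
 proof (rule Lim_null_comparison[OF _ decay_tendsto_0[of "abs C"]])
  show "EVT y. norm ((iv y) ^ Suc k * ctr s F (iv y)) <= abs C / y"
   using dec eventually_ge_at_top[of 1]
  proof eventually_elim
   case (elim y)
   have "norm ((iv y) ^ Suc k * ctr s F (iv y)) = y ^ Suc k * norm (ctr s F (iv y))"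
    using elim(2) by (simp add: norm_mult norm_power)
   also have "... <= y ^ M * (C / y ^ (M + 1))"
   proof (rule mult_mono)
    show "y ^ Suc k <= y ^ M" by (rule power_increasing) (use elim(2) less.prems in auto)
   qed (use elim in auto)
   also have "... = C / y" using elim(2) by (simp only: power_add power_one_right) (simp add: field_simps)
   also have "... <= abs C / y" using elim(2) by (intro divide_right_mono) auto
   finally show ?case .
  qed
 qed
 from tendsto_diff[OF this ctr_tendsto_0[OF T[of "Suc k"]]]
 have "((%y. (iv y) ^ Suc k * ctr s F (iv y) - ctr s (%x. cx x ^ Suc k * F x) (iv y)) ---> 0) at_top"
  by (simp only: diff_zero)
 moreover have "EVT y. (iv y) ^ Suc k * ctr s F (iv y) - ctr s (%x. cx x ^ Suc k * F x) (iv y) = sint s (%x. cx x ^ k * F x)"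
  using eventually_gt_at_top[of 0]
 proof eventually_elim
  case (elim y)
  thus ?case by (intro eq[symmetric] imag_axis_off) simp
 qed
 ultimately have "((%y. sint s (%x. cx x ^ k * F x)) ---> 0) (at_top :: real filter)"
  by (rule Lim_transform_eventually)
 thus ?case by (simp add: tendsto_const_iff)
qed

lemma orthogonal_poly:
 assumes F: "tame Dl F" and mom: "!!k. k < M ==> sint s (%x. cx x ^ k * F x) = 0"
  and p: "degree p < M"
 shows "sint s (%x. poly p (cx x) * F x) = 0"
proof -
 have T: "tame Dl (%x. cx x ^ j * F x)" for j
  using tame_mult[OF tame_poly[of Dl "monom 1 j"] F] by (simp add: poly_monom)
 have "sint s (%x. poly p (cx x) * F x) = sint s (%x. SUM i<=degree p. coeff p i * (cx x ^ i * F x))"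
  by (simp add: poly_altdef sum_distrib_right mult.assoc)
 also have "... = (SUM i<=degree p. sint s (%x. coeff p i * (cx x ^ i * F x)))"
  by (intro sint_sum[OF g] tame_mult[OF tame_const] T)
 also have "... = 0" using mom p by (intro sum.neutral) (auto simp: sint_cmult[OF g])
 finally show ?thesis .
qed

lemma ctr_real_axis:
 assumes "!!x. Im (F x) = 0"
 shows "Im (ctr s F (cx x)) = 0"
proof -
 have "F t / (cx x - cx t) = cx (Re (F t) / (x - t))" for t
  using assms[of t] by (metis complex_is_Real_iff of_real_Re of_real_diff of_real_divide)
 hence "ctr s F (cx x) = cx (fst s * (LINT t|snd s. Re (F t) / (x - t)))"
  unfolding ctr_def sint_def by (simp only: integral_complex_of_real of_real_mult)
 thus ?thesis by simp
qed

lemma gmeas_AE_pos_integral: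
 assumes "integrable (snd s) h" "AE x in snd s. h x >= 0" "\<not> (AE x in snd s. h x = 0)"
 shows "(LINT x|snd s. h x) > (0::real)"
 using integral_nonneg_eq_0_iff_AE[OF assms(1,2)] integral_nonneg_AE[OF assms(2)] assms(3)
 by (metis less_eq_real_def)

lemma cauchy_real_sign:
 assumes "convex I" "I Int Dl = {}"
 obtains e :: real where "e = 1 | e = -1" "!!x. x : I ==> e * Re (cauchy s (cx x)) > 0"
proof -
 have re: "Re (cauchy s (cx x)) = fst s * (LINT t|snd s. 1 / (x - t))" for x
 proof -
  have "1 / (cx x - cx t) = cx (1 / (x - t))" for t by simp
  hence "cauchy s (cx x) = cx (fst s * (LINT t|snd s. 1 / (x - t)))"
   unfolding cauchy_def by (simp only: integral_complex_of_real of_real_mult)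
  thus ?thesis by simp
 qed
 have int: "integrable (snd s) (%t. 1 / (x - t))" if "x : I" for x
 proof -
  have "cx x ~: cx ` Dl" using assms that by auto
  from tame_integrable[OF g tame_cauchy_kernel[OF gmeasD(3)[OF g] this tame_const[of _ 1]]]
  have "integrable (snd s) (%t. cx (1 / (x - t)))" by simp
  thus ?thesis by (simp only: complex_of_real_integrable_eq)
 qed
 have AEF: "\<not> (AE x in snd s. False)" using gmeasD(8)[OF g, of "{}"] by simp
 have fs: "fst s * fst s = 1" using gmeasD(1)[OF g] by auto
 from convex_Int_lessThan_sep[OF assms(1) gmeasD(4)[OF g] assms(2)] show ?thesis
 proof
  assume lt: "ALL x:I. ALL t:Dl. x < t"
  have "(LINT t|snd s. - (1 / (x - t))) > 0" if "x : I" for x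
  proof (rule gmeas_AE_pos_integral)
   show "integrable (snd s) (%t. - (1 / (x - t)))" using int[OF that] by simp
   show "AE t in snd s. - (1 / (x - t)) >= 0"
    using gmeasD(6)[OF g] by eventually_elim (use lt that in \<open>auto simp: divide_nonneg_neg less_imp_le\<close>)
   show "\<not> (AE t in snd s. - (1 / (x - t)) = 0)"
   proof
    assume "AE t in snd s. - (1 / (x - t)) = 0"
    hence "AE t in snd s. False" using gmeasD(6)[OF g] by eventually_elim (use lt that in auto)
    thus False using AEF by blast
   qed
  qed
  hence "- fst s * Re (cauchy s (cx x)) > 0" if "x : I" for x
   using that fs by (simp add: re mult.assoc[symmetric])
  thus ?thesis using that[of "- fst s"] gmeasD(1)[OF g] by auto
 next
  assume lt: "ALL x:I. ALL t:Dl. t < x"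
  have "(LINT t|snd s. (1 / (x - t))) > 0" if "x : I" for x
  proof (rule gmeas_AE_pos_integral)
   show "integrable (snd s) (%t. (1 / (x - t)))" using int[OF that] by simp
   show "AE t in snd s. (1 / (x - t)) >= 0"
    using gmeasD(6)[OF g] by eventually_elim (use lt that in \<open>auto simp: less_imp_le\<close>)
   show "\<not> (AE t in snd s. (1 / (x - t)) = 0)"
   proof
    assume "AE t in snd s. (1 / (x - t)) = 0"
    hence "AE t in snd s. False" using gmeasD(6)[OF g] by eventually_elim (use lt that in auto)
    thus False using AEF by blast
   qed
  qed
  hence "fst s * Re (cauchy s (cx x)) > 0" if "x : I" for x
   using that fs by (simp add: re mult.assoc[symmetric])
  thus ?thesis using that[of "fst s"] gmeasD(1)[OF g] by auto
 qed
qed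

text \<open>On the real axis off \<open>Dl\<close> the kernel has constant sign; off the real axis
  its imaginary part has.\<close>

lemma cauchy_nonzero:
 assumes "z ~: cx ` Dl"
 shows "cauchy s z ~= 0"
proof (cases "Im z = 0")
 case True
 hence z: "z = cx (Re z)" by (simp add: complex_eq_iff)
 hence "{Re z} Int Dl = {}" using assms by (metis disjoint_iff imageI singletonD)
 then obtain e where "e * Re (cauchy s (cx (Re z))) > 0"
  using cauchy_real_sign[of "{Re z}"] by (metis convex_singleton insertI1)
 thus ?thesis using z by auto
next
 case False
 let ?k = "%x. 1 / (z - cx x)"
 have int: "integrable (snd s) ?k"
  by (intro tame_integrable[OF g] tame_cauchy_kernel gmeasD[OF g] assms tame_const)
 have "Im (?k x) = - Im z / (norm (z - cx x))^2" for x by (simp add: Im_divide cmod_def)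
 hence im: "- Im (?k x) / Im z = 1 / (norm (z - cx x))^2" for x using False by simp
 have pos: "1 / (norm (z - cx x))^2 > 0" for x using False by auto
 have "(LINT x|snd s. - Im (?k x) / Im z) > 0"
 proof (rule gmeas_AE_pos_integral)
  show "integrable (snd s) (%x. - Im (?k x) / Im z)" using int by simp
  show "AE x in snd s. - Im (?k x) / Im z >= 0" unfolding im using pos by (intro always_eventually) (auto simp: less_imp_le)
  show "\<not> (AE x in snd s. - Im (?k x) / Im z = 0)"
   unfolding im using pos gmeasD(8)[OF g, of "{}"] by (simp add: less_imp_neq[symmetric] del: divide_eq_0_iff)
 qed
 hence "(LINT x|snd s. Im (?k x)) ~= 0" by auto
 hence "Im (LINT x|snd s. ?k x) ~= 0" using int by simp
 hence "(LINT x|snd s. ?k x) ~= 0" by auto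
 thus ?thesis using gmeasD(1)[OF g] by (auto simp: cauchy_def)
qed

lemma ctr_borel_measurable:
 assumes "F : bm"
 shows "ctr s F : bm"
proof -
 interpret finite_measure "snd s" by (rule gmeas_finite[OF g])
 have "(%z. \<integral>x. F x / (z - cx x) \<partial>snd s) : bm"
 proof (rule borel_measurable_lebesgue_integral)
  have "(%(z, x). F x / (z - cx x)) : borel_measurable (borel \<Otimes>\<^sub>M (borel :: real measure))"
   using assms by measurable
  thus "(%(z, x). F x / (z - cx x)) : borel_measurable (borel \<Otimes>\<^sub>M snd s)"
   by (subst measurable_cong_sets[OF sets_pair_measure_cong[OF refl gmeasD(2)[OF g]] refl])
 qed
 thus ?thesis unfolding ctr_def sint_def by measurable
qed

lemma ctr_tame:
 assumes F: "tame Dl F" and I: "closed I" "convex I" "I Int Dl = {}"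
 shows "tame I (%x. ctr s F (cx x))"
proof -
 obtain d where d: "d > 0" "!!x t. x : I ==> t : Dl ==> d <= abs (x - t)"
  using sep_closed_intervals[of I Dl] I gmeasD[OF g] by metis
 show ?thesis
 proof (rule tame_bounded)
  have "F : bm" using F by (simp add: tame_def)
  from ctr_borel_measurable[OF this]
  show "(%x. ctr s F (cx x)) : bm" by measurable
  have "continuous_on (- cx ` Dl) (ctr s F)"
   using ctr_holomorphic[OF g F] by (rule holomorphic_on_imp_continuous_on)
  thus "continuous_on I (%x. ctr s F (cx x))"
   by (rule continuous_on_compose2) (use I in \<open>auto intro!: continuous_intros\<close>)
  show "norm (ctr s F (cx x)) <= (LINT x|snd s. norm (F x)) / d" if "x : I" for x
  proof (rule ctr_bound_dist[OF g F d(1)])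
   show "d <= norm (cx x - cx t)" if "t : Dl" for t
    using d(2)[OF `x : I` that] by (metis norm_of_real of_real_diff)
  qed
 qed
qed

end

section \<open>Products of measures and the exchange of their factors\<close>

lemma cauchy_tame:
 assumes "gmeas Dl s" "closed I" "convex I" "I Int Dl = {}"
 shows "tame I (%x. cauchy s (cx x))"
 using ctr_tame[OF assms(1) tame_const[of _ 1] assms(2-)] by (simp add: cauchy_eq_ctr)

lemma cauchy_of_real:
 assumes "gmeas Dl s"
 shows "cauchy s (cx x) = cx (Re (cauchy s (cx x)))"
 using ctr_real_axis[OF assms, of "%_. 1" x] by (simp add: cauchy_eq_ctr complex_eq_iff)

text \<open>On \<open>Dl\<close> the transform of \<open>b\<close> has strictly one sign
  \<open>e\<close>. As \<open>Dl\<close> is not null for \<open>a\<close>, the sign selected in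
  \<open>mprod\<close> is \<open>e\<close>, and as the density is positive almost everywhere, the
  null sets of \<open>a\<close> and of the product agree.\<close>

lemma gmeas_mprod:
 assumes a: "gmeas Dl a" and b: "gmeas Dl' b" and disj: "Dl Int Dl' = {}"
  and fm: "finite_moments (mprod a b)"
 shows "gmeas Dl (mprod a b)"
  and "!!F. tame Dl F ==> sint (mprod a b) F = sint a (%x. F x * cauchy b (cx x))"
proof -
 let ?h = "%x. Re (cauchy b (cx x))"
 obtain e where e: "e = 1 | e = -1" "!!x. x : Dl ==> e * ?h x > 0"
  using cauchy_real_sign[OF b gmeasD(4)[OF a] disj] by blast
 have "tame Dl (%x. cauchy b (cx x))" by (rule cauchy_tame[OF b gmeasD(3,4)[OF a] disj])
 hence m0: "?h : bm" by (auto simp: tame_def)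
 have m: "?h : borel_measurable (snd a)" by (rule gmeas_borel[OF a m0])
 have AEh: "(AE x in density (snd a) (%x. ennreal (abs (?h x))). P x) \<longleftrightarrow> (AE x in snd a. P x)" for P
 proof -
  have "(AE x in density (snd a) (%x. ennreal (abs (?h x))). P x) \<longleftrightarrow> (AE x in snd a. ennreal (abs (?h x)) > 0 --> P x)"
   using m by (intro AE_density) auto
  also have "... \<longleftrightarrow> (AE x in snd a. P x)"
  proof (rule eventually_subst)
   show "AE x in snd a. (0 < ennreal (abs (?h x)) --> P x) = P x"
    using gmeasD(6)[OF a] by eventually_elim (use e in force)
  qed
  finally show ?thesis .
 qed
 let ?c = "if AE x in snd a. 0 <= ?h x then 1 else (-1::real)"
 have c: "?c = e"
 proof (cases "e = 1")
  case True
  have "AE x in snd a. 0 <= ?h x" using gmeasD(6)[OF a]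
   by eventually_elim (use e True in \<open>auto simp: less_imp_le\<close>)
  thus ?thesis using True by simp
 next
  case False
  have "\<not> (AE x in snd a. 0 <= ?h x)"
  proof
   assume "AE x in snd a. 0 <= ?h x"
   hence "AE x in snd a. x : {}" using gmeasD(6)[OF a] by eventually_elim (use e False in force)
   thus False using gmeasD(8)[OF a, of "{}"] by blast
  qed
  thus ?thesis using False e by auto
 qed
 have f: "fst (mprod a b) = fst a * e" using c by (simp add: mprod_def)
 have s: "snd (mprod a b) = density (snd a) (%x. ennreal (abs (?h x)))" by (simp add: mprod_def)
 show "gmeas Dl (mprod a b)" unfolding gmeas_def
 proof (intro conjI allI impI)
  show "fst (mprod a b) = 1 | fst (mprod a b) = - 1" using gmeasD(1)[OF a] e(1) by (auto simp: f)
  show "AE x in snd (mprod a b). x : Dl" unfolding s AEh by (rule gmeasD(6)[OF a])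
  show "\<not> (AE x in snd (mprod a b). x : X)" if "finite X" for X
   unfolding s AEh using gmeasD(8)[OF a that] .
  show "sets (snd (mprod a b)) = sets borel" unfolding s using gmeasD(2)[OF a] by simp
 qed (use fm gmeasD[OF a] in auto)
 fix F assume F: "tame Dl F"
 have F': "F : borel_measurable (snd a)" using F gmeas_borel[OF a] by (auto simp: tame_def)
 have "(LINT x|snd (mprod a b). F x) = (LINT x|snd a. abs (?h x) *\<^sub>R F x)"
  unfolding s using m F' by (intro integral_density) auto
 also have "... = (LINT x|snd a. cx e * (F x * cauchy b (cx x)))"
 proof (rule integral_cong_AE)
  have cb: "cauchy b : bm"
   using ctr_borel_measurable[OF b, of "%_. 1"] by (simp add: cauchy_eq_ctr[abs_def])
  have "(%x. cauchy b (cx x)) : borel_measurable (snd a)"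
   using `tame Dl (%x. cauchy b (cx x))` gmeas_borel[OF a] by (auto simp: tame_def)
  thus "(%x. cx e * (F x * cauchy b (cx x))) : borel_measurable (snd a)" using F' by measurable
  show "AE x in snd a. abs (?h x) *\<^sub>R F x = cx e * (F x * cauchy b (cx x))"
   using gmeasD(6)[OF a]
  proof eventually_elim
   case (elim x)
   have "abs (?h x) = e * ?h x" using e(1) e(2)[OF elim] by auto
   thus ?case by (subst cauchy_of_real[OF b]) (simp add: scaleR_conv_of_real)
  qed
 qed (use m F' in measurable)
 also have "... = cx e * (LINT x|snd a. F x * cauchy b (cx x))" by simp
 finally have "(LINT x|snd (mprod a b). F x) = cx e * (LINT x|snd a. F x * cauchy b (cx x))" .
 thus "sint (mprod a b) F = sint a (%x. F x * cauchy b (cx x))" unfolding sint_def f using e by auto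
qed

text \<open>Two points need an argument. The complement of the support is null because countably
  many null open sets cover it. The hull of the closed support is closed because a limit point
  outside it would lie at an end of the hull and yet have a gap to the support.\<close>

lemma gmeas_of_class:
 assumes "s : meas_class Dl"
 shows "gmeas Dl s"
proof -
 have fs: "fst s = 1 | fst s = -1" and se: "sets (snd s) = sets borel" and inf: "infinite (msupp s)"
  and fm: "finite_moments s" and hull: "convex hull (msupp s) = Dl"
  using assms by (auto simp: meas_class_def)
 have sp: "space (snd s) = UNIV" using sets_eq_imp_space_eq[OF se] by simp
 define \<N> where "\<N> = {U :: real set. open U & emeasure (snd s) U = 0}"
 have comp: "- msupp s = \<Union>\<N>" by (auto simp: msupp_def \<N>_def)
 have cl: "closed (msupp s)" unfolding closed_def comp by (auto simp: \<N>_def)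
 obtain \<N>' where N': "\<N>' <= \<N>" "countable \<N>'" "\<Union>\<N>' = \<Union>\<N>"
  using Lindelof[of \<N>] by (auto simp: \<N>_def)
 have "(\<Union>U\<in>\<N>'. U) : null_sets (snd s)"
  using N' by (intro null_sets_UN') (auto simp: \<N>_def null_sets_def se subset_iff)
 hence "- msupp s : null_sets (snd s)" using N' comp by simp
 hence AE: "AE x in snd s. x : msupp s" using AE_not_in by force
 have sub: "msupp s <= Dl" using hull hull_subset by metis
 have closed: "closed Dl"
 proof (rule ccontr)
  assume "\<not> closed Dl"
  then obtain x where x: "x : closure Dl" "x ~: Dl" using closure_subset_eq by blast
  have c: "convex Dl" using hull by (metis convex_convex_hull)
  have "x ~: msupp s" using x sub by blast
  then obtain d where d: "d > 0" "!!y. y : msupp s ==> d <= abs (x - y)"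
   using separate_point_closed[OF cl, of x] unfolding dist_real_def by blast
  have "{x} Int Dl = {}" using x by blast
  from convex_Int_lessThan_sep[OF convex_singleton c this]
  have "Dl <= {x + d..} | Dl <= {..x - d}"
  proof
   assume "ALL u:{x}. ALL t:Dl. u < t"
   hence "msupp s <= {x + d..}" using d sub by fastforce
   hence "convex hull (msupp s) <= {x + d..}" by (intro hull_minimal convex_real_interval)
   thus ?thesis using hull by blast
  next
   assume "ALL u:{x}. ALL t:Dl. t < u"
   hence "msupp s <= {..x - d}" using d sub by fastforce
   hence "convex hull (msupp s) <= {..x - d}" by (intro hull_minimal convex_real_interval)
   thus ?thesis using hull by blast
  qed
  hence "x : {x + d..} | x : {..x - d}"
   using x(1) by (meson closed_atLeast closed_atMost closure_minimal subsetD)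
  thus False using d(1) by auto
 qed
 show ?thesis unfolding gmeas_def
 proof (intro conjI allI impI)
  show "convex Dl" using hull by (metis convex_convex_hull)
  show "Dl ~= {}" using sub inf by auto
  show "AE x in snd s. x : Dl" using AE by (rule AE_mp) (use sub in auto)
  fix X :: "real set" assume X: "finite X"
  show "\<not> (AE x in snd s. x : X)"
  proof
   assume "AE x in snd s. x : X"
   moreover have "- X : sets (snd s)" using X by (simp add: se finite_imp_closed open_Compl borel_open)
   ultimately have "emeasure (snd s) (- X) = 0" by (subst emeasure_eq_AE[where B = "{}"]) auto
   moreover have "open (- X)" using X by (simp add: finite_imp_closed open_Compl)
   ultimately have "msupp s <= X" by (auto simp: msupp_def)
   thus False using inf X finite_subset by blast
  qed
 qed (use fs se fm closed in auto)
qed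

lemma double_kernel:
 fixes x y z f :: complex
 assumes "x ~= y" "z ~= x" "z ~= y"
 shows "f / (x - y) / (z - x) = f / (z - y) * (1 / (z - x) - 1 / (y - x))"
proof -
 have "1 / (z - x) - 1 / (y - x) = (z - y) / ((z - x) * (x - y))"
  using assms by (simp add: divide_simps) (simp add: algebra_simps)
 thus ?thesis using assms by simp
qed

text \<open>Partial fractions of the double kernel (\<open>double_kernel\<close>), then Fubini,
  which applies because the kernel is bounded in terms of the positive distances \<open>d\<close>
  and \<open>d'\<close>. For \<open>F = 1\<close> this says that the transforms of the two products
  of \<open>s\<close> and \<open>sg\<close>, taken in either order, add up to the product of the
  transforms. It is the source of the inverted system.\<close>

lemma ctr_switch:
 assumes s: "gmeas Dl s" and sg: "gmeas Dl' sg" and disj: "Dl' Int Dl = {}" and F: "tame Dl' F"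
  and z: "z ~: cx ` Dl" "z ~: cx ` Dl'"
 shows "ctr s (%x. ctr sg F (cx x)) z
    = cauchy s z * ctr sg F z - ctr sg (%y. F y * cauchy s (cx y)) z"
proof -
 interpret M1: finite_measure "snd s" by (rule gmeas_finite[OF s])
 interpret M2: finite_measure "snd sg" by (rule gmeas_finite[OF sg])
 interpret pair_sigma_finite "snd s" "snd sg" ..
 have disj': "Dl Int Dl' = {}" using disj by blast
 obtain d where d: "d > 0" "!!x y. x : Dl ==> y : Dl' ==> d <= abs (x - y)"
  using sep_closed_intervals[OF gmeasD(4)[OF s] gmeasD(4)[OF sg] disj' gmeasD(3)[OF s] gmeasD(3)[OF sg]] by metis
 obtain d' where d': "d' > 0" "!!x. x : Dl ==> d' <= norm (z - cx x)"
  using off_closed_dist[OF gmeasD(3)[OF s] z(1)] by blast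
 define K where "K = (%x y. F y / (cx x - cx y) / (z - cx x))"
 have Fm: "F : bm" using F by (simp add: tame_def)
 have "case_prod K : borel_measurable (borel \<Otimes>\<^sub>M borel)" unfolding K_def using Fm by measurable
 hence Km: "case_prod K : borel_measurable (snd s \<Otimes>\<^sub>M snd sg)"
  by (subst measurable_cong_sets[OF sets_pair_measure_cong[OF gmeasD(2)[OF s] gmeasD(2)[OF sg]] refl])
 have Kt: "tame Dl' (K x)" if "x : Dl" for x
 proof -
  have "cx x ~: cx ` Dl'" using disj that by auto
  from tame_mult[OF tame_cauchy_kernel[OF gmeasD(3)[OF sg] this F] tame_const[of _ "1 / (z - cx x)"]]
  show ?thesis by (simp add: K_def)
 qed
 have Kb: "norm (K x y) <= norm (F y) / (d * d')" if "x : Dl" "y : Dl'" for x y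
 proof -
  have "norm (cx x - cx y) >= d" using d(2)[OF that] by (metis norm_of_real of_real_diff)
  moreover have "norm (z - cx x) >= d'" using d'(2) that by blast
  ultimately show ?thesis unfolding K_def divide_divide_eq_left norm_divide norm_mult
   using d(1) d'(1) by (intro divide_left_mono mult_mono mult_pos_pos) auto
 qed
 have int: "integrable (snd s \<Otimes>\<^sub>M snd sg) (case_prod K)"
 proof (rule Fubini_integrable[OF Km])
  show "AE x in snd s. integrable (snd sg) (%y. (case (x, y) of (x, y) => K x y))"
   using gmeasD(6)[OF s] by eventually_elim (use Kt tame_integrable[OF sg] in auto)
  let ?B = "(LINT y|snd sg. norm (F y)) / (d * d')"
  show "integrable (snd s) (%x. \<integral>y. norm (case (x, y) of (x, y) => K x y) \<partial>snd sg)"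
  proof (rule Bochner_Integration.integrable_bound)
   show "integrable (snd s) (%_. ?B)" by (rule M1.integrable_const)
   show "(%x. \<integral>y. norm (case (x, y) of (x, y) => K x y) \<partial>snd sg) : borel_measurable (snd s)"
    using Km by measurable
   show "AE x in snd s. norm (LINT y|snd sg. norm (case (x, y) of (x, y) => K x y)) <= norm ?B"
    using gmeasD(6)[OF s]
   proof eventually_elim
    case (elim x)
    have "(LINT y|snd sg. norm (K x y)) <= (LINT y|snd sg. norm (F y) / (d * d'))"
     using gmeasD(6)[OF sg] tame_integrable[OF sg Kt[OF elim]] tame_integrable[OF sg F] Kb[OF elim]
     by (intro integral_mono_AE) (auto elim: eventually_mono)
    also have "... = ?B" by simp
    finally have "(LINT y|snd sg. norm (K x y)) <= ?B" .
    moreover have "(LINT y|snd sg. norm (K x y)) >= 0" by simp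
    ultimately show ?case using d(1) d'(1) by simp
   qed
  qed
 qed
 have T1: "tame Dl' (%y. F y / (z - cx y))" by (intro tame_cauchy_kernel gmeasD[OF sg] z F)
 have inner: "(LINT x|snd s. K x y) * cx (fst s) = F y / (z - cx y) * (cauchy s z - cauchy s (cx y))"
  if y: "y : Dl'" for y
 proof -
  have yn: "cx y ~: cx ` Dl" using disj y by auto
  have t: "tame Dl (%x. 1 / (z - cx x))" "tame Dl (%x. 1 / (cx y - cx x))"
   by (intro tame_cauchy_kernel gmeasD[OF s] z yn tame_const)+
  have Km2: "(%x. K x y) : borel_measurable (snd s)"
   by (rule gmeas_borel[OF s]) (unfold K_def, measurable)
  have "(LINT x|snd s. K x y) = (LINT x|snd s. F y / (z - cx y) * (1 / (z - cx x) - 1 / (cx y - cx x)))"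
  proof (rule integral_cong_AE[OF Km2])
   show "(%x. F y / (z - cx y) * (1 / (z - cx x) - 1 / (cx y - cx x))) : borel_measurable (snd s)"
    by (rule gmeas_borel[OF s]) measurable
   show "AE x in snd s. K x y = F y / (z - cx y) * (1 / (z - cx x) - 1 / (cx y - cx x))"
    using gmeasD(6)[OF s]
   proof eventually_elim
    case (elim x)
    show ?case unfolding K_def using elim y z disj by (intro double_kernel) auto
   qed
  qed
  also have "... = F y / (z - cx y) * ((LINT x|snd s. 1 / (z - cx x)) - (LINT x|snd s. 1 / (cx y - cx x)))"
   using t tame_integrable[OF s] by simp
  finally have eq: "(LINT x|snd s. K x y) = F y / (z - cx y) * ((LINT x|snd s. 1 / (z - cx x)) - (LINT x|snd s. 1 / (cx y - cx x)))" .
  show ?thesis unfolding eq cauchy_def right_diff_distrib left_diff_distrib by (simp only: ac_simps)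
 qed
 have "ctr s (%x. ctr sg F (cx x)) z = cx (fst s * fst sg) * (\<integral>x. (LINT y|snd sg. K x y) \<partial>snd s)"
 proof -
  have "ctr sg F (cx x) / (z - cx x) = cx (fst sg) * (LINT y|snd sg. K x y)" for x
   unfolding ctr_def sint_def K_def by (simp del: divide_divide_eq_left)
  thus ?thesis unfolding ctr_def[of s] sint_def[of s] by simp
 qed
 also have "(\<integral>x. (LINT y|snd sg. K x y) \<partial>snd s) = (\<integral>y. (LINT x|snd s. K x y) \<partial>snd sg)"
  using Fubini_integral[of K] int by simp
 also have "cx (fst s * fst sg) * ... = cx (fst sg) * (\<integral>y. (LINT x|snd s. K x y) * cx (fst s) \<partial>snd sg)"
  by simp
 also have "(\<integral>y. (LINT x|snd s. K x y) * cx (fst s) \<partial>snd sg)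
   = (LINT y|snd sg. F y / (z - cx y) * (cauchy s z - cauchy s (cx y)))"
 proof (rule integral_cong_AE)
  show "(%y. (LINT x|snd s. K x y) * cx (fst s)) : borel_measurable (snd sg)"
  proof -
   have "(%(y, x). K x y) : borel_measurable (snd sg \<Otimes>\<^sub>M snd s)"
    using measurable_pair_swap[OF Km] by simp
   thus ?thesis by measurable
  qed
  have "(%y. cauchy s (cx y)) : bm"
   using ctr_borel_measurable[OF s, of "%_. 1"] by (simp add: cauchy_eq_ctr[abs_def])
  note [measurable] = this Fm
  show "(%y. F y / (z - cx y) * (cauchy s z - cauchy s (cx y))) : borel_measurable (snd sg)"
   by (rule gmeas_borel[OF sg]) measurable
  show "AE y in snd sg. (LINT x|snd s. K x y) * cx (fst s) = F y / (z - cx y) * (cauchy s z - cauchy s (cx y))"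
   using gmeasD(6)[OF sg] by eventually_elim (rule inner)
 qed
 also have "cx (fst sg) * ... = sint sg (%y. cauchy s z * (F y / (z - cx y)) - F y * cauchy s (cx y) / (z - cx y))"
  unfolding sint_def by (simp add: algebra_simps diff_divide_distrib)
 also have "... = cauchy s z * ctr sg F z - ctr sg (%y. F y * cauchy s (cx y)) z"
 proof -
  have "tame Dl' (%y. F y * cauchy s (cx y) / (z - cx y))"
   by (intro tame_cauchy_kernel tame_mult F cauchy_tame[OF s] gmeasD[OF sg] disj z)
  thus ?thesis
   unfolding ctr_def by (subst sint_diff[OF sg tame_mult[OF tame_const T1]]) (simp_all only: sint_cmult[OF sg])
 qed
 finally show ?thesis .
qed

section \<open>Real polynomials on the complex plane\<close>

lemma cpoly_simps [simp]:
 "cpoly 0 = 0" "cpoly 1 = 1" "cpoly (p + q) = cpoly p + cpoly q" "cpoly (p - q) = cpoly p - cpoly q"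
 "cpoly (- p) = - cpoly p" "cpoly (p * q) = cpoly p * cpoly q" "cpoly (smult a p) = smult (cx a) (cpoly p)"
 "cpoly [:a:] = [:cx a:]" "cpoly (p ^ n) = cpoly p ^ n"
proof -
 show mult: "cpoly (p * q) = cpoly p * cpoly q" for p q
  by (rule poly_eqI) (simp add: coeff_map_poly coeff_mult)
 show one: "cpoly 1 = 1" by (simp add: map_poly_pCons flip: one_pCons)
 show "cpoly (p ^ n) = cpoly p ^ n" by (induction n) (simp_all add: mult one)
qed (auto intro!: poly_eqI simp: coeff_map_poly coeff_pCons split: nat.split)

lemma cpoly_of_real [simp]: "pc p (cx x) = cx (poly p x)"
 by (induction p) (simp_all add: map_poly_pCons)

lemma degree_cpoly [simp]: "degree (cpoly p) = degree p" by (rule degree_map_poly) simp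

lemma cpoly_eq_0_iff [simp]: "cpoly p = 0 \<longleftrightarrow> p = 0"
 by (rule map_poly_eq_0_iff) auto

lemma cpoly_inj: "cpoly p = cpoly q ==> p = q" using cpoly_eq_0_iff[of "p - q"] by simp

lemma poly_cpoly_nodal: "pc (nodal X) z = (\<Prod>x\<in>X. z - cx x)"
proof (induction X rule: infinite_finite_induct)
 case (insert x X)
 thus ?case using nodal_remove[of "insert x X" x] by (simp add: map_poly_pCons del: mult_pCons_left)
qed (simp_all add: nodal_def)

lemma poly_cpoly_nodal_eq_0_iff: "finite X ==> pc (nodal X) z = 0 \<longleftrightarrow> z : cx ` X"
 by (auto simp: poly_cpoly_nodal)

lemma poly_cpoly_nodal_remove:
 "finite X ==> x : X ==> pc (nodal X) z = (z - cx x) * pc (nodal (X - {x})) z"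
 by (simp add: poly_cpoly_nodal prod.remove)

lemma tame_divide_nodal:
 assumes "finite X" "X Int Dl = {}" "closed Dl" "tame Dl F"
 shows "tame Dl (%x. F x / cx (poly (nodal X) x))" using assms(1,2)
proof (induction X)
 case empty
 thus ?case using assms(4) by (simp add: nodal_def)
next
 case (insert r X)
 have "cx r ~: cx ` Dl" using insert.prems by auto
 moreover have "tame Dl (%x. F x / cx (poly (nodal X) x))" using insert by auto
 ultimately have "tame Dl (%x. - (F x / cx (poly (nodal X) x) / (cx r - cx x)))"
  by (intro tame_minus tame_cauchy_kernel[OF assms(3)])
 moreover have "- (F x / cx (poly (nodal X) x) / (cx r - cx x)) = F x / cx (poly (nodal (insert r X)) x)" for x
 proof -
  have "poly (nodal (insert r X)) x = (x - r) * poly (nodal X) x"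
   using insert.hyps by (simp add: poly_nodal)
  hence "cx (poly (nodal (insert r X)) x) = - (cx r - cx x) * cx (poly (nodal X) x)"
   by (simp only: of_real_mult of_real_diff minus_diff_eq)
  moreover have "- (f / b / a) = f / (- a * b)" for f a b :: complex by simp
  ultimately show ?thesis by metis
 qed
 ultimately show ?case by (simp only:)
qed

lemma cpoly_nodal_dvd:
 assumes "finite X" "!!x. x : X ==> poly d (cx x) = 0"
 shows "cpoly (nodal X) dvd d" using assms
proof (induction X arbitrary: d)
 case empty
 thus ?case by (simp add: nodal_def)
next
 case (insert x X)
 have "poly d (cx x) = 0" using insert.prems by blast
 then obtain q where q: "d = [:- cx x, 1:] * q" using poly_eq_0_iff_dvd by blast
 have "poly q (cx y) = 0" if "y : X" for y
 proof -
  have "poly d (cx y) = 0" using insert.prems that by blast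
  moreover have "y ~= x" using insert.hyps that by blast
  ultimately show ?thesis by (auto simp: q)
 qed
 hence "cpoly (nodal X) dvd q" by (rule insert.IH)
 hence "[:- cx x, 1:] * cpoly (nodal X) dvd d" unfolding q by (rule mult_dvd_mono[OF dvd_refl])
 moreover have "nodal (insert x X) = [:- x, 1:] * nodal X"
  using nodal_remove[of "insert x X" x] insert.hyps by simp
 hence "cpoly (nodal (insert x X)) = cpoly [:- x, 1:] * cpoly (nodal X)"
  by (simp only: cpoly_simps(6))
 moreover have "cpoly [:- x, 1:] = [:- cx x, 1:]" by (simp add: map_poly_pCons)
 ultimately show ?case by simp
qed

section \<open>Orthogonality from interpolation\<close>

text \<open>\<open>H\<close> minus \<open>nodal X\<close> times the transform of \<open>Ph\<close>
  is a polynomial, since polynomial factors move under the integral up to polynomials. It vanishes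
  on \<open>X\<close>, where both terms do, so \<open>nodal X\<close> divides it; the quotient tends
  to \<open>0\<close> along the imaginary axis and is therefore \<open>0\<close>. The decay of
  \<open>H / nodal X\<close> then becomes the vanishing of moments of \<open>Ph\<close>.\<close>

lemma orth_of_zeros:
 assumes g: "gmeas Dl s" and F: "tame Dl F" and X: "finite X" "X Int Dl = {}"
  and H: "!!z. z ~: cx ` Dl ==> H z = poly T z * ctr s F z - poly c z"
  and zero: "!!r. r : X ==> H (cx r) = 0"
  and dec: "EVT y. norm (H (iv y) / pc (nodal X) (iv y)) <= C / y ^ (M + 1)"
  and Ph: "Ph = (%x. poly T (cx x) * F x / cx (poly (nodal X) x))"
 shows "tame Dl Ph" and "!!z. z ~: cx ` Dl ==> H z = pc (nodal X) z * ctr s Ph z"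
  and "!!p. degree p < M ==> sint s (%x. poly p (cx x) * Ph x) = 0"
proof -
 let ?R = "cpoly (nodal X)"
 show tPh: "tame Dl Ph" unfolding Ph
  by (rule tame_divide_nodal[OF X gmeasD(3)[OF g]]) (intro tame_mult tame_poly F)
 have RPh: "poly ?R (cx x) * Ph x = poly T (cx x) * F x" if "x : Dl" for x
  using that X by (auto simp: Ph poly_nodal_eq_0_iff)
 obtain d1 where d1: "!!z. z ~: cx ` Dl ==> poly T z * ctr s F z - ctr s (%x. poly T (cx x) * F x) z = poly d1 z"
  using ctr_poly_mult[OF g F] by blast
 obtain d2 where d2: "!!z. z ~: cx ` Dl ==> poly ?R z * ctr s Ph z - ctr s (%x. poly ?R (cx x) * Ph x) z = poly d2 z"
  using ctr_poly_mult[OF g tPh] by blast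
 define d where "d = d1 - c - d2"
 have eq: "H z - poly ?R z * ctr s Ph z = poly d z" if z: "z ~: cx ` Dl" for z
 proof -
  have "ctr s (%x. poly ?R (cx x) * Ph x) z = ctr s (%x. poly T (cx x) * F x) z"
  proof (rule ctr_cong[OF g z _ _ RPh])
   show "tame Dl (%x. poly ?R (cx x) * Ph x)" by (intro tame_mult tame_poly tPh)
   show "tame Dl (%x. poly T (cx x) * F x)" by (intro tame_mult tame_poly F)
  qed
  thus ?thesis using d1[OF z] d2[OF z] H[OF z] by (simp add: d_def algebra_simps)
 qed
 have "?R dvd d"
 proof (rule cpoly_nodal_dvd[OF X(1)])
  fix x assume x: "x : X"
  hence "cx x ~: cx ` Dl" using X by auto
  moreover have "poly (nodal X) x = 0" using x X by (simp add: poly_nodal_eq_0_iff)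
  ultimately show "poly d (cx x) = 0" using eq[of "cx x"] zero[OF x] by simp
 qed
 then obtain q where q: "d = ?R * q" by blast
 have Rnz: "poly ?R (iv y) ~= 0" if "y > 0" for y :: real
  using that X imag_axis_off[of y X] by (simp add: poly_cpoly_nodal_eq_0_iff)
 have ratio: "H (iv y) / poly ?R (iv y) - ctr s Ph (iv y) = poly q (iv y)"
  if "y > 0" for y :: real
  using eq[OF imag_axis_off[of y]] Rnz[OF that] that by (simp add: q field_simps)
 have "((%y. H (iv y) / poly ?R (iv y)) ---> 0) at_top"
 proof (rule Lim_null_comparison[OF _ decay_tendsto_0[of "abs C"]])
  show "EVT y. norm (H (iv y) / poly ?R (iv y)) <= abs C / y" using dec eventually_ge_at_top[of 1]
  proof eventually_elim
   case (elim y)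
   have "C / y ^ (M + 1) <= abs C / y ^ (M + 1)" using elim(2) by (intro divide_right_mono) auto
   also have "... <= abs C / y ^ 1" using elim(2) by (intro divide_left_mono power_increasing) auto
   finally show ?case using elim(1) by simp
  qed
 qed
 from tendsto_diff[OF this ctr_tendsto_0[OF g tPh]]
 have "((%y. poly q (iv y)) ---> 0) at_top" unfolding diff_zero
  by (rule Lim_transform_eventually) (auto intro!: eventually_mono[OF eventually_gt_at_top[of 0]] ratio)
 hence "q = 0" by (rule poly_imag_axis_zero)
 hence d0: "poly d z = 0" for z by (simp add: q)
 show fin: "H z = poly ?R z * ctr s Ph z" if "z ~: cx ` Dl" for z using eq[OF that] d0[of z] by simp
 have "EVT y. norm (ctr s Ph (iv y)) <= C / y ^ (M + 1)" using dec eventually_gt_at_top[of 0]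
 proof eventually_elim
  case (elim y)
  thus ?case using fin[OF imag_axis_off[of y]] Rnz[of y] by simp
 qed
 from moments_vanish[OF g tPh this] show "sint s (%x. poly p (cx x) * Ph x) = 0" if "degree p < M" for p
  by (intro orthogonal_poly[OF g tPh, of M]) (use that in auto)
qed

text \<open>The rule attached to the density \<open>te\<close>, which is what remains of an
  orthogonal function after its sign changes \<open>Y\<close> have been divided out;
  \<open>e\<close> makes it nonnegative. Strict positivity on squares holds because
  \<open>te\<close> has finitely many zeros and \<open>s\<close> is not concentrated on a finite
  set.\<close>

locale quad_meas =
 fixes Dl :: "real set" and s :: smeasure and Y :: "real set" and te :: "real => real" and e :: real and N :: nat
 assumes gm: "gmeas Dl s" and tm: "tame Dl (%x. cx (te x))" and fY: "finite Y"
  and e: "e = 1 | e = -1" and pos: "!!x. x : Dl ==> 0 <= e * te x"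
  and zer: "finite {x : Dl. te x = 0}"
  and orth: "!!p. degree p < N ==> (LINT x|snd s. poly (nodal Y * p) x * te x) = 0"
begin

definition L :: "real poly => real" where "L p = e * (LINT x|snd s. poly p x * te x)"

lemma L_integrable: "integrable (snd s) (%x. poly p x * te x)"
proof -
 have "tame Dl (%x. pc p (cx x) * cx (te x))" by (intro tame_mult tame_poly tm)
 from tame_integrable[OF gm this]
 have "integrable (snd s) (%x. cx (poly p x * te x))" by simp
 thus ?thesis by (simp only: complex_of_real_integrable_eq)
qed

lemma L_square_pos:
 assumes "p ~= 0" shows "L (p^2) > 0"
proof -
 have "(LINT x|snd s. e * (poly (p^2) x * te x)) > 0"
 proof (rule gmeas_AE_pos_integral[OF gm])
  show "integrable (snd s) (%x. e * (poly (p^2) x * te x))"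
   by (intro Bochner_Integration.integrable_mult_right L_integrable)
  show "AE x in snd s. 0 <= e * (poly (p^2) x * te x)" using gmeasD(6)[OF gm]
  proof eventually_elim
   case (elim x)
   have "0 <= (poly p x)^2 * (e * te x)" using pos[OF elim] by simp
   thus ?case by (simp add: poly_power algebra_simps)
  qed
  show "\<not> (AE x in snd s. e * (poly (p^2) x * te x) = 0)"
  proof
   assume "AE x in snd s. e * (poly (p^2) x * te x) = 0"
   hence "AE x in snd s. x : {x. poly p x = 0} Un {x : Dl. te x = 0}"
    using gmeasD(6)[OF gm] by eventually_elim (use e in \<open>auto simp: poly_power\<close>)
   moreover have "finite ({x. poly p x = 0} Un {x : Dl. te x = 0})"
    using zer poly_roots_finite[OF assms] by simp
   ultimately show False using gmeasD(8)[OF gm] by blast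
  qed
 qed
 thus ?thesis by (simp add: L_def)
qed

sublocale quadrature L Y N
proof
 show "L (p + q) = L p + L q" for p q using L_integrable by (simp add: L_def algebra_simps)
 show "L (smult c p) = c * L p" for c p by (simp add: L_def mult.assoc)
 show "L (nodal Y * p) = 0" if "degree p < N" for p using orth[OF that] by (simp add: L_def)
 show "0 < L (p^2)" if "p ~= 0" for p using L_square_pos[OF that] .
 show "finite Y" by (rule fY)
qed

lemma sint_eq_L: "sint s (%x. cx (poly p x * te x)) = cx (fst s * e * L p)"
proof -
 have "e * (e * r) = r" for r using e by auto
 thus ?thesis unfolding sint_def L_def integral_complex_of_real
  by (simp only: of_real_mult[symmetric] mult.assoc)
qed

end

lemma holomorphic_divide_nodal:
 assumes "open U" "finite Y" "Ph holomorphic_on U" "!!y. y : Y ==> Ph (cx y) = 0"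
 shows "EX Th. Th holomorphic_on U & (ALL z:U. Ph z = pc (nodal Y) z * Th z)" using assms(2-4)
 proof (induction Y arbitrary: Ph)
  case empty
  thus ?case by (intro exI[of _ Ph]) (simp add: nodal_def)
 next
  case (insert y Y)
  define Ps where "Ps = (%z. if z = cx y then deriv Ph (cx y) else (Ph z - Ph (cx y)) / (z - cx y))"
  have 1: "Ps holomorphic_on U" unfolding Ps_def by (rule pole_lemma_open[OF insert.prems(1) assms(1)])
  have y0: "Ph (cx y) = 0" using insert.prems by blast
  have "Ps (cx x) = 0" if "x : Y" for x
  proof -
   have "x ~= y" using that insert.hyps by blast
   moreover have "Ph (cx x) = 0" using insert.prems that by blast
   ultimately show ?thesis using y0 by (simp add: Ps_def)
  qed
  from insert.IH[OF 1 this] obtain Th where Th: "Th holomorphic_on U"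
   "!!z. z : U ==> Ps z = pc (nodal Y) z * Th z" by blast
  have "Ph z = pc (nodal (insert y Y)) z * Th z" if "z : U" for z
  proof -
   have "Ph z = (z - cx y) * Ps z" using y0 by (auto simp: Ps_def)
   thus ?thesis using Th(2)[OF that] insert.hyps by (simp add: poly_cpoly_nodal)
  qed
  thus ?case using Th(1) by blast
 qed

lemma vertical_approach: "(%n. cx y + \<i> * cx (inverse (real (Suc n)))) ----> cx y"
proof -
 have "(%n. cx y + \<i> * cx (inverse (real (Suc n)))) ----> cx y + \<i> * cx 0"
  by (intro tendsto_intros LIMSEQ_inverse_real_of_nat)
 thus ?thesis by simp
qed

text \<open>The node lies on \<open>Dl\<close>, where the transforms are singular, so it is
  approached vertically. The difference is the integral of \<open>(Ph x - Ph z) / (z - x)\<close>,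
  and since \<open>Ph\<close> vanishes at \<open>y\<close> the limit is the integral of
  \<open>- Ph x / (x - y)\<close>. The quotient of \<open>Ph\<close> by \<open>x - y\<close> is the
  nodal polynomial of the other nodes times \<open>te\<close>: an unnormalized quadrature weight
  appears.\<close>

lemma value_at_node:
 fixes y :: real
 defines "z == %n. cx y + \<i> * cx (inverse (real (Suc n)))"
 assumes g: "gmeas Dl s" and t: "tame Dl (%x. Ph (cx x))" and U: "open U" "cx ` Dl <= U"
  and h: "Ph holomorphic_on U" "Th holomorphic_on U"
  and fact: "!!z. z : U ==> Ph z = pc (nodal Y) z * Th z" and Y: "finite Y" "Y <= Dl" "y : Y"
  and te: "tame Dl te" "!!x. x : Dl ==> te x = Th (cx x)"
 shows "(%n. ctr s (%x. Ph (cx x)) (z n) - Ph (z n) * cauchy s (z n))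
      ----> - sint s (%x. cx (poly (nodal (Y - {y})) x) * te x)"
proof -
 let ?y = "cx y"
 let ?N = "nodal (Y - {y})"
 have zlim: "z ----> ?y" unfolding z_def by (rule vertical_approach)
 have zIm: "Im (z n) ~= 0" for n by (simp add: z_def)
 have zoff: "z n ~: cx ` Dl" for n using zIm[of n] by auto
 have yU: "?y : U" using Y U by blast
 obtain dl where dl: "dl > 0" "cball ?y (2 * dl) <= U"
 proof -
  obtain r where "r > 0" "cball ?y r <= U" using U(1) yU open_contains_cball by blast
  thus ?thesis using that[of "r / 2"] by simp
 qed
 have sub: "cball ?y dl <= cball ?y (2 * dl)" using dl(1) by (simp add: cball_subset_cball_iff)
 have "continuous_on (cball ?y (2 * dl)) (deriv Ph)"
  using holomorphic_deriv[OF h(1) U(1)] dl(2) holomorphic_on_imp_continuous_on holomorphic_on_subset by blast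
 hence "bounded (deriv Ph ` cball ?y (2 * dl))" by (intro compact_imp_bounded compact_continuous_image) auto
 then obtain B where B: "B > 0" "!!w. w : cball ?y (2 * dl) ==> norm (deriv Ph w) <= B"
  by (auto simp: bounded_pos)
 have lip: "norm (Ph a - Ph b) <= B * norm (a - b)" if "a : cball ?y (2 * dl)" "b : cball ?y (2 * dl)" for a b
 proof (rule field_differentiable_bound[OF convex_cball _ B(2) that])
  fix w assume "w : cball ?y (2 * dl)"
  thus "(Ph has_field_derivative deriv Ph w) (at w within cball ?y (2 * dl))"
   using holomorphic_derivI[OF h(1) U(1)] dl(2) has_field_derivative_at_within by blast
 qed
 have "continuous_on (cball ?y (2 * dl)) Ph"
  using holomorphic_on_imp_continuous_on[OF h(1)] dl(2) continuous_on_subset by blast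
 hence "bounded (Ph ` cball ?y (2 * dl))" by (intro compact_imp_bounded compact_continuous_image) auto
 then obtain B' where B': "B' > 0" "!!w. w : cball ?y (2 * dl) ==> norm (Ph w) <= B'"
  by (auto simp: bounded_pos)
 obtain n0 where n0: "!!n. n >= n0 ==> z n : cball ?y dl"
  using zlim dl(1) unfolding lim_sequentially by (metis dist_commute less_imp_le mem_cball)
 define ze where "ze n = z (n + n0)" for n
 have zelim: "ze ----> ?y" unfolding ze_def using zlim by (rule LIMSEQ_ignore_initial_segment)
 have zeoff: "ze n ~: cx ` Dl" for n unfolding ze_def by (rule zoff)
 have zeball: "ze n : cball ?y dl" for n unfolding ze_def by (rule n0) simp
 let ?Ps = "%w. pc ?N w * Th w"
 have Psc: "isCont ?Ps ?y"
 proof -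
  have "continuous_on U Th" using h(2) by (rule holomorphic_on_imp_continuous_on)
  hence "isCont Th ?y" using U(1) yU continuous_on_eq_continuous_at by blast
  thus ?thesis by (intro continuous_intros)
 qed
 have PhPs: "Ph w = (w - ?y) * ?Ps w" if "w : U" for w
  using fact[OF that] poly_cpoly_nodal_remove[OF Y(1,3)] by (simp add: mult.assoc)
 have Phy: "Ph ?y = 0" using PhPs[OF yU] by simp
 have Phc: "isCont Ph ?y"
  using holomorphic_on_imp_continuous_on[OF h(1)] U(1) yU continuous_on_eq_continuous_at by blast
 let ?K = "%n x. (Ph (cx x) - Ph (ze n)) / (ze n - cx x)"
 have Kt: "tame Dl (?K n)" for n
  by (intro tame_cauchy_kernel gmeasD[OF g] zeoff tame_diff t tame_const)
 have lt: "tame Dl (%x. - (cx (poly ?N x) * te x))"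
  using tame_minus[OF tame_mult[OF tame_poly[of _ "cpoly ?N"] te(1)]] by simp
 have "(%n. \<integral>x. ?K n x \<partial>snd s) ----> (LINT x|snd s. - (cx (poly ?N x) * te x))"
 proof (rule integral_dominated_convergence)
  show "(%x. - (cx (poly ?N x) * te x)) : borel_measurable (snd s)"
   using lt gmeas_borel[OF g] by (auto simp: tame_def)
  show "?K n : borel_measurable (snd s)" for n using Kt gmeas_borel[OF g] by (auto simp: tame_def)
  \<comment> \<open>The majorant combines two bounds: within \<open>2 * dl\<close> of the node the
    Lipschitz constant \<open>B\<close>, and farther away the quotient with a denominator of modulus
    at least \<open>dl\<close>.\<close>
  show "integrable (snd s) (%x. B + (norm (Ph (cx x)) + B') / dl)"
   using tame_integrable[OF g t] tame_integrable[OF g tame_const[of _ 1]] gmeas_finite[OF g]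
   by (intro Bochner_Integration.integrable_add integrable_divide integrable_norm)
     (auto intro: finite_measure.integrable_const)
  show "AE x in snd s. norm (?K n x) <= B + (norm (Ph (cx x)) + B') / dl" for n
   using gmeasD(6)[OF g]
  proof eventually_elim
   case (elim x)
   have ne: "norm (ze n - cx x) > 0" using zeoff[of n] elim by auto
   show ?case
   proof (cases "cx x : cball ?y (2 * dl)")
    case True
    have "norm (Ph (cx x) - Ph (ze n)) <= B * norm (cx x - ze n)"
     using lip[OF True] zeball[of n] sub by blast
    hence "norm (?K n x) <= B" using ne by (simp add: norm_divide divide_le_eq norm_minus_commute)
    thus ?thesis using dl(1) B'(1) by (simp add: add_increasing2)
   next
    case False
    have "2 * dl < dist ?y (cx x)" using False by simp
    also have "... <= dist ?y (ze n) + dist (ze n) (cx x)" by (rule dist_triangle)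
    also have "dist ?y (ze n) <= dl" using zeball[of n] by simp
    finally have d: "dl <= norm (ze n - cx x)" by (simp add: dist_norm)
    have "norm (Ph (cx x) - Ph (ze n)) <= norm (Ph (cx x)) + B'"
     using norm_triangle_ineq4[of "Ph (cx x)" "Ph (ze n)"] B'(2)[of "ze n"] zeball[of n] sub by fastforce
    hence "norm (?K n x) <= (norm (Ph (cx x)) + B') / dl"
     unfolding norm_divide using d dl(1) B'(1) by (intro frac_le) auto
    thus ?thesis using B(1) by linarith
   qed
  qed
  show "AE x in snd s. (%n. ?K n x) ----> - (cx (poly ?N x) * te x)" using gmeasD(6)[OF g]
  proof eventually_elim
   case (elim x)
   have xU: "cx x : U" using elim U by blast
   show ?case
   proof (cases "x = y")
    case True
    have "(%n. - ?Ps (ze n)) ----> - ?Ps ?y"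
     by (intro tendsto_minus isCont_tendsto_compose[OF Psc zelim])
    moreover have "?K n x = - ?Ps (ze n)" for n
    proof -
     have "ze n : U" using zeball[of n] sub dl(2) by blast
     from PhPs[OF this] show ?thesis using zeoff[of n] elim True Phy by auto
    qed
    moreover have "?Ps ?y = cx (poly ?N x) * te x" using te(2)[OF elim] True by simp
    ultimately show ?thesis by (simp only:)
   next
    case False
    have "(%n. ?K n x) ----> (Ph (cx x) - Ph ?y) / (?y - cx x)"
     by (intro tendsto_intros isCont_tendsto_compose[OF Phc zelim] zelim) (use False in auto)
    moreover have "(Ph (cx x) - Ph ?y) / (?y - cx x) = - (cx (poly ?N x) * te x)"
     using PhPs[OF xU] Phy False te(2)[OF elim] by (simp add: field_simps)
    ultimately show ?thesis by (simp only:)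
   qed
  qed
 qed
 hence "(%n. sint s (?K n)) ----> cx (fst s) * (LINT x|snd s. - (cx (poly ?N x) * te x))"
  unfolding sint_def by (intro tendsto_intros)
 moreover have "cx (fst s) * (LINT x|snd s. - (cx (poly ?N x) * te x)) = - sint s (%x. cx (poly ?N x) * te x)"
  by (simp add: sint_def)
 moreover have "sint s (?K n) = ctr s (%x. Ph (cx x)) (ze n) - Ph (ze n) * cauchy s (ze n)" for n
 proof -
  have "sint s (?K n) = ctr s (%x. Ph (cx x) - Ph (ze n) * 1) (ze n)" by (simp add: ctr_def)
  also have "... = ctr s (%x. Ph (cx x)) (ze n) - ctr s (%x. Ph (ze n) * 1) (ze n)"
   by (intro ctr_diff[OF g zeoff t]) simp
  finally show ?thesis unfolding ctr_cmult[OF g] cauchy_eq_ctr by simp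
 qed
 ultimately have "(%n. ctr s (%x. Ph (cx x)) (z (n + n0)) - Ph (z (n + n0)) * cauchy s (z (n + n0)))
   ----> - sint s (%x. cx (poly ?N x) * te x)" by (simp add: ze_def)
 thus ?thesis by (rule LIMSEQ_offset)
qed

lemma nodal_abs_ge_1:
 assumes "finite Y" "abs x >= 1 + (SUM y:Y. abs y)"
 shows "abs (poly (nodal Y) x) >= 1"
proof -
 have "1 <= (\<Prod>y\<in>Y. abs (x - y))"
 proof (rule prod_ge_1)
  fix y assume "y : Y"
  hence "abs y <= (SUM y:Y. abs y)" using assms(1) by (intro member_le_sum) auto
  thus "1 <= abs (x - y)" using assms(2) by linarith
 qed
 thus ?thesis by (simp add: poly_nodal abs_prod)
qed

text \<open>Far out \<open>abs (nodal Y)\<close> is at least \<open>1\<close> and the growth of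
  \<open>ph\<close> carries over; the rest of \<open>Dl\<close> is compact. The case distinction
  keeps the function measurable on the whole line: \<open>Th\<close>, which is controlled on
  \<open>Dl\<close> only, enters at finitely many points.\<close>

lemma tame_quotient_nodal:
 assumes Y: "finite Y" and cl: "closed Dl" and t: "tame Dl ph" and c: "continuous_on Dl Th"
  and q: "!!x. x : Dl ==> ph x = cx (poly (nodal Y) x) * Th x"
 shows "tame Dl (%x. if x : Y then Th x else ph x / cx (poly (nodal Y) x))" (is "tame Dl ?te")
proof -
 have eq: "?te x = Th x" if "x : Dl" for x using q[OF that] Y by (auto simp: poly_nodal_eq_0_iff)
 have "(%x. ph x / cx (poly (nodal Y) x)) : bm"
 proof -
  have "(%x. pc (nodal Y) (cx x)) : bm"
   using tame_poly[of UNIV "cpoly (nodal Y)"] unfolding tame_def by blast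
  moreover have "ph : bm" using t by (simp add: tame_def)
  ultimately show ?thesis by simp
 qed
 hence "?te : bm"
  by (rule measurable_discrete_difference[of _ _ _ Y]) (use Y in \<open>auto intro: countable_finite\<close>)
 moreover have "continuous_on Dl ?te" using c eq by (simp cong: continuous_on_cong)
 moreover have "EX C k. ALL x:Dl. norm (?te x) <= C * (1 + abs x) ^ k"
 proof -
  obtain C k where C: "C >= 0" "!!x. x : Dl ==> norm (ph x) <= C * (1 + abs x) ^ k"
   using tame_bound[OF t] by blast
  let ?B = "1 + (SUM y:Y. abs y)"
  have "compact (Dl Int {- ?B..?B})" using cl by (intro closed_Int_compact) auto
  hence "bounded (Th ` (Dl Int {- ?B..?B}))"
   using c by (intro compact_imp_bounded compact_continuous_image) (auto intro: continuous_on_subset)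
  then obtain K where K: "K > 0" "!!x. x : Dl Int {- ?B..?B} ==> norm (Th x) <= K"
   by (auto simp: bounded_pos)
  have "norm (?te x) <= (C + K) * (1 + abs x) ^ k" if x: "x : Dl" for x
  proof -
   have p: "1 <= (1 + abs x) ^ k" by (rule one_le_power) simp
   have "norm (Th x) <= C * (1 + abs x) ^ k + K * (1 + abs x) ^ k"
   proof (cases "abs x >= ?B")
    case True
    have "norm (Th x) <= abs (poly (nodal Y) x) * norm (Th x)"
     using nodal_abs_ge_1[OF Y True] by (simp add: mult_le_cancel_right1)
    also have "... = norm (ph x)" using q[OF x] by (simp add: norm_mult)
    also have "... <= C * (1 + abs x) ^ k" by (rule C(2)[OF x])
    finally show ?thesis using K(1) p by (smt (verit) mult_nonneg_nonneg)
   next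
    case False
    hence "- ?B <= x" "x <= ?B" by linarith+
    hence "norm (Th x) <= K" using K(2) x by simp
    also have "... <= K * (1 + abs x) ^ k" using K(1) p by simp
    finally show ?thesis using C(1) p by (smt (verit) mult_nonneg_nonneg)
   qed
   thus ?thesis using eq[OF x] by (simp add: distrib_right)
  qed
  thus ?thesis by blast
 qed
 ultimately show ?thesis unfolding tame_def by blast
qed

lemma tame_Re_measurable:
 assumes "tame Dl (%x. cx (ph x))"
 shows "ph : bm"
proof -
 have [measurable]: "(%x. cx (ph x)) : bm" using assms unfolding tame_def by blast
 have "(%x. Re (cx (ph x))) : bm" by measurable
 thus ?thesis by simp
qed

lemma tame_of_real_Re:
 assumes "tame Dl f" "!!x. x : Dl ==> f x = cx (Re (f x))"
 shows "tame Dl (%x. cx (Re (f x)))" unfolding tame_def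
proof (intro conjI)
 show "(%x. cx (Re (f x))) : bm" using assms(1) unfolding tame_def by auto
 have "continuous_on Dl f" using assms(1) unfolding tame_def by blast
 thus "continuous_on Dl (%x. cx (Re (f x)))" by (intro continuous_intros)
 obtain C k where C: "!!x. x : Dl ==> norm (f x) <= C * (1 + abs x) ^ k"
  using tame_bound[OF assms(1)] by blast
 have "norm (cx (Re (f x))) <= C * (1 + abs x) ^ k" if "x : Dl" for x
  using C[OF that] abs_Re_le_cmod[of "f x"] by simp
 thus "EX C k. ALL x:Dl. norm (cx (Re (f x))) <= C * (1 + abs x) ^ k" by blast
qed

text \<open>With fewer than \<open>N\<close> sign changes their nodal polynomial would be an
  admissible test polynomial, but the integral against it is strictly of one sign.\<close>

lemma orth_card_sign_changes:
 assumes g: "gmeas Dl s" and t: "tame Dl (%x. cx (ph x))" and fin: "finite {x : Dl. ph x = 0}"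
  and orth: "!!p. degree p < N ==> (LINT x|snd s. poly p x * ph x) = 0"
 obtains Y e where "Y <= {x : Dl. ph x = 0} Int interior Dl" "N <= card Y" "e = 1 | e = -1"
  "!!x. x : Dl ==> ph x ~= 0 ==> e * ph x * poly (nodal Y) x > 0"
proof -
 have "continuous_on Dl (%x. Re (cx (ph x)))"
  using t unfolding tame_def by (intro continuous_intros) auto
 hence c: "continuous_on Dl ph" by simp
 obtain Y e where Y: "Y <= {x : Dl. ph x = 0} Int interior Dl" and e: "e = 1 | e = -1"
  and pos: "!!x. x : Dl ==> ph x ~= 0 ==> e * ph x * poly (nodal Y) x > 0"
  using sign_structure[OF fin gmeasD(4)[OF g] c refl] by blast
 have "N <= card Y"
 proof (rule ccontr)
  assume "\<not> N <= card Y"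
  hence 0: "(LINT x|snd s. e * (poly (nodal Y) x * ph x)) = 0" using orth[of "nodal Y"] by simp
  have "tame Dl (%x. pc (nodal Y) (cx x) * cx (ph x))" by (intro tame_mult tame_poly t)
  from tame_integrable[OF g this]
  have int: "integrable (snd s) (%x. poly (nodal Y) x * ph x)"
   by (simp only: cpoly_of_real of_real_mult[symmetric] complex_of_real_integrable_eq)
  have "(LINT x|snd s. e * (poly (nodal Y) x * ph x)) > 0"
  proof (rule gmeas_AE_pos_integral[OF g])
   show "integrable (snd s) (%x. e * (poly (nodal Y) x * ph x))"
    using int by (rule Bochner_Integration.integrable_mult_right)
   show "AE x in snd s. 0 <= e * (poly (nodal Y) x * ph x)" using gmeasD(6)[OF g]
   proof eventually_elim
    case (elim x)
    show ?case using pos[OF elim] by (cases "ph x = 0") (simp_all add: ac_simps less_imp_le)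
   qed
   show "\<not> (AE x in snd s. e * (poly (nodal Y) x * ph x) = 0)"
   proof
    assume "AE x in snd s. e * (poly (nodal Y) x * ph x) = 0"
    hence "AE x in snd s. x : {x : Dl. ph x = 0}" using gmeasD(6)[OF g]
    proof eventually_elim
     case (elim x)
     have "e * (poly (nodal Y) x * ph x) = e * ph x * poly (nodal Y) x" by (simp only: ac_simps)
     thus ?case using pos[OF elim(2)] elim by force
    qed
    thus False using gmeasD(8)[OF g fin] by blast
   qed
  qed
  thus False using 0 by linarith
 qed
 thus ?thesis using that[OF Y _ e] pos by blast
qed

lemma real_orth_of_sint:
 assumes g: "gmeas Dl s" and Ph: "tame Dl Ph" and ph: "tame Dl (%x. cx (ph x))"
  and eq: "!!x. x : Dl ==> Ph x = cx (ph x)" and orth: "sint s (%x. pc p (cx x) * Ph x) = 0"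
 shows "(LINT x|snd s. poly p x * ph x) = 0"
proof -
 have "sint s (%x. pc p (cx x) * Ph x) = sint s (%x. pc p (cx x) * cx (ph x))"
  by (rule sint_cong[OF g]) (intro tame_mult tame_poly Ph ph, intro tame_mult tame_poly Ph ph, simp only: eq)
 also have "... = cx (fst s * (LINT x|snd s. poly p x * ph x))"
  unfolding sint_def by (simp only: cpoly_of_real of_real_mult[symmetric] integral_complex_of_real)
 finally show ?thesis using orth gmeasD(1)[OF g] by auto
qed

text \<open>The passage from \<open>H\<close> to the next function \<open>G\<close> costs one sign change: the values of \<open>G\<close> at the
 sign changes of \<open>T F\<close> are, up to factors of known sign, the weights of an interpolatory
 quadrature, almost all of which are positive.\<close>

lemma alternation_step:
 assumes g: "gmeas Dl s" and F: "tame Dl (%x. Fc (cx x))" and X: "finite X" "X Int Dl = {}"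
  and H: "!!z. z ~: cx ` Dl ==> H z = pc T z * ctr s (%x. Fc (cx x)) z - poly c z"
  and zero: "!!r. r : X ==> H (cx r) = 0"
  and dec: "EVT y. norm (H (iv y) / pc (nodal X) (iv y)) <= C / y ^ (M + 1)"
  and U: "open U" "cx ` Dl <= U" "Fc holomorphic_on U" and re: "!!x. x : Dl ==> Im (Fc (cx x)) = 0"
  and T: "T ~= 0" and fin: "finite {x : Dl. Fc (cx x) = 0}"
  and G: "!!z. Im z > 0 ==> G z = H z - pc T z * cauchy s z * Fc z"
  and Gc: "!!x. x : Dl ==> isCont G (cx x)" and M: "Suc N <= M"
 shows "alternates (%x. Re (G (cx x))) Dl N"
proof -
 let ?R = "pc (nodal X)"
 define Ph where "Ph = (%z. pc T z * Fc z / ?R z)"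
 define ph where "ph = (%x. Re (Ph (cx x)))"
 define U' where "U' = U - cx ` X"
 have PhF: "(%x. pc T (cx x) * Fc (cx x) / cx (poly (nodal X) x)) = (%x. Ph (cx x))"
  by (simp add: Ph_def)
 note oz = orth_of_zeros[OF g F X H zero dec, OF _ _ refl, unfolded PhF]
 have tPh: "tame Dl (%x. Ph (cx x))" using oz(1) by simp
 have Hrep: "H z = ?R z * ctr s (%x. Ph (cx x)) z" if "z ~: cx ` Dl" for z using oz(2) that by simp
 have orthc: "sint s (%x. poly p (cx x) * Ph (cx x)) = 0" if "degree p < M" for p
  using oz(3)[of p] that by (simp add: Ph_def)
 have U': "open U'" "cx ` Dl <= U'"
  using U X by (auto simp: U'_def intro!: open_Diff finite_imp_closed)
 have Rnz: "?R z ~= 0" if "z ~: cx ` X" for z using that X by (simp add: poly_cpoly_nodal_eq_0_iff)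
 have hPh: "Ph holomorphic_on U'" unfolding Ph_def using U(3) Rnz
  by (intro holomorphic_intros) (auto simp: U'_def intro: holomorphic_on_subset)
 have Phre: "Ph (cx x) = cx (ph x)" if "x : Dl" for x
 proof -
  have "Fc (cx x) = cx (Re (Fc (cx x)))" using re[OF that] by (simp add: complex_eq_iff)
  hence "Ph (cx x) = cx (poly T x * Re (Fc (cx x)) / poly (nodal X) x)" by (simp add: Ph_def)
  thus ?thesis by (simp add: ph_def)
 qed
 have tph: "tame Dl (%x. cx (ph x))"
  unfolding ph_def by (rule tame_of_real_Re[OF tPh]) (use Phre in \<open>simp add: ph_def\<close>)
 define Z where "Z = {x : Dl. ph x = 0}"
 have Zfin: "finite Z"
 proof (rule finite_subset)
  show "Z <= {x : Dl. Fc (cx x) = 0} Un {x. poly T x = 0}"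
  proof
   fix x assume "x : Z"
   hence x: "x : Dl" "Ph (cx x) = 0" using Phre by (auto simp: Z_def)
   have "cx x ~: cx ` X" using x X by auto
   hence "pc T (cx x) * Fc (cx x) = 0"
    using x(2) Rnz[of "cx x"] unfolding Ph_def by (metis divide_eq_0_iff)
   thus "x : {x : Dl. Fc (cx x) = 0} Un {x. poly T x = 0}" using x by auto
  qed
  show "finite ({x : Dl. Fc (cx x) = 0} Un {x. poly T x = 0})"
   using fin poly_roots_finite[OF T] by simp
 qed
 have rorth: "(LINT x|snd s. poly p x * ph x) = 0" if "degree p < M" for p
  by (rule real_orth_of_sint[OF g tPh tph Phre orthc]) (use that in simp_all)
 obtain Y e where Y: "Y <= Z Int interior Dl" and e: "e = 1 | e = -1"
  and pos: "!!x. x : Dl ==> ph x ~= 0 ==> e * ph x * poly (nodal Y) x > 0"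
 proof (rule orth_card_sign_changes[OF g tph Zfin[unfolded Z_def] rorth])
  fix Y and e :: real
  assume "Y <= {x : Dl. ph x = 0} Int interior Dl" "e = 1 | e = -1"
   and "!!x. x : Dl ==> ph x ~= 0 ==> e * ph x * poly (nodal Y) x > 0"
  thus thesis by (intro that[of Y e]) (simp_all only: Z_def)
 qed
 have fY: "finite Y" and YDl: "Y <= Dl" and Yi: "Y <= interior Dl"
  using Y Zfin finite_subset by (auto simp: Z_def)
 have Ph0: "Ph (cx y) = 0" if "y : Y" for y using Phre[of y] Y that by (auto simp: Z_def)
 have "EX Th. Th holomorphic_on U' & (ALL z:U'. Ph z = pc (nodal Y) z * Th z)"
  by (rule holomorphic_divide_nodal[OF U'(1) fY hPh Ph0])
 then obtain Th where hTh: "Th holomorphic_on U'"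
  and fact': "ALL z:U'. Ph z = pc (nodal Y) z * Th z" by (elim exE conjE)
 have fact: "Ph z = pc (nodal Y) z * Th z" if "z : U'" for z using fact' that by (rule bspec)
 have Thq: "Ph (cx x) = cx (poly (nodal Y) x) * Th (cx x)" if "x : Dl" for x
  using fact[of "cx x"] U'(2) that by (simp add: image_subset_iff)
 have Thc: "continuous_on Dl (%x. Th (cx x))"
 proof (rule continuous_on_compose2[of U' Th])
  show "continuous_on U' Th" by (rule holomorphic_on_imp_continuous_on[OF hTh])
  show "continuous_on Dl cx" by (intro continuous_intros)
 qed (rule U'(2))
 \<comment> \<open>The quotient of \<open>Ph\<close> by \<open>nodal Y\<close>, with the values of
   the holomorphic quotient filled in at the nodes.\<close>
 define tec where "tec = (%x. if x : Y then Th (cx x) else Ph (cx x) / cx (poly (nodal Y) x))"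
 have tecTh: "tec x = Th (cx x)" if "x : Dl" for x
 proof (cases "x : Y")
  case False
  hence "poly (nodal Y) x ~= 0" using fY by (simp add: poly_nodal_eq_0_iff)
  thus ?thesis unfolding tec_def Thq[OF that] using False by simp
 qed (simp add: tec_def)
 have ttec: "tame Dl tec" unfolding tec_def
  by (rule tame_quotient_nodal[OF fY gmeasD(3)[OF g] tPh Thc Thq])
 define te where "te = (%x. Re (tec x))"
 have off: "tec x = cx (ph x / poly (nodal Y) x)" if "x : Dl" "x ~: Y" for x
  using that Phre by (simp add: tec_def)
 have nn: "0 <= e * (ph x / poly (nodal Y) x)" if "x : Dl" "x ~: Y" for x
 proof (cases "ph x = 0")
  case False
  have "0 < (e * ph x * poly (nodal Y) x) / (poly (nodal Y) x)^2"
   using pos[OF that(1) False] by (intro divide_pos_pos) auto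
  moreover have "(e * a * b) / b^2 = e * (a / b)" for a b :: real by (simp add: power2_eq_square)
  ultimately show ?thesis by (simp only: less_imp_le)
 qed simp
 \<comment> \<open>At a node, realness and sign of the quotient are known only in the limit. Nodes
   are interior to \<open>Dl\<close>, hence limits of points of \<open>Dl\<close> outside
   \<open>Y\<close>.\<close>
 have onY: "Im (tec y) = 0 & 0 <= e * Re (tec y)" if "y : Y" for y
 proof -
  have yi: "y : interior Dl" using Yi that by blast
  have "isCont (%x. Th (cx x)) y" using Thc yi by (rule continuous_on_interior)
  hence lim: "((%x. Th (cx x)) ---> tec y) (at y)"
   using tecTh[of y] YDl that by (auto simp: isCont_def)
  have ev: "\<forall>\<^sub>F x in at y. x : Dl & x ~: Y"
  proof (rule eventually_conj)
   show "\<forall>\<^sub>F x in at y. x : Dl"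
    using eventually_at_in_open'[OF open_interior yi] by (rule eventually_mono) (use interior_subset in blast)
   have "open (- (Y - {y}))" using fY by (intro open_Compl finite_imp_closed finite_Diff)
   moreover have "y : - (Y - {y})" by simp
   ultimately have "\<forall>\<^sub>F x in at y. x : - (Y - {y})" by (rule eventually_at_in_open')
   from this eventually_neq_at_within[of y y UNIV]
   show "\<forall>\<^sub>F x in at y. x ~: Y" by eventually_elim auto
  qed
  have "((%x. Im (Th (cx x))) ---> Im (tec y)) (at y)" using lim by (rule tendsto_Im)
  moreover have "\<forall>\<^sub>F x in at y. Im (Th (cx x)) = 0" using ev
  proof eventually_elim
   case (elim x)
   hence "Th (cx x) = cx (ph x / poly (nodal Y) x)" using tecTh[of x] off[of x] by simp
   thus ?case by (simp only: Im_complex_of_real)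
  qed
  ultimately have "((%x::real. 0) ---> Im (tec y)) (at y)" by (rule Lim_transform_eventually)
  hence 1: "Im (tec y) = 0" by (simp add: tendsto_const_iff)
  have "((%x. e * Re (Th (cx x))) ---> e * Re (tec y)) (at y)" using lim by (intro tendsto_intros)
  moreover have "\<forall>\<^sub>F x in at y. 0 <= e * Re (Th (cx x))" using ev
  proof eventually_elim
   case (elim x)
   hence "Th (cx x) = cx (ph x / poly (nodal Y) x)" using tecTh[of x] off[of x] by simp
   moreover have "0 <= e * (ph x / poly (nodal Y) x)" using nn[of x] elim by blast
   ultimately show ?case by (simp only: Re_complex_of_real)
  qed
  ultimately have "0 <= e * Re (tec y)" by (rule tendsto_lowerbound) simp
  with 1 show ?thesis by blast
 qed
 have tere: "tec x = cx (te x)" if "x : Dl" for x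
  using off[OF that] onY[of x] by (cases "x : Y") (auto simp: te_def complex_eq_iff)
 have tte: "tame Dl (%x. cx (te x))"
  unfolding te_def by (rule tame_of_real_Re[OF ttec]) (use tere in \<open>simp add: te_def\<close>)
 have Nte: "poly (nodal Y) x * te x = ph x" if "x : Dl" for x
 proof -
  have "cx (poly (nodal Y) x * te x) = cx (poly (nodal Y) x) * tec x"
   by (simp only: of_real_mult tere[OF that])
  also have "... = Ph (cx x)" by (simp only: tecTh[OF that] Thq[OF that])
  also have "... = cx (ph x)" by (rule Phre[OF that])
  finally have "cx (poly (nodal Y) x * te x) = cx (ph x)" .
  thus ?thesis by (simp only: of_real_eq_iff)
 qed
 interpret quad_meas Dl s Y te e M
 proof
  show "0 <= e * te x" if "x : Dl" for x
   using off[OF that] onY[of x] nn[OF that] by (cases "x : Y") (auto simp: te_def)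
  show "finite {x : Dl. te x = 0}"
   by (rule finite_subset[OF _ Zfin]) (use Nte in \<open>force simp: Z_def\<close>)
  fix p :: "real poly" assume "degree p < M"
  have "(LINT x|snd s. poly (nodal Y * p) x * te x) = (LINT x|snd s. poly p x * ph x)"
  proof (rule integral_cong_AE)
   have m: "te : bm" "ph : bm" using tte tph by (auto intro: tame_Re_measurable)
   have p: "poly q : bm" for q :: "real poly"
    by (intro borel_measurable_continuous_onI continuous_intros)
   show "(%x. poly (nodal Y * p) x * te x) : borel_measurable (snd s)"
    "(%x. poly p x * ph x) : borel_measurable (snd s)"
    by (rule gmeas_borel[OF g], intro borel_measurable_times m p)+
   show "AE x in snd s. poly (nodal Y * p) x * te x = poly p x * ph x"
    using gmeasD(6)[OF g] by eventually_elim (simp add: Nte[symmetric] ac_simps)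
  qed
  thus "(LINT x|snd s. poly (nodal Y * p) x * te x) = 0" using rorth[OF `degree p < M`] by simp
 qed (rule g tte fY e)+
 \<comment> \<open>Above the real axis \<open>G\<close> equals \<open>nodal X\<close> times the
   difference in \<open>value_at_node\<close>, because \<open>T F\<close> is \<open>nodal X\<close>
   times \<open>Ph\<close>. Letting the point descend to a node expresses \<open>G\<close> there by
   a value of \<open>L\<close>.\<close>
 have Gval: "G (cx y) = - cx (poly (nodal X) y * (fst s * e * L (nodal (Y - {y}))))" if y: "y : Y" for y
 proof -
  let ?z = "%n. cx y + \<i> * cx (inverse (real (Suc n)))"
  have l1: "(%n. ctr s (%x. Ph (cx x)) (?z n) - Ph (?z n) * cauchy s (?z n))
      ----> - sint s (%x. cx (poly (nodal (Y - {y})) x) * cx (te x))"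
  proof (rule value_at_node[OF g tPh U' hPh hTh fact fY YDl y tte])
   show "cx (te x) = Th (cx x)" if "x : Dl" for x using tere[OF that] tecTh[OF that] by (simp only:)
  qed
  have l2: "sint s (%x. cx (poly (nodal (Y - {y})) x) * cx (te x)) = cx (fst s * e * L (nodal (Y - {y})))"
   using sint_eq_L[of "nodal (Y - {y})"] by (simp only: of_real_mult)
  have l3: "(%n. ?R (?z n)) ----> ?R (cx y)"
   by (rule isCont_tendsto_compose[OF _ vertical_approach]) (intro continuous_intros)
  have "(%n. ?R (?z n) * (ctr s (%x. Ph (cx x)) (?z n) - Ph (?z n) * cauchy s (?z n)))
    ----> ?R (cx y) * - cx (fst s * e * L (nodal (Y - {y})))"
   by (rule tendsto_mult[OF l3 l1[unfolded l2]])
  moreover have "?R (?z n) * (ctr s (%x. Ph (cx x)) (?z n) - Ph (?z n) * cauchy s (?z n)) = G (?z n)" for n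
  proof -
   have im: "Im (?z n) > 0" by simp
   have 1: "?z n ~: cx ` A" for A
   proof
    assume "?z n : cx ` A"
    hence "Im (?z n) = 0" by (elim imageE) (simp only: Im_complex_of_real)
    thus False using im by linarith
   qed
   have "?R (?z n) * Ph (?z n) = pc T (?z n) * Fc (?z n)" unfolding Ph_def using Rnz[OF 1] by simp
   hence "?R (?z n) * (Ph (?z n) * cauchy s (?z n)) = pc T (?z n) * Fc (?z n) * cauchy s (?z n)"
    by (simp only: mult.assoc[symmetric])
   also have "... = pc T (?z n) * cauchy s (?z n) * Fc (?z n)" by (simp only: ac_simps)
   finally show ?thesis unfolding G[OF im] Hrep[OF 1] right_diff_distrib by (simp only:)
  qed
  ultimately have "(%n. G (?z n)) ----> ?R (cx y) * - cx (fst s * e * L (nodal (Y - {y})))"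
   by (simp only:)
  moreover have "(%n. G (?z n)) ----> G (cx y)"
   using YDl y by (intro isCont_tendsto_compose[OF Gc vertical_approach]) auto
  ultimately have "G (cx y) = ?R (cx y) * - cx (fst s * e * L (nodal (Y - {y})))"
   by (rule LIMSEQ_unique[rotated])
  thus ?thesis by simp
 qed
 have Rx: "poly (nodal X) x ~= 0" if "x : Dl" for x using that X by (auto simp: poly_nodal_eq_0_iff)
 have Rc: "continuous_on Dl (poly (nodal X))" by (intro continuous_intros)
 have "\<exists>eR::real. (eR = 1 | eR = -1) & (ALL x:Dl. eR * poly (nodal X) x > 0)"
 proof (rule no_zero_sign[OF gmeasD(4)[OF g] Rc Rx])
  fix e :: real assume "e = 1 | e = -1" "!!x. x : Dl ==> e * poly (nodal X) x > 0"
  thus "\<exists>eR::real. (eR = 1 | eR = -1) & (ALL x:Dl. eR * poly (nodal X) x > 0)" by blast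
 qed
 then obtain eR :: real where eR: "eR = 1 | eR = -1" "ALL x:Dl. eR * poly (nodal X) x > 0" by blast
 \<comment> \<open>\<open>L (nodal (Y - {y}))\<close> is the weight times the derivative of
   \<open>nodal Y\<close> at \<open>y\<close>, so at nodes of positive weight \<open>G\<close> has
   the alternating sign of that derivative; \<open>eR\<close> removes the constant sign of
   \<open>nodal X\<close> on \<open>Dl\<close>.\<close>
 have "alternates (%x. Re (G (cx x))) Y N"
 proof (rule alternates_nodes[OF fY, of bad _ "- (eR * fst s * e)"])
  show "bad <= Y" by (auto simp: bad_def)
  show "2 * card bad + Suc N <= card Y" using card_bad M by linarith
  fix y assume y: "y : Y - bad"
  hence w: "weight y > 0" by (auto simp: bad_def)
  let ?n = "poly (nodal (Y - {y})) y" and ?l = "L (nodal (Y - {y}))"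
  have "0 < ?l / ?n" using w unfolding weight_def .
  hence "0 < ?l * ?n" unfolding zero_less_divide_iff zero_less_mult_iff .
  hence "0 < ?n * ?l" by (simp only: mult.commute)
  moreover have "eR * poly (nodal X) y > 0" using eR(2) y YDl by blast
  ultimately have "0 < (eR * poly (nodal X) y) * (?n * ?l)" by (rule mult_pos_pos[rotated])
  moreover have "Re (G (cx y)) = - (poly (nodal X) y * (fst s * e * ?l))" using Gval[of y] y by simp
  moreover have "- (eR * fst s * e) * ?n * - (r * (fst s * e * l)) = (eR * r) * (?n * l)" for r l
   using e gmeasD(1)[OF g] by auto
  ultimately show "- (eR * fst s * e) * ?n * Re (G (cx y)) > 0" by (simp only:)
 qed
 thus ?thesis by (rule alternates_mono[OF _ YDl order_refl])
qed

text \<open>The version of \<open>ctr_poly_mult\<close> with real coefficients: the polynomials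
  obtained here enter \<open>Hf\<close> and the interpolation identities, whose values on the real
  line have to be real.\<close>

lemma ctr_poly_mult_real:
 assumes g: "gmeas Dl s" and F: "tame Dl F" and re: "!!x. Im (F x) = 0"
 shows "\<exists>d :: real poly. degree d <= degree p & (ALL z. z ~: cx ` Dl -->
   pc p z * ctr s F z - ctr s (%x. cx (poly p x) * F x) z = pc d z)"
proof (induction p)
 case 0
 show ?case by (rule exI[of _ 0]) (simp add: ctr_def sint_def)
next
 case (pCons a p)
 then obtain d :: "real poly" where d: "degree d <= degree p"
  "!!z. z ~: cx ` Dl ==> pc p z * ctr s F z - ctr s (%x. cx (poly p x) * F x) z = pc d z" by blast
 let ?G = "%x. cx (poly p x) * F x"
 have G: "tame Dl ?G" using tame_mult[OF tame_poly[of Dl "cpoly p"] F] by simp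
 have "Im (sint s ?G) = 0"
 proof -
  have "?G x = cx (poly p x * Re (F x))" for x using re[of x] by (simp add: complex_eq_iff)
  hence "sint s ?G = cx (fst s) * (LINT x|snd s. cx (poly p x * Re (F x)))"
   unfolding sint_def by (simp only:)
  hence "sint s ?G = cx (fst s * (LINT x|snd s. poly p x * Re (F x)))"
   by (simp only: integral_complex_of_real of_real_mult[of "fst s"])
  thus ?thesis by simp
 qed
 hence r: "sint s ?G = cx (Re (sint s ?G))" by (simp add: complex_eq_iff)
 have eq: "pc (pCons a p) z * ctr s F z - ctr s (%x. cx (poly (pCons a p) x) * F x) z
   = z * pc d z + sint s ?G" if z: "z ~: cx ` Dl" for z
 proof -
  have "ctr s (%x. cx (poly (pCons a p) x) * F x) z = ctr s (%x. cx a * F x + cx x * ?G x) z"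
   by (simp add: algebra_simps)
  also have "... = ctr s (%x. cx a * F x) z + ctr s (%x. cx x * ?G x) z"
   by (intro ctr_add[OF g z] tame_mult tame_const tame_id F G)
  also have "... = cx a * ctr s F z + (z * ctr s ?G z - sint s ?G)"
   unfolding ctr_cmult[OF g] ctr_times_z[OF g G z] by simp
  finally have e: "ctr s (%x. cx (poly (pCons a p) x) * F x) z = cx a * ctr s F z + (z * ctr s ?G z - sint s ?G)" .
  have "pc (pCons a p) z = cx a + z * pc p z" by (simp add: map_poly_pCons)
  thus ?thesis unfolding e d(2)[OF z, symmetric] by (simp only:) (simp add: algebra_simps)
 qed
 show ?case
 proof (cases "p = 0")
  case True
  hence "sint s ?G = 0" by (simp add: sint_def)
  moreover have "pc d z = 0" if "z ~: cx ` Dl" for z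
   using d(2)[OF that] True by (simp add: ctr_def sint_def)
  ultimately show ?thesis using eq True by (intro exI[of _ 0]) simp
 next
  case False
  hence "degree (pCons (Re (sint s ?G)) d) <= degree (pCons a p)"
   using d(1) degree_pCons_le[of "Re (sint s ?G)" d] by simp
  moreover have "pc (pCons (Re (sint s ?G)) d) z = z * pc d z + sint s ?G" for z
   using r by (simp add: map_poly_pCons)
  ultimately show ?thesis using eq by metis
 qed
qed

text \<open>The distance from \<open>iv y\<close> to any nonempty real set is at least
  \<open>y\<close>, so the axis stays in the nontangential region with constant
  \<open>1\<close>.\<close>

lemma order_at_infinity_imag_axis:
 assumes "order_at_infinity S N A" "S ~= {}"
 obtains C where "EVT y. norm (A (iv y)) <= C / y ^ N"
proof -
 have "filterlim (%y::real. \<i> * cx y) (nontangential S 1) at_top"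
  unfolding nontangential_def filterlim_inf filterlim_principal
 proof (intro conjI)
  show "filterlim (%y::real. \<i> * cx y) at_infinity at_top" by (rule filterlim_imag_axis)
  show "EVT y. \<i> * cx y : {z. 1 * cmod z <= infdist z (cx ` S)}" using eventually_gt_at_top[of 0]
  proof eventually_elim
   case (elim y)
   have "y <= infdist (iv y) (cx ` S)"
   proof -
    have ne: "cx ` S ~= {}" using assms(2) by simp
    have "y <= dist (iv y) a" if "a : cx ` S" for a
     using that abs_Im_le_cmod[of "\<i> * cx y - a"] elim by (auto simp: dist_norm)
    thus "y <= infdist (iv y) (cx ` S)"
     unfolding infdist_notempty[OF ne] by (intro cINF_greatest[OF ne])
   qed
   thus ?case using elim by (simp add: norm_mult)
  qed
 qed
 moreover have "A : O[nontangential S 1](%z. 1 / z ^ N)"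
  using assms(1) unfolding order_at_infinity_def by simp
 ultimately have "(%y::real. A (iv y)) : O[at_top](%y. 1 / (iv y) ^ N)"
  by (rule landau_o.big.compose[rotated])
 then obtain C where "EVT y. norm (A (\<i> * cx (y::real))) <= C * norm (1 / (iv y) ^ N)"
  by (rule landau_o.bigE)
 hence "EVT y. norm (A (\<i> * cx (y::real))) <= C / y ^ N" using eventually_gt_at_top[of 0]
  by eventually_elim (simp add: norm_divide norm_power norm_mult)
 thus ?thesis by (rule that)
qed

lemma nodal_imag_axis:
 assumes "y > 0"
 shows "y ^ card X <= norm (pc (nodal X) (iv y))"
proof -
 have "(\<Prod>x\<in>X. y) <= (\<Prod>x\<in>X. norm (\<i> * cx y - cx x))"
 proof (rule prod_mono)
  fix x
  show "0 <= y & y <= norm (\<i> * cx y - cx x)"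
   using assms abs_Im_le_cmod[of "\<i> * cx y - cx x"] by simp
 qed
 thus ?thesis by (simp add: poly_cpoly_nodal prod_norm)
qed

lemma poly_imag_axis_bound:
 obtains K where "!!y. y >= 1 ==> norm (poly p (iv y)) <= K * y ^ degree p" "K >= 0"
proof
 fix y :: real assume y: "y >= 1"
 have "norm (poly p (iv y)) <= (SUM i<=degree p. norm (coeff p i * (iv y) ^ i))"
  unfolding poly_altdef by (rule norm_sum)
 also have "... <= (SUM i<=degree p. norm (coeff p i) * y ^ degree p)"
  using y by (intro sum_mono) (auto simp: norm_mult norm_power intro!: mult_left_mono power_increasing)
 finally show "norm (poly p (iv y)) <= (SUM i<=degree p. norm (coeff p i)) * y ^ degree p"
  by (simp add: sum_distrib_right)
qed (simp add: sum_nonneg)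

lemma tame_cpoly_real [simp]: "tame Dl (%x. cx (poly p x))" using tame_poly[of Dl "cpoly p"] by simp

section \<open>Nikishin systems and their inversion\<close>

locale nik_sys =
 fixes m :: nat and sg :: "nat => smeasure" and Dl :: "nat => real set"
 assumes m2: "m >= 2" and gen: "nikishin_generators m sg Dl"
begin

abbreviation (input) cn :: "nat \<Rightarrow> complex \<Rightarrow> complex" where "cn j \<equiv> cauchy (nik sg m j)"

lemma disj: "1 <= j ==> j < m ==> Dl j Int Dl (Suc j) = {}"
 using gen unfolding nikishin_generators_def by auto

lemma gen_class: "1 <= j ==> j <= m ==> sg j : meas_class (Dl j)"
 using gen unfolding nikishin_generators_def by auto

lemma gsg: "1 <= j ==> j <= m ==> gmeas (Dl j) (sg j)" using gen_class gmeas_of_class by blast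

lemma msupp_ne: "1 <= j ==> j <= m ==> msupp (sg j) ~= {}"
 using gen_class unfolding meas_class_def by fastforce

lemma nik_self: "nik sg j j = sg j" by (simp add: nik_def)

lemma nik_up: "j < k ==> nik sg j k = mprod (sg j) (nik sg (Suc j) k)"
 by (simp add: nik_def upt_conv_Cons del: upt_Suc)

lemma nik_down: "k < j ==> nik sg j k = mprod (sg j) (nik sg (j - 1) k)"
proof -
 assume "k < j"
 then obtain l where j: "j = Suc l" "k <= l" by (cases j) auto
 have 1: "nik sg j k = iter_mprod (sg j # map sg (rev [k..<Suc l]))" using j by (simp add: nik_def)
 have 2: "map sg (rev [k..<Suc l]) = sg l # map sg (rev [k..<l])" using j by simp
 have 3: "nik sg l k = iter_mprod (map sg (rev [k..<Suc l]))"
  using j by (cases "l = k") (auto simp: nik_def)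
 show ?thesis unfolding 1 using 3 2 j by simp
qed

lemma fin_mom: "1 <= j ==> j <= m ==> 1 <= k ==> k <= m ==> finite_moments (nik sg j k)"
 using gen unfolding nikishin_generators_def by auto

lemma gnik_up:
 assumes "1 <= j" "j <= k" "k <= m" shows "gmeas (Dl j) (nik sg j k)" using assms(2,1)
proof (induction j rule: inc_induct)
 case base
 thus ?case using gsg[of k] assms by (simp add: nik_self)
next
 case (step j)
 have "finite_moments (mprod (sg j) (nik sg (Suc j) k))"
  using fin_mom[of j k] step assms by (simp add: nik_up)
 from gmeas_mprod(1)[OF gsg step.IH disj this] show ?case using step assms by (simp add: nik_up)
qed

lemma gnik_down:
 assumes "1 <= k" "k <= j" "j <= m" shows "gmeas (Dl j) (nik sg j k)" using assms(2,3)
proof (induction j rule: dec_induct)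
 case base
 thus ?case using gsg[of k] assms by (simp add: nik_self)
next
 case (step j)
 have "finite_moments (mprod (sg (Suc j)) (nik sg j k))"
  using fin_mom[of "Suc j" k] step assms by (simp add: nik_down)
 moreover have "Dl (Suc j) Int Dl j = {}" using disj[of j] step assms by (simp add: Int_commute)
 ultimately show ?case using gmeas_mprod(1)[OF gsg[of "Suc j"] step.IH] step assms
  by (simp add: nik_down)
qed

lemma ctr_nik_up:
 assumes "1 <= j" "j < k" "k <= m" and F: "tame (Dl j) F" and z: "z ~: cx ` Dl j"
 shows "ctr (nik sg j k) F z = ctr (sg j) (%x. F x * cauchy (nik sg (Suc j) k) (cx x)) z"
proof -
 have g: "gmeas (Dl j) (sg j)" "gmeas (Dl (Suc j)) (nik sg (Suc j) k)"
  using gsg gnik_up assms by auto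
 have "finite_moments (mprod (sg j) (nik sg (Suc j) k))"
  using fin_mom[of j k] assms by (simp add: nik_up)
 moreover have "Dl j Int Dl (Suc j) = {}" using disj assms by auto
 moreover have "tame (Dl j) (%x. F x / (z - cx x))"
  by (intro tame_cauchy_kernel gmeasD[OF g(1)] z F)
 ultimately show ?thesis unfolding ctr_def nik_up[OF assms(2)]
  by (subst gmeas_mprod(2)[OF g]) (simp_all add: ac_simps)
qed

lemma ctr_nik_down:
 assumes "1 <= k" "k <= j" "Suc j <= m" and F: "tame (Dl (Suc j)) F" and z: "z ~: cx ` Dl (Suc j)"
 shows "ctr (nik sg (Suc j) k) F z = ctr (sg (Suc j)) (%x. F x * cauchy (nik sg j k) (cx x)) z"
proof -
 have g: "gmeas (Dl (Suc j)) (sg (Suc j))" "gmeas (Dl j) (nik sg j k)"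
  using gsg gnik_down assms by auto
 have eq: "nik sg (Suc j) k = mprod (sg (Suc j)) (nik sg j k)" using nik_down[of k "Suc j"] assms by simp
 have "finite_moments (mprod (sg (Suc j)) (nik sg j k))"
  using fin_mom[of "Suc j" k] assms by (simp add: eq)
 moreover have "Dl (Suc j) Int Dl j = {}" using disj[of j] assms by auto
 moreover have "tame (Dl (Suc j)) (%x. F x / (z - cx x))"
  by (intro tame_cauchy_kernel gmeasD[OF g(1)] z F)
 ultimately show ?thesis unfolding ctr_def eq
  by (subst gmeas_mprod(2)[OF g]) (simp_all add: ac_simps)
qed

lemma cauchy_nik_tame:
 assumes "1 <= i" "i < m" "Suc i <= k" "k <= m"
 shows "tame (Dl i) (%x. cauchy (nik sg (Suc i) k) (cx x))"
proof (rule cauchy_tame)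
 show "gmeas (Dl (Suc i)) (nik sg (Suc i) k)" using assms by (intro gnik_up) auto
 show "closed (Dl i)" "convex (Dl i)" using gmeasD[OF gsg[of i]] assms by auto
 show "Dl i Int Dl (Suc i) = {}" using disj assms by auto
qed

text \<open>Transform of s_{i+1,k}, with the value \<open>1\<close> for the empty product
  \<open>i = k\<close>. With this convention a form is one sum over \<open>k >= i\<close>, and every
  \<open>nh i k\<close> with \<open>i < k\<close> is the transform of \<open>nh (Suc i) k\<close>
  against \<open>sg (Suc i)\<close>.\<close>

definition nh :: "nat => nat => complex => complex" where
 "nh i k z = (if i = k then 1 else cauchy (nik sg (Suc i) k) z)"

lemma nh_tame: "1 <= i ==> i <= k ==> k <= m ==> tame (Dl i) (%x. nh i k (cx x))"
 unfolding nh_def using cauchy_nik_tame[of i k] by (cases "i = k") auto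

lemma nh_rec:
 assumes "i < k" "k <= m" "z ~: cx ` Dl (Suc i)"
 shows "nh i k z = ctr (sg (Suc i)) (%x. nh (Suc i) k (cx x)) z"
proof (cases "Suc i = k")
 case True
 thus ?thesis using assms by (simp add: nh_def nik_self cauchy_eq_ctr)
next
 case False
 hence "nh i k z = ctr (nik sg (Suc i) k) (%_. 1) z" using assms by (simp add: nh_def cauchy_eq_ctr)
 also have "... = ctr (sg (Suc i)) (%x. 1 * cauchy (nik sg (Suc (Suc i)) k) (cx x)) z"
  using assms False by (intro ctr_nik_up) auto
 finally show ?thesis using False by (simp add: nh_def)
qed

text \<open>\<open>ctr_switch\<close> for the measure s_{i,l}: the exchanged product of
  \<open>sg (Suc i)\<close> with s_{i,l} is s_{i+1,l}, so the last term has the same shape with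
  \<open>i\<close> raised by one and the recursion can continue.\<close>

lemma switch_step:
 assumes "1 <= l" "l <= i" "Suc i <= m" and F: "tame (Dl (Suc i)) F" and A: "tame (Dl i) (%x. A (cx x))"
  and rec: "!!w. w ~: cx ` Dl (Suc i) ==> A w = ctr (sg (Suc i)) F w" and z: "Im z ~= 0"
 shows "ctr (nik sg i l) (%x. A (cx x)) z = cauchy (nik sg i l) z * A z - ctr (nik sg (Suc i) l) F z"
proof -
 have zo: "z ~: cx ` S" for S using z by auto
 have g: "gmeas (Dl i) (nik sg i l)" "gmeas (Dl (Suc i)) (sg (Suc i))"
  using assms by (auto intro!: gnik_down gsg)
 have d: "Dl (Suc i) Int Dl i = {}" "Dl i Int Dl (Suc i) = {}" using disj[of i] assms by auto
 have t: "tame (Dl i) (%x. ctr (sg (Suc i)) F (cx x))"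
  using gmeasD[OF g(1)] d by (intro ctr_tame[OF g(2) F]) auto
 have "ctr (nik sg i l) (%x. A (cx x)) z = ctr (nik sg i l) (%x. ctr (sg (Suc i)) F (cx x)) z"
 proof (rule ctr_cong[OF g(1) zo A t])
  fix x assume "x : Dl i"
  hence "cx x ~: cx ` Dl (Suc i)" using d by auto
  thus "A (cx x) = ctr (sg (Suc i)) F (cx x)" by (rule rec)
 qed
 also have "... = cauchy (nik sg i l) z * ctr (sg (Suc i)) F z - ctr (sg (Suc i)) (%y. F y * cauchy (nik sg i l) (cx y)) z"
  by (rule ctr_switch[OF g d(1) F zo zo])
 also have "ctr (sg (Suc i)) (%y. F y * cauchy (nik sg i l) (cx y)) z = ctr (nik sg (Suc i) l) F z"
  using assms by (intro ctr_nik_down[symmetric] zo) auto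
 finally show ?thesis using rec[OF zo] by simp
qed

text \<open>Transform of the product in descending order s_{i,j+1}. Up to signs these functions form
  the triangular matrix inverse to that of the \<open>nh\<close>, as
  \<open>inversion_identity\<close> shows.\<close>

definition th :: "nat => nat => complex => complex" where
 "th j i z = (if i = j then 1 else cauchy (nik sg i (Suc j)) z)"

text \<open>By \<open>switch_step\<close> each product \<open>th j i z * nh i k z\<close> is the sum
  of two neighbouring terms \<open>?X i + ?X (Suc i)\<close>, so the alternating sum telescopes. A
  nonreal \<open>z\<close> avoids all intervals at once.\<close>

lemma inversion_identity:
 assumes "j < k" "k <= m" and z: "Im z ~= 0"
 shows "(SUM i=j..k. (-1) ^ (i - j) * th j i z * nh i k z) = 0"
proof -
 have zo: "z ~: cx ` S" for S using z by auto
 let ?X = "%i. ctr (nik sg i (Suc j)) (%x. nh i k (cx x)) z"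
 have step: "?X i = th j i z * nh i k z - ?X (Suc i)" if "Suc j <= i" "i < k" for i
 proof -
  have "?X i = cauchy (nik sg i (Suc j)) z * nh i k z - ?X (Suc i)"
   using that assms by (intro switch_step nh_tame nh_rec z) auto
  thus ?thesis using that by (simp add: th_def)
 qed
 have "(SUM i=j..l. (-1) ^ (i - j) * th j i z * nh i k z) = (-1) ^ (l - j) * (?X (Suc l))" if "j <= l" "l < k" for l
  using that
 proof (induction l rule: dec_induct)
  case base
  have "nh j k z = ctr (sg (Suc j)) (%x. nh (Suc j) k (cx x)) z" using assms zo by (intro nh_rec) auto
  thus ?case by (simp add: th_def nik_self)
 next
  case (step l)
  have "(SUM i=j..Suc l. (-1) ^ (i - j) * th j i z * nh i k z)
   = (-1) ^ (l - j) * (?X (Suc l)) + (-1) ^ (Suc l - j) * th j (Suc l) z * nh (Suc l) k z"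
   using step by simp
  also have "?X (Suc l) = th j (Suc l) z * nh (Suc l) k z - ?X (Suc (Suc l))"
   using step.hyps step.prems by (intro `!!i. Suc j <= i ==> i < k ==> ?X i = th j i z * nh i k z - ?X (Suc i)`) auto
  finally show ?case using step.hyps by (simp add: Suc_diff_le algebra_simps)
 qed
 from this[of "k - 1"] have "(SUM i=j..k - 1. (-1) ^ (i - j) * th j i z * nh i k z) = (-1) ^ (k - 1 - j) * ?X k"
  using assms by simp
 moreover have "?X k = th j k z" using assms by (simp add: nh_def th_def cauchy_eq_ctr)
 moreover have "(SUM i=j..k. (-1) ^ (i - j) * th j i z * nh i k z)
   = (SUM i=j..k - 1. (-1) ^ (i - j) * th j i z * nh i k z) + (-1) ^ (k - j) * th j k z * nh k k z"
  using assms by (cases k) auto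
 moreover have "(- 1 :: complex) ^ (k - j) = (- 1) * (- 1) ^ (k - 1 - j)"
  using assms by (cases k) (auto simp: Suc_diff_le)
 moreover have "nh k k z = 1" by (simp add: nh_def)
 ultimately show ?thesis by simp
qed

end

section \<open>The forms for one index \<open>n\<close> and their zeros\<close>

locale mlhp_sys = nik_sys +
 fixes v t :: "nat => real poly" and T :: "real poly" and n :: nat and a :: "nat => real poly"
 assumes T0: "T ~= 0" and tT: "!!k. 1 <= k ==> k <= m ==> t k dvd T"
  and hp: "mlhp m sg v t n a" and nD: "degree T <= n" and TDl: "!!x. x : Dl 1 ==> poly T x ~= 0"
begin

definition B :: "nat => complex => complex" where "B i = form_level m sg a i"

lemma B_eq: "i <= m ==> B i z = (SUM k=i..m. (-1) ^ k * pc (a k) z * nh i k z)"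
proof -
 assume i: "i <= m"
 have "(SUM k=i..m. (-1) ^ k * pc (a k) z * nh i k z)
   = (-1) ^ i * pc (a i) z * nh i i z + (SUM k=Suc i..m. (-1) ^ k * pc (a k) z * nh i k z)"
  using i by (rule sum.atLeast_Suc_atMost)
 also have "... = B i z" unfolding B_def form_level_def by (auto simp: nh_def intro!: sum.cong)
 finally show ?thesis ..
qed

lemma B_m: "B m z = (-1) ^ m * pc (a m) z" by (simp add: B_def form_level_def)

lemma B_real: "i <= m ==> Im (B i (cx x)) = 0"
proof -
 assume i: "i <= m"
 have "Im ((-1) ^ k * pc (a k) (cx x) * nh i k (cx x)) = 0" if "k : {i..m}" for k
 proof -
  have "nh i k (cx x) = cx (Re (nh i k (cx x)))"
  proof (cases "i = k")
   case False
   thus ?thesis using cauchy_of_real[OF gnik_up[of "Suc i" k]] that by (simp add: nh_def)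
  qed (simp add: nh_def)
  then obtain r where "nh i k (cx x) = cx r" by blast
  thus ?thesis by (cases "even k") auto
 qed
 thus ?thesis unfolding B_eq[OF i] Im_sum by (intro sum.neutral ballI)
qed

lemma B_tame: "1 <= i ==> i <= m ==> tame (Dl i) (%x. B i (cx x))"
 unfolding B_eq by (intro tame_sum tame_mult nh_tame tame_poly tame_const) auto

lemma nh_holomorphic:
 assumes "i <= k" "k <= m"
 shows "nh i k holomorphic_on (if i = k then UNIV else - cx ` Dl (Suc i))"
proof (cases "i = k")
 case True
 have "nh k k = (%_. 1)" by (auto simp: nh_def)
 thus ?thesis using True by simp
next
 case False
 hence "gmeas (Dl (Suc i)) (nik sg (Suc i) k)" using assms by (intro gnik_up) auto
 from ctr_holomorphic[OF this tame_const[of _ 1]] False show ?thesis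
  by (simp add: nh_def[abs_def] cauchy_eq_ctr[abs_def])
qed

definition dom :: "nat => complex set" where
 "dom i = (if i < m then - cx ` Dl (Suc i) else UNIV)"

lemma dom_open: "open (dom i)"
 unfolding dom_def using gmeasD(3)[OF gsg[of "Suc i"]] by (auto intro!: open_Compl closed_of_real_image)

lemma dom_sub: "1 <= i ==> i <= m ==> cx ` Dl i <= dom i" unfolding dom_def using disj[of i] by auto

lemma B_holomorphic: "i <= m ==> B i holomorphic_on dom i"
proof -
 assume i: "i <= m"
 have "nh i k holomorphic_on dom i" if "k : {i..m}" for k
  by (rule holomorphic_on_subset[OF nh_holomorphic]) (use that i in \<open>auto simp: dom_def\<close>)
 hence "(%z. SUM k=i..m. (-1) ^ k * pc (a k) z * nh i k z) holomorphic_on dom i"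
  by (intro holomorphic_on_sum holomorphic_on_mult) (auto intro!: holomorphic_intros)
 moreover have "B i = (%z. SUM k=i..m. (-1) ^ k * pc (a k) z * nh i k z)" using B_eq i by blast
 ultimately show ?thesis by simp
qed

text \<open>Each coefficient \<open>a k\<close> with \<open>k > i\<close> may be moved under the
  integral against \<open>sg (Suc i)\<close> at the cost of a polynomial; the term with
  \<open>k = i\<close> is a polynomial itself.\<close>

lemma B_rec_poly:
 assumes i: "i < m"
 shows "EX d. ALL z. z ~: cx ` Dl (Suc i) --> B i z - ctr (sg (Suc i)) (%x. B (Suc i) (cx x)) z = poly d z"
proof -
 have g: "gmeas (Dl (Suc i)) (sg (Suc i))" using i by (intro gsg) auto
 have tn: "tame (Dl (Suc i)) (%x. nh (Suc i) k (cx x))" if "k : {Suc i..m}" for k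
  using that by (intro nh_tame) auto
 have "EX d. ALL z. z ~: cx ` Dl (Suc i) -->
   pc (a k) z * ctr (sg (Suc i)) (%x. nh (Suc i) k (cx x)) z
   - ctr (sg (Suc i)) (%x. pc (a k) (cx x) * nh (Suc i) k (cx x)) z = poly d z"
  if "k : {Suc i..m}" for k using ctr_poly_mult[OF g tn[OF that]] by blast
 then obtain d where d: "!!k z. k : {Suc i..m} ==> z ~: cx ` Dl (Suc i) ==>
   pc (a k) z * ctr (sg (Suc i)) (%x. nh (Suc i) k (cx x)) z
   - ctr (sg (Suc i)) (%x. pc (a k) (cx x) * nh (Suc i) k (cx x)) z = poly (d k) z" by metis
 let ?d = "smult ((-1) ^ i) (cpoly (a i)) + (SUM k=Suc i..m. smult ((-1) ^ k) (d k))"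
 show ?thesis
 proof (intro exI[of _ ?d] allI impI)
  fix z assume z: "z ~: cx ` Dl (Suc i)"
  have "ctr (sg (Suc i)) (%x. B (Suc i) (cx x)) z
   = ctr (sg (Suc i)) (%x. SUM k=Suc i..m. (-1) ^ k * (pc (a k) (cx x) * nh (Suc i) k (cx x))) z"
   using i by (simp add: B_eq mult.assoc)
  also have "... = (SUM k=Suc i..m. ctr (sg (Suc i)) (%x. (-1) ^ k * (pc (a k) (cx x) * nh (Suc i) k (cx x))) z)"
   by (intro ctr_sum[OF g z] tame_mult tame_const tame_poly tn)
  also have "... = (SUM k=Suc i..m. (-1) ^ k * (pc (a k) z * nh i k z - poly (d k) z))"
  proof (rule sum.cong[OF refl])
   fix k assume k: "k : {Suc i..m}"
   have "nh i k z = ctr (sg (Suc i)) (%x. nh (Suc i) k (cx x)) z" using k z by (intro nh_rec) auto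
   thus "ctr (sg (Suc i)) (%x. (-1) ^ k * (pc (a k) (cx x) * nh (Suc i) k (cx x))) z
    = (-1) ^ k * (pc (a k) z * nh i k z - poly (d k) z)"
    unfolding ctr_cmult[OF g] d[OF k z, symmetric] by simp
  qed
  finally have c: "ctr (sg (Suc i)) (%x. B (Suc i) (cx x)) z = (SUM k=Suc i..m. (-1) ^ k * (pc (a k) z * nh i k z - poly (d k) z))" .
  have "B i z = (-1) ^ i * pc (a i) z + (SUM k=Suc i..m. (-1) ^ k * pc (a k) z * nh i k z)"
   using i by (simp add: B_eq sum.atLeast_Suc_atMost nh_def)
  thus "B i z - ctr (sg (Suc i)) (%x. B (Suc i) (cx x)) z = poly ?d z"
   unfolding c by (simp add: poly_sum right_diff_distrib sum_subtractf mult.assoc)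
 qed
qed

lemma B_decay:
 assumes "1 <= i" "i < m"
 obtains C where "EVT y. norm (B i (iv y)) <= C / y"
proof -
 have "order_at_infinity (msupp (sg (Suc i))) 1 (form_level m sg a i)"
  using hp assms unfolding mlhp_def by auto
 from order_at_infinity_imag_axis[OF this] obtain C where
  "EVT y. norm (form_level m sg a i (iv y)) <= C / y ^ 1" using msupp_ne[of "Suc i"] assms by auto
 thus ?thesis using that[of C] by (simp add: B_def)
qed

lemma decay_imp_tendsto_0:
 assumes "EVT y. norm (f y :: complex) <= C / y"
 shows "(f ---> 0) at_top" by (rule Lim_null_comparison[OF assms decay_tendsto_0])

text \<open>The polynomial left over in \<open>B_rec_poly\<close> must vanish because the form and
  the transform both tend to \<open>0\<close> at infinity.\<close>

lemma B_rec:
 assumes "1 <= i" "i < m" "z ~: cx ` Dl (Suc i)"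
 shows "B i z = ctr (sg (Suc i)) (%x. B (Suc i) (cx x)) z"
proof -
 have g: "gmeas (Dl (Suc i)) (sg (Suc i))" using assms by (intro gsg) auto
 obtain d where d: "!!z. z ~: cx ` Dl (Suc i) ==> B i z - ctr (sg (Suc i)) (%x. B (Suc i) (cx x)) z = poly d z"
  using B_rec_poly[OF assms(2)] by blast
 obtain C where C: "EVT y. norm (B i (iv y)) <= C / y" using B_decay[OF assms(1,2)] by blast
 have t: "tame (Dl (Suc i)) (%x. B (Suc i) (cx x))" using assms by (intro B_tame) auto
 have "((%y. B i (iv y) - ctr (sg (Suc i)) (%x. B (Suc i) (cx x)) (iv y)) ---> 0 - 0) at_top"
  by (rule tendsto_diff[OF decay_imp_tendsto_0[OF C] ctr_tendsto_0[OF g t]])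
 hence "((%y. poly d (iv y)) ---> 0) at_top" unfolding diff_zero by (rule Lim_transform_eventually)
    (use d imag_axis_off in \<open>auto intro!: eventually_mono[OF eventually_gt_at_top[of 0]]\<close>)
 hence "d = 0" by (rule poly_imag_axis_zero)
 thus ?thesis using d[OF assms(3)] by simp
qed

lemma poly_zero_off_real:
 assumes "!!z. Im z > 0 ==> poly p z = (0::complex)"
 shows "p = 0"
proof (rule poly_imag_axis_zero, rule Lim_transform_eventually[OF tendsto_const])
 show "EVT y. 0 = poly p (iv y)"
  using eventually_gt_at_top[of 0] by eventually_elim (use assms in simp)
qed

text \<open>If \<open>a m\<close> vanished, so would \<open>B m\<close>, and \<open>B_rec\<close>
  would carry this down through the levels: each time \<open>B i = 0\<close> reduces to
  \<open>a i = 0\<close>. At level \<open>0\<close> only \<open>a 0\<close> would remain, and it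
  decays at infinity, which a nonzero polynomial does not.\<close>

lemma a_m_nonzero: "a m ~= 0"
proof
 assume am: "a m = 0"
 have all: "a k = 0" if "1 <= i" "i <= m" "i <= k" "k <= m" for i k using that(2,1,3,4)
 proof (induction i arbitrary: k rule: inc_induct)
  case base
  thus ?case using am by simp
 next
  case (step i)
  have z: "a k = 0" if "Suc i <= k" "k <= m" for k using step.IH[of k] that step.prems by simp
  have "cpoly (a i) = 0"
  proof (rule poly_zero_off_real)
   fix z :: complex assume "Im z > 0"
   hence zo: "z ~: cx ` Dl (Suc i)" by auto
   have "B (Suc i) w = 0" for w using z step.hyps by (simp add: B_eq)
   hence "B i z = 0" using B_rec[OF _ _ zo] step.prems step.hyps by (simp add: ctr_def sint_def)
   moreover have "B i z = (-1) ^ i * pc (a i) z"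
    using z step.hyps by (simp add: B_eq sum.atLeast_Suc_atMost nh_def)
   ultimately show "pc (a i) z = 0" by simp
  qed
  thus ?case using z step.prems by (cases "k = i") auto
 qed
 have z: "a k = 0" if "1 <= k" "k <= m" for k using all[of 1 k] that m2 by simp
 have "order_at_infinity (msupp (sg 1)) (n + 1) (form_zero m sg v t a)"
  using hp unfolding mlhp_def by blast
 from order_at_infinity_imag_axis[OF this] obtain C where
  C: "EVT y. norm (form_zero m sg v t a (iv y)) <= C / y ^ (n + 1)" using msupp_ne[of 1] m2 by auto
 have f: "form_zero m sg v t a w = pc (a 0) w" for w using z by (simp add: form_zero_def)
 have "EVT y. norm (pc (a 0) (iv y)) <= abs C / y" using C eventually_ge_at_top[of 1]
 proof eventually_elim
  case (elim y)
  have "C / y ^ (n + 1) <= abs C / y ^ (n + 1)" using elim(2) by (intro divide_right_mono) auto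
  also have "... <= abs C / y ^ 1" using elim(2) by (intro divide_left_mono power_increasing) auto
  finally show ?case using elim(1) f by simp
 qed
 from poly_imag_axis_zero[OF decay_imp_tendsto_0[OF this]] have "a 0 = 0" by simp
 moreover obtain j where "j <= m" "a j ~= 0" using hp unfolding mlhp_def by auto
 ultimately show False using z[of j] by (cases "j = 0") auto
qed

text \<open>Dividing the form by the nodal polynomial of its zeros raises the order at infinity by
  \<open>card X\<close>, so \<open>B (Suc i) / nodal X\<close> is orthogonal to all degrees below
  \<open>card X\<close>. As \<open>nodal X\<close> has no zero on the next interval, the sign
  changes obtained are sign changes of the next form.\<close>

lemma zeros_transfer:
 assumes i: "1 <= i" "i < m" and X: "finite X" "X <= {x : Dl i. B i (cx x) = 0}"
  and fin: "finite {x : Dl (Suc i). B (Suc i) (cx x) = 0}"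
 obtains Y e where "Y <= {x : Dl (Suc i). B (Suc i) (cx x) = 0} Int interior (Dl (Suc i))" "card X <= card Y"
  "e = 1 | e = -1" "!!x. x : Dl (Suc i) ==> 0 <= e * Re (B (Suc i) (cx x)) * poly (nodal Y) x"
proof -
 have g: "gmeas (Dl (Suc i)) (sg (Suc i))" using i by (intro gsg) auto
 have t: "tame (Dl (Suc i)) (%x. B (Suc i) (cx x))" using i by (intro B_tame) auto
 have Xd: "X Int Dl (Suc i) = {}" using X disj[OF i] by auto
 obtain C where C: "EVT y. norm (B i (iv y)) <= C / y" using B_decay[OF i] by blast
 have dec: "EVT y. norm (B i (iv y) / pc (nodal X) (iv y)) <= C / y ^ (card X + 1)"
  using C eventually_gt_at_top[of 0]
 proof eventually_elim
  case (elim y)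
  have "norm (B i (iv y) / pc (nodal X) (iv y)) <= (C / y) / y ^ card X"
   unfolding norm_divide using elim nodal_imag_axis[OF elim(2), of X] by (intro frac_le) (auto intro: order_trans[OF norm_ge_zero])
  thus ?case by simp
 qed
 define Ph where "Ph = (%x. poly 1 (cx x) * B (Suc i) (cx x) / cx (poly (nodal X) x))"
 define ph where "ph = (%x. Re (Ph x))"
 note oz = orth_of_zeros[OF g t X(1) Xd, of "B i" 1 0, OF _ _ dec Ph_def]
 have H: "B i z = poly 1 z * ctr (sg (Suc i)) (%x. B (Suc i) (cx x)) z - poly 0 z" if "z ~: cx ` Dl (Suc i)" for z
  using B_rec[OF i that] by simp
 have zero: "B i (cx r) = 0" if "r : X" for r using X that by auto
 have tPh: "tame (Dl (Suc i)) Ph" by (rule oz(1)[OF H zero])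
 have re: "Ph x = cx (Re (Ph x))" for x
  using B_real[of "Suc i" x] i by (simp add: Ph_def complex_eq_iff)
 have tph: "tame (Dl (Suc i)) (%x. cx (ph x))" unfolding ph_def by (rule tame_of_real_Re[OF tPh re])
 have zeq: "{x : Dl (Suc i). ph x = 0} = {x : Dl (Suc i). B (Suc i) (cx x) = 0}"
 proof -
  have "ph x = 0 \<longleftrightarrow> B (Suc i) (cx x) = 0" if "x : Dl (Suc i)" for x
  proof -
   have "poly (nodal X) x ~= 0" using that Xd X(1) by (auto simp: poly_nodal_eq_0_iff)
   moreover have "ph x = 0 \<longleftrightarrow> Ph x = 0" using re[of x] unfolding ph_def by (metis Re_complex_of_real of_real_0)
   ultimately show ?thesis by (simp add: Ph_def)
  qed
  thus ?thesis by blast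
 qed
 have orth: "(LINT x|snd (sg (Suc i)). poly p x * ph x) = 0" if "degree p < card X" for p
 proof (rule real_orth_of_sint[OF g tPh tph])
  show "Ph x = cx (ph x)" for x using re[of x] by (simp add: ph_def)
  show "sint (sg (Suc i)) (%x. pc p (cx x) * Ph x) = 0"
   by (rule oz(3)[OF H zero]) (use that in auto)
 qed
 have Xnz: "poly (nodal X) x ~= 0" if "x : Dl (Suc i)" for x
  using that Xd X(1) by (auto simp: poly_nodal_eq_0_iff)
 have Xc: "continuous_on (Dl (Suc i)) (poly (nodal X))" by (intro continuous_intros)
 show ?thesis
 proof (rule orth_card_sign_changes[OF g tph fin[folded zeq] orth])
  fix Y and e :: real
  assume Y: "Y <= {x : Dl (Suc i). ph x = 0} Int interior (Dl (Suc i))" "card X <= card Y"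
   and e: "e = 1 | e = -1" "!!x. x : Dl (Suc i) ==> ph x ~= 0 ==> e * ph x * poly (nodal Y) x > 0"
  show thesis
  proof (rule no_zero_sign[OF gmeasD(4)[OF g] Xc Xnz])
   fix e' :: real
   assume e': "e' = 1 | e' = -1" "!!x. x : Dl (Suc i) ==> e' * poly (nodal X) x > 0"
   show thesis
   proof (rule that[OF Y[unfolded zeq], of "e * e'"])
    show "e * e' = 1 | e * e' = -1" using e(1) e'(1) by auto
    fix x assume x: "x : Dl (Suc i)"
    have "0 <= e * ph x * poly (nodal Y) x" using e(2)[OF x] by (cases "ph x = 0") (auto simp: less_imp_le)
    hence "0 <= (e' * poly (nodal X) x) * (e * ph x * poly (nodal Y) x)" using e'(2)[OF x] by simp
    moreover have "Re (B (Suc i) (cx x)) = poly (nodal X) x * ph x"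
     using Xnz[OF x] by (simp add: ph_def Ph_def)
    ultimately show "0 <= e * e' * Re (B (Suc i) (cx x)) * poly (nodal Y) x"
     by (simp only: ac_simps)
   qed
  qed
 qed
qed

text \<open>At level \<open>m\<close> the bound is the degree of \<open>a m\<close>. Below, every
  finite set of zeros is matched by one at least as large on the next level, and a common bound for
  all finite subsets gives finiteness.\<close>

lemma B_zeros_finite:
 assumes "1 <= i" "i <= m"
 shows "finite {x : Dl i. B i (cx x) = 0} & card {x : Dl i. B i (cx x) = 0} <= n" using assms(2,1)
proof (induction i rule: inc_induct)
 case base
 have "{x : Dl m. B m (cx x) = 0} <= {x. poly (a m) x = 0}" by (auto simp: B_m)
 moreover have "finite {x. poly (a m) x = 0}" by (rule poly_roots_finite[OF a_m_nonzero])
 moreover have "card {x. poly (a m) x = 0} <= n"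
  using card_poly_roots_bound[OF a_m_nonzero] hp unfolding mlhp_def by linarith
 ultimately show ?case by (meson card_mono finite_subset order_trans)
next
 case (step i)
 let ?Z = "{x : Dl i. B i (cx x) = 0}" and ?Z' = "{x : Dl (Suc i). B (Suc i) (cx x) = 0}"
 have IH: "finite ?Z'" "card ?Z' <= n" using step.IH by auto
 have "card X <= n" if X: "X <= ?Z" "finite X" for X
 proof (rule zeros_transfer[OF step.prems step.hyps(2) X(2,1) IH(1)])
  fix Y assume "Y <= ?Z' Int interior (Dl (Suc i))" "card X <= card Y"
  thus "card X <= n" using card_mono[OF IH(1), of Y] IH(2) by auto
 qed
 thus ?case using finite_if_finite_subsets_card_bdd[of ?Z n] by auto
qed

end

context mlhp_sys
begin

lemma form_zero_split:
 "form_zero m sg v t a z = B 0 z + (SUM k=1..m. (-1) ^ k * pc (a k) z * ratfun (v k) (t k) z)"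
 unfolding form_zero_def B_def form_level_def by (simp add: distrib_left sum.distrib)

text \<open>Numerator of \<open>r_k\<close> over the common denominator \<open>T\<close>.\<close>

definition tr :: "nat => real poly" where "tr k = v k * (T div t k)"

lemma T_ratfun:
 assumes "1 <= k" "k <= m" "pc T z ~= 0"
 shows "pc T z * ratfun (v k) (t k) z = pc (tr k) z"
proof -
 obtain q where q: "T = t k * q" using tT[OF assms(1,2)] by (elim dvdE)
 hence "T div t k = q" using T0 by simp
 moreover have "pc T z = pc (t k) z * pc q z" by (simp add: q)
 ultimately have e: "pc T z = pc (t k) z * pc (T div t k) z" by simp
 hence "pc (t k) z ~= 0" using assms(3) by auto
 thus ?thesis unfolding e ratfun_def tr_def by (simp add: field_simps)
qed

text \<open>After multiplication by \<open>T\<close> the form of level \<open>0\<close> is the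
  transform of \<open>T B_1\<close> plus a polynomial. Both functions tend to \<open>0\<close>,
  since \<open>T\<close> uses up only \<open>degree T <= n\<close> of the \<open>n + 1\<close>
  orders at infinity, so the polynomial is \<open>0\<close>. The polynomial \<open>c\<close> is the
  price of taking \<open>T\<close> out of the integral again.\<close>

lemma form_zero_rep:
 "\<exists>c :: real poly. degree c <= degree T &
  (ALL z. z ~: cx ` Dl 1 -->
    pc T z * ctr (sg 1) (%x. B 1 (cx x)) z - pc c z
    = ctr (sg 1) (%x. cx (poly T x) * B 1 (cx x)) z) &
  (ALL z. z ~: cx ` Dl 1 --> pc T z ~= 0 -->
    pc T z * form_zero m sg v t a z
    = pc T z * ctr (sg 1) (%x. B 1 (cx x)) z - pc c z) &
  (EX C. EVT y. norm (pc T (iv y) * ctr (sg 1) (%x. B 1 (cx x)) (iv y)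
     - pc c (iv y)) <= C / y ^ (n - degree T + 1))"
proof -
 have g: "gmeas (Dl 1) (sg 1)" using m2 by (intro gsg) auto
 have t1: "tame (Dl 1) (%x. B 1 (cx x))" using m2 by (intro B_tame) auto
 have tT1: "tame (Dl 1) (%x. cx (poly T x) * B 1 (cx x))" by (intro tame_mult tame_cpoly_real t1)
 have re: "Im (B 1 (cx x)) = 0" for x using B_real[of 1 x] m2 by simp
 obtain c where c: "degree c <= degree T" "!!z. z ~: cx ` Dl 1 ==>
   pc T z * ctr (sg 1) (%x. B 1 (cx x)) z
   - ctr (sg 1) (%x. cx (poly T x) * B 1 (cx x)) z = pc c z"
  using ctr_poly_mult_real[OF g t1 re, of T] by blast
 have "0 < m" using m2 by simp
 from B_rec_poly[OF this] obtain d where d: "!!z. z ~: cx ` Dl 1 ==>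
   B 0 z - ctr (sg 1) (%x. B 1 (cx x)) z = poly d z" by auto
 let ?q = "cpoly T * d + (SUM k=1..m. smult ((-1) ^ k) (cpoly (a k * tr k))) + cpoly c"
 have q: "pc T z * form_zero m sg v t a z - ctr (sg 1) (%x. cx (poly T x) * B 1 (cx x)) z = poly ?q z"
  if z: "z ~: cx ` Dl 1" and Tz: "pc T z ~= 0" for z
 proof -
  have B0: "B 0 z = ctr (sg 1) (%x. B 1 (cx x)) z + poly d z" using d[OF z] by (simp add: algebra_simps)
  have "pc T z * (SUM k=1..m. (-1) ^ k * pc (a k) z * ratfun (v k) (t k) z)
    = (SUM k=1..m. (-1) ^ k * pc (a k) z * pc (tr k) z)" unfolding sum_distrib_left
  proof (rule sum.cong[OF refl])
   fix k assume "k : {1..m}"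
   hence "pc T z * ratfun (v k) (t k) z = pc (tr k) z" using Tz by (intro T_ratfun) auto
   thus "pc T z * ((-1) ^ k * pc (a k) z * ratfun (v k) (t k) z)
     = (-1) ^ k * pc (a k) z * pc (tr k) z" by (simp only: mult.left_commute[of "pc T z"])
  qed
  hence "pc T z * form_zero m sg v t a z = pc T z * ctr (sg 1) (%x. B 1 (cx x)) z
    + pc T z * poly d z + (SUM k=1..m. (-1) ^ k * pc (a k) z * pc (tr k) z)"
   unfolding form_zero_split B0 distrib_left by (simp only:)
  thus ?thesis using c(2)[OF z] by (simp add: poly_sum mult.assoc)
 qed
 have "order_at_infinity (msupp (sg 1)) (n + 1) (form_zero m sg v t a)"
  using hp unfolding mlhp_def by blast
 from order_at_infinity_imag_axis[OF this] obtain C where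
  C: "EVT y. norm (form_zero m sg v t a (iv y)) <= C / y ^ (n + 1)" using msupp_ne[of 1] m2 by auto
 obtain K where K: "!!y. y >= 1 ==> norm (pc T (iv y)) <= K * y ^ degree T" "K >= 0"
  using poly_imag_axis_bound[of "cpoly T"] by auto
 have C': "EVT y. norm (pc T (iv y) * form_zero m sg v t a (iv y)) <= K * C / y ^ (n - degree T + 1)"
  using C eventually_ge_at_top[of 1]
 proof eventually_elim
  case (elim y)
  have "norm (pc T (iv y) * form_zero m sg v t a (iv y)) <= (K * y ^ degree T) * (C / y ^ (n + 1))"
   unfolding norm_mult using elim K(2) K(1)[OF elim(2)] by (intro mult_mono) auto
  also have "y ^ (n + 1) = y ^ degree T * y ^ (n - degree T + 1)" using nD by (simp flip: power_add)
  finally show ?case using elim(2) by simp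
 qed
 have Tnz: "EVT y. pc T (iv y) ~= 0"
 proof -
  have "finite {z. pc T z = 0}" using T0 by (intro poly_roots_finite) simp
  hence "bounded {z. pc T z = 0}" by (rule finite_imp_bounded)
  then obtain b where b: "!!z. pc T z = 0 ==> norm z <= b" by (auto simp: bounded_iff)
  show ?thesis using eventually_gt_at_top[of "max 0 b"]
   by eventually_elim (use b in \<open>fastforce simp: norm_mult\<close>)
 qed
 have "((%y. poly ?q (iv y)) ---> 0) at_top"
 proof -
  have "EVT y. norm (pc T (iv y) * form_zero m sg v t a (iv y)) <= abs (K * C) / y"
   using C' eventually_ge_at_top[of 1]
  proof eventually_elim
   case (elim y)
   have "K * C / y ^ (n - degree T + 1) <= abs (K * C) / y ^ (n - degree T + 1)" using elim(2) by (intro divide_right_mono) auto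
   also have "... <= abs (K * C) / y ^ 1" using elim(2) by (intro divide_left_mono power_increasing) auto
   finally show ?case using elim(1) by simp
  qed
  from tendsto_diff[OF decay_imp_tendsto_0[OF this] ctr_tendsto_0[OF g tT1]]
  show ?thesis unfolding diff_zero
  proof (rule Lim_transform_eventually)
   show "EVT y. pc T (iv y) * form_zero m sg v t a (iv y)
     - ctr (sg 1) (%x. cx (poly T x) * B 1 (cx x)) (iv y) = poly ?q (iv y)"
    using Tnz eventually_gt_at_top[of 0]
    by eventually_elim (intro q imag_axis_off, simp_all)
  qed
 qed
 hence "?q = 0" by (rule poly_imag_axis_zero)
 hence q0: "pc T z * form_zero m sg v t a z = ctr (sg 1) (%x. cx (poly T x) * B 1 (cx x)) z"
  if "z ~: cx ` Dl 1" "pc T z ~= 0" for z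
  using q[OF that] `?q = 0` by (simp only: poly_0 right_minus_eq)
 show ?thesis
 proof (intro exI[of _ c] conjI allI impI)
  show "degree c <= degree T" by (rule c(1))
  show 1: "pc T z * ctr (sg 1) (%x. B 1 (cx x)) z - pc c z
    = ctr (sg 1) (%x. cx (poly T x) * B 1 (cx x)) z" if "z ~: cx ` Dl 1" for z
   using c(2)[OF that] by (simp add: algebra_simps)
  show 2: "pc T z * form_zero m sg v t a z
    = pc T z * ctr (sg 1) (%x. B 1 (cx x)) z - pc c z"
   if "z ~: cx ` Dl 1" "pc T z ~= 0" for z unfolding 1[OF that(1)] by (rule q0[OF that])
  have "EVT y. norm (pc T (iv y) * ctr (sg 1) (%x. B 1 (cx x)) (iv y)
     - pc c (iv y)) <= K * C / y ^ (n - degree T + 1)" using C' Tnz eventually_gt_at_top[of 0]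
  proof eventually_elim
   case (elim y)
   show ?case using elim(1) 2[OF imag_axis_off[of y] elim(2)] elim(3) by simp
  qed
  thus "EX C. EVT y. norm (pc T (iv y) * ctr (sg 1) (%x. B 1 (cx x)) (iv y)
     - pc c (iv y)) <= C / y ^ (n - degree T + 1)" by blast
 qed
qed

text \<open>The induction starts from the orthogonality of \<open>T B_1\<close> to all degrees below
  \<open>n - degree T\<close>; its sign changes are zeros of \<open>B_1\<close> because
  \<open>T\<close> has no zero on \<open>Dl 1\<close>. \<open>zeros_transfer\<close> does the
  rest.\<close>

lemma B_zeros_lower:
 assumes "1 <= i" "i <= m"
 shows "EX X. X <= {x : Dl i. B i (cx x) = 0} & n - degree T <= card X" using assms
proof (induction i rule: dec_induct)
 case base
 have g: "gmeas (Dl 1) (sg 1)" using m2 by (intro gsg) auto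
 have t1: "tame (Dl 1) (%x. B 1 (cx x))" using m2 by (intro B_tame) auto
 have tT1: "tame (Dl 1) (%x. cx (poly T x) * B 1 (cx x))" by (intro tame_mult tame_cpoly_real t1)
 obtain c where c: "!!z. z ~: cx ` Dl 1 ==>
    pc T z * ctr (sg 1) (%x. B 1 (cx x)) z - pc c z
    = ctr (sg 1) (%x. cx (poly T x) * B 1 (cx x)) z"
  and "EX C. EVT y. norm (pc T (iv y) * ctr (sg 1) (%x. B 1 (cx x)) (iv y)
     - pc c (iv y)) <= C / y ^ (n - degree T + 1)" using form_zero_rep by blast
 then obtain C where C: "EVT y. norm (pc T (iv y) * ctr (sg 1) (%x. B 1 (cx x)) (iv y)
     - pc c (iv y)) <= C / y ^ (n - degree T + 1)" by blast
 have dec: "EVT y. norm (ctr (sg 1) (%x. cx (poly T x) * B 1 (cx x)) (iv y)) <= C / y ^ (n - degree T + 1)"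
  using C eventually_gt_at_top[of 0]
 proof eventually_elim
  case (elim y)
  thus ?case using c[OF imag_axis_off[of y]] by simp
 qed
 let ?ph = "%x. poly T x * Re (B 1 (cx x))"
 have re: "cx (poly T x) * B 1 (cx x) = cx (?ph x)" for x
  using B_real[of 1 x] m2 by (simp add: complex_eq_iff)
 have tph: "tame (Dl 1) (%x. cx (?ph x))" using tT1 by (simp only: re)
 have zeq: "{x : Dl 1. ?ph x = 0} = {x : Dl 1. B 1 (cx x) = 0}"
 proof -
  have "B 1 (cx x) = 0 \<longleftrightarrow> Re (B 1 (cx x)) = 0" for x
   using B_real[of 1 x] m2 by (simp add: complex_eq_iff)
  thus ?thesis using TDl by auto
 qed
 have fin: "finite {x : Dl 1. ?ph x = 0}" unfolding zeq using B_zeros_finite[of 1] m2 by auto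
 have orth: "(LINT x|snd (sg 1). poly p x * ?ph x) = 0" if "degree p < n - degree T" for p
 proof (rule real_orth_of_sint[OF g tT1 tph re])
  show "sint (sg 1) (%x. pc p (cx x) * (cx (poly T x) * B 1 (cx x))) = 0"
  proof (rule orthogonal_poly[OF g tT1])
   show "sint (sg 1) (%x. cx x ^ k * (cx (poly T x) * B 1 (cx x))) = 0" if "k < n - degree T" for k
    by (rule moments_vanish[OF g tT1 dec that])
   show "degree (cpoly p) < n - degree T" using that by simp
  qed
 qed
 show ?case
 proof (rule orth_card_sign_changes[OF g tph fin orth])
  fix Y assume "Y <= {x : Dl 1. ?ph x = 0} Int interior (Dl 1)" "n - degree T <= card Y"
  thus ?thesis unfolding zeq by (intro exI[of _ Y]) auto
 qed
next
 case (step i)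
 then obtain X where X: "X <= {x : Dl i. B i (cx x) = 0}" "n - degree T <= card X" by auto
 have "finite X" using X(1) B_zeros_finite[of i] step finite_subset by auto
 show ?case
 proof (rule zeros_transfer[of i X])
  show "finite {x : Dl (Suc i). B (Suc i) (cx x) = 0}" using B_zeros_finite[of "Suc i"] step by auto
  fix Y assume "Y <= {x : Dl (Suc i). B (Suc i) (cx x) = 0} Int interior (Dl (Suc i))" "card X <= card Y"
  thus ?thesis using X(2) by (intro exI[of _ Y]) auto
 qed (use step X `finite X` in auto)
qed

lemma a_m_sign_changes:
 obtains Y e where "Y <= interior (Dl m)" "Y <= {x. poly (a m) x = 0}" "finite Y" "n - degree T <= card Y"
  "e = 1 | e = -1" "!!x. x : Dl m ==> 0 <= e * poly (a m) x * poly (nodal Y) x"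
proof -
 define i where "i = m - 1"
 have i: "1 <= i" "i < m" "Suc i = m" using m2 by (auto simp: i_def)
 obtain X where X: "X <= {x : Dl i. B i (cx x) = 0}" "n - degree T <= card X"
  using B_zeros_lower[of i] i by auto
 have fX: "finite X" using X(1) B_zeros_finite[of i] i finite_subset by auto
 have fin: "finite {x : Dl (Suc i). B (Suc i) (cx x) = 0}" using B_zeros_finite[of "Suc i"] i by auto
 show ?thesis
 proof (rule zeros_transfer[OF i(1,2) fX X(1) fin])
  fix Y and e :: real
  assume Y: "Y <= {x : Dl (Suc i). B (Suc i) (cx x) = 0} Int interior (Dl (Suc i))" "card X <= card Y"
   and e: "e = 1 | e = -1" "!!x. x : Dl (Suc i) ==> 0 <= e * Re (B (Suc i) (cx x)) * poly (nodal Y) x"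
  have Bm: "B (Suc i) (cx x) = cx ((-1) ^ m * poly (a m) x)" for x unfolding i(3) by (simp add: B_m)
  show thesis
  proof (rule that[of Y "e * (-1) ^ m"])
   show "Y <= interior (Dl m)" "Y <= {x. poly (a m) x = 0}" using Y(1) unfolding Bm by (auto simp: i(3))
   show "finite Y" using Y(1) fin finite_subset by blast
   show "n - degree T <= card Y" using X(2) Y(2) by linarith
   show "e * (-1) ^ m = 1 | e * (-1) ^ m = -1" using e(1) by (cases "even m") auto
   show "0 <= e * (-1) ^ m * poly (a m) x * poly (nodal Y) x" if "x : Dl m" for x
    using e(2)[of x, unfolded Bm] that by (simp add: mult.assoc i(3))
  qed
 qed
qed

end

section \<open>Elimination of the intermediate measures\<close>

context mlhp_sys
begin

text \<open>The sign counts the eliminations carried out so far, each of which contributes a factor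
  \<open>-1\<close> in \<open>switch_step\<close>.\<close>

definition Fc :: "nat => nat => complex => complex" where
 "Fc j k z = (-1) ^ (k - j) * B (Suc k) z"

text \<open>With \<open>S = 1, c = 0\<close> at level \<open>j \<ge> 1\<close>, and \<open>S = T\<close> at level \<open>0\<close>, the functions \<open>Hf S c j k\<close>
 for \<open>k = j, j + 1, \<dots>\<close> arise from the form of level \<open>j\<close> by eliminating one measure at a time.\<close>

definition Hf :: "real poly => real poly => nat => nat => complex => complex" where
 "Hf S c j k z = pc S z * ctr (nik sg (Suc k) (Suc j)) (%x. Fc j k (cx x)) z - pc c z"

lemma Fc_tame: "k < m ==> tame (Dl (Suc k)) (%x. Fc j k (cx x))"
 unfolding Fc_def by (intro tame_mult tame_const B_tame) auto

lemma Fc_real: "k < m ==> Im (Fc j k (cx x)) = 0"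
 unfolding Fc_def using B_real[of "Suc k" x] by (cases "even (k - j)") auto

lemma gnj: "j <= k ==> k < m ==> gmeas (Dl (Suc k)) (nik sg (Suc k) (Suc j))"
 by (intro gnik_down) auto

lemma Hf_holomorphic: "j <= k ==> k < m ==> Hf S c j k holomorphic_on dom k"
proof -
 assume jk: "j <= k" "k < m"
 have "ctr (nik sg (Suc k) (Suc j)) (%x. Fc j k (cx x)) holomorphic_on - cx ` Dl (Suc k)"
  by (rule ctr_holomorphic[OF gnj[OF jk] Fc_tame[OF jk(2)]])
 thus ?thesis unfolding Hf_def[abs_def] dom_def using jk by (simp, intro holomorphic_intros)
qed

lemma Hf_isCont: "j <= k ==> k < m ==> 1 <= k ==> x : Dl k ==> isCont (Hf S c j k) (cx x)"
proof -
 assume *: "j <= k" "k < m" "1 <= k" "x : Dl k"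
 have "continuous_on (dom k) (Hf S c j k)"
  by (rule holomorphic_on_imp_continuous_on[OF Hf_holomorphic[OF *(1,2)]])
 hence "ALL w:dom k. isCont (Hf S c j k) w" using continuous_on_eq_continuous_at[OF dom_open] by blast
 moreover have "cx x : dom k" using dom_sub[of k] * by auto
 ultimately show ?thesis by blast
qed

lemma Hf_real: "j <= k ==> k < m ==> Im (Hf S c j k (cx x)) = 0"
 using ctr_real_axis[OF gnj, of j k "%x. Fc j k (cx x)" x] Fc_real[of k] by (simp add: Hf_def)

lemma Hf_succ:
 assumes "j <= k" "Suc k < m" "Im z ~= 0"
 shows "Hf S c j (Suc k) z = Hf S c j k z - pc S z * cauchy (nik sg (Suc k) (Suc j)) z * Fc j k z"
proof -
 have "ctr (nik sg (Suc k) (Suc j)) (%x. B (Suc k) (cx x)) z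
   = cauchy (nik sg (Suc k) (Suc j)) z * B (Suc k) z
    - ctr (nik sg (Suc (Suc k)) (Suc j)) (%x. B (Suc (Suc k)) (cx x)) z"
  using assms by (intro switch_step B_tame B_rec) auto
 moreover have "(-1 :: complex) ^ (Suc k - j) = - ((-1) ^ (k - j))" using assms(1) by (simp add: Suc_diff_le)
 moreover have "gmeas (Dl (Suc k)) (nik sg (Suc k) (Suc j))" "gmeas (Dl (Suc (Suc k))) (nik sg (Suc (Suc k)) (Suc j))"
  using assms by (auto intro!: gnik_down)
 ultimately show ?thesis unfolding Hf_def Fc_def by (simp only: ctr_cmult) (simp add: algebra_simps)
qed

text \<open>The orders at infinity lost through the factor \<open>S\<close> and the polynomial part \<open>c\<close>.\<close>

definition loss :: "real poly => real poly => nat" where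
 "loss S c = (if c = 0 then degree S else Suc (degree S))"

lemma Hf_decay:
 assumes "j <= k" "k < m" "degree c <= degree S" and X: "finite X" "loss S c <= card X"
 shows "EX C. EVT y. norm (Hf S c j k (iv y) / pc (nodal X) (iv y))
   <= C / y ^ (card X - loss S c + 1)"
proof -
 obtain C where C: "!!y. y > 0 ==> norm (ctr (nik sg (Suc k) (Suc j)) (%x. Fc j k (cx x)) (iv y)) <= C / y"
  using ctr_imag_axis[OF gnj[OF assms(1,2)] Fc_tame[OF assms(2)]] by blast
 obtain K where K: "!!y. y >= 1 ==> norm (pc S (iv y)) <= K * y ^ degree S" "K >= 0"
  using poly_imag_axis_bound[of "cpoly S"] by auto
 obtain K' where K': "!!y. y >= 1 ==> norm (pc c (iv y)) <= K' * y ^ degree c" "K' >= 0"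
  using poly_imag_axis_bound[of "cpoly c"] by auto
 \<comment> \<open>The first term of \<open>Hf\<close> is of order \<open>y^(degree S) / y\<close>,
   the second of order \<open>y^(degree S)\<close> if present; \<open>loss\<close> is chosen so that
   \<open>y^(loss S c) / y\<close> covers both.\<close>
 have bound: "norm (Hf S c j k (iv y)) <= (K * abs C + K') * y ^ loss S c / y" if y: "y >= 1" for y
 proof -
  have C': "C / y <= abs C / y" using y by (intro divide_right_mono) auto
  have "norm (Hf S c j k (iv y)) <= norm (pc S (iv y))
    * norm (ctr (nik sg (Suc k) (Suc j)) (%x. Fc j k (cx x)) (iv y)) + norm (pc c (iv y))"
   unfolding Hf_def by (rule order_trans[OF norm_triangle_ineq4]) (simp add: norm_mult)
  also have "... <= (K * y ^ degree S) * (abs C / y) + norm (pc c (iv y))"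
   using K(1)[OF y] C[of y] C' y K(2) by (intro add_right_mono mult_mono) auto
  also have "(K * y ^ degree S) * (abs C / y) <= K * abs C * y ^ loss S c / y"
  proof -
   have "y ^ degree S <= y ^ loss S c" using y by (intro power_increasing) (auto simp: loss_def)
   hence "(K * abs C) * y ^ degree S <= (K * abs C) * y ^ loss S c" using K(2) by (intro mult_left_mono) auto
   hence "(K * abs C) * y ^ degree S / y <= (K * abs C) * y ^ loss S c / y" using y by (intro divide_right_mono) auto
   thus ?thesis by (simp add: ac_simps)
  qed
  also have "norm (pc c (iv y)) <= K' * y ^ loss S c / y"
  proof (cases "c = 0")
   case True
   thus ?thesis using y K'(2) by simp
  next
   case False
   have "norm (pc c (iv y)) <= K' * y ^ degree c" by (rule K'(1)[OF y])
   also have "... <= K' * y ^ degree S" using y assms(3) K'(2) by (intro mult_left_mono power_increasing) auto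
   also have "... = K' * y ^ loss S c / y" using False y by (simp add: loss_def)
   finally show ?thesis .
  qed
  finally show ?thesis by (simp add: add_divide_distrib distrib_right)
 qed
 have "EVT y. norm (Hf S c j k (iv y) / pc (nodal X) (iv y))
   <= (K * abs C + K') / y ^ (card X - loss S c + 1)" using eventually_ge_at_top[of 1]
 proof eventually_elim
  case (elim y)
  hence y: "y >= 1" .
  have "norm (Hf S c j k (iv y) / pc (nodal X) (iv y))
    <= ((K * abs C + K') * y ^ loss S c / y) / y ^ card X"
   unfolding norm_divide using bound[OF y] y nodal_imag_axis[of y X] K(2) K'(2) by (intro frac_le) auto
  also have "y ^ card X = y ^ loss S c * y ^ (card X - loss S c)" using X(2) by (simp flip: power_add)
  also have "((K * abs C + K') * y ^ loss S c / y) / (y ^ loss S c * y ^ (card X - loss S c)) = (K * abs C + K') / y ^ (card X - loss S c + 1)"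
   using y by simp
  finally show ?case .
 qed
 thus ?thesis by blast
qed

text \<open>\<open>G\<close> is kept abstract because at the last level \<open>k = m - 1\<close> it
  is no longer a function \<open>Hf\<close> but the polynomial in
  \<open>pade_common\<close>.\<close>

lemma Hf_alternation:
 assumes jk: "j <= k" "k < m" and S: "S ~= 0" and X: "finite X" "X Int Dl (Suc k) = {}"
  and zero: "!!r. r : X ==> Hf S c j k (cx r) = 0"
  and dec: "EVT y. norm (Hf S c j k (iv y) / pc (nodal X) (iv y)) <= C / y ^ (M + 1)"
  and G: "!!z. Im z > 0 ==> G z = Hf S c j k z - pc S z * cauchy (nik sg (Suc k) (Suc j)) z * Fc j k z"
  and Gc: "!!x. x : Dl (Suc k) ==> isCont G (cx x)" and M: "Suc N <= M"
 shows "alternates (%x. Re (G (cx x))) (Dl (Suc k)) N"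
proof (rule alternation_step[OF gnj[OF jk] Fc_tame[OF jk(2)] X _ zero dec dom_open[of "Suc k"] _ _ _ S _ G Gc M])
 show "cx ` Dl (Suc k) <= dom (Suc k)" using jk by (intro dom_sub) auto
 show "Fc j k holomorphic_on dom (Suc k)"
  unfolding Fc_def[abs_def] using B_holomorphic[of "Suc k"] jk by (intro holomorphic_intros) auto
 show "finite {x : Dl (Suc k). Fc j k (cx x) = 0}"
  using B_zeros_finite[of "Suc k"] jk by (simp add: Fc_def)
 show "Im (Fc j k (cx x)) = 0" for x by (rule Fc_real[OF jk(2)])
qed (simp_all add: Hf_def)

lemma Hf_next_zeros:
 assumes jk: "j <= k" "Suc k < m" and alt: "alternates (%x. Re (Hf S c j (Suc k) (cx x))) (Dl (Suc k)) N"
 shows "EX X. finite X & X <= Dl (Suc k) & card X = N & (ALL r:X. Hf S c j (Suc k) (cx r) = 0)"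
proof -
 have g: "gmeas (Dl (Suc k)) (sg (Suc k))" using jk by (intro gsg) auto
 have "continuous_on (Dl (Suc k)) (%x. Re (Hf S c j (Suc k) (cx x)))"
 proof (rule continuous_at_imp_continuous_on, rule ballI)
  fix x assume "x : Dl (Suc k)"
  hence "isCont (Hf S c j (Suc k)) (cx x)" using jk by (intro Hf_isCont) auto
  hence "isCont (%x::real. Hf S c j (Suc k) (cx x)) x"
   by (intro isCont_o2[where f = cx and g = "Hf S c j (Suc k)"]) auto
  thus "isCont (%x. Re (Hf S c j (Suc k) (cx x))) x" by (rule isCont_Re)
 qed
 from alternates_zeros[OF alt this gmeasD(4)[OF g]] obtain X where X: "finite X" "card X = N" "X <= Dl (Suc k)"
  "!!x. x : X ==> Re (Hf S c j (Suc k) (cx x)) = 0" by blast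
 have "Hf S c j (Suc k) (cx r) = 0" if "r : X" for r
  using X(4)[OF that] Hf_real[of j "Suc k" S c r] jk by (simp add: complex_eq_iff)
 thus ?thesis using X by blast
qed

text \<open>Each level costs \<open>loss S c\<close> orders of decay and one more sign change in
  \<open>alternation_step\<close>. If fewer zeros than that are left, the empty set already
  satisfies the estimate.\<close>

lemma Hf_chain:
 assumes jk: "j <= k0" "1 <= k0" "k0 <= k" "k < m" and S: "S ~= 0" "degree c <= degree S"
  and X0: "finite X0" "X0 <= Dl k0" "!!r. r : X0 ==> Hf S c j k0 (cx r) = 0"
 shows "EX X. finite X & X <= Dl k & (ALL r:X. Hf S c j k (cx r) = 0) &
   card X0 <= card X + (k - k0) * (loss S c + 1)" using jk(3,4)
proof (induction k rule: dec_induct)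
 case base
 thus ?case using X0 by auto
next
 case (step k)
 then obtain X where X: "finite X" "X <= Dl k" "!!r. r : X ==> Hf S c j k (cx r) = 0"
  "card X0 <= card X + (k - k0) * (loss S c + 1)" by auto
 have k: "j <= k" "k < m" "1 <= k" "Suc k < m" using jk step by auto
 show ?case
 proof (cases "loss S c + 1 <= card X")
  case True
  have Xd: "X Int Dl (Suc k) = {}" using X(2) disj[of k] k by blast
  obtain C where C: "EVT y. norm (Hf S c j k (iv y) / pc (nodal X) (iv y))
   <= C / y ^ (card X - loss S c + 1)" using Hf_decay[OF k(1,2) S(2) X(1)] True by auto
  have "alternates (%x. Re (Hf S c j (Suc k) (cx x))) (Dl (Suc k)) (card X - loss S c - 1)"
  proof (rule Hf_alternation[OF k(1,2) S(1) X(1) Xd X(3) C])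
   show "Hf S c j (Suc k) z = Hf S c j k z - pc S z * cauchy (nik sg (Suc k) (Suc j)) z * Fc j k z"
    if "Im z > 0" for z using Hf_succ[OF k(1,4)] that by simp
   show "isCont (Hf S c j (Suc k)) (cx x)" if "x : Dl (Suc k)" for x
    using k that by (intro Hf_isCont) auto
  qed (use True in auto)
  from Hf_next_zeros[OF k(1,4) this] obtain X' where X': "finite X'" "X' <= Dl (Suc k)"
   "card X' = card X - loss S c - 1" "ALL r:X'. Hf S c j (Suc k) (cx r) = 0" by blast
  have "card X0 <= card X' + (Suc k - k0) * (loss S c + 1)"
   using X(4) X'(3) True step.hyps by (simp add: Suc_diff_le)
  thus ?thesis using X' by blast
 next
  case False
  hence "card X0 <= card ({} :: real set) + (Suc k - k0) * (loss S c + 1)"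
   using X(4) step.hyps by (simp add: Suc_diff_le)
  thus ?thesis by (intro exI[of _ "{}"]) auto
 qed
qed

lemma Hf_start_pos:
 assumes "1 <= j" "j < m"
 shows "EX X. finite X & X <= Dl j & (ALL r:X. Hf 1 0 j j (cx r) = 0) & n - degree T <= card X"
  and "!!z. z ~: cx ` Dl (Suc j) ==> Hf 1 0 j j z = B j z"
proof -
 show eq: "Hf 1 0 j j z = B j z" if "z ~: cx ` Dl (Suc j)" for z
  using B_rec[OF assms that] by (simp add: Hf_def Fc_def nik_self)
 obtain X where X: "X <= {x : Dl j. B j (cx x) = 0}" "n - degree T <= card X"
  using B_zeros_lower[of j] assms by auto
 have "finite X" using X(1) B_zeros_finite[of j] assms finite_subset by auto
 moreover have "Hf 1 0 j j (cx r) = 0" if "r : X" for r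
 proof -
  have "cx r ~: cx ` Dl (Suc j)" using disj[OF assms] that X by auto
  thus ?thesis using eq X that by auto
 qed
 ultimately show "EX X. finite X & X <= Dl j & (ALL r:X. Hf 1 0 j j (cx r) = 0) & n - degree T <= card X"
  using X by blast
qed

text \<open>At level \<open>0\<close> no zeros on an interval are known, only the order at infinity.
  One elimination with an empty set of zeros converts \<open>n - degree T\<close> orders into
  \<open>n - degree T - 1\<close> zeros on \<open>Dl 1\<close>.\<close>

lemma Hf_start_zero:
 "EX c X. degree c <= degree T & finite X & X <= Dl 1 & (ALL r:X. Hf T c 0 1 (cx r) = 0) &
   n - degree T <= card X + 1 &
   (ALL z. z ~: cx ` Dl 1 --> pc T z ~= 0 --> Hf T c 0 0 z = pc T z * form_zero m sg v t a z)"
proof -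
 obtain c where c: "degree c <= degree T" and c2: "!!z. z ~: cx ` Dl 1 ==> pc T z ~= 0 ==>
    pc T z * form_zero m sg v t a z
    = pc T z * ctr (sg 1) (%x. B 1 (cx x)) z - pc c z"
  and c3: "EX C. EVT y. norm (pc T (iv y) * ctr (sg 1) (%x. B 1 (cx x)) (iv y)
     - pc c (iv y)) <= C / y ^ (n - degree T + 1)" using form_zero_rep by blast
 have H0: "Hf T c 0 0 z = pc T z * ctr (sg 1) (%x. B 1 (cx x)) z - pc c z" for z
  by (simp add: Hf_def Fc_def nik_self)
 obtain C where C: "EVT y. norm (Hf T c 0 0 (iv y) / pc (nodal {}) (iv y)) <= C / y ^ (n - degree T + 1)"
  using c3 by (auto simp: H0 nodal_def)
 have "EX X. finite X & X <= Dl 1 & (ALL r:X. Hf T c 0 1 (cx r) = 0) & n - degree T <= card X + 1"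
 proof (cases "n - degree T = 0")
  case True
  thus ?thesis by (intro exI[of _ "{}"]) auto
 next
  case False
  have "alternates (%x. Re (Hf T c 0 (Suc 0) (cx x))) (Dl (Suc 0)) (n - degree T - 1)"
  proof (rule Hf_alternation[OF _ _ T0 _ _ _ C])
   show "Hf T c 0 (Suc 0) z = Hf T c 0 0 z - pc T z * cauchy (nik sg (Suc 0) (Suc 0)) z * Fc 0 0 z"
    if "Im z > 0" for z using Hf_succ[of 0 0 z T c] that m2 by simp
   show "isCont (Hf T c 0 (Suc 0)) (cx x)" if "x : Dl (Suc 0)" for x
    using m2 that by (intro Hf_isCont) auto
  qed (use False m2 in auto)
  from Hf_next_zeros[OF _ _ this] m2 obtain X where "finite X" "X <= Dl (Suc 0)" "card X = n - degree T - 1"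
   "ALL r:X. Hf T c 0 (Suc 0) (cx r) = 0" by auto
  thus ?thesis by (intro exI[of _ X]) auto
 qed
 then obtain X where X: "finite X" "X <= Dl 1" "ALL r:X. Hf T c 0 1 (cx r) = 0" "n - degree T <= card X + 1"
  by blast
 show ?thesis by (intro exI[of _ c] exI[of _ X] conjI allI impI c X) (simp add: H0 c2)
qed

lemma Hf_telescope:
 assumes "j <= k" "k < m" "Im z ~= 0"
 shows "Hf S c j k z = Hf S c j j z + pc S z * (SUM i=Suc j..k. (-1) ^ (i - j) * th j i z * B i z)"
 using assms(1,2)
proof (induction k rule: dec_induct)
 case (step k)
 have "Hf S c j (Suc k) z = Hf S c j k z - pc S z * cauchy (nik sg (Suc k) (Suc j)) z * Fc j k z"
  using step assms by (intro Hf_succ) auto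
 moreover have "Hf S c j k z = Hf S c j j z + pc S z * (SUM i=Suc j..k. (-1) ^ (i - j) * th j i z * B i z)"
  using step by simp
 moreover have "cauchy (nik sg (Suc k) (Suc j)) z * Fc j k z = - ((-1) ^ (Suc k - j) * th j (Suc k) z * B (Suc k) z)"
  using step.hyps by (simp add: Fc_def th_def Suc_diff_le)
 ultimately show ?case using step.hyps by (simp add: algebra_simps)
qed simp

text \<open>Interchanging the sums leaves in front of each \<open>a k\<close> the expression in
  \<open>inversion_identity\<close>, which vanishes for \<open>k > j\<close>. The forms thereby give
  back the polynomial \<open>a j\<close> itself.\<close>

lemma inversion_sum:
 assumes "j <= m" "Im z ~= 0"
 shows "(SUM i=j..m. (-1) ^ (i - j) * th j i z * B i z) = (-1) ^ j * pc (a j) z"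
proof -
 let ?t = "%i k. (-1) ^ (i - j) * th j i z * ((-1) ^ k * pc (a k) z * nh i k z)"
 have "(SUM i=j..m. (-1) ^ (i - j) * th j i z * B i z) = (SUM i=j..m. SUM k=i..m. ?t i k)"
  by (intro sum.cong refl) (simp add: B_eq sum_distrib_left)
 also have "... = (SUM i=j..m. \<Sum>k | k : {j..m} & i <= k. ?t i k)" by (intro sum.cong refl) auto
 also have "... = (SUM k=j..m. \<Sum>i | i : {j..m} & i <= k. ?t i k)"
  by (rule sum.swap_restrict) auto
 also have "... = (SUM k=j..m. SUM i=j..k. ?t i k)" by (intro sum.cong refl) auto
 also have "... = (SUM k=j..m. (-1) ^ k * pc (a k) z * (SUM i=j..k. (-1) ^ (i - j) * th j i z * nh i k z))"
  by (simp add: sum_distrib_left ac_simps)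
 also have "... = (SUM k:{j}. (-1) ^ k * pc (a k) z * (SUM i=j..k. (-1) ^ (i - j) * th j i z * nh i k z))"
 proof (rule sum.mono_neutral_right)
  show "ALL k:{j..m} - {j}. (-1) ^ k * pc (a k) z * (SUM i=j..k. (-1) ^ (i - j) * th j i z * nh i k z) = 0"
   using inversion_identity[of j _ z] assms(2) by auto
 qed (use assms in auto)
 also have "... = (-1) ^ j * pc (a j) z" by (simp add: th_def nh_def)
 finally show ?thesis .
qed

end

lemma cpoly_sum: "cpoly (SUM i:I. f i) = (SUM i:I. cpoly (f i))"
 by (induction I rule: infinite_finite_induct) auto

lemma alternates_scale: "e = 1 | e = -1 ==> alternates (%x. e * g x) S N ==> alternates g S N"
 unfolding alternates_def by auto

section \<open>Interpolation by the inverted system\<close>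

context mlhp_sys
begin

text \<open>On the last level \<open>Fc\<close> is \<open>a m\<close> up to sign, and taking this
  polynomial out of the integral turns the eliminated form into \<open>S a_m\<close> times the
  transform of s_{m,j+1} minus a real polynomial \<open>P\<close>. The third clause describes
  \<open>P\<close> through the forms, which is how \<open>pade_pos\<close> and
  \<open>pade_zero\<close> identify it; the last clause comes from one more elimination
  step.\<close>

lemma pade_common:
 assumes j: "j < m" and S: "S ~= 0" "degree c <= degree S" and X: "finite X" "X <= Dl (m - 1)"
  and zero: "!!r. r : X ==> Hf S c j (m - 1) (cx r) = 0" and l: "loss S c <= card X"
 shows "EX P. (ALL z. z ~: cx ` Dl m -->
    pc (S * a m) z * cn (Suc j) z - pc P z
    = pc (nodal X) z * ctr (nik sg m (Suc j)) (%x. cx (poly (S * a m) x / poly (nodal X) x)) z)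
   & (ALL p. degree p < card X - loss S c -->
    (LINT x|snd (nik sg m (Suc j)). poly p x * (poly (S * a m) x / poly (nodal X) x)) = 0)
   & (ALL z. Im z > 0 --> pc P z = (-1) ^ j * (Hf S c j j z
     + pc S z * (SUM i=Suc j..m. (-1) ^ (i - j) * th j i z * B i z)))
   & (ALL N. Suc N <= card X - loss S c --> alternates (poly P) (Dl m) N)"
proof -
 define k where "k = m - 1"
 have k: "j <= k" "k < m" "Suc k = m" "1 <= k" using j m2 by (auto simp: k_def)
 let ?s = "nik sg (Suc k) (Suc j)"
 have g: "gmeas (Dl (Suc k)) ?s" by (rule gnj[OF k(1,2)])
 \<comment> \<open>The sign of \<open>a m\<close> in the last \<open>Fc\<close>:
   \<open>(-1)^(m - 1 - j)\<close> from the eliminations times \<open>(-1)^m\<close> from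
   \<open>B m\<close>.\<close>
 define ep :: real where "ep = (-1) ^ Suc j"
 have ep: "ep * ep = 1" "ep = 1 | ep = -1" unfolding ep_def by (cases "even j"; simp)+
 have Fce: "Fc j k z = cx ep * pc (a m) z" for z
 proof -
  obtain i where i: "k = j + i" using k(1) le_Suc_ex by blast
  have "(-1 :: complex) ^ i * (-1) ^ Suc (j + i) = (-1) ^ Suc j * ((-1) ^ i * (-1) ^ i)"
   by (simp add: power_add)
  also have "(-1 :: complex) ^ i * (-1) ^ i = 1" by (simp flip: power_add)
  finally have "(-1 :: complex) ^ i * (-1) ^ Suc (j + i) = (-1) ^ Suc j * 1" .
  moreover have m: "m = Suc (j + i)" using k(3) i by simp
  ultimately have e: "(-1 :: complex) ^ i * (-1) ^ m = (-1) ^ Suc j" by (simp only: mult_1_right)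
  have "Fc j k z = ((-1) ^ i * (-1) ^ m) * pc (a m) z" unfolding Fc_def k(3) B_m using i by (simp add: mult.assoc)
  thus ?thesis unfolding e by (simp add: ep_def)
 qed
 have Xd: "X Int Dl (Suc k) = {}" using X(2) disj[of k] k unfolding k_def by auto
 have zero': "!!r. r : X ==> Hf S c j k (cx r) = 0" using zero by (simp add: k_def)
 obtain C where C: "EVT y. norm (Hf S c j k (iv y) / pc (nodal X) (iv y))
   <= C / y ^ (card X - loss S c + 1)" using Hf_decay[OF k(1,2) S(2) X(1) l] by blast
 define Ph where "Ph = (%x. pc S (cx x) * Fc j k (cx x) / cx (poly (nodal X) x))"
 define ph where "ph = (%x. poly (S * a m) x / poly (nodal X) x)"
 have Phph: "Ph x = cx ep * cx (ph x)" for x by (simp add: Ph_def ph_def Fce)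
 note oz = orth_of_zeros[OF g Fc_tame[OF k(2)] X(1) Xd Hf_def zero' C Ph_def]
 have tPh: "tame (Dl (Suc k)) Ph" by (rule oz(1))
 have tph: "tame (Dl (Suc k)) (%x. cx (ph x))"
 proof -
  have "tame (Dl (Suc k)) (%x. cx (poly (S * a m) x) / cx (poly (nodal X) x))"
   by (rule tame_divide_nodal[OF X(1) Xd gmeasD(3)[OF g]]) (rule tame_cpoly_real)
  thus ?thesis by (simp add: ph_def)
 qed
 have t1: "tame (Dl (Suc k)) (%_. 1)" by simp
 obtain d :: "real poly" where d: "!!z. z ~: cx ` Dl (Suc k) ==>
   pc (a m) z * ctr ?s (%_. 1) z - ctr ?s (%x. cx (poly (a m) x) * 1) z = pc d z"
  using ctr_poly_mult_real[OF g t1, of "a m"] by auto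
 define P where "P = S * d + smult ep c"
 have Hk: "cx ep * Hf S c j k z = pc (S * a m) z * cauchy ?s z - pc P z"
  if z: "z ~: cx ` Dl (Suc k)" for z
 proof -
  have "ctr ?s (%x. Fc j k (cx x)) z = cx ep * ctr ?s (%x. cx (poly (a m) x) * 1) z"
   unfolding Fce ctr_cmult[OF g, symmetric] by simp
  also have "ctr ?s (%x. cx (poly (a m) x) * 1) z = pc (a m) z * cauchy ?s z - pc d z"
   using d[OF z] unfolding cauchy_eq_ctr by (simp add: algebra_simps)
  finally have fc: "ctr ?s (%x. Fc j k (cx x)) z = cx ep * (pc (a m) z * cauchy ?s z - pc d z)" .
  have "cx ep * Hf S c j k z = (cx ep * cx ep) * pc S z * (pc (a m) z * cauchy ?s z - pc d z)
    - cx ep * pc c z" unfolding Hf_def fc by (simp add: algebra_simps)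
  also have "cx ep * cx ep = 1" using ep(1) by (simp flip: of_real_mult)
  finally show ?thesis by (simp add: P_def algebra_simps)
 qed
 have A: "pc (S * a m) z * cauchy ?s z - pc P z
    = pc (nodal X) z * ctr ?s (%x. cx (ph x)) z" if z: "z ~: cx ` Dl (Suc k)" for z
 proof -
  have "ctr ?s Ph z = cx ep * ctr ?s (%x. cx (ph x)) z" unfolding ctr_cmult[OF g, symmetric] Phph ..
  moreover have "Hf S c j k z = pc (nodal X) z * ctr ?s Ph z" by (rule oz(2)) (use z in auto)
  ultimately have "cx ep * Hf S c j k z = (cx ep * cx ep) * (pc (nodal X) z * ctr ?s (%x. cx (ph x)) z)"
   by (simp add: algebra_simps)
  also have "cx ep * cx ep = 1" using ep(1) by (simp flip: of_real_mult)
  finally show ?thesis unfolding Hk[OF z] by simp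
 qed
 have Bo: "(LINT x|snd ?s. poly p x * ph x) = 0" if p: "degree p < card X - loss S c" for p
 proof -
  have t: "tame (Dl (Suc k)) (%x. cx (ep * ph x))" using tame_mult[OF tame_const tph] by simp
  have "(LINT x|snd ?s. poly p x * (ep * ph x)) = 0"
  proof (rule real_orth_of_sint[OF g tPh t])
   show "Ph x = cx (ep * ph x)" for x using Phph by simp
   show "sint ?s (%x. pc p (cx x) * Ph x) = 0" by (rule oz(3)) (use p in auto)
  qed
  moreover have "(LINT x|snd ?s. poly p x * (ep * ph x)) = ep * (LINT x|snd ?s. poly p x * ph x)"
   by (subst integral_mult_right_zero[symmetric]) (simp add: ac_simps)
  ultimately show ?thesis using ep(2) by auto
 qed
 \<comment> \<open>At level \<open>m - 1\<close> the next function of the chain is a polynomial,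
   because the transform of s_{m,j+1} cancels. The alternation step therefore yields sign changes of
   \<open>P\<close> itself.\<close>
 have G: "pc (smult (- ep) P) z = Hf S c j k z - pc S z * cauchy ?s z * Fc j k z"
  if "z ~: cx ` Dl (Suc k)" for z
 proof -
  have e1: "cx ep * cx ep = 1" using ep(1) by (simp flip: of_real_mult)
  have "pc P z = pc (S * a m) z * cauchy ?s z - cx ep * Hf S c j k z"
   using Hk[OF that] by (simp add: algebra_simps)
  moreover have "pc (smult (- ep) P) z = - cx ep * pc P z" by simp
  ultimately have "pc (smult (- ep) P) z = (cx ep * cx ep) * Hf S c j k z - cx ep * (pc (S * a m) z * cauchy ?s z)"
   by (simp only:) (simp add: algebra_simps)
  thus ?thesis unfolding e1 Fce by (simp add: ac_simps)
 qed
 have D: "pc P z = (-1) ^ j * (Hf S c j j z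
     + pc S z * (SUM i=Suc j..m. (-1) ^ (i - j) * th j i z * B i z))" if z: "Im z > 0" for z
 proof -
  have zo: "z ~: cx ` Dl (Suc k)" using z by auto
  have "Hf S c j k z = Hf S c j j z + pc S z * (SUM i=Suc j..k. (-1) ^ (i - j) * th j i z * B i z)"
   using Hf_telescope[OF k(1,2)] z by simp
  moreover have "cauchy ?s z * Fc j k z = - ((-1) ^ (Suc k - j) * th j (Suc k) z * B (Suc k) z)"
   using k(1) by (simp add: Fc_def th_def Suc_diff_le)
  ultimately have "pc (smult (- ep) P) z = Hf S c j j z + pc S z * (SUM i=Suc j..Suc k. (-1) ^ (i - j) * th j i z * B i z)"
   unfolding G[OF zo] mult.assoc using k(1) by (simp add: algebra_simps)
  moreover have "pc (smult (- ep) P) z = (-1) ^ j * pc P z" by (simp add: ep_def)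
  moreover have "(-1 :: complex) ^ j * ((-1) ^ j * w) = w" for w by (cases "even j") auto
  ultimately show ?thesis unfolding k(3) by metis
 qed
 have E: "alternates (poly P) (Dl (Suc k)) N" if N: "Suc N <= card X - loss S c" for N
 proof -
  have "alternates (%x. Re (pc (smult (- ep) P) (cx x))) (Dl (Suc k)) N"
  proof (rule Hf_alternation[OF k(1,2) S(1) X(1) Xd zero' C _ _ N])
   show "pc (smult (- ep) P) z = Hf S c j k z - pc S z * cauchy ?s z * Fc j k z" if "Im z > 0" for z
    by (rule G) (use that in auto)
   show "isCont (pc (smult (- ep) P)) (cx x)" for x by (rule poly_isCont)
  qed
  hence "alternates (%x. (- ep) * poly P x) (Dl (Suc k)) N" by simp
  thus ?thesis by (rule alternates_scale[rotated]) (use ep(2) in auto)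
 qed
 show ?thesis using A Bo D E unfolding ph_def k(3) by (intro exI[of _ P] conjI allI impI)
qed

lemma loss_le: "degree S <= degree T ==> loss S c <= degree T + 1" by (simp add: loss_def)

lemma poly_eq_upper_half_plane:
 fixes p q :: "real poly"
 assumes "!!z. Im z > 0 ==> pc p z = pc q z"
 shows "p = q"
proof -
 have "cpoly p - cpoly q = 0" by (rule poly_zero_off_real) (use assms in simp)
 thus ?thesis by (intro cpoly_inj) simp
qed

text \<open>Starting from at least \<open>n - degree T\<close> zeros on \<open>Dl j\<close>, each of
  the \<open>m - 1 - j\<close> eliminations takes one and the final step one more, which leaves
  \<open>n + j - (degree T + m)\<close> sign changes of \<open>a j\<close>.\<close>

lemma pade_pos:
 assumes j: "1 <= j" "j < m" and n: "degree T + m <= n + j"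
 shows "EX X. finite X & X <= Dl (m - 1) & n <= card X + degree T + m &
   (ALL z. z ~: cx ` Dl m -->
    pc (a m) z * cn (Suc j) z - pc (a j) z
    = pc (nodal X) z * ctr (nik sg m (Suc j)) (%x. cx (poly (a m) x / poly (nodal X) x)) z)
   & (ALL p. degree p < card X -->
    (LINT x|snd (nik sg m (Suc j)). poly p x * (poly (a m) x / poly (nodal X) x)) = 0)
   & alternates (poly (a j)) (Dl m) (n + j - (degree T + m))"
proof -
 obtain X0 where X0: "finite X0" "X0 <= Dl j" "!!r. r : X0 ==> Hf 1 0 j j (cx r) = 0" "n - degree T <= card X0"
  using Hf_start_pos(1)[OF j] by blast
 have "j <= m - 1" "m - 1 < m" using j by auto
 from Hf_chain[OF order_refl j(1) this _ _ X0(1-3)] obtain X where X: "finite X" "X <= Dl (m - 1)"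
  "!!r. r : X ==> Hf 1 0 j (m - 1) (cx r) = 0" "card X0 <= card X + (m - 1 - j) * (loss 1 0 + 1)"
  by auto
 have l: "loss 1 0 = 0" by (simp add: loss_def)
 have cX: "n - degree T <= card X + (m - 1 - j)" using X(4) X0(4) l by simp
 from pade_common[OF j(2) _ _ X(1-3), unfolded l] obtain P where
  P1: "ALL z. z ~: cx ` Dl m -->
    pc (1 * a m) z * cn (Suc j) z - pc P z
    = pc (nodal X) z * ctr (nik sg m (Suc j)) (%x. cx (poly (1 * a m) x / poly (nodal X) x)) z"
  and P2: "ALL p. degree p < card X - 0 -->
    (LINT x|snd (nik sg m (Suc j)). poly p x * (poly (1 * a m) x / poly (nodal X) x)) = 0"
  and P3: "!!z. Im z > 0 ==> pc P z = (-1) ^ j * (Hf 1 0 j j z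
     + pc 1 z * (SUM i=Suc j..m. (-1) ^ (i - j) * th j i z * B i z))"
  and P4: "ALL N. Suc N <= card X - 0 --> alternates (poly P) (Dl m) N" by fastforce
 have "P = a j"
 proof (rule poly_eq_upper_half_plane)
  fix z :: complex assume z: "Im z > 0"
  hence zo: "z ~: cx ` Dl (Suc j)" by auto
  have "(SUM i=j..m. (-1) ^ (i - j) * th j i z * B i z) = B j z + (SUM i=Suc j..m. (-1) ^ (i - j) * th j i z * B i z)"
   using j by (simp add: sum.atLeast_Suc_atMost th_def)
  hence "pc P z = (-1) ^ j * ((-1) ^ j * pc (a j) z)"
   using P3[OF z] Hf_start_pos(2)[OF j zo] inversion_sum[of j z] j z by simp
  thus "pc P z = pc (a j) z" by (cases "even j") auto
 qed
 moreover have "alternates (poly P) (Dl m) (n + j - (degree T + m))"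
  by (rule P4[rule_format]) (use cX n j nD in linarith)
 moreover have "n <= card X + degree T + m" using cX nD by linarith
 ultimately show ?thesis using X(1,2) P1 P2 by (intro exI[of _ X]) simp
qed

lemma pade_zero:
 assumes n: "2 * degree T + m * (degree T + 2) + 1 <= n"
 shows "EX X. finite X & X <= Dl (m - 1) & n <= card X + degree T + m * (degree T + 2) &
   (ALL z. z ~: cx ` Dl m -->
    pc (T * a m) z * cn 1 z
     - pc (T * a 0 + (SUM k=1..m. smult ((-1) ^ k) (a k * tr k))) z
    = pc (nodal X) z * ctr (nik sg m 1) (%x. cx (poly (T * a m) x / poly (nodal X) x)) z)
   & (ALL p. degree p < card X - (degree T + 1) -->
    (LINT x|snd (nik sg m 1). poly p x * (poly (T * a m) x / poly (nodal X) x)) = 0)"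
proof -
 obtain c X0 where c: "degree c <= degree T" and X0: "finite X0" "X0 <= Dl 1" "!!r. r : X0 ==> Hf T c 0 1 (cx r) = 0"
   "n - degree T <= card X0 + 1"
  and H0: "!!z. z ~: cx ` Dl 1 ==> pc T z ~= 0 ==> Hf T c 0 0 z = pc T z * form_zero m sg v t a z"
  using Hf_start_zero by blast
 have "1 <= m - 1" "m - 1 < m" using m2 by auto
 from Hf_chain[OF _ order_refl this T0 c X0(1-3)] obtain X where X: "finite X" "X <= Dl (m - 1)"
  "!!r. r : X ==> Hf T c 0 (m - 1) (cx r) = 0" "card X0 <= card X + (m - 1 - 1) * (loss T c + 1)"
  by auto
 have lo: "loss T c <= degree T + 1" by (rule loss_le) simp
 have "(m - 1 - 1) * (loss T c + 1) <= (m - 1) * (degree T + 2)" using lo by (intro mult_mono) auto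
 hence "n - degree T <= card X + (m - 1) * (degree T + 2) + 1" using X(4) X0(4) by linarith
 moreover have "m * (degree T + 2) = (m - 1) * (degree T + 2) + (degree T + 2)" using m2 by (cases m) auto
 ultimately have cX: "n <= card X + degree T + m * (degree T + 2)" "degree T + 1 <= card X"
  using n nD by linarith+
 have lc: "loss T c <= card X" using lo cX(2) by linarith
 have m0: "0 < m" using m2 by simp
 from pade_common[OF m0 T0 c X(1-3) lc] obtain P where
  P1: "ALL z. z ~: cx ` Dl m -->
    pc (T * a m) z * cn (Suc 0) z - pc P z
    = pc (nodal X) z * ctr (nik sg m (Suc 0)) (%x. cx (poly (T * a m) x / poly (nodal X) x)) z"
  and P2: "ALL p. degree p < card X - loss T c -->
    (LINT x|snd (nik sg m (Suc 0)). poly p x * (poly (T * a m) x / poly (nodal X) x)) = 0"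
  and P3: "!!z. Im z > 0 ==> pc P z = (-1) ^ 0 * (Hf T c 0 0 z
     + pc T z * (SUM i=Suc 0..m. (-1) ^ (i - 0) * th 0 i z * B i z))" by blast
 let ?P = "T * a 0 + (SUM k=1..m. smult ((-1) ^ k) (a k * tr k))"
 \<comment> \<open>The rational functions become polynomials after multiplication by
   \<open>T\<close> only away from the zeros of \<open>T\<close>. The further factor
   \<open>T\<close> makes the identity trivial at these zeros and is cancelled afterwards.\<close>
 have eqT: "pc T z * pc P z = pc T z * pc ?P z" if z: "Im z > 0" for z
 proof (cases "pc T z = 0")
  case False
  have zo: "z ~: cx ` Dl 1" using z by auto
  have sumP: "pc (SUM k=1..m. smult ((-1) ^ k) (a k * tr k)) z = (SUM k=1..m. (-1) ^ k * pc (a k) z * pc (tr k) z)"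
   unfolding cpoly_sum poly_sum by (simp add: mult.assoc)
  have "(SUM i=0..m. (-1) ^ (i - 0) * th 0 i z * B i z) = B 0 z + (SUM i=Suc 0..m. (-1) ^ (i - 0) * th 0 i z * B i z)"
   by (simp add: sum.atLeast_Suc_atMost th_def)
  hence s: "B 0 z + (SUM i=Suc 0..m. (-1) ^ (i - 0) * th 0 i z * B i z) = pc (a 0) z"
   using inversion_sum[of 0 z] z by simp
  have r: "pc T z * (SUM k=1..m. (-1) ^ k * pc (a k) z * ratfun (v k) (t k) z)
    = (SUM k=1..m. (-1) ^ k * pc (a k) z * pc (tr k) z)" unfolding sum_distrib_left
  proof (rule sum.cong[OF refl])
   fix k assume "k : {1..m}"
   hence "pc T z * ratfun (v k) (t k) z = pc (tr k) z" using False by (intro T_ratfun) auto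
   thus "pc T z * ((-1) ^ k * pc (a k) z * ratfun (v k) (t k) z)
     = (-1) ^ k * pc (a k) z * pc (tr k) z" by (simp only: mult.left_commute[of "pc T z"])
  qed
  have "pc P z = pc T z * form_zero m sg v t a z + pc T z * (SUM i=Suc 0..m. (-1) ^ (i - 0) * th 0 i z * B i z)"
   using P3[OF z] H0[OF zo False] by simp
  also have "... = pc T z * (B 0 z + (SUM i=Suc 0..m. (-1) ^ (i - 0) * th 0 i z * B i z))
    + pc T z * (SUM k=1..m. (-1) ^ k * pc (a k) z * ratfun (v k) (t k) z)"
   unfolding form_zero_split by (simp add: algebra_simps)
  also have "... = pc ?P z" unfolding s r sumP[symmetric] by simp
  finally show ?thesis by simp
 qed simp
 have "T * P = T * ?P" by (rule poly_eq_upper_half_plane) (use eqT in simp)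
 hence "P = ?P" using T0 by simp
 thus ?thesis using X(1,2) cX(1) P1 P2 lo by (intro exI[of _ X]) auto
qed

end

section \<open>Quasi-analyticity and matching moments\<close>

lemma sum_inverse_fact_le_e: "(SUM j<J. 1 / fact j) <= exp (1::real)"
proof -
 have "(%j. 1 ^ j /\<^sub>R fact j :: real) sums exp 1" by (rule exp_converges)
 hence "(%j. 1 / fact j :: real) sums exp 1" by (simp add: divide_inverse)
 hence s: "summable (%j. 1 / fact j :: real)" "(\<Sum>j. 1 / fact j) = exp (1::real)"
  by (simp_all add: sums_iff)
 have "(SUM j<J. 1 / fact j :: real) <= (\<Sum>j. 1 / fact j)" by (rule sum_le_suminf[OF s(1)]) auto
 thus ?thesis unfolding s(2) .
qed

definition bratio :: "(nat => real) => nat => real" where "bratio M k = M (k - 1) / M k"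

text \<open>Bang's proof of the Denjoy--Carleman theorem: starting from a point where all derivatives of order
  below \<open>N\<close> vanish, the order up to which the derivatives are small drops by one on each
 interval of length \<open>M (k - 1) / (e M k)\<close>.\<close>

context
 fixes f :: "nat => real => real" and M :: "nat => real" and N :: nat
 assumes der: "!!k x. (f k has_real_derivative f (Suc k) x) (at x)"
  and bnd: "!!k x. k <= N ==> abs (f k x) <= M k" and zero: "!!k. k < N ==> f k 0 = 0"
  and Mpos: "!!k. M k > 0" and conv: "!!k. M (Suc k) * M (Suc k) <= M k * M (Suc (Suc k))"
begin

lemma bratio_pos: "bratio M k > 0" using Mpos by (simp add: bratio_def)

lemma bratio_antimono:
 assumes "1 <= i" "i <= j" shows "bratio M j <= bratio M i" using assms(2,1)
proof (induction j rule: dec_induct)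
 case (step j)
 then obtain i' where j: "j = Suc i'" by (cases j) auto
 have "bratio M (Suc j) <= bratio M j"
  using conv[of i'] Mpos by (simp add: bratio_def j divide_simps mult.commute)
 thus ?case using step by linarith
qed simp

lemma M_growth: "n + j <= q ==> M (n + j) <= M n / bratio M q ^ j"
proof (induction j)
 case (Suc j)
 have "M (n + Suc j) = M (n + j) / bratio M (n + Suc j)" using Mpos by (simp add: bratio_def less_imp_neq[symmetric])
 also have "... <= M (n + j) / bratio M q"
  using bratio_antimono[of "n + Suc j" q] Suc.prems bratio_pos Mpos by (intro divide_left_mono) (auto simp: less_imp_le)
 also have "... <= (M n / bratio M q ^ j) / bratio M q" using Suc bratio_pos by (intro divide_right_mono) (auto simp: less_imp_le)
 finally show ?case by (simp add: mult.commute)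
qed simp

text \<open>Taylor expansion at \<open>x\<close> with remainder of order \<open>q\<close>. By
  \<open>M_growth\<close> and the choice of \<open>h\<close> the \<open>j\<close>-th term is at most
  \<open>exp (n - q) * M n / fact j\<close>. The inverse factorials sum to at most \<open>e\<close>,
  which is exactly the factor by which the bound for \<open>q - 1\<close> exceeds that for
  \<open>q\<close>.\<close>

lemma bang_step:
 assumes q: "1 <= q" "q <= N" and S: "!!n. n <= q ==> abs (f n x) <= exp (real n - real q) * M n"
  and h: "0 <= h" "h <= bratio M q / exp 1" and n: "n <= q - 1"
 shows "abs (f n (x + h)) <= exp (real n - real (q - 1)) * M n"
proof (cases "h = 0")
 case True
 have "exp (real n - real q) <= exp (real n - real (q - 1))" using q by simp
 hence "exp (real n - real q) * M n <= exp (real n - real (q - 1)) * M n"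
  using Mpos[of n] by (intro mult_right_mono) auto
 moreover have "abs (f n x) <= exp (real n - real q) * M n" using n by (intro S) simp
 ultimately show ?thesis using True by simp
next
 case False
 hence h0: "h > 0" using h by simp
 define J where "J = q - n"
 have J: "J > 0" "n + J = q" using n q by (auto simp: J_def)
 define E where "E = exp (real n - real q) * M n"
 have E: "E > 0" using Mpos by (simp add: E_def)
 have eh: "exp 1 * h / bratio M q <= 1" "0 <= exp 1 * h / bratio M q"
  using h bratio_pos[of q] by (auto simp: field_simps)
 have "EX t. f n (x + h) = (SUM j<J. (f (n + j) x / fact j) * (x + h - x) ^ j) + (f (n + J) t / fact J) * (x + h - x) ^ J"
  using Taylor_up[of J "%j. f (n + j)" "f n" x "x + h" x] J(1) h0 der by (auto intro: exI)
 then obtain t where t: "f n (x + h) = (SUM j<J. (f (n + j) x / fact j) * (x + h - x) ^ j) + (f (n + J) t / fact J) * (x + h - x) ^ J" ..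
 have tm: "exp (real (n + j) - real q) * M (n + j) / fact j * h ^ j <= E / fact j" if "j <= J" for j
 proof -
  have "exp (real (n + j) - real q) = exp (real n - real q) * exp 1 ^ j"
   by (simp add: exp_add[symmetric] exp_of_nat_mult[symmetric] algebra_simps)
  moreover have "M (n + j) <= M n / bratio M q ^ j" using that J by (intro M_growth) auto
  ultimately have "exp (real (n + j) - real q) * M (n + j) / fact j * h ^ j
    <= exp (real n - real q) * exp 1 ^ j * (M n / bratio M q ^ j) / fact j * h ^ j"
   using h Mpos[of "n + j"] by (intro mult_right_mono divide_right_mono mult_mono) auto
  also have "... = E / fact j * (exp 1 * h / bratio M q) ^ j"
   by (simp add: E_def power_mult_distrib power_divide ac_simps)
  also have "... <= E / fact j * 1" using eh E by (intro mult_left_mono power_le_one) auto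
  finally show ?thesis by simp
 qed
 have "abs (f n (x + h)) <= (SUM j<J. abs (f (n + j) x) / fact j * h ^ j) + abs (f (n + J) t) / fact J * h ^ J"
  unfolding t using h0
  by (intro order_trans[OF abs_triangle_ineq] add_mono order_trans[OF sum_abs]) (auto simp: abs_mult power_abs)
 also have "(SUM j<J. abs (f (n + j) x) / fact j * h ^ j) <= (SUM j<J. E / fact j)"
 proof (rule sum_mono)
  fix j assume j: "j : {..<J}"
  have "abs (f (n + j) x) / fact j * h ^ j <= exp (real (n + j) - real q) * M (n + j) / fact j * h ^ j"
   using S[of "n + j"] j J h by (intro mult_right_mono divide_right_mono) auto
  also have "... <= E / fact j" using tm[of j] j by simp
  finally show "abs (f (n + j) x) / fact j * h ^ j <= E / fact j" .
 qed
 also have "abs (f (n + J) t) / fact J * h ^ J <= E / fact J"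
 proof -
  have "abs (f (n + J) t) / fact J * h ^ J <= exp (real (n + J) - real q) * M (n + J) / fact J * h ^ J"
   using bnd[of "n + J" t] J q h by (intro mult_right_mono divide_right_mono) auto
  also have "... <= E / fact J" using tm[of J] J by simp
  finally show ?thesis .
 qed
 also have "(SUM j<J. E / fact j) + E / fact J = E * (SUM j<Suc J. 1 / fact j)"
  by (simp add: sum_distrib_left distrib_left)
 also have "... <= E * exp 1" using E by (intro mult_left_mono sum_inverse_fact_le_e) auto
 also have "... = exp (real n - real (q - 1)) * M n"
 proof -
  have "exp (real n - real q) * exp 1 = exp (real n - real (q - 1))"
   using q by (simp add: exp_add[symmetric] of_nat_diff)
  thus ?thesis by (simp add: E_def ac_simps)
 qed
 finally show ?thesis by simp
qed

lemma bang:
 assumes "k0 <= N" "0 <= x" "x <= (SUM k:{k0<..N}. bratio M k) / exp 1" "n <= k0"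
 shows "abs (f n x) <= exp (real n - real k0) * M n" using assms
proof (induction k0 arbitrary: x n rule: inc_induct)
 case base
 hence "x = 0" by simp
 thus ?case using zero[of n] bnd[of N 0] base Mpos[of n] by (cases "n = N") (auto simp: less_imp_le)
next
 case (step k)
 let ?s = "(SUM k:{Suc k<..N}. bratio M k) / exp 1"
 have "{k<..N} = insert (Suc k) {Suc k<..N}" using step.hyps by auto
 hence sum: "(SUM k:{k<..N}. bratio M k) / exp 1 = bratio M (Suc k) / exp 1 + ?s"
  by (simp add: add_divide_distrib)
 have s0: "0 <= ?s" using bratio_pos by (auto intro!: divide_nonneg_pos sum_nonneg simp: less_imp_le)
 \<comment> \<open>The point at which the induction hypothesis is used: as close to \<open>x\<close>
   as its range \<open>?s\<close> permits, so that the remaining step fits into one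
   interval.\<close>
 define y where "y = min x ?s"
 have y: "0 <= y" "y <= ?s" using step.prems s0 by (auto simp: y_def)
 have S: "abs (f n y) <= exp (real n - real (Suc k)) * M n" if "n <= Suc k" for n
  by (rule step.IH[OF y that])
 have h: "0 <= x - y" "x - y <= bratio M (Suc k) / exp 1"
  using step.prems(2) sum bratio_pos[of "Suc k"] by (auto simp: y_def min_def divide_nonneg_pos less_imp_le)
 have "abs (f n (y + (x - y))) <= exp (real n - real (Suc k - 1)) * M n"
  by (rule bang_step[OF _ _ S h]) (use step in auto)
 thus ?case by simp
qed

end

text \<open>A bound on the second derivative makes the error of the difference quotient at most
  \<open>abs (t - s)\<close> times the integral of \<open>b\<close>, so a direct estimate replaces a
  limit theorem.\<close>

lemma has_real_derivative_integral:
 fixes g g' g'' :: "real => 'a => real"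
 assumes d1: "!!s x. ((%s. g s x) has_real_derivative g' s x) (at s)"
  and d2: "!!s x. ((%s. g' s x) has_real_derivative g'' s x) (at s)"
  and b: "!!s x. abs (g'' s x) <= b x"
  and i: "!!s. integrable M (g s)" "!!s. integrable M (g' s)" "integrable M b"
 shows "((%s. \<integral>x. g s x \<partial>M) has_real_derivative (LINT x|M. g' s x)) (at s)"
proof -
 have sq: "(t - s)^2 = abs (t - s) * abs (t - s)" for t by (simp add: power2_eq_square)
 have pt: "abs (g t x - g s x - (t - s) * g' s x) <= (t - s)^2 * b x" for t x
 proof -
  have "EX \<xi>. abs (\<xi> - s) <= abs (t - s) & g t x - g s x = (t - s) * g' \<xi> x"
  proof (cases "t = s")
   case False
   then consider "s < t" | "t < s" by linarith
   thus ?thesis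
   proof cases
    case 1
    from MVT2[OF 1, of "%s. g s x" "%s. g' s x"] d1 obtain z where "s < z" "z < t" "g t x - g s x = (t - s) * g' z x" by blast
    thus ?thesis by (intro exI[of _ z]) auto
   next
    case 2
    from MVT2[OF 2, of "%s. g s x" "%s. g' s x"] d1 obtain z where z: "t < z" "z < s" "g s x - g t x = (s - t) * g' z x" by blast
    hence "g t x - g s x = (t - s) * g' z x" by (simp add: algebra_simps)
    thus ?thesis using z by (intro exI[of _ z]) auto
   qed
  qed auto
  then obtain \<xi> where \<xi>: "abs (\<xi> - s) <= abs (t - s)" "g t x - g s x = (t - s) * g' \<xi> x" by blast
  have "norm (g' \<xi> x - g' s x) <= b x * norm (\<xi> - s)"
   by (rule field_differentiable_bound[of UNIV _ "%s. g'' s x"]) (use d2 b in auto)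
  hence "abs (g' \<xi> x - g' s x) <= b x * abs (\<xi> - s)" by simp
  also have "... <= b x * abs (t - s)" using \<xi>(1) b[of s x] by (intro mult_left_mono) auto
  finally have "abs (t - s) * abs (g' \<xi> x - g' s x) <= abs (t - s) * (b x * abs (t - s))" by (intro mult_left_mono) auto
  hence "abs ((t - s) * (g' \<xi> x - g' s x)) <= (t - s)^2 * b x"
   unfolding abs_mult sq by (simp only: ac_simps)
  thus ?thesis using \<xi>(2) by (simp add: algebra_simps)
 qed
 let ?D = "\<integral>x. g' s x \<partial>M" and ?B = "\<integral>x. b x \<partial>M"
 have main: "abs ((LINT x|M. g t x) - (LINT x|M. g s x) - (t - s) * ?D) <= (t - s)^2 * ?B" for t
 proof -
  have "(LINT x|M. g t x) - (LINT x|M. g s x) - (t - s) * ?D = (LINT x|M. g t x - g s x - (t - s) * g' s x)"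
   using i by simp
  also have "abs (...) <= (LINT x|M. abs (g t x - g s x - (t - s) * g' s x))"
   by (rule integral_abs_bound)
  also have "... <= (LINT x|M. (t - s)^2 * b x)"
   using i pt by (intro integral_mono integrable_abs) auto
  finally show ?thesis by simp
 qed
 have key: "abs (((LINT x|M. g t x) - (LINT x|M. g s x)) / (t - s) - ?D) <= abs (t - s) * ?B" if "t ~= s" for t
 proof -
  have "abs (((LINT x|M. g t x) - (LINT x|M. g s x)) / (t - s) - ?D) = abs ((LINT x|M. g t x) - (LINT x|M. g s x) - (t - s) * ?D) / abs (t - s)"
   using that by (simp add: abs_divide[symmetric] diff_divide_distrib)
  also have "... <= (t - s)^2 * ?B / abs (t - s)" by (intro divide_right_mono) (simp_all add: main)
  also have "... = abs (t - s) * ?B" using that unfolding sq by (simp del: abs_mult_self_eq abs_mult_self)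
  finally show ?thesis .
 qed
 have "((%t. ((LINT x|M. g t x) - (LINT x|M. g s x)) / (t - s) - ?D) ---> 0) (at s)"
 proof (rule Lim_null_comparison)
  show "\<forall>\<^sub>F t in at s. norm (((LINT x|M. g t x) - (LINT x|M. g s x)) / (t - s) - ?D) <= abs (t - s) * ?B"
   using eventually_neq_at_within[of s] by eventually_elim (use key in simp)
  have "((%t. abs (t - s) * ?B) ---> (abs (s - s)) * ?B) (at s)" by (intro tendsto_intros)
  thus "((%t. abs (t - s) * ?B) ---> 0) (at s)" by simp
 qed
 thus ?thesis unfolding has_field_derivative_iff by (subst Lim_null)
qed

lemma carleman_inequality:
 fixes r :: "nat => real"
 assumes r: "!!i. r i > 0"
 shows "(SUM n=1..N. (\<Prod>i<n. r i) powr (1 / real n)) <= exp 1 * (SUM i<N. r i)"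
proof -
 \<comment> \<open>The classical weights: their partial products are \<open>(n + 1)^n\<close>, so
   the geometric mean gains the factor \<open>n + 1\<close>. After the interchange of sums
   \<open>1 / (n (n + 1))\<close> telescopes, and
   \<open>c i / (i + 1) = (1 + 1 / (i + 1))^(i + 1)\<close> is at most \<open>e\<close>.\<close>
 define c where "c i = real (i + 2) ^ (i + 1) / real (i + 1) ^ i" for i
 have c: "c i > 0" for i by (simp add: c_def)
 have prodc: "(\<Prod>i<n. c i) = real (n + 1) ^ n" for n
 proof (induction n)
  case (Suc n)
  have "(\<Prod>i<Suc n. c i) = real (n + 1) ^ n * c n" using Suc by simp
  also have "... = real (n + 2) ^ (n + 1)" by (simp add: c_def)
  finally show ?case by simp
 qed simp
 have gm: "(\<Prod>i<n. r i) powr (1 / real n) <= (SUM i<n. c i * r i) / (real n * real (n + 1))" if n: "n >= 1" for n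
 proof -
  have "(\<Prod>i<n. c i * r i) powr (1 / real (card {..<n})) <= (SUM i<n. c i * r i / real (card {..<n}))"
   using c r n by (intro arith_geom_mean) (auto simp: less_imp_le lessThan_empty_iff)
  moreover have "(\<Prod>i<n. c i * r i) = real (n + 1) ^ n * (\<Prod>i<n. r i)"
   by (simp add: prod.distrib prodc)
  moreover have "(real (n + 1) ^ n * (\<Prod>i<n. r i)) powr (1 / real n) = real (n + 1) * (\<Prod>i<n. r i) powr (1 / real n)"
  proof -
   have "(real (n + 1) ^ n) powr (1 / real n) = real (n + 1) powr (real n * (1 / real n))"
    by (simp only: powr_powr powr_realpow[symmetric] of_nat_0_less_iff zero_less_Suc add_Suc_right Suc_eq_plus1[symmetric])
   also have "... = real (n + 1)" using n by simp
   finally have "(real (n + 1) ^ n) powr (1 / real n) = real (n + 1)" .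
   thus ?thesis using r by (subst powr_mult) (auto intro!: prod_nonneg simp: less_imp_le)
  qed
  ultimately have *: "real (n + 1) * (\<Prod>i<n. r i) powr (1 / real n) <= (SUM i<n. c i * r i) / real n"
   by (simp only: sum_divide_distrib card_lessThan)
  have "(\<Prod>i<n. r i) powr (1 / real n) = real (n + 1) * (\<Prod>i<n. r i) powr (1 / real n) / real (n + 1)" by simp
  also have "... <= (SUM i<n. c i * r i) / real n / real (n + 1)" using * by (intro divide_right_mono) auto
  finally show ?thesis by simp
 qed
 have "(SUM n=1..N. (\<Prod>i<n. r i) powr (1 / real n)) <= (SUM n=1..N. SUM i<n. c i * r i / (real n * real (n + 1)))"
  using gm by (intro sum_mono) (auto simp: sum_divide_distrib)
 also have "... = (SUM n=1..N. \<Sum>i | i : {..<N} & i < n. c i * r i / (real n * real (n + 1)))"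
  by (intro sum.cong refl) auto
 also have "... = (SUM i<N. \<Sum>n | n : {1..N} & i < n. c i * r i / (real n * real (n + 1)))"
  by (rule sum.swap_restrict) auto
 also have "... <= (SUM i<N. exp 1 * r i)"
 proof (rule sum_mono)
  fix i assume "i : {..<N}"
  hence i: "i < N" by simp
  have tele: "(SUM n:{i<..K}. 1 / (real n * real (n + 1))) = 1 / real (i + 1) - 1 / real (K + 1)" if "i <= K" for K
   using that
  proof (induction K rule: dec_induct)
   case (step K)
   have "{i<..Suc K} = insert (Suc K) {i<..K}" using step by auto
   hence "(SUM n:{i<..Suc K}. 1 / (real n * real (n + 1)))
     = 1 / (real (Suc K) * real (Suc K + 1)) + (1 / real (i + 1) - 1 / real (K + 1))"
    using step by simp
   also have "1 / (real (Suc K) * real (Suc K + 1)) = 1 / real (K + 1) - 1 / real (Suc K + 1)"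
    by (simp add: diff_frac_eq)
   also have "1 / real (K + 1) - 1 / real (Suc K + 1) + (1 / real (i + 1) - 1 / real (K + 1)) = 1 / real (i + 1) - 1 / real (Suc K + 1)"
    by linarith
   finally show ?case .
  qed simp
  have "{n : {1..N}. i < n} = {i<..N}" by auto
  hence "(\<Sum>n | n : {1..N} & i < n. c i * r i / (real n * real (n + 1))) = c i * r i * (SUM n:{i<..N}. 1 / (real n * real (n + 1)))"
   by (simp add: sum_distrib_left)
  also have "... <= c i * r i * (1 / real (i + 1))"
   using tele[of N] i c[of i] r[of i] by (intro mult_left_mono) auto
  also have "c i * r i * (1 / real (i + 1)) = (1 + 1 / real (i + 1)) ^ (i + 1) * r i"
  proof -
   have "(1 + 1 / real (i + 1)) = real (i + 2) / real (i + 1)" by (simp add: field_simps)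
   thus ?thesis by (simp add: c_def power_divide)
  qed
  also have "... <= exp 1 * r i"
  proof (intro mult_right_mono)
   have "(1 + 1 / real (i + 1)) ^ (i + 1) <= exp (1 / real (i + 1)) ^ (i + 1)"
    by (intro power_mono) (auto simp: exp_ge_add_one_self)
   also have "... = exp (real (i + 1) * (1 / real (i + 1)))" by (rule exp_of_nat_mult[symmetric])
   also have "... = exp 1" by simp
   finally show "(1 + 1 / real (i + 1)) ^ (i + 1) <= exp 1" .
  qed (use r[of i] in auto)
  finally show "(\<Sum>n | n : {1..N} & i < n. c i * r i / (real n * real (n + 1))) <= exp 1 * r i" .
 qed
 finally show ?thesis by (simp add: sum_distrib_left)
qed

text \<open>Two positive measures, one with density \<open>g\<close> and one with masses
  \<open>wt\<close> on \<open>Y\<close>, both carried to the half-line by \<open>rh\<close>. Below,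
  \<open>I\<close> integrates against their difference and \<open>J\<close> gives the moments of
  their sum. In the application \<open>rh^2\<close> is affine in \<open>x\<close>, so the even
  moments in \<open>rh\<close> are polynomial moments in \<open>x\<close>.\<close>

locale transform_pair =
 fixes M :: "real measure" and g rh :: "real => real" and Y :: "real set" and wt :: "real => real"
 assumes g0: "!!x. g x >= 0" and rh0: "!!x. rh x >= 0" and wt0: "!!y. y : Y ==> wt y >= 0"
  and fin: "finite Y" and meas: "g : borel_measurable M" "rh : borel_measurable M"
  and integ: "!!k::nat. integrable M (%x. g x * rh x ^ k)"
begin

definition I :: "(real => real) => real" where
 "I F = (LINT x|M. g x * F (rh x)) - (SUM y:Y. wt y * F (rh y))"

definition J :: "nat => real" where
 "J k = (LINT x|M. g x * rh x ^ k) + (SUM y:Y. wt y * rh y ^ k)"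

lemma integrable_growth:
 assumes "F : bm" and b: "!!r. r >= 0 ==> abs (F r) <= C * r ^ k"
 shows "integrable M (%x. g x * F (rh x))"
proof (rule Bochner_Integration.integrable_bound)
 show "integrable M (%x. C * (g x * rh x ^ k))" using integ by simp
 have "norm (g x * F (rh x)) <= norm (C * (g x * rh x ^ k))" for x
 proof -
  have "abs (F (rh x)) <= C * rh x ^ k" using b rh0 by simp
  hence "g x * abs (F (rh x)) <= g x * (C * rh x ^ k)" using g0 by (intro mult_left_mono) auto
  also have "... = C * (g x * rh x ^ k)" by simp
  also have "... <= abs (C * (g x * rh x ^ k))" by simp
  finally show ?thesis using g0[of x] by (simp add: abs_mult)
 qed
 thus "AE x in M. norm (g x * F (rh x)) <= norm (C * (g x * rh x ^ k))" by simp
next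
 show "(%x. g x * F (rh x)) : borel_measurable M"
  by (intro borel_measurable_times meas measurable_compose[OF meas(2) assms(1)])
qed

lemma I_bound:
 assumes "F : bm" and b: "!!r. r >= 0 ==> abs (F r) <= C * r ^ k"
 shows "abs (I F) <= C * J k"
proof -
 have 1: "abs (\<integral>x. g x * F (rh x) \<partial>M) <= (LINT x|M. C * (g x * rh x ^ k))"
 proof (rule order_trans[OF integral_abs_bound], rule integral_mono)
  show "integrable M (%x. abs (g x * F (rh x)))" using integrable_growth[OF assms] by (rule integrable_abs)
  show "integrable M (%x. C * (g x * rh x ^ k))" using integ by simp
  fix x
  have "g x * abs (F (rh x)) <= g x * (C * rh x ^ k)" using g0 b rh0 by (intro mult_left_mono) auto
  thus "abs (g x * F (rh x)) <= C * (g x * rh x ^ k)" using g0[of x] by (simp add: abs_mult mult.left_commute)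
 qed
 have 2: "abs (SUM y:Y. wt y * F (rh y)) <= (SUM y:Y. C * (wt y * rh y ^ k))"
 proof (rule order_trans[OF sum_abs], rule sum_mono)
  fix y assume y: "y : Y"
  have "wt y * abs (F (rh y)) <= wt y * (C * rh y ^ k)" using wt0[OF y] b rh0 by (intro mult_left_mono) auto
  thus "abs (wt y * F (rh y)) <= C * (wt y * rh y ^ k)" using wt0[OF y] by (simp add: abs_mult mult.left_commute)
 qed
 have "abs (I F) <= abs (\<integral>x. g x * F (rh x) \<partial>M) + abs (SUM y:Y. wt y * F (rh y))"
  unfolding I_def by (rule abs_triangle_ineq4)
 thus ?thesis using 1 2 by (simp add: J_def distrib_left sum_distrib_left)
qed

lemma I_add:
 assumes "F : bm" "!!r. r >= 0 ==> abs (F r) <= C * r ^ k"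
  "G : bm" "!!r. r >= 0 ==> abs (G r) <= C' * r ^ k'"
 shows "I (%r. F r + G r) = I F + I G"
 using integrable_growth[OF assms(1,2)] integrable_growth[OF assms(3,4)]
 by (simp add: I_def distrib_left sum.distrib)

lemma I_cmult: "I (%r. c * F r) = c * I F"
 by (simp add: I_def sum_distrib_left right_diff_distrib mult.left_commute[of _ c])

lemma I_derivative:
 assumes d: "!!s r. ((%s. F s r) has_real_derivative F' s r) (at s)" "!!s r. ((%s. F' s r) has_real_derivative F'' s r) (at s)"
  and m: "!!s. F s : bm" "!!s. F' s : bm"
  and b: "!!s r. r >= 0 ==> abs (F s r) <= C * r ^ k" "!!s r. r >= 0 ==> abs (F' s r) <= C' * r ^ k'"
   "!!s r. r >= 0 ==> abs (F'' s r) <= C'' * r ^ k''"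
 shows "((%s. I (F s)) has_real_derivative I (F' s)) (at s)"
proof -
 have "((%s. \<integral>x. g x * F s (rh x) \<partial>M) has_real_derivative (LINT x|M. g x * F' s (rh x))) (at s)"
 proof (rule has_real_derivative_integral)
  fix s x
  show "((%s. g x * F s (rh x)) has_real_derivative g x * F' s (rh x)) (at s)" by (intro DERIV_cmult d)
  show "((%s. g x * F' s (rh x)) has_real_derivative g x * F'' s (rh x)) (at s)" by (intro DERIV_cmult d)
  have "g x * abs (F'' s (rh x)) <= g x * (C'' * rh x ^ k'')" using g0 b rh0 by (intro mult_left_mono) auto
  thus "abs (g x * F'' s (rh x)) <= C'' * (g x * rh x ^ k'')" using g0[of x] by (simp add: abs_mult mult.left_commute)
 next
  show "integrable M (%x. C'' * (g x * rh x ^ k''))" using integ by simp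
 qed (rule integrable_growth[OF m(1) b(1)] integrable_growth[OF m(2) b(2)]; assumption)+
 moreover have "((%s. SUM y:Y. wt y * F s (rh y)) has_real_derivative (SUM y:Y. wt y * F' s (rh y))) (at s)"
  by (intro DERIV_sum DERIV_cmult d)
 ultimately show ?thesis unfolding I_def by (rule DERIV_diff)
qed

text \<open>The \<open>k\<close>-th derivative of the cosine transform of the difference; one
  formula covers all orders because differentiating a cosine shifts its argument by
  \<open>pi / 2\<close>.\<close>

definition fder :: "nat => real => real" where
 "fder k s = I (%r. r ^ k * cos (s * r + real k * (pi / 2)))"

lemma fder_derivative: "(fder k has_real_derivative fder (Suc k) s) (at s)"
proof -
 have d: "((%s. r ^ k * cos (s * r + real k * (pi / 2))) has_real_derivative
    r ^ Suc k * cos (s * r + real (Suc k) * (pi / 2))) (at s)" for k s r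
 proof -
  have "s * r + real (Suc k) * (pi / 2) = (s * r + real k * (pi / 2)) + pi / 2"
   by (simp add: algebra_simps add_divide_distrib)
  hence "cos (s * r + real (Suc k) * (pi / 2)) = - sin (s * r + real k * (pi / 2))"
   by (simp only: cos_add) simp
  thus ?thesis by (auto intro!: derivative_eq_intros)
 qed
 have b: "abs (r ^ k * cos t) <= 1 * r ^ k" if "r >= 0" for r t :: real and k
  using that mult_left_mono[OF abs_cos_le_one[of t], of "r ^ k"] by (simp add: abs_mult)
 have "((%s. I (%r. r ^ k * cos (s * r + real k * (pi / 2)))) has_real_derivative
   I (%r. r ^ Suc k * cos (s * r + real (Suc k) * (pi / 2)))) (at s)"
  by (rule I_derivative[OF d d _ _ b b b])
   (assumption | intro borel_measurable_continuous_onI continuous_intros)+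
 thus ?thesis unfolding fder_def .
qed

lemma fder_bound: "abs (fder k s) <= J k"
proof -
 have b: "abs (r ^ k * cos t) <= 1 * r ^ k" if "r >= 0" for r t :: real
  using that mult_left_mono[OF abs_cos_le_one[of t], of "r ^ k"] by (simp add: abs_mult)
 have "abs (fder k s) <= 1 * J k" unfolding fder_def by (rule I_bound[OF _ b])
  (assumption | intro borel_measurable_continuous_onI continuous_intros)+
 thus ?thesis by simp
qed

text \<open>For odd \<open>k\<close> the cosine of \<open>k * pi / 2\<close> is \<open>0\<close>, so
  only the even moments have to agree.\<close>

lemma fder_zero:
 assumes "even k ==> I (%r. r ^ k) = 0"
 shows "fder k 0 = 0"
proof -
 have "fder k 0 = I (%r. cos (real k * (pi / 2)) * r ^ k)" by (simp add: fder_def mult.commute)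
 also have "... = cos (real k * (pi / 2)) * I (%r. r ^ k)" by (rule I_cmult)
 also have "... = 0"
 proof (cases "even k")
  case False
  thus ?thesis using cos_zero_iff[of "real k * (pi / 2)"] by auto
 qed (use assms in simp)
 finally show ?thesis .
qed

text \<open>The function \<open>s \<mapsto> I(e\<^sup>-\<^sup>a\<^sup>s (r sin s r - a cos s r) / (a\<^sup>2 + r\<^sup>2))\<close> has derivative \<open>e\<^sup>-\<^sup>a\<^sup>s fder 0 s\<close>.\<close>

lemma transform_difference_bound:
 assumes a: "a > 0" and L: "L >= 0" and small: "!!s. 0 <= s ==> s <= L ==> abs (fder 0 s) <= dl"
 shows "a * abs (I (%r. 1 / (a^2 + r^2))) <= exp (- a * L) * (2 / a * J 0) + L * dl"
proof -
 have pos: "a^2 + r^2 > 0" for r using a by (simp add: add_pos_nonneg)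
 have pos': "a^2 + r^2 ~= 0" for r by (rule less_imp_neq[OF pos, symmetric])
 \<comment> \<open>\<open>a / (a^2 + r^2)\<close> is the Laplace transform of
   \<open>cos (s * r)\<close> at \<open>a\<close>; this explicit antiderivative takes the place of
   the integral over \<open>s\<close>.\<close>
 let ?G = "%s r. (r * sin (s * r) - a * cos (s * r)) / (a^2 + r^2)"
 let ?G' = "%s r. (r^2 * cos (s * r) + a * r * sin (s * r)) / (a^2 + r^2)"
 let ?G'' = "%s r. (- (r ^ 3) * sin (s * r) + a * r^2 * cos (s * r)) / (a^2 + r^2)"
 have d: "((%s. ?G s r) has_real_derivative ?G' s r) (at s)" "((%s. ?G' s r) has_real_derivative ?G'' s r) (at s)" for s r
  by (intro DERIV_cdivide; auto intro!: derivative_eq_intros simp: power2_eq_square power3_eq_cube algebra_simps)+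
 have le: "abs (p * x + q * y) <= abs p + abs q" if "abs x <= 1" "abs y <= 1" for p q x y :: real
  using mult_left_mono[OF that(1), of "abs p"] mult_left_mono[OF that(2), of "abs q"]
  by (intro order_trans[OF abs_triangle_ineq]) (simp add: abs_mult)
 have base: "r / (a^2 + r^2) <= 1 / a" "a / (a^2 + r^2) <= 1 / a"
  "a * r / (a^2 + r^2) <= 1" "r^2 / (a^2 + r^2) <= 1" if "r >= 0" for r
 proof -
  have ar: "a * r <= a^2 + r^2"
   using sum_squares_bound[of a r] mult_nonneg_nonneg[of a r] a that by linarith
  show "r / (a^2 + r^2) <= 1 / a" using ar a pos[of r] by (simp add: divide_simps mult.commute)
  show "a / (a^2 + r^2) <= 1 / a" using a pos[of r] by (simp add: divide_simps power2_eq_square)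
  show "a * r / (a^2 + r^2) <= 1" using ar pos[of r] by (simp add: divide_simps)
  show "r^2 / (a^2 + r^2) <= 1" using pos[of r] by (simp add: divide_simps)
 qed
 have b0: "abs (?G s r) <= 2 / a * r ^ 0" if "r >= 0" for s r
 proof -
  have "abs (r * sin (s * r) + (- a) * cos (s * r)) <= abs r + abs (- a)" by (rule le) auto
  hence "abs (?G s r) <= (r + a) / (a^2 + r^2)" using a that pos[of r] by (simp add: abs_divide divide_right_mono)
  thus ?thesis using base[OF that] by (simp add: add_divide_distrib)
 qed
 have le_div: "abs ((p * x + q * y) / (a^2 + r^2)) <= abs p / (a^2 + r^2) + abs q / (a^2 + r^2)"
  if "abs x <= 1" "abs y <= 1" for p q x y r :: real
  using divide_right_mono[OF le[OF that, of p q], of "a^2 + r^2"] pos[of r]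
  by (simp add: abs_divide add_divide_distrib[symmetric])
 have b1: "abs (?G' s r) <= 2 * r ^ 0" if "r >= 0" for s r
 proof -
  have "abs (?G' s r) <= abs (r^2) / (a^2 + r^2) + abs (a * r) / (a^2 + r^2)" by (rule le_div) auto
  also have "... <= 1 + 1" using base[OF that] a that by (intro add_mono) (auto simp: abs_mult)
  finally show ?thesis by simp
 qed
 have b2: "abs (?G'' s r) <= 2 * r ^ 1" if r: "r >= 0" for s r
 proof -
  have "abs (?G'' s r) <= abs (- (r ^ 3)) / (a^2 + r^2) + abs (a * r^2) / (a^2 + r^2)" by (rule le_div) auto
  also have "... = r * (r^2 / (a^2 + r^2)) + r * (a * r / (a^2 + r^2))"
   using r a by (simp add: power2_eq_square power3_eq_cube abs_mult ac_simps)
  also have "... <= r * 1 + r * 1" using base[OF r] r by (intro add_mono mult_left_mono) auto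
  finally show ?thesis by simp
 qed
 have mG: "?G s : bm" and mG': "?G' s : bm" for s
  using pos' by (auto intro!: borel_measurable_continuous_onI continuous_intros)
 define \<psi> where "\<psi> s = I (?G s)" for s
 have \<psi>': "(\<psi> has_real_derivative a * \<psi> s + fder 0 s) (at s)" for s
 proof -
  have "((%s. I (?G s)) has_real_derivative I (?G' s)) (at s)"
   by (rule I_derivative[OF d mG mG' b0 b1 b2])
  moreover have "I (?G' s) = I (%r. a * ?G s r + r ^ 0 * cos (s * r + real 0 * (pi / 2)))"
  proof -
   have "?G' s r = a * ?G s r + r ^ 0 * cos (s * r + real 0 * (pi / 2))" for r
   proof -
    have "?G' s r = (a * (r * sin (s * r) - a * cos (s * r)) + (a^2 + r^2) * cos (s * r)) / (a^2 + r^2)"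
     by (rule arg_cong[of _ _ "%x. x / _"]) (simp add: algebra_simps power2_eq_square)
    also have "... = a * ?G s r + cos (s * r)" unfolding add_divide_distrib using pos'[of r] by simp
    finally show ?thesis by simp
   qed
   thus ?thesis by simp
  qed
  moreover have "... = I (%r. a * ?G s r) + I (%r. r ^ 0 * cos (s * r + real 0 * (pi / 2)))"
  proof (rule I_add)
   show "abs (a * ?G s r) <= 2 * r ^ 0" if "r >= 0" for r
    using mult_left_mono[OF b0[OF that, of s], of a] a by (simp add: abs_mult)
   show "abs (r ^ 0 * cos (s * r + real 0 * (pi / 2))) <= 1 * r ^ 0" for r by simp
   show "(%r. a * ?G s r) : bm" by (intro borel_measurable_times borel_measurable_const mG)
   show "(%r. r ^ 0 * cos (s * r + real 0 * (pi / 2))) : bm"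
    by (intro borel_measurable_continuous_onI continuous_intros)
  qed
  ultimately show ?thesis unfolding I_cmult by (simp add: \<psi>_def[abs_def] fder_def)
 qed
 have \<psi>_bound: "abs (\<psi> s) <= 2 / a * J 0" for s
  unfolding \<psi>_def by (rule I_bound[OF mG b0])
 have \<psi>_0: "\<psi> 0 = - a * I (%r. 1 / (a^2 + r^2))"
  unfolding \<psi>_def I_cmult[symmetric] by simp
 \<comment> \<open>At \<open>0\<close> this is, up to the factor \<open>- a\<close>, the quantity to
   be estimated; at \<open>L\<close> it is small because of the exponential; the mean value theorem
   and \<open>small\<close> control the difference.\<close>
 define ph where "ph s = exp (- a * s) * \<psi> s" for s
 have ph': "(ph has_real_derivative exp (- a * s) * fder 0 s) (at s)" for s
  unfolding ph_def[abs_def] by (auto intro!: derivative_eq_intros \<psi>' simp: algebra_simps)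
 have "abs (ph L - ph 0) <= L * dl"
 proof (cases "L = 0")
  case False
  hence L0: "0 < L" using L by simp
  have "EX z. 0 < z & z < L & ph L - ph 0 = (L - 0) * (exp (- a * z) * fder 0 z)"
   by (rule MVT2[OF L0 ph'])
  then obtain z where z: "0 < z" "z < L" "ph L - ph 0 = (L - 0) * (exp (- a * z) * fder 0 z)" by (elim exE conjE)
  have "abs (ph L - ph 0) = L * (exp (- a * z) * abs (fder 0 z))" using L0 unfolding z(3) by (simp add: abs_mult)
  also have "... <= L * (1 * dl)" using L0 a z small[of z] by (intro mult_left_mono mult_mono) auto
  finally show ?thesis by simp
 qed simp
 moreover have "abs (ph L) <= exp (- a * L) * (2 / a * J 0)"
  using mult_left_mono[OF \<psi>_bound[of L], of "exp (- a * L)"] by (simp add: ph_def abs_mult)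
 moreover have "abs (ph 0) = a * abs (I (%r. 1 / (a^2 + r^2)))" using a by (simp add: ph_def \<psi>_0 abs_mult)
 ultimately show ?thesis by linarith
qed


text \<open>This is \<open>2 * te * r <= te^2 + r^2\<close>, integrated. For the balancing value of
  \<open>te\<close> it becomes the Cauchy-Schwarz bound by the neighbouring even moments.\<close>

lemma J_odd:
 assumes te: "te > 0"
 shows "J (Suc (2 * i)) <= (te * J (2 * i) + J (2 * Suc i) / te) / 2"
proof -
 have pt: "r ^ Suc (2 * i) <= (te / 2) * r ^ (2 * i) + (1 / (2 * te)) * r ^ (2 * Suc i)" for r :: real
 proof -
  have "0 <= (r - te)^2" by simp
  hence "2 * te * r <= te * te + r * r" by (simp add: power2_eq_square algebra_simps)
  hence "r <= (te * te + r * r) / (2 * te)" using te by (simp add: pos_le_divide_eq mult.commute)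
  also have "... = te / 2 + (1 / (2 * te)) * (r * r)" using te by (simp add: add_divide_distrib)
  finally have "r ^ (2 * i) * r <= r ^ (2 * i) * (te / 2 + (1 / (2 * te)) * (r * r))" by (intro mult_left_mono) auto
  thus ?thesis by (simp add: distrib_left ac_simps)
 qed
 have "(LINT x|M. g x * rh x ^ Suc (2 * i)) <= (LINT x|M. (te / 2) * (g x * rh x ^ (2 * i)) + (1 / (2 * te)) * (g x * rh x ^ (2 * Suc i)))"
 proof (rule integral_mono)
  fix x
  have "g x * rh x ^ Suc (2 * i) <= g x * ((te / 2) * rh x ^ (2 * i) + (1 / (2 * te)) * rh x ^ (2 * Suc i))"
   by (rule mult_left_mono[OF pt g0])
  thus "g x * rh x ^ Suc (2 * i) <= (te / 2) * (g x * rh x ^ (2 * i)) + (1 / (2 * te)) * (g x * rh x ^ (2 * Suc i))"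
   by (simp only: distrib_left mult.left_commute)
 qed (intro Bochner_Integration.integrable_add integrable_mult_right integ)+
 also have "... = (te / 2) * (LINT x|M. g x * rh x ^ (2 * i)) + (1 / (2 * te)) * (LINT x|M. g x * rh x ^ (2 * Suc i))"
  by (simp only: Bochner_Integration.integral_add[OF integrable_mult_right[OF integ] integrable_mult_right[OF integ]] integral_mult_right_zero)
 finally have 1: "(LINT x|M. g x * rh x ^ Suc (2 * i)) <= ..." .
 have "(SUM y:Y. wt y * rh y ^ Suc (2 * i)) <= (SUM y:Y. (te / 2) * (wt y * rh y ^ (2 * i)) + (1 / (2 * te)) * (wt y * rh y ^ (2 * Suc i)))"
 proof (rule sum_mono)
  fix y assume "y : Y"
  hence "wt y * rh y ^ Suc (2 * i) <= wt y * ((te / 2) * rh y ^ (2 * i) + (1 / (2 * te)) * rh y ^ (2 * Suc i))"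
   by (intro mult_left_mono[OF pt wt0])
  thus "wt y * rh y ^ Suc (2 * i) <= (te / 2) * (wt y * rh y ^ (2 * i)) + (1 / (2 * te)) * (wt y * rh y ^ (2 * Suc i))"
   by (simp only: distrib_left mult.left_commute)
 qed
 also have "... = (te / 2) * (SUM y:Y. wt y * rh y ^ (2 * i)) + (1 / (2 * te)) * (SUM y:Y. wt y * rh y ^ (2 * Suc i))"
  by (simp only: sum.distrib sum_distrib_left)
 finally have 2: "(SUM y:Y. wt y * rh y ^ Suc (2 * i)) <= ..." .
 have "J (Suc (2 * i)) <= (te / 2) * J (2 * i) + (1 / (2 * te)) * J (2 * Suc i)"
  using add_mono[OF 1 2] unfolding J_def distrib_left by (simp only: ac_simps)
 thus ?thesis by (simp add: add_divide_distrib)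
qed

text \<open>\<open>bang\<close> for the cosine transform, whose derivatives of order below
  \<open>2 * n\<close> vanish at \<open>0\<close>. At even orders the bounds \<open>Mf\<close> are
  those of both measures together, whence \<open>2 * K\<close>, and at odd orders geometric means.
  Consecutive ratios of \<open>Mf\<close> are then equal in pairs, which explains the factor
  \<open>2\<close> in the sum.\<close>

lemma moment_difference_small:
 fixes S :: "nat => real"
 assumes Spos: "!!i. S i > 0" and conv: "!!i. S (Suc i) * S (Suc i) <= S i * S (Suc (Suc i))"
  and K: "K > 0" and bound: "!!i. (LINT x|M. g x * rh x ^ (2 * i)) <= K * S i"
  and eq: "!!i. i <= n ==> I (%r. r ^ (2 * i)) = 0"
  and p: "p <= n" and s: "0 <= s" "s <= (SUM i:{p..<n}. 2 * sqrt (S i / S (Suc i))) / exp 1"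
 shows "abs (fder 0 s) <= exp (- (2 * real p)) * (2 * K * S 0)"
proof -
 define Mf where "Mf k = 2 * K * sqrt (S (k div 2) * S (Suc k div 2))" for k
 have Mf_even: "Mf (2 * i) = 2 * K * S i" for i using Spos[of i] by (simp add: Mf_def)
 have Mf_odd: "Mf (Suc (2 * i)) = 2 * K * sqrt (S i * S (Suc i))" for i by (simp add: Mf_def)
 have Mf_pos: "Mf k > 0" for k using K Spos by (simp add: Mf_def)
 have J_even: "J (2 * i) <= Mf (2 * i)" if "i <= n" for i
  using eq[OF that] bound[of i] by (simp add: J_def I_def Mf_even)
 have J_le: "J k <= Mf k" if k: "k <= 2 * n" for k
 proof (cases "even k")
  case True
  then obtain i where "k = 2 * i" by blast
  thus ?thesis using J_even[of i] k by simp
 next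
  case False
  then obtain i where i: "k = Suc (2 * i)" by (auto elim: oddE)
  \<comment> \<open>The balancing value: both terms in \<open>J_odd\<close> become the same multiple
    of \<open>sqrt (S i) * sqrt (S (Suc i))\<close>.\<close>
  define te where "te = sqrt (S (Suc i)) / sqrt (S i)"
  have te: "te > 0" using Spos by (simp add: te_def)
  have sq: "S j = sqrt (S j) * sqrt (S j)" for j using Spos[of j] by simp
  have ne: "sqrt (S j) ~= 0" for j using Spos[of j] by simp
  have "J (Suc (2 * i)) <= (te * J (2 * i) + J (2 * Suc i) / te) / 2" by (rule J_odd[OF te])
  also have "... <= (te * Mf (2 * i) + Mf (2 * Suc i) / te) / 2"
   using te J_even[of i] J_even[of "Suc i"] k i
   by (intro divide_right_mono add_mono mult_left_mono) auto
  also have "... = K * (te * S i + S (Suc i) / te)" unfolding Mf_even by (simp add: field_simps)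
  also have "te * S i = sqrt (S i) * sqrt (S (Suc i))" using ne[of i]
   using ne[of i] by (subst sq[of i]) (simp del: real_sqrt_mult_self add: te_def)
  also have "S (Suc i) / te = sqrt (S i) * sqrt (S (Suc i))" using ne
   by (subst sq[of "Suc i"]) (simp only: te_def divide_divide_eq_right nonzero_divide_eq_eq[OF ne] ac_simps)
  finally show ?thesis unfolding i Mf_odd by (simp add: real_sqrt_mult)
 qed
 have Mf_conv: "Mf (Suc k) * Mf (Suc k) <= Mf k * Mf (Suc (Suc k))" for k
 proof (cases "even k")
  case True
  then obtain i where i: "k = 2 * i" by blast
  have "Mf (Suc k) * Mf (Suc k) = (2 * K) * (2 * K) * (S i * S (Suc i))"
   using Spos[of i] Spos[of "Suc i"] unfolding i Mf_odd by simp
  also have "... = Mf (2 * i) * Mf (2 * Suc i)" unfolding Mf_even by simp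
  finally show ?thesis by (simp add: i)
 next
  case False
  then obtain i where i: "k = Suc (2 * i)" by (auto elim: oddE)
  have "sqrt (S (Suc i) * S (Suc i)) <= sqrt (S i * S (Suc (Suc i)))" using conv by (intro real_sqrt_le_mono)
  hence le: "S (Suc i) <= sqrt (S i) * sqrt (S (Suc (Suc i)))" using Spos[of "Suc i"] by (simp add: real_sqrt_mult)
  have "Mf (Suc k) * Mf (Suc k) = Mf (2 * Suc i) * Mf (2 * Suc i)" by (simp add: i)
  also have "... = (2 * K) * (2 * K) * (S (Suc i) * S (Suc i))" unfolding Mf_even by simp
  also have "... <= (2 * K) * (2 * K) * (S (Suc i) * (sqrt (S i) * sqrt (S (Suc (Suc i)))))"
   using le K Spos[of "Suc i"] by (intro mult_left_mono) auto
  also have "... = Mf (Suc (2 * i)) * Mf (Suc (2 * Suc i))"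
   using Spos[of "Suc i"] unfolding Mf_odd real_sqrt_mult by simp
  finally show ?thesis by (simp add: i)
 qed
 have ratio_odd: "bratio Mf (Suc (2 * i)) = sqrt (S i / S (Suc i))" for i
  using K Spos[of i] Spos[of "Suc i"]
  by (simp add: bratio_def Mf_even Mf_odd real_sqrt_mult real_sqrt_divide divide_simps)
 have ratio_even: "bratio Mf (Suc (Suc (2 * i))) = sqrt (S i / S (Suc i))" for i
  using K Spos[of i] Spos[of "Suc i"] Mf_even[of "Suc i"]
  by (simp add: bratio_def Mf_odd real_sqrt_mult real_sqrt_divide divide_simps)
 have ratio_sum: "(SUM k:{2 * p<..2 * n}. bratio Mf k) = (SUM i:{p..<n}. 2 * sqrt (S i / S (Suc i)))"
  using p
 proof (induction n rule: dec_induct)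
  case (step n)
  have "{2 * p<..2 * Suc n} = insert (Suc (Suc (2 * n))) (insert (Suc (2 * n)) {2 * p<..2 * n})" using step by auto
  moreover have "{p..<Suc n} = insert n {p..<n}" using step by auto
  ultimately show ?case using step by (simp add: ratio_odd ratio_even)
 qed simp
 have "abs (fder 0 s) <= exp (real 0 - real (2 * p)) * Mf 0"
 proof (rule bang[where f = fder and M = Mf and N = "2 * n" and ?k0.0 = "2 * p" and x = s and n = 0])
  show "(fder k has_real_derivative fder (Suc k) x) (at x)" for k x by (rule fder_derivative)
  show "abs (fder k x) <= Mf k" if "k <= 2 * n" for k x using fder_bound[of k x] J_le[OF that] by linarith
  show "fder k 0 = 0" if "k < 2 * n" for k
  proof (rule fder_zero)
   assume "even k"
   then obtain i where "k = 2 * i" by blast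
   thus "I (%r. r ^ k) = 0" using eq[of i] that by simp
  qed
  show "s <= (SUM k:{2 * p<..2 * n}. bratio Mf k) / exp 1" unfolding ratio_sum by (rule s)
 qed (use Mf_pos Mf_conv p s in auto)
 thus ?thesis using Mf_even[of 0] by simp
qed

end

text \<open>\<open>N\<close> depends on \<open>S\<close> and the constants only, not on the two
  measures; qualitative quasi-analyticity would not give this uniformity. First \<open>L\<close>
  makes the exponential tail small, then \<open>p\<close> the bound for the transform on
  \<open>[0, L]\<close>, and then divergence of the series supplies an \<open>N\<close> for which
  Bang's intervals of order above \<open>2 * p\<close> cover \<open>[0, L]\<close>.\<close>

lemma transform_convergence:
 fixes S :: "nat => real"
 assumes Spos: "!!i. S i > 0" and conv: "!!i. S (Suc i) * S (Suc i) <= S i * S (Suc (Suc i))"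
  and div: "\<not> summable (%i. sqrt (S i / S (Suc i)))" and K: "K > 0" and a: "a > 0" and ep: "ep > 0"
 shows "EX N. ALL n>=N. ALL M g rh Y wt. transform_pair M g rh Y wt -->
  (ALL i<=n. (LINT x|M. g x * rh x ^ (2 * i)) = (SUM y:Y. wt y * rh y ^ (2 * i))) -->
  (ALL i. (LINT x|M. g x * rh x ^ (2 * i)) <= K * S i) -->
  abs ((LINT x|M. g x * qk a (rh x)) - (SUM y:Y. wt y * qk a (rh y))) <= ep"
proof -
 define C where "C = 2 / a * (2 * K * S 0)"
 define C' where "C' = 2 * K * S 0"
 have C: "C > 0" "C' > 0" using a K Spos by (auto simp: C_def C'_def)
 have lim: "((%x. exp (- (b * x)) * c) ---> 0) at_top" if "b > 0" for b c :: real
 proof -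
  have "((%x. exp (- (b * x))) ---> 0) at_top" using that by real_asymp
  thus ?thesis using tendsto_mult_left_zero by blast
 qed
 have "EVT L. exp (- (a * L)) * C < a * ep / 2"
  using order_tendstoD(2)[OF lim[OF a, of C], of "a * ep / 2"] a ep by simp
 hence "EX L>=0. exp (- (a * L)) * C < a * ep / 2"
  using eventually_happens'[OF trivial_limit_at_top_linorder eventually_conj[OF eventually_ge_at_top[of "0::real"]]] by blast
 then obtain L where L: "L >= 0" "exp (- (a * L)) * C < a * ep / 2" by blast
 have "((%p::nat. exp (- (2 * real p)) * (L * C')) ---> 0) sequentially"
  using filterlim_compose[OF lim[of 2 "L * C'"] filterlim_real_sequentially] by simp
 hence "EVN p. exp (- (2 * real p)) * (L * C') < a * ep / 2"
  using order_tendstoD(2)[of _ 0 sequentially "a * ep / 2"] a ep by simp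
 then obtain p where p: "exp (- (2 * real p)) * (L * C') < a * ep / 2"
  using eventually_happens'[OF sequentially_bot] by blast
 have nonneg: "0 <= sqrt (S i / S (Suc i))" for i using Spos[of i] Spos[of "Suc i"] by simp
 have "EX N>=p. L * exp 1 <= (SUM i:{p..<N}. 2 * sqrt (S i / S (Suc i)))"
 proof (rule ccontr)
  assume "\<not> ?thesis"
  hence le: "ALL N. p <= N --> (SUM i:{p..<N}. 2 * sqrt (S i / S (Suc i))) < L * exp 1" by (meson not_le)
  have "summable (%i. sqrt (S i / S (Suc i)))"
  proof (rule summableI_nonneg_bounded)
   fix n
   have "(SUM i<n. sqrt (S i / S (Suc i))) <= (SUM i<n+p. sqrt (S i / S (Suc i)))"
    using nonneg by (intro sum_mono2) auto
   also have "{..<n+p} = {..<p} Un {p..<n+p}" by auto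
   also have "(SUM i:{..<p} Un {p..<n+p}. sqrt (S i / S (Suc i))) = (SUM i<p. sqrt (S i / S (Suc i))) + (SUM i:{p..<n+p}. sqrt (S i / S (Suc i)))"
    by (intro sum.union_disjoint) auto
   also have "(SUM i:{p..<n+p}. sqrt (S i / S (Suc i))) <= L * exp 1"
    using le[rule_format, of "n + p"] sum_nonneg[of "{p..<n+p}" "%i. sqrt (S i / S (Suc i))"] nonneg
    by (simp add: sum_distrib_left[symmetric])
   finally show "(SUM i<n. sqrt (S i / S (Suc i))) <= (SUM i<p. sqrt (S i / S (Suc i))) + L * exp 1" by simp
  qed (rule nonneg)
  thus False using div by simp
 qed
 then obtain N where N: "N >= p" "L * exp 1 <= (SUM i:{p..<N}. 2 * sqrt (S i / S (Suc i)))" by blast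
 show ?thesis
 proof (intro exI[of _ N] allI impI)
  fix n M g rh Y wt
  assume n: "n >= N" and tp: "transform_pair M g rh Y wt"
   and eq: "ALL i<=n. (LINT x|M. g x * rh x ^ (2 * i)) = (SUM y:Y. wt y * rh y ^ (2 * i))"
   and bd: "ALL i. (LINT x|M. g x * rh x ^ (2 * i)) <= K * S i"
  interpret transform_pair M g rh Y wt by (rule tp)
  have I0: "I (%r. r ^ (2 * i)) = 0" if "i <= n" for i using eq that by (simp add: I_def)
  have J0: "J 0 <= 2 * K * S 0"
   using eq[rule_format, of 0] bd[rule_format, of 0] by (simp add: J_def)
  have "L <= (SUM i:{p..<N}. 2 * sqrt (S i / S (Suc i))) / exp 1"
   using N(2) by (simp add: pos_le_divide_eq)
  also have "... <= (SUM i:{p..<n}. 2 * sqrt (S i / S (Suc i))) / exp 1"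
   using n nonneg by (intro divide_right_mono sum_mono2) auto
  finally have Ln: "L <= ..." .
  have "a * abs (I (%r. 1 / (a^2 + r^2))) <= exp (- a * L) * (2 / a * J 0) + L * (exp (- (2 * real p)) * (2 * K * S 0))"
  proof (rule transform_difference_bound[OF a L(1)])
   fix s assume s: "0 <= s" "s <= L"
   show "abs (fder 0 s) <= exp (- (2 * real p)) * (2 * K * S 0)"
    by (rule moment_difference_small[where n = n and S = S and K = K, OF Spos conv K _ I0])
     (use bd N n s Ln in auto)
  qed
  also have "exp (- a * L) * (2 / a * J 0) <= exp (- a * L) * C"
   using J0 a unfolding C_def by (intro mult_left_mono) auto
  also have "L * (exp (- (2 * real p)) * (2 * K * S 0)) = exp (- (2 * real p)) * (L * C')"
   by (simp add: C'_def)
  finally have "a * abs (I (%r. 1 / (a^2 + r^2))) <= a * ep" using L(2) p by simp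
  hence "abs (I (%r. 1 / (a^2 + r^2))) <= ep" using a by simp
  thus "abs ((LINT x|M. g x * qk a (rh x)) - (SUM y:Y. wt y * qk a (rh y))) <= ep"
   by (simp add: I_def)
 qed
qed

section \<open>Convergence of interpolating rational functions\<close>

text \<open>\<open>nodal Y * u\<close> is the denominator of an interpolating fraction and
  \<open>X\<close> the set of interpolation points. Weighted by \<open>u / nodal X\<close>, the
  measure carries a quadrature rule on \<open>Y\<close>, positive up to the sign
  \<open>e\<close>.\<close>

locale pade_quad =
 fixes Dl :: "real set" and s :: smeasure and Y X :: "real set" and u :: "real poly" and e :: real and M :: nat
 assumes gm: "gmeas Dl s" and fY: "finite Y" and YDl: "Y <= Dl" and fX: "finite X" and XDl: "X Int Dl = {}"
  and e: "e = 1 | e = -1" and R_sign: "!!x. x : Dl ==> e * poly (nodal X) x > 0"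
  and u_pos: "!!x. x : Dl ==> 0 <= poly u x" and u0: "u ~= 0"
  and orth: "!!p. degree p < M ==> (LINT x|snd s. poly p x * (poly (nodal Y * u) x / poly (nodal X) x)) = 0"
  and M0: "M > 0" and XM: "card X <= 2 * M" and YM: "card Y <= 2 * M"
begin

abbreviation te :: "real => real" where "te == %x. poly u x / poly (nodal X) x"

sublocale Q: quad_meas Dl s Y te e M
proof
 show "tame Dl (%x. cx (te x))"
  using tame_divide_nodal[OF fX XDl gmeasD(3)[OF gm] tame_cpoly_real[of Dl u]] by simp
 show "0 <= e * te x" if "x : Dl" for x
 proof -
  have "e * te x = poly u x / (e * poly (nodal X) x)" using e by auto
  thus ?thesis using R_sign[OF that] u_pos[OF that] by simp
 qed
 have "{x : Dl. te x = 0} <= {x. poly u x = 0}" using R_sign by fastforce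
 thus "finite {x : Dl. te x = 0}" using poly_roots_finite[OF u0] by (rule finite_subset)
 show "(LINT x|snd s. poly (nodal Y * p) x * te x) = 0" if "degree p < M" for p
  using orth[OF that] by (simp add: ac_simps)
qed (use gm fY e in auto)

text \<open>The factor \<open>h\<^sup>2\<close> removes the nodes of nonpositive weight, so that all \<open>La y\<close> are nonnegative.\<close>

definition h :: "real poly" where
 "h = smult (\<Prod>y\<in>Q.bad. 1 / (1 + abs y)) (nodal Q.bad)"

definition La :: "real => real" where "La y = Q.weight y * (e * poly (nodal X) y) * (poly h y)^2"

lemma bad_sub: "Q.bad <= Y" by (auto simp: Q.bad_def)

lemma finite_bad: "finite Q.bad" using bad_sub fY finite_subset by blast

lemma degree_h: "degree h = card Q.bad" by (simp add: h_def prod_zero_iff finite_bad add_nonneg_eq_0_iff)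

lemma degree_h_le: "2 * degree h + M <= card Y" using Q.card_bad by (simp add: degree_h)

lemma poly_h: "pc h z = (\<Prod>y\<in>Q.bad. (z - cx y) / cx (1 + abs y))"
 by (simp add: h_def poly_cpoly_nodal prod.distrib[symmetric] divide_inverse mult.commute)

text \<open>The factors \<open>1 / (1 + abs y)\<close> in \<open>h\<close> serve two estimates:
  \<open>abs (x - y) <= (1 + abs x) * (1 + abs y)\<close> gives this one, and \<open>h_lower\<close>
  is its counterpart off \<open>Dl\<close>. Neither bound depends on where the bad nodes
  lie.\<close>

lemma h_upper: "(poly h x)^2 <= (1 + abs x) ^ (2 * degree h)"
proof -
 have "abs (poly h x) = norm (pc h (cx x))" by simp
 also have "... = (\<Prod>y\<in>Q.bad. norm ((cx x - cx y) / cx (1 + abs y)))"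
  unfolding poly_h prod_norm ..
 also have "... <= (\<Prod>y\<in>Q.bad. 1 + abs x)"
 proof (rule prod_mono)
  fix y assume "y : Q.bad"
  have "norm ((cx x - cx y) / cx (1 + abs y)) = abs (x - y) / (1 + abs y)"
   by (simp only: of_real_diff[symmetric] norm_divide norm_of_real)
  also have "... <= 1 + abs x"
  proof -
   have "abs (x - y) <= (1 + abs x) * (1 + abs y)"
    using abs_triangle_ineq4[of x y] mult_nonneg_nonneg[OF abs_ge_zero[of x] abs_ge_zero[of y]]
    unfolding distrib_left distrib_right by linarith
   thus ?thesis by (simp add: divide_le_eq)
  qed
  finally show "0 <= norm ((cx x - cx y) / cx (1 + abs y)) &
   norm ((cx x - cx y) / cx (1 + abs y)) <= 1 + abs x" by (intro conjI norm_ge_zero)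
 qed
 finally have "abs (poly h x) <= (1 + abs x) ^ degree h" by (simp add: degree_h)
 hence "abs (poly h x)^2 <= ((1 + abs x) ^ degree h)^2" by (intro power_mono) auto
 thus ?thesis by (simp add: power_mult[symmetric] mult.commute)
qed

lemma h_lower:
 assumes kp: "0 < kp" "!!y. y : Dl ==> kp * (1 + abs y) <= norm (z - cx y)"
 shows "kp ^ degree h <= norm (pc h z)"
proof -
 have "(\<Prod>y\<in>Q.bad. kp) <= (\<Prod>y\<in>Q.bad. norm ((z - cx y) / cx (1 + abs y)))"
 proof (rule prod_mono)
  fix y assume "y : Q.bad"
  hence "y : Dl" using bad_sub YDl by blast
  hence "kp <= norm (z - cx y) / (1 + abs y)" using kp(2) by (simp add: pos_le_divide_eq)
  thus "0 <= kp & kp <= norm ((z - cx y) / cx (1 + abs y))" using kp(1)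
   by (simp only: norm_divide norm_of_real) simp
 qed
 thus ?thesis unfolding poly_h prod_norm by (simp add: degree_h)
qed

lemma h_bad: "y : Q.bad ==> poly h y = 0" by (simp add: h_def poly_nodal_eq_0_iff[OF finite_bad])

lemma La_nonneg: "y : Y ==> 0 <= La y"
proof (cases "y : Q.bad")
 case False
 assume "y : Y"
 hence "Q.weight y > 0" "e * poly (nodal X) y > 0" using False R_sign YDl by (auto simp: Q.bad_def)
 thus ?thesis by (simp add: La_def)
qed (simp add: La_def h_bad)

text \<open>The factor \<open>nodal X\<close> cancels the denominator of \<open>te\<close> and turns
  the rule into one for the density \<open>u h^2\<close>, at the cost of \<open>card X\<close>
  degrees of exactness.\<close>

lemma moments_match:
 assumes "card X + 2 * degree h + degree p < card Y + M"
 shows "(LINT x|snd s. poly u x * (poly h x)^2 * poly p x) = (SUM y:Y. La y * poly p y)"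
proof -
 have deg: "degree (nodal X * (h^2 * p)) < card Y + M"
 proof -
  have "degree (nodal X * (h^2 * p)) <= card X + (degree (h^2) + degree p)"
   using degree_mult_le[of "nodal X" "h^2 * p"] degree_mult_le[of "h^2" p] by simp
  moreover have "degree (h^2) <= 2 * degree h" using degree_power_le[of h 2] by (simp add: mult.commute)
  ultimately show ?thesis using assms by linarith
 qed
 have "e * (LINT x|snd s. poly u x * (poly h x)^2 * poly p x) = e * (LINT x|snd s. poly (nodal X * (h^2 * p)) x * te x)"
 proof (intro arg_cong2[of _ _ _ _ "(*)"] refl integral_cong_AE)
  show "AE x in snd s. poly u x * (poly h x)^2 * poly p x = poly (nodal X * (h^2 * p)) x * te x"
   using gmeasD(6)[OF gm]
  proof eventually_elim
   case (elim x)
   hence "poly (nodal X) x ~= 0" using R_sign[of x] by auto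
   thus ?case by (simp add: ac_simps)
  qed
 next
  have "(%x. poly p x) : bm" for p :: "real poly"
   by (intro borel_measurable_continuous_onI continuous_intros)
  hence 1: "(%x. poly u x * (poly h x)^2 * poly p x) : bm"
   by (intro borel_measurable_times borel_measurable_power) auto
  thus "(%x. poly u x * (poly h x)^2 * poly p x) : borel_measurable (snd s)"
   by (rule gmeas_borel[OF gm])
  show "(%x. poly (nodal X * (h^2 * p)) x * te x) : borel_measurable (snd s)"
   by (rule borel_measurable_integrable[OF Q.L_integrable])
 qed
 also have "... = Q.L (nodal X * (h^2 * p))" unfolding Q.L_def ..
 also have "... = (SUM y:Y. Q.weight y * poly (nodal X * (h^2 * p)) y)" by (rule Q.exact[OF deg])
 also have "... = e * (SUM y:Y. La y * poly p y)"
  using e by (auto simp: La_def sum_distrib_left sum_negf ac_simps)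
 finally show ?thesis using e by auto
qed

lemma exact_complex:
 assumes "degree p < card Y + M"
 shows "sint s (%x. poly p (cx x) * cx (te x)) = cx (fst s * e) * (SUM y:Y. cx (Q.weight y) * poly p (cx y))"
proof -
 have m: "sint s (%x. cx x ^ i * cx (te x)) = cx (fst s * e) * (SUM y:Y. cx (Q.weight y) * cx y ^ i)"
  if "i <= degree p" for i
 proof -
  have "sint s (%x. cx x ^ i * cx (te x)) = cx (fst s * e * Q.L (monom 1 i))"
   unfolding Q.sint_eq_L[symmetric] by (simp add: poly_monom)
  also have "Q.L (monom 1 i) = (SUM y:Y. Q.weight y * y ^ i)"
   using Q.exact[of "monom 1 i"] that assms by (simp add: poly_monom degree_monom_eq)
  finally show ?thesis by simp
 qed
 have t: "tame Dl (%x. cx x ^ i)" for i using tame_poly[of Dl "monom 1 i"] by (simp add: poly_monom)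
 have "sint s (%x. poly p (cx x) * cx (te x)) = sint s (%x. SUM i<=degree p. coeff p i * (cx x ^ i * cx (te x)))"
  unfolding poly_altdef[of p] sum_distrib_right mult.assoc ..
 also have "... = (SUM i<=degree p. coeff p i * sint s (%x. cx x ^ i * cx (te x)))"
  unfolding sint_cmult[OF gm, symmetric]
  by (rule sint_sum[OF gm]) (intro tame_cmult tame_mult t Q.tm)
 also have "... = (SUM i<=degree p. coeff p i * (cx (fst s * e) * (SUM y:Y. cx (Q.weight y) * cx y ^ i)))"
  by (intro sum.cong refl) (simp only: m atMost_iff)
 also have "... = cx (fst s * e) * (SUM i<=degree p. SUM y:Y. cx (Q.weight y) * (coeff p i * cx y ^ i))"
  by (simp add: sum_distrib_left ac_simps)
 also have "... = cx (fst s * e) * (SUM y:Y. cx (Q.weight y) * poly p (cx y))"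
  by (subst sum.swap) (simp add: poly_altdef sum_distrib_left)
 finally show ?thesis .
qed

lemma quotient_difference:
 fixes p :: "complex poly"
 assumes "degree p <= d" "poly p z = 0" "d > 0"
 shows "EX g. degree g < d & (ALL x. poly p x = (x - z) * poly g x)"
proof -
 obtain g where g: "p = [:-z, 1:] * g" using assms(2) by (auto simp: poly_eq_0_iff_dvd elim: dvdE)
 show ?thesis
 proof (cases "g = 0")
  case False
  hence "degree p = Suc (degree g)" unfolding g by (subst degree_mult_eq) auto
  thus ?thesis using assms(1) by (intro exI[of _ g]) (simp add: g algebra_simps del: mult_pCons_left)
 qed (use assms g in \<open>auto intro!: exI[of _ 0]\<close>)
qed

lemma tame_power_poly: "tame Dl (%x. (pc p (cx x))^2)"
 using tame_poly[of Dl "(cpoly p)^2"] by (simp add: poly_power)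

lemma tame_uh: "tame Dl (%x. cx (poly u x * (poly h x)^2))"
 using tame_cpoly_real[of Dl "u * h^2"] by (simp add: poly_power)

text \<open>Two divisions by \<open>x - z\<close> do the work. \<open>h(z)^2 - h(x)^2\<close> yields
  a polynomial of degree below \<open>M\<close>, annihilated by orthogonality, so
  \<open>h(z)^2\<close> may be moved under the integral. \<open>W(z) R(x) - R(z) W(x)\<close>, with
  \<open>R\<close> and \<open>W\<close> the nodal polynomials of \<open>X\<close> and
  \<open>Y\<close>, yields a polynomial to which the exact rule applies; at the nodes
  \<open>W\<close> vanishes and the simple fractions appear.\<close>

lemma stieltjes_representation:
 assumes z: "z ~: cx ` Dl"
 shows "(pc h z)^2 * (pc (nodal X) z / pc (nodal Y) z
    * ctr s (%x. cx (poly (nodal Y * u) x / poly (nodal X) x)) z)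
  = ctr s (%x. cx (poly u x * (poly h x)^2)) z - cx (fst s) * (SUM y:Y. cx (La y) / (z - cx y))"
proof -
 let ?H = "cpoly h" and ?R = "cpoly (nodal X)" and ?W = "cpoly (nodal Y)"
 define ph where "ph x = cx (poly (nodal Y * u) x / poly (nodal X) x)" for x
 have cl: "closed Dl" by (rule gmeasD(3)[OF gm])
 have Wz: "poly ?W z ~= 0" using z YDl by (auto simp: poly_cpoly_nodal_eq_0_iff[OF fY])
 have zy: "z - cx y ~= 0" if "y : Dl" for y using z that by auto
 have ph: "ph x = poly ?W (cx x) * cx (te x)" for x by (simp add: ph_def)
 have tph: "tame Dl ph" unfolding ph by (intro tame_mult tame_poly Q.tm)
 have tk: "tame Dl (%x. F x / (z - cx x))" if "tame Dl F" for F by (rule tame_cauchy_kernel[OF cl z that])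
 have dH: "degree (?H^2) <= 2 * degree h" using degree_power_le[of ?H 2] by (simp add: mult.commute)
 have "degree ([:(poly ?H z)^2:] - ?H^2) <= M"
  using dH degree_h_le YM degree_diff_le[of "[:(poly ?H z)^2:]" "2 * degree h" "?H^2"] by simp
 from quotient_difference[OF this _ M0, of z] obtain g1 where g1: "degree g1 < M"
  "!!x. (poly ?H z)^2 - (poly ?H x)^2 = (x - z) * poly g1 x" by auto
 have orth1: "sint s (%x. poly g1 (cx x) * ph x) = 0"
 proof -
  have "degree (?W * g1) < card Y + M" using g1(1) degree_mult_le[of ?W g1] by simp
  from exact_complex[OF this] have "sint s (%x. poly (?W * g1) (cx x) * cx (te x)) = 0"
   using poly_nodal_eq_0_iff[OF fY] by (simp del: of_real_divide add: sum.neutral)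
  thus ?thesis unfolding ph by (simp add: ac_simps del: of_real_divide)
 qed
 have 1: "(poly ?H z)^2 * ctr s ph z = ctr s (%x. (poly ?H (cx x))^2 * ph x) z"
 proof -
  have "ctr s (%x. (poly ?H z)^2 * ph x) z - ctr s (%x. (poly ?H (cx x))^2 * ph x) z
    = ctr s (%x. (poly ?H z)^2 * ph x - (poly ?H (cx x))^2 * ph x) z"
   by (rule ctr_diff[OF gm z, symmetric]) (intro tame_mult tame_const tph tame_power_poly)+
  also have "... = sint s (%x. (- 1) * (poly g1 (cx x) * ph x))" unfolding ctr_def
  proof (rule sint_cong[OF gm])
   show "tame Dl (%x. ((poly ?H z)^2 * ph x - (poly ?H (cx x))^2 * ph x) / (z - cx x))"
    by (intro tk tame_diff tame_mult tame_const tph tame_power_poly)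
   show "tame Dl (%x. (- 1) * (poly g1 (cx x) * ph x))" by (intro tame_mult tame_const tame_poly tph)
   fix x assume x: "x : Dl"
   have "(poly ?H z)^2 * ph x - (poly ?H (cx x))^2 * ph x = (- 1) * (poly g1 (cx x) * ph x) * (z - cx x)"
    unfolding left_diff_distrib[symmetric] g1(2) by (simp add: algebra_simps)
   thus "((poly ?H z)^2 * ph x - (poly ?H (cx x))^2 * ph x) / (z - cx x) = (- 1) * (poly g1 (cx x) * ph x)"
    unfolding nonzero_divide_eq_eq[OF zy[OF x]] .
  qed
  also have "... = 0" unfolding sint_cmult[OF gm] orth1 by simp
  finally show ?thesis unfolding ctr_cmult[OF gm] by simp
 qed
 \<comment> \<open>The maximum with \<open>1\<close> meets the condition \<open>d > 0\<close> of
   \<open>quotient_difference\<close> when both sets are empty.\<close>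
 define d where "d = max (max (card X) (card Y)) 1"
 have "degree (smult (poly ?W z) ?R - smult (poly ?R z) ?W) <= d"
  using degree_diff_le[of "smult (poly ?W z) ?R" d "smult (poly ?R z) ?W"] degree_smult_le[of "poly ?W z" ?R] degree_smult_le[of "poly ?R z" ?W]
  by (simp add: d_def)
 hence "EX g. degree g < d & (ALL x. poly (smult (poly ?W z) ?R - smult (poly ?R z) ?W) x = (x - z) * poly g x)"
  by (rule quotient_difference) (simp_all add: d_def)
 then obtain g2 where g2: "degree g2 < d"
  "!!x. poly ?W z * poly ?R x - poly ?R z * poly ?W x = (x - z) * poly g2 x"
  unfolding poly_diff poly_smult by blast
 have "degree (g2 * ?H^2) < card Y + M"
  using g2(1) dH degree_mult_le[of g2 "?H^2"] degree_h_le XM YM M0 unfolding d_def by linarith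
 from exact_complex[OF this]
 have "sint s (%x. poly (g2 * ?H^2) (cx x) * cx (te x))
   = cx (fst s * e) * (SUM y:Y. cx (Q.weight y) * poly (g2 * ?H^2) (cx y))" .
 also have "... = - poly ?W z * (cx (fst s) * (SUM y:Y. cx (La y) / (z - cx y)))"
 proof -
  have "cx e * (cx (Q.weight y) * poly (g2 * ?H^2) (cx y)) = - poly ?W z * (cx (La y) / (z - cx y))"
   if y: "y : Y" for y
  proof -
   have "poly ?W z * poly ?R (cx y) = - ((z - cx y) * poly g2 (cx y))"
    using g2(2)[of "cx y"] y poly_nodal_eq_0_iff[OF fY, of y] by (simp add: algebra_simps)
   moreover have "z - cx y ~= 0" using zy y YDl by blast
   ultimately have "poly g2 (cx y) = - (poly ?W z * poly ?R (cx y)) / (z - cx y)" by simp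
   thus ?thesis by (simp add: La_def ac_simps)
  qed
  hence "(SUM y:Y. cx e * (cx (Q.weight y) * poly (g2 * ?H^2) (cx y)))
    = (SUM y:Y. - poly ?W z * (cx (La y) / (z - cx y)))" by (rule sum.cong[OF refl])
  thus ?thesis unfolding sum_distrib_left[symmetric] by (simp only: of_real_mult mult.assoc mult.left_commute)
 qed
 also have "sint s (%x. poly (g2 * ?H^2) (cx x) * cx (te x))
   = sint s (%x. poly ?R z * ((poly ?H (cx x))^2 * ph x / (z - cx x)) - poly ?W z * (cx (poly u x * (poly h x)^2) / (z - cx x)))"
 proof (rule sint_cong[OF gm])
  show "tame Dl (%x. poly (g2 * ?H^2) (cx x) * cx (te x))" by (intro tame_mult tame_poly Q.tm)
  show "tame Dl (%x. poly ?R z * ((poly ?H (cx x))^2 * ph x / (z - cx x)) - poly ?W z * (cx (poly u x * (poly h x)^2) / (z - cx x)))"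
   by (intro tame_diff tame_cmult tk tame_mult tph tame_power_poly tame_uh)
  fix x assume x: "x : Dl"
  have R: "poly ?R (cx x) * cx (te x) = cx (poly u x)" using R_sign[OF x] by auto
  have "poly g2 (cx x) = (poly ?R z * poly ?W (cx x) - poly ?W z * poly ?R (cx x)) / (z - cx x)"
   unfolding nonzero_eq_divide_eq[OF zy[OF x]] using g2(2)[of "cx x"] by (simp only: algebra_simps)
  moreover have "(p * b - c * q) / w * (H * t) = H * (p * (b * t) - c * (q * t)) / w" for p b c q w H t :: complex
   by (simp add: algebra_simps)
  ultimately have "poly (g2 * ?H^2) (cx x) * cx (te x) = (poly ?H (cx x))^2 *
   (poly ?R z * (poly ?W (cx x) * cx (te x)) - poly ?W z * (poly ?R (cx x) * cx (te x))) / (z - cx x)"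
   unfolding poly_mult poly_power mult.assoc by (simp only:)
  also have "... = poly ?R z * ((poly ?H (cx x))^2 * ph x / (z - cx x)) - poly ?W z * (cx (poly u x * (poly h x)^2) / (z - cx x))"
   unfolding R ph[symmetric] by (simp add: algebra_simps diff_divide_distrib)
  finally show "poly (g2 * ?H^2) (cx x) * cx (te x) = ..." .
 qed
 also have "... = poly ?R z * ctr s (%x. (poly ?H (cx x))^2 * ph x) z - poly ?W z * ctr s (%x. cx (poly u x * (poly h x)^2)) z"
  unfolding ctr_def sint_cmult[OF gm, symmetric]
  by (rule sint_diff[OF gm]) (intro tame_cmult tk tame_mult tph tame_power_poly tame_uh)+
 finally have "poly ?R z * ((poly ?H z)^2 * ctr s ph z) = poly ?W z *
   (ctr s (%x. cx (poly u x * (poly h x)^2)) z - cx (fst s) * (SUM y:Y. cx (La y) / (z - cx y)))"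
  unfolding 1[symmetric] by (simp only: right_diff_distrib minus_mult_left[symmetric] diff_eq_eq) (simp add: algebra_simps)
 hence "poly ?R z * ((poly ?H z)^2 * ctr s ph z) / poly ?W z =
   ctr s (%x. cx (poly u x * (poly h x)^2)) z - cx (fst s) * (SUM y:Y. cx (La y) / (z - cx y))"
  unfolding nonzero_divide_eq_eq[OF Wz] by (simp only: mult.commute)
 thus ?thesis unfolding ph_def by (simp add: mult.left_commute)
qed

end

section \<open>Normal families with vanishing limits\<close>

lemma connected_complement_real:
 assumes "x0 ~: Dl"
 shows "connected (- cx ` Dl)"
proof (rule connected_intermediate_closure)
 \<comment> \<open>This set is star-shaped about \<open>x0\<close>, and the complement of the image
   of \<open>Dl\<close> lies between it and its closure.\<close>
 let ?U = "{z. Im z ~= 0} Un {cx x0}"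
 have seg: "closed_segment (cx x0) z <= ?U" if "z : ?U" for z
 proof
  fix w assume "w : closed_segment (cx x0) z"
  then obtain t where t: "0 <= t" "t <= 1" "w = (1 - t) *\<^sub>R cx x0 + t *\<^sub>R z" by (auto simp: closed_segment_def)
  show "w : ?U"
  proof (cases "t = 0 | z = cx x0")
   case True
   hence "w = cx x0" using t(3) by (auto simp: scaleR_left_distrib[symmetric])
   thus ?thesis by simp
  next
   case False
   hence "Im z ~= 0" using that by auto
   thus ?thesis using t(3) False by simp
  qed
 qed
 have "starlike ?U" unfolding starlike_def using seg by (intro bexI[of _ "cx x0"] ballI) auto
 thus "connected ?U" by (rule starlike_imp_connected)
 show "?U <= - cx ` Dl" using assms by auto
 have "closure {z. Im z ~= 0} = UNIV"
 proof -
  have "z : closure {z. Im z ~= 0}" for z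
  proof (rule closure_sequential[THEN iffD2], intro exI conjI allI)
   define c where "c = (if Im z >= 0 then 1 else - 1 :: real)"
   let ?w = "%n. z + \<i> * cx (c * inverse (real (Suc n)))"
   show "?w n : {z. Im z ~= 0}" for n
   proof -
    have b: "inverse (real (Suc n)) > 0" by simp
    have "Im (z + \<i> * cx (c * b)) ~= 0" if "b > 0" for b
     using that by (cases "Im z >= 0") (auto simp: c_def)
    thus ?thesis using b by blast
   qed
   have "?w ----> z + \<i> * cx (c * 0)" by (intro tendsto_intros LIMSEQ_inverse_real_of_nat)
   thus "?w ----> z" by simp
  qed
  thus ?thesis by auto
 qed
 moreover have "closure {z. Im z ~= 0} <= closure ?U" by (intro closure_mono) auto
 ultimately show "- cx ` Dl <= closure ?U" by auto
qed

text \<open>If convergence failed, a subsequence would stay away from \<open>0\<close> on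
  \<open>K\<close>; Montel's theorem extracts a convergent subsequence of it, whose limit is
  \<open>0\<close> by \<open>lim\<close>.\<close>

lemma vitali_zero:
 fixes F :: "nat => complex => complex"
 assumes S: "open S" and hol: "!!n. F n holomorphic_on S"
  and bd: "!!K. compact K ==> K <= S ==> EX B. ALL n. ALL z:K. norm (F n z) <= B"
  and lim: "!!r g. strict_mono r ==> g holomorphic_on S ==> (!!z. z : S ==> (%n. F (r n) z) ----> g z)
   ==> ALL z:S. g z = 0" and K: "compact K" "K <= S"
 shows "uniform_limit K F (%_. 0) sequentially"
proof (rule uniform_limitI, rule ccontr)
 fix ep :: real assume ep: "ep > 0"
 assume "\<not> (EVN n. ALL x:K. dist (F n x) 0 < ep)"
 hence "infinite {n. \<not> (ALL x:K. dist (F n x) 0 < ep)}"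
  by (simp add: cofinite_eq_sequentially[symmetric] eventually_cofinite)
 then obtain r0 :: "nat => nat" where r0: "strict_mono r0" "!!n. r0 n : {n. \<not> (ALL x:K. dist (F n x) 0 < ep)}"
  using infinite_enumerate by blast
 have "EX g r. g holomorphic_on S & strict_mono (r :: nat => nat) & (ALL x:S. (%n. F (r0 (r n)) x) ----> g x)
   & uniform_limit K ((%n. F (r0 n)) \<circ> r) g sequentially"
 proof (rule Montel[OF S, of "range F" "%n. F (r0 n)"])
  show "!!h. h : range F ==> h holomorphic_on S" using hol by auto
  show "!!K. compact K ==> K <= S ==> EX B. ALL h:range F. ALL z:K. norm (h z) <= B" using bd by (simp add: image_iff)
  show "range (%n. F (r0 n)) <= range F" by auto
  fix g and r :: "nat => nat"
  assume 1: "g holomorphic_on S" "strict_mono r" "!!x. x : S ==> (%n. F (r0 (r n)) x) ----> g x"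
   "!!K. compact K ==> K <= S ==> uniform_limit K ((%n. F (r0 n)) \<circ> r) g sequentially"
  thus ?thesis using K by blast
 qed
 then obtain g r where gr: "g holomorphic_on S" "strict_mono (r :: nat => nat)" "ALL x:S. (%n. F (r0 (r n)) x) ----> g x"
   "uniform_limit K ((%n. F (r0 n)) \<circ> r) g sequentially" by blast
 have "strict_mono (r0 \<circ> r)" using r0(1) gr(2) by (rule strict_mono_o)
 hence g0: "ALL z:S. g z = 0" by (rule lim[OF _ gr(1)]) (use gr(3) in auto)
 have "EVN n. ALL x:K. dist (F (r0 (r n)) x) (g x) < ep" using uniform_limitD[OF gr(4) ep] by simp
 then obtain n where "ALL x:K. dist (F (r0 (r n)) x) (g x) < ep"
  using eventually_happens'[OF sequentially_bot] by blast
 hence "ALL x:K. dist (F (r0 (r n)) x) 0 < ep" using g0 K(2) by (metis subsetD)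
 thus False using r0(2)[of "r n"] by simp
qed

text \<open>Maximum principle for \<open>f / nodal X\<close> on a disc of four times the radius:
  each factor of \<open>nodal X\<close> has modulus at least \<open>3 * dl\<close> on the boundary
  and at most \<open>2 * dl\<close> at \<open>z\<close>.\<close>

lemma zeros_decay:
 assumes U: "open U" "f holomorphic_on U" "cball c (4 * dl) <= U" and dl: "dl > 0"
  and B: "!!w. w : cball c (4 * dl) ==> norm (f w) <= B"
  and X: "finite X" "!!x. x : X ==> norm (cx x - c) <= dl & f (cx x) = 0" and z: "z : cball c dl"
 shows "norm (f z) <= B * (2 / 3) ^ card X"
proof -
 obtain Th where Th: "Th holomorphic_on U" "!!z. z : U ==> f z = pc (nodal X) z * Th z"
  using holomorphic_divide_nodal[OF U(1) X(1) U(2)] X(2) by blast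
 have B0: "B >= 0" using B[of c] dl order_trans[OF norm_ge_zero[of "f c"]] by auto
 have "norm (Th z) <= B / (3 * dl) ^ card X"
 proof (rule maximum_modulus_frontier[of Th "cball c (4 * dl)"])
  show "Th holomorphic_on interior (cball c (4 * dl))" using Th(1) U(3) by (meson holomorphic_on_subset interior_subset)
  show "continuous_on (closure (cball c (4 * dl))) Th"
   using holomorphic_on_imp_continuous_on[OF Th(1)] U(3) by (auto intro: continuous_on_subset)
  show "z : cball c (4 * dl)" using z dl by auto
  fix w assume "w : frontier (cball c (4 * dl))"
  hence w: "norm (w - c) = 4 * dl" using dl by (simp add: dist_norm norm_minus_commute frontier_cball)
  hence wc: "w : cball c (4 * dl)" by (simp add: dist_norm norm_minus_commute)
  have "(\<Prod>x\<in>X. 3 * dl) <= (\<Prod>x\<in>X. norm (w - cx x))"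
  proof (rule prod_mono)
   fix x assume "x : X"
   hence "norm (cx x - c) <= dl" using X(2) by blast
   moreover have "norm (w - c) <= norm (w - cx x) + norm (cx x - c)"
    using norm_triangle_ineq[of "w - cx x" "cx x - c"] by simp
   ultimately show "0 <= 3 * dl & 3 * dl <= norm (w - cx x)" using w dl by auto
  qed
  hence R: "(3 * dl) ^ card X <= norm (pc (nodal X) w)"
   unfolding poly_cpoly_nodal prod_norm[symmetric] by simp
  have pos: "(3 * dl) ^ card X > 0" using dl by simp
  have "(3 * dl) ^ card X * norm (Th w) <= norm (pc (nodal X) w) * norm (Th w)"
   using R by (intro mult_right_mono) auto
  also have "... = norm (f w)" using Th(2)[of w] wc U(3) by (auto simp: norm_mult)
  also have "... <= B" by (rule B[OF wc])
  finally show "norm (Th w) <= B / (3 * dl) ^ card X" using pos by (simp add: pos_le_divide_eq mult.commute)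
 qed auto
 moreover have "norm (pc (nodal X) z) <= (2 * dl) ^ card X"
 proof -
  have "(\<Prod>x\<in>X. norm (z - cx x)) <= (\<Prod>x\<in>X. 2 * dl)"
  proof (rule prod_mono)
   fix x assume "x : X"
   hence "norm (cx x - c) <= dl" using X(2) by blast
   moreover have "norm (z - cx x) <= norm (z - c) + norm (cx x - c)"
    using norm_triangle_ineq4[of "z - c" "cx x - c"] by simp
   ultimately show "0 <= norm (z - cx x) & norm (z - cx x) <= 2 * dl"
    using z by (simp add: dist_norm norm_minus_commute)
  qed
  thus ?thesis unfolding poly_cpoly_nodal prod_norm[symmetric] by simp
 qed
 ultimately have "norm (pc (nodal X) z) * norm (Th z) <= (2 * dl) ^ card X * (B / (3 * dl) ^ card X)"
  using dl by (intro mult_mono) auto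
 also have "... = B * (2 / 3) ^ card X" using dl by (simp add: power_mult_distrib power_divide)
 also have "norm (pc (nodal X) z) * norm (Th z) = norm (f z)"
 proof -
  have "z : U" using z U(3) dl by auto
  thus ?thesis using Th(2)[of z] by (simp add: norm_mult)
 qed
 finally show ?thesis .
qed

text \<open>Finitely many small discs cover \<open>C\<close>, so for infinitely many
  \<open>n\<close> one fixed disc contains at least the share \<open>1 / card D\<close> of the
  zeros. There \<open>zeros_decay\<close> forces the limit to vanish, and the identity theorem
  extends this to \<open>S\<close>.\<close>

lemma many_zeros_limit_zero:
 fixes F :: "nat => complex => complex"
 assumes S: "open S" "connected S" and hol: "!!n. F n holomorphic_on S"
  and bd: "!!K. compact K ==> K <= S ==> EX B. ALL n. ALL z:K. norm (F n z) <= B"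
  and C: "compact C" "cx ` C <= S"
  and X: "!!n. finite (X n)" "!!n. X n <= C" "!!n x. x : X n ==> F n (cx x) = 0"
  and card: "filterlim (%n. card (X n)) at_top sequentially"
  and g: "g holomorphic_on S" "!!z. z : S ==> (%n. F n z) ----> g z"
 shows "ALL z:S. g z = 0"
proof -
 have cC: "compact (cx ` C)" using C(1) by (intro compact_continuous_image continuous_intros)
 obtain dl where dl: "dl > 0" "!!c. c : cx ` C ==> cball c (4 * dl) <= S"
 proof (cases "S = UNIV")
  case True
  thus ?thesis using that[of 1] by simp
 next
  case False
  have "\<exists>d>0. ALL x:cx ` C. ALL y:-S. d <= dist x y"
   by (rule separate_compact_closed[OF cC]) (use S(1) C(2) in auto)
  then obtain d where d: "d > 0" "!!x y. x : cx ` C ==> y ~: S ==> d <= dist x y" by auto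
  show ?thesis
  proof (rule that[of "d / 8"])
   fix c assume c: "c : cx ` C"
   show "cball c (4 * (d / 8)) <= S"
   proof
    fix w assume "w : cball c (4 * (d / 8))"
    hence "dist c w < d" using d(1) by simp
    thus "w : S" using d(2)[OF c, of w] by fastforce
   qed
  qed (use d in simp)
 qed
 obtain D where D: "finite D" "D <= cx ` C" "cx ` C <= (\<Union>c\<in>D. ball c dl)"
 proof (rule compactE_image[OF cC, of "cx ` C" "%c. ball c dl"])
  show "cx ` C <= (\<Union>c\<in>cx ` C. ball c dl)" using dl(1) by force
 qed auto
 define Xc where "Xc n c = {x : X n. norm (cx x - c) <= dl}" for n and c :: complex
 have "EX c. infinite {n. card (X n) <= card D * card (Xc n c)} & (c : D)"
 proof (rule ccontr)
  assume no: "\<not> ?thesis"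
  have "EVN n. card (X n) > 0"
   using card[unfolded filterlim_at_top, rule_format, of 1] by eventually_elim simp
  then obtain N where N: "!!n. n >= N ==> card (X n) > 0" unfolding eventually_sequentially by blast
  have "{N..} <= (\<Union>c\<in>D. {n. card (X n) <= card D * card (Xc n c)})"
  proof
   fix n assume "n : {N..}"
   hence n: "card (X n) > 0" using N by simp
   have "X n <= (\<Union>c\<in>D. Xc n c)"
   proof
    fix x assume x: "x : X n"
    hence "cx x : (\<Union>c\<in>D. ball c dl)" using X(2) D(3) by blast
    thus "x : (\<Union>c\<in>D. Xc n c)" using x by (auto simp: Xc_def dist_norm norm_minus_commute intro: less_imp_le)
   qed
   hence "card (X n) <= card (\<Union>c\<in>D. Xc n c)" using D(1) X(1) by (intro card_mono) (auto simp: Xc_def)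
   also have "... <= (SUM c:D. card (Xc n c))" by (rule card_UN_le[OF D(1)])
   finally have le: "card (X n) <= (SUM c:D. card (Xc n c))" .
   have "EX c:D. card (X n) <= card D * card (Xc n c)"
   proof (rule ccontr)
    assume "\<not> ?thesis"
    hence "(SUM c:D. card D * card (Xc n c)) < (SUM c:D. card (X n))"
     using D(1) le n by (intro sum_strict_mono) (auto simp: not_le)
    thus False using le n by (simp add: sum_distrib_left[symmetric])
   qed
   thus "n : (\<Union>c\<in>D. {n. card (X n) <= card D * card (Xc n c)})" by blast
  qed
  moreover have "finite (\<Union>c\<in>D. {n. card (X n) <= card D * card (Xc n c)})" using no D(1) by blast
  ultimately have "finite {N..}" by (rule finite_subset)
  thus False using infinite_Ici[of N] by blast
 qed
 then obtain c where c: "infinite {n. card (X n) <= card D * card (Xc n c)}" "c : D" by blast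
 then obtain r :: "nat => nat" where r: "strict_mono r" "!!n. r n : {n. card (X n) <= card D * card (Xc n c)}"
  using infinite_enumerate by blast
 have cS: "cball c (4 * dl) <= S" using dl(2) c(2) D(2) by blast
 obtain B where B: "!!n z. z : cball c (4 * dl) ==> norm (F n z) <= B" using bd[OF compact_cball cS] by blast
 have lim: "filterlim (%n. card (Xc (r n) c)) at_top sequentially"
 proof (unfold filterlim_at_top, rule allI)
  fix Z
  have "EVN n. card (X n) >= card D * Z" using card by (simp add: filterlim_at_top)
  hence "EVN n. card (X (r n)) >= card D * Z" by (rule eventually_compose_filterlim[OF _ filterlim_subseq[OF r(1)]])
  thus "EVN n. Z <= card (Xc (r n) c)"
  proof eventually_elim
   case (elim n)
   have "card D > 0" using c(2) D(1) by (auto simp: card_gt_0_iff)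
   moreover have "card D * Z <= card D * card (Xc (r n) c)" by (rule order_trans[OF elim]) (use r(2)[of n] in simp)
   ultimately show ?case by simp
  qed
 qed
 have g0: "g z = 0" if z: "z : ball c dl" for z
 proof -
  have zS: "z : S" using z cS dl(1) by auto
  have "(%n. F (r n) z) ----> 0"
  proof (rule Lim_null_comparison)
   show "EVN n. norm (F (r n) z) <= B * (2 / 3) ^ card (Xc (r n) c)"
   proof (rule always_eventually, rule allI)
    fix n
    show "norm (F (r n) z) <= B * (2 / 3) ^ card (Xc (r n) c)"
     by (rule zeros_decay[OF S(1) hol cS dl(1) B]) (use X z in \<open>auto simp: Xc_def\<close>)
   qed
   have "(%k::nat. (2 / 3) ^ k :: real) ----> 0" by (rule LIMSEQ_realpow_zero) auto
   from filterlim_compose[OF this lim] have "(%n. B * (2 / 3) ^ card (Xc (r n) c)) ----> B * 0" by (intro tendsto_mult_left)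
   thus "(%n. B * (2 / 3) ^ card (Xc (r n) c)) ----> 0" by simp
  qed
  moreover have "(%n. F (r n) z) ----> g z" using LIMSEQ_subseq_LIMSEQ[OF g(2)[OF zS] r(1)] by (simp add: o_def)
  ultimately show ?thesis using LIMSEQ_unique by blast
 qed
 have "c : S" using cS dl(1) by auto
 moreover have "c islimpt ball c dl" using dl(1) by (simp add: islimpt_ball)
 moreover have "ball c dl <= S" using cS dl(1) by (auto intro!: subsetD[OF cS])
 ultimately show ?thesis using analytic_continuation[OF g(1) S, of "ball c dl" c] g0 by blast
qed

section \<open>Carleman's condition for the shifted moments\<close>

context
 fixes Dl :: "real set" and s :: smeasure and ep A :: real
 assumes g: "gmeas Dl s" and ep: "ep = 1 | ep = -1" and A: "A >= 1" and y1: "!!x. x : Dl ==> 1 <= ep * x + A"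
begin

private abbreviation (input) S :: "nat => real" where "S i == \<integral>x. (ep * x + A) ^ i \<partial>snd s"

lemma integrable_real_poly: "integrable (snd s) (%x. poly p x :: real)"
 using tame_integrable[OF g tame_cpoly_real[of Dl p]] by (simp only: complex_of_real_integrable_eq)

lemma shift_integrable: "integrable (snd s) (%x. (ep * x + A) ^ i)"
 using integrable_real_poly[of "[:A, ep:] ^ i"] by (simp add: poly_power add.commute mult.commute)

lemma power_integrable: "integrable (snd s) (%x. (ep * x) ^ i)"
 using integrable_real_poly[of "[:0, ep:] ^ i"] by (simp add: poly_power mult.commute)

lemma shift_pos: "S i > 0"
proof (rule gmeas_AE_pos_integral[OF g shift_integrable])
 have pos: "AE x in snd s. (ep * x + A) ^ i > 0"
  using gmeasD(6)[OF g] by eventually_elim (use y1 in \<open>fastforce intro: zero_less_power\<close>)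
 thus "AE x in snd s. 0 <= (ep * x + A) ^ i" by eventually_elim simp
 show "\<not> (AE x in snd s. (ep * x + A) ^ i = 0)"
 proof
  assume "AE x in snd s. (ep * x + A) ^ i = 0"
  hence "AE x in snd s. x : {}" using pos by eventually_elim linarith
  thus False using gmeasD(8)[OF g, of "{}"] by blast
 qed
qed

text \<open>Integrate \<open>w^i * (w - \<tau>)^2 >= 0\<close> for \<open>w = ep * x + A\<close>,
  with the value of \<open>\<tau>\<close> that minimizes the integral.\<close>

lemma shift_convex: "S (Suc i) * S (Suc i) <= S i * S (Suc (Suc i))"
proof -
 define \<tau> where "\<tau> = S (Suc i) / S i"
 have "0 <= (LINT x|snd s. (ep * x + A) ^ Suc (Suc i) - 2 * \<tau> * (ep * x + A) ^ Suc i + \<tau>^2 * (ep * x + A) ^ i)"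
 proof (rule integral_nonneg_AE)
  show "AE x in snd s. 0 <= (ep * x + A) ^ Suc (Suc i) - 2 * \<tau> * (ep * x + A) ^ Suc i + \<tau>^2 * (ep * x + A) ^ i"
   using gmeasD(6)[OF g]
  proof eventually_elim
   case (elim x)
   define w where "w = ep * x + A"
   have "w >= 0" using y1[OF elim] by (simp add: w_def)
   hence "0 <= w ^ i * (w - \<tau>)^2" by simp
   also have "... = w ^ Suc (Suc i) - 2 * \<tau> * w ^ Suc i + \<tau>^2 * w ^ i" by (simp add: power2_eq_square algebra_simps)
   finally show ?case unfolding w_def .
  qed
 qed
 also have "... = S (Suc (Suc i)) - 2 * \<tau> * S (Suc i) + \<tau>^2 * S i"
  using shift_integrable[of "Suc (Suc i)"] shift_integrable[of "Suc i"] shift_integrable[of i]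
  by (simp del: power_Suc)
 finally have "0 <= (S (Suc (Suc i)) - 2 * \<tau> * S (Suc i) + \<tau>^2 * S i) * S i"
  using shift_pos[of i] by (intro mult_nonneg_nonneg) auto
 also have "... = S i * S (Suc (Suc i)) - S (Suc i) * S (Suc i)"
  using shift_pos[of i] by (simp add: \<tau>_def power2_eq_square field_simps del: power_Suc)
 finally show ?thesis by simp
qed

text \<open>For bounded support the ratios are bounded below. This case is separate because there
  the moments of \<open>s\<close> may be far smaller than the shifted ones, or vanish.\<close>

lemma ratio_divergence_bounded:
 assumes b: "AE x in snd s. abs x <= b"
 shows "\<not> summable (%i. sqrt (S i / S (Suc i)))"
proof
 define K where "K = abs b + A"
 have K: "K > 0" using A by (simp add: K_def)
 have le: "S (Suc i) <= K * S i" for i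
 proof -
  have "S (Suc i) <= (LINT x|snd s. K * (ep * x + A) ^ i)"
  proof (rule integral_mono_AE)
   show "AE x in snd s. (ep * x + A) ^ Suc i <= K * (ep * x + A) ^ i" using gmeasD(6)[OF g] b
   proof eventually_elim
    case (elim x)
    have "ep * x + A <= K" using elim(2) ep by (auto simp: K_def)
    thus ?case using y1[OF elim(1)] by (simp add: mult_right_mono)
   qed
  qed (intro shift_integrable integrable_mult_right)+
  thus ?thesis by simp
 qed
 assume "summable (%i. sqrt (S i / S (Suc i)))"
 hence "(%i. sqrt (S i / S (Suc i))) ----> 0" by (rule summable_LIMSEQ_zero)
 moreover have "sqrt (1 / K) <= sqrt (S i / S (Suc i))" for i
  using le[of i] shift_pos[of i] shift_pos[of "Suc i"] K by (intro real_sqrt_le_mono) (simp add: divide_simps mult.commute)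
 ultimately have "sqrt (1 / K) <= 0" by (intro LIMSEQ_le_const) auto
 thus False using K by simp
qed

text \<open>Unbounded support is unbounded in the direction \<open>ep\<close>, and the mass beyond
  \<open>4 * A\<close> dominates. With \<open>t = ep * x\<close> one has
  \<open>8^n t^n - (t + A)^n >= (4 t)^n >= (16 A)^n\<close> there, while elsewhere the difference is
  at least \<open>- 2 (8 A)^n\<close>; so its integral is eventually nonnegative.\<close>

lemma shift_moment_le:
 assumes nb: "!!b. \<not> (AE x in snd s. abs x <= b)"
 shows "EVN n. S n <= 8 ^ n * abs (moment s n)"
proof -
 interpret finite_measure "snd s" by (rule gmeas_finite[OF g])
 define E where "E = {x. 4 * A <= ep * x}"
 have E[measurable]: "E : sets (snd s)" unfolding E_def gmeasD(2)[OF g] by measurable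
 have pt: "(16 * A) ^ n * indicator E x - 2 * (8 * A) ^ n <= 8 ^ n * (ep * x) ^ n - (ep * x + A) ^ n"
  if x: "x : Dl" and n: "n >= 1" for x n
 proof -
  define t where "t = ep * x"
  have t: "t + A >= 1" using y1[OF x] by (simp add: t_def)
  consider "t >= 4 * A" | "A <= t" "t < 4 * A" | "t < A" by linarith
  hence "(16 * A) ^ n * indicator E x - 2 * (8 * A) ^ n <= 8 ^ n * t ^ n - (t + A) ^ n"
  proof cases
   case 1
   have e1: "(2::real) ^ n <= 4 ^ n" by (intro power_mono) auto
   have "(2::real) ^ 1 <= 2 ^ n" using n by (intro power_increasing) auto
   hence "(2::real) * 4 ^ n <= 2 ^ n * 4 ^ n" by (intro mult_right_mono) auto
   moreover have "(2::real) ^ n * 4 ^ n = 8 ^ n" by (simp add: power_mult_distrib[symmetric])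
   ultimately have e: "(4::real) ^ n + 2 ^ n <= 8 ^ n" using e1 by linarith
   have "(t + A) ^ n <= (2 * t) ^ n" using 1 A t by (intro power_mono) auto
   moreover have "(16 * A) ^ n <= (4 * t) ^ n" using 1 A by (intro power_mono) auto
   moreover have "(4 * t) ^ n + (2 * t) ^ n <= 8 ^ n * t ^ n"
    using mult_right_mono[OF e, of "t ^ n"] 1 A by (simp add: power_mult_distrib distrib_right)
   moreover have "(16 * A) ^ n * indicator E x <= (16 * A) ^ n" using A by (simp add: indicator_def)
   moreover have "0 <= 2 * (8 * A) ^ n" using A by simp
   ultimately show ?thesis by linarith
  next
   case 2
   have "(t + A) ^ n <= (8 * t) ^ n" using 2 A t by (intro power_mono) auto
   moreover have "(8 * t) ^ n = 8 ^ n * t ^ n" by (rule power_mult_distrib)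
   moreover have "(16 * A) ^ n * indicator E x = 0" using 2 by (simp add: E_def t_def)
   moreover have "0 <= 2 * (8 * A) ^ n" using A by simp
   ultimately show ?thesis by linarith
  next
   case 3
   have "(t + A) ^ n <= (8 * A) ^ n" using 3 A t by (intro power_mono) auto
   moreover have "abs (8 * t) ^ n <= (8 * A) ^ n" using 3 A t by (intro power_mono) auto
   moreover have "- (abs (8 * t) ^ n) <= (8 * t) ^ n" unfolding power_abs[symmetric] by linarith
   moreover have "(8 * t) ^ n = 8 ^ n * t ^ n" by (rule power_mult_distrib)
   moreover have "(16 * A) ^ n * indicator E x = 0" using 3 A by (simp add: E_def t_def)
   ultimately show ?thesis by linarith
  qed
  thus ?thesis unfolding t_def .
 qed
 define dl where "dl = measure (snd s) E"
 have dl: "dl > 0"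
 proof (rule ccontr)
  assume "\<not> dl > 0"
  hence "measure (snd s) E = 0" using measure_nonneg[of "snd s" E] by (simp add: dl_def)
  hence "E : null_sets (snd s)" by (simp add: emeasure_eq_measure null_sets_def)
  hence "AE x in snd s. x ~: E" by (rule AE_not_in)
  with gmeasD(6)[OF g] have "AE x in snd s. abs x <= 4 * A"
  proof eventually_elim
   case (elim x)
   show ?case using y1[OF elim(1)] elim(2) ep by (auto simp: E_def)
  qed
  thus False using nb by blast
 qed
 define \<mu> where "\<mu> = measure (snd s) (space (snd s))"
 obtain N where N: "2 * \<mu> / dl < 2 ^ N" using real_arch_pow[of 2] by auto
 have "EVN n. 2 * \<mu> / dl <= 2 ^ n" using eventually_ge_at_top[of N]
 proof eventually_elim
  case (elim n)
  have "(2::real) ^ N <= 2 ^ n" using elim by (intro power_increasing) auto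
  thus ?case using N by linarith
 qed
 with eventually_ge_at_top[of "1::nat"] show ?thesis
 proof eventually_elim
  case (elim n)
  have "2 * \<mu> <= dl * 2 ^ n" using elim(2) dl by (simp add: pos_divide_le_eq mult.commute)
  define p where "p = (8 * A) ^ n"
  have p: "(16 * A) ^ n = p * 2 ^ n" unfolding p_def power_mult_distrib[symmetric] by simp
  have "p * (2 * \<mu>) <= p * (dl * 2 ^ n)" using A `2 * \<mu> <= dl * 2 ^ n` by (intro mult_left_mono) (auto simp: p_def)
  hence "0 <= (16 * A) ^ n * dl - 2 * (8 * A) ^ n * \<mu>"
   unfolding p p_def[symmetric] by (simp add: mult.commute mult.left_commute)
  also have "... = (LINT x|snd s. (16 * A) ^ n * indicator E x - 2 * (8 * A) ^ n)"
   by (subst Bochner_Integration.integral_diff) (auto simp: dl_def \<mu>_def emeasure_eq_measure)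
  also have "... <= (LINT x|snd s. 8 ^ n * (ep * x) ^ n - (ep * x + A) ^ n)"
  proof (rule integral_mono_AE)
   show "AE x in snd s. (16 * A) ^ n * indicator E x - 2 * (8 * A) ^ n <= 8 ^ n * (ep * x) ^ n - (ep * x + A) ^ n"
    using gmeasD(6)[OF g] by eventually_elim (rule pt[OF _ elim(1)])
   show "integrable (snd s) (%x. 8 ^ n * (ep * x) ^ n - (ep * x + A) ^ n)"
    by (intro Bochner_Integration.integrable_diff integrable_mult_right shift_integrable power_integrable)
   show "integrable (snd s) (%x. (16 * A) ^ n * indicator E x - 2 * (8 * A) ^ n)"
    by (auto simp: emeasure_eq_measure)
  qed
  also have "... = 8 ^ n * (ep ^ n * (LINT x|snd s. x ^ n)) - S n"
   using shift_integrable[of n] power_integrable[of n]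
   by (subst Bochner_Integration.integral_diff) (auto simp: power_mult_distrib)
  finally have "S n <= 8 ^ n * (ep ^ n * (LINT x|snd s. x ^ n))" by simp
  also have "... <= 8 ^ n * abs (ep ^ n * (LINT x|snd s. x ^ n))" by (intro mult_left_mono) auto
  also have "abs (ep ^ n * (LINT x|snd s. x ^ n)) = abs (moment s n)"
   using ep gmeasD(1)[OF g] by (auto simp: moment_def abs_mult power_abs)
  finally show ?case .
 qed
qed

text \<open>The products of the ratios telescope to \<open>sqrt (S 0 / S n)\<close>. If the series
  of ratios converged, Carleman's inequality would make the series of the \<open>n\<close>-th roots
  of these products converge, and comparison of \<open>S n\<close> with the moments would contradict
  Carleman's condition.\<close>

lemma ratio_divergence:
 assumes car: "carleman s"
 shows "\<not> summable (%i. sqrt (S i / S (Suc i)))"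
proof (cases "EX b. AE x in snd s. abs x <= b")
 case True
 thus ?thesis using ratio_divergence_bounded by blast
next
 case False
 hence ev: "EVN n. S n <= 8 ^ n * abs (moment s n)" using shift_moment_le by blast
 show ?thesis
 proof
  assume sm: "summable (%i. sqrt (S i / S (Suc i)))"
  have r: "sqrt (S i / S (Suc i)) > 0" for i using shift_pos[of i] shift_pos[of "Suc i"] by simp
  define P where "P n = (\<Prod>i<n. sqrt (S i / S (Suc i)))" for n
  have P: "P n = sqrt (S 0 / S n)" for n
  proof (induction n)
   case (Suc n)
   have "P (Suc n) = sqrt (S 0 / S n) * sqrt (S n / S (Suc n))" using Suc by (simp add: P_def)
   also have "... = sqrt (S 0 / S (Suc n))" using shift_pos[of n] by (simp add: real_sqrt_mult[symmetric] del: power_Suc)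
   finally show ?case .
  next
   case 0
   show ?case using shift_pos[of 0] by (simp add: P_def)
  qed
  have "summable (%n. P (Suc n) powr (1 / real (Suc n)))"
  proof (rule summableI_nonneg_bounded)
   fix n
   have "(SUM i<n. P (Suc i) powr (1 / real (Suc i))) = (SUM i=1..n. P i powr (1 / real i))"
    by (rule sum.reindex_bij_witness[of _ "%i. i - 1" Suc]) auto
   also have "... <= exp 1 * (SUM i<n. sqrt (S i / S (Suc i)))" unfolding P_def by (rule carleman_inequality[OF r])
   also have "... <= exp 1 * (\<Sum>i. sqrt (S i / S (Suc i)))"
    using r by (intro mult_left_mono sum_le_suminf[OF sm]) (auto intro: less_imp_le)
   finally show "(SUM i<n. P (Suc i) powr (1 / real (Suc i))) <= exp 1 * (\<Sum>i. sqrt (S i / S (Suc i)))" .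
  qed simp
  hence sP: "summable (%n. P n powr (1 / real n))" by (subst summable_Suc_iff[symmetric])
  \<comment> \<open>\<open>sqrt 8\<close> is \<open>8^n\<close> to the power
    \<open>1 / (2 * n)\<close>, from \<open>shift_moment_le\<close>; the maximum bounds the powers
    of \<open>1 / S 0\<close> with exponents between \<open>0\<close> and \<open>1\<close>.\<close>
  define C where "C = sqrt 8 * max 1 (1 / S 0)"
  have "summable (%n::nat. if n >= 1 & moment s n ~= 0 then abs (moment s n) powr (- 1 / (2 * real n)) else 0)"
  proof (rule summable_comparison_test_ev[OF _ summable_mult[OF sP, of C]])
   show "EVN n. norm (if n >= 1 & moment s n ~= 0 then abs (moment s n) powr (- 1 / (2 * real n)) else 0) <= C * P n powr (1 / real n)"
    using ev eventually_ge_at_top[of "1::nat"]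
   proof eventually_elim
    case (elim n)
    have Sn: "S n > 0" "S 0 > 0" by (rule shift_pos)+
    define q where "q = 1 / (2 * real n)"
    have q: "q > 0" "q <= 1" using elim(2) by (auto simp: q_def)
    have "S n / 8 ^ n <= abs (moment s n)" using elim(1) by (simp add: pos_divide_le_eq mult.commute)
    hence "abs (moment s n) powr (- q) <= (S n / 8 ^ n) powr (- q)"
     using Sn q by (intro powr_mono2') auto
    also have "... = 8 powr (real n * q) * (1 / S n) powr q"
    proof -
     have "(S n / 8 ^ n) powr (- q) = inverse (S n / 8 ^ n) powr q"
      using Sn by (simp add: powr_minus inverse_powr del: inverse_divide)
     also have "inverse (S n / 8 ^ n) = 8 ^ n * (1 / S n)" by simp
     also have "(8 ^ n * (1 / S n)) powr q = (8 ^ n) powr q * (1 / S n) powr q" using Sn by (intro powr_mult)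
     also have "((8::real) ^ n) powr q = 8 powr (real n * q)" by (simp add: powr_realpow[symmetric] powr_powr)
     finally show ?thesis .
    qed
    also have "8 powr (real n * q) = sqrt 8" using elim(2) by (simp add: q_def powr_half_sqrt[symmetric])
    also have "(1 / S n) powr q = (1 / S 0) powr q * (S 0 / S n) powr q"
     using Sn by (subst powr_mult[symmetric]) auto
    also have "(1 / S 0) powr q <= max 1 (1 / S 0)"
    proof (cases "1 / S 0 <= 1")
     case True
     thus ?thesis using Sn q powr_mono2[of q "1 / S 0" 1] by simp
    next
     case False
     hence "(1 / S 0) powr q <= (1 / S 0) powr 1" using q by (intro powr_mono) auto
     thus ?thesis using Sn by simp
    qed
    also have "(S 0 / S n) powr q = P n powr (1 / real n)"
    proof -
     have "P n powr (1 / real n) = ((S 0 / S n) powr (1 / 2)) powr (1 / real n)"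
      using Sn by (simp add: P powr_half_sqrt)
     thus ?thesis by (simp add: powr_powr q_def)
    qed
    finally have "abs (moment s n) powr (- q) <= sqrt 8 * (max 1 (1 / S 0) * P n powr (1 / real n))"
     by (simp add: mult_left_mono mult_right_mono)
    moreover have "- 1 / (2 * real n) = - q" by (simp add: q_def)
    moreover have "0 <= C * P n powr (1 / real n)" by (simp add: C_def)
    ultimately show ?case by (simp add: C_def mult.assoc)
   qed
  qed
  thus False using car unfolding carleman_def by blast
 qed
qed

end

text \<open>One number \<open>c\<close> bounds all defects, namely those of the orthogonality and of
  the numbers of nodes and interpolation points, and also the growth of \<open>u\<close>. The
  condition \<open>n0 > 2 * c\<close> makes \<open>M n > c\<close>, so that at least the total
  masses agree.\<close>

locale pade_seq =
 fixes Dl Dl' :: "real set" and s :: smeasure and X Y :: "nat => real set" and u P :: "nat => real poly"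
  and M :: "nat => nat" and c n0 :: nat
 assumes gm: "gmeas Dl s" and Dl': "closed Dl'" "convex Dl'" "Dl' ~= {}" "Dl Int Dl' = {}"
  and n0: "n0 > 2 * c" and sets: "!!n. n >= n0 ==> finite (X n)" "!!n. n >= n0 ==> X n <= Dl'"
   "!!n. n >= n0 ==> finite (Y n)" "!!n. n >= n0 ==> Y n <= Dl"
  and u: "!!n. n >= n0 ==> u n ~= 0" "!!n x. n >= n0 ==> x : Dl ==> 0 <= poly (u n) x"
   "!!n x. n >= n0 ==> abs (poly (u n) x) <= (1 + abs x) ^ c"
  and card: "!!n. n >= n0 ==> n <= M n + c" "!!n. n >= n0 ==> card (X n) <= M n + c"
   "!!n. n >= n0 ==> card (Y n) <= M n + c" "!!n. n >= n0 ==> n <= card (X n) + c"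
  and orth: "!!n p. n >= n0 ==> degree p < M n ==>
   (LINT x|snd s. poly p x * (poly (nodal (Y n) * u n) x / poly (nodal (X n)) x)) = 0"
  and rem: "!!n z. n >= n0 ==> z ~: cx ` Dl ==>
   pc (nodal (Y n) * u n) z * cauchy s z - pc (P n) z
   = pc (nodal (X n)) z * ctr s (%x. cx (poly (nodal (Y n) * u n) x / poly (nodal (X n)) x)) z"
begin

definition G :: "nat => complex => complex" where
 "G n z = pc (u n) z * cauchy s z - pc (P n) z / pc (nodal (Y n)) z"

lemma W_nonzero: "n >= n0 ==> z ~: cx ` Dl ==> pc (nodal (Y n)) z ~= 0"
 using sets(3,4) by (auto simp: poly_cpoly_nodal_eq_0_iff)

text \<open>What is kept of \<open>pade_quad\<close> for one \<open>n\<close>, with all degrees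
  absorbed in \<open>c\<close>; a single predicate allows one pair to be selected for every
  \<open>n\<close> in \<open>hL\<close>.\<close>

definition positive_rule :: "nat => real poly => (real => real) => bool" where
 "positive_rule n h La \<longleftrightarrow> (ALL x. (poly h x)^2 <= (1 + abs x) ^ c)
  & (ALL kp z. 0 < kp --> kp <= 1 --> (ALL y:Dl. kp * (1 + abs y) <= norm (z - cx y)) --> kp ^ c <= (norm (pc h z))^2)
  & (ALL y:Y n. 0 <= La y)
  & (ALL p. degree p + c < M n --> (LINT x|snd s. poly (u n) x * (poly h x)^2 * poly p x) = (SUM y:Y n. La y * poly p y))
  & (ALL z. z ~: cx ` Dl --> (pc h z)^2 * G n z
     = ctr s (%x. cx (poly (u n) x * (poly h x)^2)) z - cx (fst s) * (SUM y:Y n. cx (La y) / (z - cx y)))"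

lemma quadrature_exists:
 assumes n: "n >= n0"
 shows "EX h La. positive_rule n h La"
proof -
 have XDl: "X n Int Dl = {}" using sets(2)[OF n] Dl'(4) by blast
 obtain e :: real where e: "e = 1 | e = -1" "!!x. x : Dl ==> e * poly (nodal (X n)) x > 0"
 proof (rule no_zero_sign[of Dl "poly (nodal (X n))"])
  show "convex Dl" by (rule gmeasD(4)[OF gm])
  show "continuous_on Dl (poly (nodal (X n)))" by (intro continuous_intros)
  show "poly (nodal (X n)) x ~= 0" if "x : Dl" for x
   using that XDl by (auto simp: poly_nodal_eq_0_iff[OF sets(1)[OF n]])
 qed blast
 have Mc: "M n > c" using card(1)[OF n] n n0 by linarith
 interpret pade_quad Dl s "Y n" "X n" "u n" e "M n"
  by standard (use gm sets[OF n] XDl e u(1,2)[OF n] orth[OF n] card(2,3)[OF n] Mc in auto)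
 have dh: "2 * degree h <= c" using degree_h_le card(3)[OF n] by linarith
 show ?thesis unfolding positive_rule_def
 proof (intro exI[of _ h] exI[of _ La] conjI allI impI ballI)
  fix x :: real
  show "(poly h x)^2 <= (1 + abs x) ^ c"
   by (rule order_trans[OF h_upper]) (use dh in \<open>intro power_increasing; auto\<close>)
 next
  fix kp and z :: complex assume kp: "0 < kp" "kp <= 1" "ALL y:Dl. kp * (1 + abs y) <= norm (z - cx y)"
  have "kp ^ c <= kp ^ (2 * degree h)" using kp dh by (intro power_decreasing) auto
  also have "... = (kp ^ degree h)^2" by (simp add: power_mult[symmetric] mult.commute)
  also have "... <= (norm (pc h z))^2" using kp by (intro power_mono h_lower) auto
  finally show "kp ^ c <= (norm (pc h z))^2" .
 next
  fix y assume "y : Y n"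
  thus "0 <= La y" by (rule La_nonneg)
 next
  fix p :: "real poly" assume "degree p + c < M n"
  thus "(LINT x|snd s. poly (u n) x * (poly h x)^2 * poly p x) = (SUM y:Y n. La y * poly p y)"
   using degree_h_le card(2)[OF n] by (intro moments_match) linarith
 next
  fix z assume z: "z ~: cx ` Dl"
  have "G n z = pc (nodal (X n)) z / pc (nodal (Y n)) z
    * ctr s (%x. cx (poly (nodal (Y n) * u n) x / poly (nodal (X n)) x)) z"
   using rem[OF n z, symmetric] W_nonzero[OF n z] by (simp add: G_def diff_divide_distrib)
  thus "(pc h z)^2 * G n z
     = ctr s (%x. cx (poly (u n) x * (poly h x)^2)) z - cx (fst s) * (SUM y:Y n. cx (La y) / (z - cx y))"
   using stieltjes_representation[OF z] by simp
 qed
qed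

lemma G_zero: "n >= n0 ==> x : X n ==> G n (cx x) = 0"
proof -
 assume n: "n >= n0" and x: "x : X n"
 have off: "cx x ~: cx ` Dl" using sets(2)[OF n] Dl'(4) x by auto
 have "pc (nodal (X n)) (cx x) = 0" using x sets(1)[OF n] by (simp only: poly_cpoly_nodal_eq_0_iff) blast
 hence "pc (nodal (Y n) * u n) (cx x) * cauchy s (cx x) = pc (P n) (cx x)"
  using rem[OF n off] by (simp del: cpoly_of_real)
 thus ?thesis using W_nonzero[OF n off] by (simp add: G_def del: cpoly_of_real) (metis nonzero_mult_div_cancel_left mult.assoc)
qed

lemma G_holomorphic: "n >= n0 ==> G n holomorphic_on - cx ` Dl"
 unfolding G_def[abs_def] cauchy_eq_ctr
 by (intro holomorphic_intros ctr_holomorphic[OF gm] tame_const) (use W_nonzero in auto)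

text \<open>The lower bound has to grow with \<open>y\<close>, since it is applied factor by factor
  to \<open>h\<close>, whose factors are normalized by \<open>1 + abs y\<close>.\<close>

lemma compact_kappa:
 assumes "compact K" "K <= - cx ` Dl"
 shows "EX kp. 0 < kp & kp <= 1 & (ALL z:K. ALL y:Dl. kp * (1 + abs y) <= norm (z - cx y))"
proof -
 obtain d where d: "d > 0" "!!z y. z : K ==> y : Dl ==> d <= norm (z - cx y)"
 proof -
  have "\<exists>d>0. ALL x:K. ALL y:cx ` Dl. d <= dist x y"
   by (rule separate_compact_closed[OF assms(1) closed_of_real_image[OF gmeasD(3)[OF gm]]]) (use assms(2) in auto)
  then obtain d where "d > 0" "ALL x:K. ALL y:cx ` Dl. d <= dist x y" by blast
  thus ?thesis using that[of d] by (auto simp: dist_norm)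
 qed
 obtain b where b: "b > 0" "!!z. z : K ==> norm z <= b"
  using compact_imp_bounded[OF assms(1)] bounded_pos by metis
 define kp where "kp = min 1 (d / (d + 1 + b))"
 have kp: "0 < kp" "kp <= 1" "kp <= d / (d + 1 + b)" using d(1) b(1) by (auto simp: kp_def)
 have "kp * (1 + abs y) <= norm (z - cx y)" if "z : K" "y : Dl" for z y
 proof -
  let ?N = "norm (z - cx y)"
  have dN: "d <= ?N" by (rule d(2)[OF that])
  have "norm (cx y) <= norm z + ?N" using norm_triangle_ineq4[of z "z - cx y"] by simp
  hence y: "1 + abs y <= 1 + b + ?N" using b(2)[OF that(1)] by simp
  have "kp * (1 + abs y) <= d / (d + 1 + b) * (1 + b + ?N)"
   using y kp d(1) b(1) by (intro mult_mono) auto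
  also have "... <= ?N"
  proof -
   have "d * (1 + b) <= ?N * (1 + b)" using dN b(1) by (intro mult_right_mono) auto
   hence "d * (1 + b + ?N) <= ?N * (d + 1 + b)" by (simp add: algebra_simps)
   thus ?thesis using d(1) b(1) by (simp add: pos_divide_le_eq)
  qed
  finally show ?thesis .
 qed
 thus ?thesis using kp by blast
qed

definition hL :: "nat => real poly \<times> (real => real)" where
 "hL n = (SOME hL. positive_rule n (fst hL) (snd hL))"

abbreviation h :: "nat => real poly" where "h n == fst (hL n)"
abbreviation La :: "nat => real => real" where "La n == snd (hL n)"

lemma hL:
 assumes "n >= n0"
 shows "(poly (h n) x)^2 <= (1 + abs x) ^ c"
  and "0 < kp ==> kp <= 1 ==> ALL y:Dl. kp * (1 + abs y) <= norm (z - cx y) ==> kp ^ c <= (norm (pc (h n) z))^2"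
  and "y : Y n ==> 0 <= La n y"
  and "degree p + c < M n ==> (LINT x|snd s. poly (u n) x * (poly (h n) x)^2 * poly p x) = (SUM y:Y n. La n y * poly p y)"
  and "z ~: cx ` Dl ==> (pc (h n) z)^2 * G n z
     = ctr s (%x. cx (poly (u n) x * (poly (h n) x)^2)) z - cx (fst s) * (SUM y:Y n. cx (La n y) / (z - cx y))"
proof -
 have "EX hL. positive_rule n (fst hL) (snd hL)" using quadrature_exists[OF assms] by simp
 hence "positive_rule n (h n) (La n)" unfolding hL_def by (rule someI_ex)
 note r = this[unfolded positive_rule_def]
 show "(poly (h n) x)^2 <= (1 + abs x) ^ c" using r[THEN conjunct1] by blast
 show "0 < kp ==> kp <= 1 ==> ALL y:Dl. kp * (1 + abs y) <= norm (z - cx y) ==> kp ^ c <= (norm (pc (h n) z))^2"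
  using r[THEN conjunct2, THEN conjunct1] by blast
 show "y : Y n ==> 0 <= La n y" using r[THEN conjunct2, THEN conjunct2, THEN conjunct1] by blast
 show "degree p + c < M n ==> (LINT x|snd s. poly (u n) x * (poly (h n) x)^2 * poly p x) = (SUM y:Y n. La n y * poly p y)"
  using r[THEN conjunct2, THEN conjunct2, THEN conjunct2, THEN conjunct1] by blast
 show "z ~: cx ` Dl ==> (pc (h n) z)^2 * G n z
     = ctr s (%x. cx (poly (u n) x * (poly (h n) x)^2)) z - cx (fst s) * (SUM y:Y n. cx (La n y) / (z - cx y))"
  using r[THEN conjunct2, THEN conjunct2, THEN conjunct2, THEN conjunct2] by blast
qed

lemma M_gt: "n >= n0 ==> c < M n" using card(1)[of n] n0 by linarith

text \<open>Put to \<open>0\<close> below \<open>n0\<close>, so that the family is holomorphic and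
  locally bounded for all \<open>n\<close>.\<close>

definition F :: "nat => complex => complex" where
 "F n z = (if n0 <= n then (pc (h n) z)^2 * G n z else 0)"

lemma F_holomorphic: "F n holomorphic_on - cx ` Dl"
proof (cases "n0 <= n")
 case True
 hence "F n = (%z. (pc (h n) z)^2 * G n z)" by (auto simp: F_def)
 thus ?thesis using G_holomorphic[OF True] by (auto intro!: holomorphic_intros)
qed (simp add: F_def[abs_def])

lemma tame_uh: "tame Dl (%x. cx (poly (u n) x * (poly (h n) x)^2))"
 using tame_cpoly_real[of Dl "u n * (h n)^2"] by (simp add: poly_power)

lemma uh_upper:
 assumes "n >= n0" shows "abs (poly (u n) x) * (poly (h n) x)^2 <= (1 + abs x) ^ (2 * c)"
proof -
 have "abs (poly (u n) x) * (poly (h n) x)^2 <= (1 + abs x) ^ c * (1 + abs x) ^ c"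
  by (intro mult_mono u(3)[OF assms] hL(1)[OF assms]) auto
 thus ?thesis by (simp add: power_add[symmetric] mult_2)
qed

lemma integrable_growth: "integrable (snd s) (%x. (1 + abs x) ^ k)"
proof -
 have "tame Dl (%x. cx ((1 + abs x) ^ k))" unfolding tame_def
 proof (intro conjI exI[of _ "1::real"] exI[of _ k] ballI)
  show "continuous_on Dl (%x. cx ((1 + abs x) ^ k))" by (intro continuous_intros)
  show "(%x. cx ((1 + abs x) ^ k)) : bm"
   by (intro borel_measurable_continuous_onI continuous_intros)
  show "norm (cx ((1 + abs x) ^ k)) <= 1 * (1 + abs x) ^ k" for x unfolding norm_of_real by simp
 qed
 from tame_integrable[OF gm this] show ?thesis by (simp only: complex_of_real_integrable_eq)
qed

lemma mass_bound:
 assumes n: "n >= n0"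
 shows "(LINT x|snd s. poly (u n) x * (poly (h n) x)^2) <= (LINT x|snd s. (1 + abs x) ^ (2 * c))"
  and "(SUM y:Y n. La n y) = (LINT x|snd s. poly (u n) x * (poly (h n) x)^2)"
proof -
 show "(LINT x|snd s. poly (u n) x * (poly (h n) x)^2) <= (LINT x|snd s. (1 + abs x) ^ (2 * c))"
 proof (rule integral_mono)
  show "integrable (snd s) (%x. poly (u n) x * (poly (h n) x)^2)"
   using tame_integrable[OF gm tame_uh[of n]] by (simp only: complex_of_real_integrable_eq)
  fix x
  have "poly (u n) x * (poly (h n) x)^2 <= abs (poly (u n) x) * (poly (h n) x)^2" by (intro mult_right_mono) auto
  also note uh_upper[OF n]
  finally show "poly (u n) x * (poly (h n) x)^2 <= (1 + abs x) ^ (2 * c)" .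
 qed (rule integrable_growth)
 show "(SUM y:Y n. La n y) = (LINT x|snd s. poly (u n) x * (poly (h n) x)^2)"
  using hL(4)[OF n, of 1] M_gt[OF n] by simp
qed

text \<open>From \<open>n0\<close> on, \<open>F n\<close> is up to sign the difference of the
  transforms of two positive measures with the same total mass, which \<open>mass_bound\<close>
  limits independently of \<open>n\<close>.\<close>

lemma F_bounded:
 assumes "compact K" "K <= - cx ` Dl"
 shows "EX B. ALL n. ALL z:K. norm (F n z) <= B"
proof -
 define C where "C = (LINT x|snd s. (1 + abs x) ^ (2 * c))"
 obtain kp where kp: "0 < kp" "kp <= 1" "!!z y. z : K ==> y : Dl ==> kp * (1 + abs y) <= norm (z - cx y)"
  using compact_kappa[OF assms] by blast
 have kp': "kp <= norm (z - cx y)" if "z : K" "y : Dl" for z y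
 proof -
  have "kp * 1 <= kp * (1 + abs y)" using kp(1) by (intro mult_left_mono) auto
  thus ?thesis using kp(3)[OF that] by linarith
 qed
 have C0: "C >= 0" unfolding C_def by (intro integral_nonneg_AE) auto
 have "norm (F n z) <= 2 * C / kp" if z: "z : K" for n z
 proof (cases "n >= n0")
  case True
  have off: "z ~: cx ` Dl" using z assms(2) by auto
  have 1: "norm (ctr s (%x. cx (poly (u n) x * (poly (h n) x)^2)) z) <= C / kp"
  proof -
   have "norm (ctr s (%x. cx (poly (u n) x * (poly (h n) x)^2)) z)
     <= (LINT x|snd s. norm (cx (poly (u n) x * (poly (h n) x)^2))) / kp"
    by (rule ctr_bound_dist[OF gm tame_uh kp(1) kp'[OF z]])
   also have "(LINT x|snd s. norm (cx (poly (u n) x * (poly (h n) x)^2))) <= C" unfolding C_def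
   proof (rule integral_mono)
    show "integrable (snd s) (%x. norm (cx (poly (u n) x * (poly (h n) x)^2)))"
     by (rule integrable_norm[OF tame_integrable[OF gm tame_uh]])
    show "norm (cx (poly (u n) x * (poly (h n) x)^2)) <= (1 + abs x) ^ (2 * c)" for x
     using uh_upper[OF True, of x] by (simp only: norm_of_real abs_mult abs_power2)
   qed (rule integrable_growth)
   finally show ?thesis using kp(1) by (simp add: divide_right_mono)
  qed
  have 2: "norm (cx (fst s) * (SUM y:Y n. cx (La n y) / (z - cx y))) <= C / kp"
  proof -
   have "norm (SUM y:Y n. cx (La n y) / (z - cx y)) <= (SUM y:Y n. La n y / kp)"
   proof (rule sum_norm_le)
    fix y assume y: "y : Y n"
    have "kp <= norm (z - cx y)" using kp'[OF z] y sets(4)[OF True] by blast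
    moreover from this have "0 < norm (z - cx y)" using kp(1) by linarith
    ultimately have "La n y / norm (z - cx y) <= La n y / kp"
     using hL(3)[OF True y] kp(1) by (intro divide_left_mono mult_pos_pos) auto
    thus "norm (cx (La n y) / (z - cx y)) <= La n y / kp"
     using hL(3)[OF True y] by (simp add: norm_divide)
   qed
   also have "... = (SUM y:Y n. La n y) / kp" by (simp add: sum_divide_distrib)
   also have "... <= C / kp" using mass_bound[OF True] kp(1) unfolding C_def by (intro divide_right_mono) auto
   finally show ?thesis using gmeasD(1)[OF gm] by (auto simp: norm_mult)
  qed
  have "F n z = ctr s (%x. cx (poly (u n) x * (poly (h n) x)^2)) z - cx (fst s) * (SUM y:Y n. cx (La n y) / (z - cx y))"
   using hL(5)[OF True off] True by (simp add: F_def)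
  also have "norm ... <= C / kp + C / kp" by (rule order_trans[OF norm_triangle_ineq4 add_mono[OF 1 2]])
  finally show ?thesis by simp
 qed (use C0 kp(1) in \<open>simp add: F_def\<close>)
 thus ?thesis by blast
qed

lemma complement: "open (- cx ` Dl)" "connected (- cx ` Dl)"
proof -
 show "open (- cx ` Dl)" by (intro open_Compl closed_of_real_image gmeasD(3)[OF gm])
 obtain x0 where "x0 : Dl'" using Dl'(3) by blast
 hence "x0 ~: Dl" using Dl'(4) by blast
 thus "connected (- cx ` Dl)" by (rule connected_complement_real)
qed

lemma limit_zero_bounded:
 assumes b: "bounded Dl'" and r: "strict_mono r" and g: "g holomorphic_on - cx ` Dl"
  and lim: "!!z. z : - cx ` Dl ==> (%n. F (r n) z) ----> g z"
 shows "ALL z:- cx ` Dl. g z = 0"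
proof (rule many_zeros_limit_zero[OF complement, of "%n. F (r n)" Dl' "%n. if n0 <= r n then X (r n) else {}"])
 show "F (r n) holomorphic_on - cx ` Dl" for n by (rule F_holomorphic)
 show "EX B. ALL n. ALL z:K. norm (F (r n) z) <= B" if "compact K" "K <= - cx ` Dl" for K
  using F_bounded[OF that] by blast
 show "compact Dl'" using b Dl'(1) by (simp add: compact_eq_bounded_closed)
 show "cx ` Dl' <= - cx ` Dl" using Dl'(4) by auto
 show "F (r n) (cx x) = 0" if "x : (if n0 <= r n then X (r n) else {})" for n x
  using that G_zero[of "r n" x] by (simp add: F_def split: if_splits)
 show "filterlim (%n. card (if n0 <= r n then X (r n) else {})) at_top sequentially"
  unfolding filterlim_at_top
 proof
  fix Z
  show "EVN n. Z <= card (if n0 <= r n then X (r n) else {})"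
   using eventually_ge_at_top[of "n0 + Z + c"]
  proof eventually_elim
   case (elim n)
   have "n <= r n" by (rule seq_suble[OF r])
   thus ?case using elim card(4)[of "r n"] by simp
  qed
 qed
 show "finite (if n0 <= r n then X (r n) else {})" for n using sets(1) by simp
 show "(if n0 <= r n then X (r n) else {}) <= Dl'" for n using sets(2)[of "r n"] by simp
qed (fact g, fact lim)

end

context pade_seq
begin

text \<open>At the points \<open>- ep (A + a\<^sup>2)\<close> the Cauchy kernel is, up to sign, \<open>1 / (a\<^sup>2 + rh\<^sup>2)\<close> with
 \<open>rh\<^sup>2 = ep x + A\<close>; by analytic continuation it suffices that \<open>g\<close> vanishes there.\<close>

lemma limit_zero_carleman:
 fixes S :: "nat => real"
 assumes S: "!!i. S i > 0" "!!i. S (Suc i) * S (Suc i) <= S i * S (Suc (Suc i))"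
   "\<not> summable (%i. sqrt (S i / S (Suc i)))"
  and ep: "ep = 1 | ep = -1" and A: "A >= 1" and y1: "!!x. x : Dl ==> 1 <= ep * x + A"
  and K: "K > 0" "!!i. (LINT x|snd s. (ep * x + A) ^ i) <= K * S i"
  and r: "strict_mono r" and g: "g holomorphic_on - cx ` Dl"
  and lim: "!!z. z : - cx ` Dl ==> (%n. F (r n) z) ----> g z"
 shows "ALL z:- cx ` Dl. g z = 0"
proof -
 \<comment> \<open>The absolute values here and in \<open>w\<close> make both functions nonnegative
   on the whole line, as \<open>transform_pair\<close> demands; on \<open>Dl\<close> they change
   nothing once \<open>n >= n0\<close>.\<close>
 define rh where "rh x = sqrt (abs (ep * x + A))" for x
 define w where "w n x = abs (poly (u n) x) * (poly (h n) x)^2" for n x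
 have rh2: "(rh x)^2 = abs (ep * x + A)" for x by (simp add: rh_def)
 have rh_pow: "rh x ^ (2 * i) = (ep * x + A) ^ i" if "x : Dl" for x i
  using y1[OF that] by (simp add: power_mult rh2)
 have cont: "continuous_on UNIV rh" "continuous_on UNIV (w n)" for n
  unfolding rh_def[abs_def] w_def[abs_def] by (intro continuous_intros)+
 have meas: "rh : borel_measurable (snd s)" "w n : borel_measurable (snd s)" for n
  by (intro gmeas_borel[OF gm] borel_measurable_continuous_onI cont)+
 have w_eq: "w n x = poly (u n) x * (poly (h n) x)^2" if "n >= n0" "x : Dl" for n x
  using u(2)[OF that] by (simp add: w_def)
 have rh_upper: "rh x <= (A + 1) * (1 + abs x)" for x
 proof -
  have "abs (ep * x + A) <= abs x + A" using ep A by auto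
  also have "t <= (1 + t)^2" if "t >= 0" for t :: real
   using that by (simp add: power2_eq_square algebra_simps)
  hence "abs x + A <= (1 + (abs x + A))^2" using A by simp
  finally have "abs (ep * x + A) <= (1 + (abs x + A))^2" .
  hence "rh x <= 1 + (abs x + A)" unfolding rh_def using A by (intro real_le_lsqrt) auto
  also have "... <= (A + 1) * (1 + abs x)" using A by (simp add: algebra_simps)
  finally show ?thesis .
 qed
 have tp: "transform_pair (snd s) (w n) rh (Y n) (La n)" if n: "n >= n0" for n
 proof
  show "integrable (snd s) (%x. w n x * rh x ^ k)" for k
  proof (rule Bochner_Integration.integrable_bound)
   show "integrable (snd s) (%x. (A + 1) ^ k * (1 + abs x) ^ (2 * c + k))"
    by (intro integrable_mult_right integrable_growth)
   show "(%x. w n x * rh x ^ k) : borel_measurable (snd s)"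
    by (intro borel_measurable_times borel_measurable_power meas)
   have "norm (w n x * rh x ^ k) <= norm ((A + 1) ^ k * (1 + abs x) ^ (2 * c + k))" for x
   proof -
    have rh0: "0 <= rh x" by (simp add: rh_def)
    have "rh x ^ k <= ((A + 1) * (1 + abs x)) ^ k" by (rule power_mono[OF rh_upper rh0])
    hence "w n x * rh x ^ k <= (1 + abs x) ^ (2 * c) * ((A + 1) * (1 + abs x)) ^ k"
     using uh_upper[OF n, of x] rh0 unfolding w_def by (intro mult_mono) auto
    also have "... = (A + 1) ^ k * (1 + abs x) ^ (2 * c + k)" by (simp add: power_mult_distrib power_add)
    also have "... <= norm ..." by simp
    finally show ?thesis using rh0 by (simp add: w_def abs_mult)
   qed
   thus "AE x in snd s. norm (w n x * rh x ^ k) <= norm ((A + 1) ^ k * (1 + abs x) ^ (2 * c + k))" by simp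
  qed
 qed (use meas sets(3)[OF n] hL(3)[OF n] in \<open>auto simp: w_def rh_def\<close>)
 have mom: "(LINT x|snd s. w n x * rh x ^ (2 * i)) = (SUM y:Y n. La n y * rh y ^ (2 * i))"
  if n: "n >= n0" and i: "i + c < M n" for n i
 proof -
  have p: "poly ([:A, ep:] ^ i) x = (ep * x + A) ^ i" for x by (simp add: poly_power add.commute mult.commute)
  have d: "degree ([:A, ep:] ^ i) + c < M n"
   using degree_power_le[of "[:A, ep:]" i] i by (auto simp: degree_pCons_eq_if split: if_splits)
  have "(LINT x|snd s. w n x * rh x ^ (2 * i)) = (LINT x|snd s. poly (u n) x * (poly (h n) x)^2 * poly ([:A, ep:] ^ i) x)"
  proof (rule integral_cong_AE)
   show "AE x in snd s. w n x * rh x ^ (2 * i) = poly (u n) x * (poly (h n) x)^2 * poly ([:A, ep:] ^ i) x"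
    using gmeasD(6)[OF gm]
   proof eventually_elim
    case (elim x)
    show ?case unfolding p rh_pow[OF elim] w_eq[OF n elim] ..
   qed
   show "(%x. w n x * rh x ^ (2 * i)) : borel_measurable (snd s)"
    by (intro borel_measurable_times borel_measurable_power meas)
   show "(%x. poly (u n) x * (poly (h n) x)^2 * poly ([:A, ep:] ^ i) x) : borel_measurable (snd s)"
    by (intro gmeas_borel[OF gm] borel_measurable_continuous_onI continuous_intros)
  qed
  also have "... = (SUM y:Y n. La n y * poly ([:A, ep:] ^ i) y)" by (rule hL(4)[OF n d])
  also have "... = (SUM y:Y n. La n y * rh y ^ (2 * i))"
  proof (rule sum.cong[OF refl])
   fix y assume "y : Y n"
   hence "y : Dl" using sets(4)[OF n] by blast
   thus "La n y * poly ([:A, ep:] ^ i) y = La n y * rh y ^ (2 * i)" unfolding p using rh_pow by simp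
  qed
  finally show ?thesis .
 qed
 \<comment> \<open>The density \<open>u h^2\<close> is at most \<open>(1 + abs x)^(2 * c)\<close>,
   and \<open>1 + abs x\<close> is at most \<open>(A + 2) * (ep * x + A)\<close> on
   \<open>Dl\<close>. Its effect on the moments is this constant and a shift of the index of
   \<open>S\<close> by \<open>2 * c\<close>, under which the divergence persists.\<close>
 define K' where "K' = (A + 2) ^ (2 * c) * K"
 have K': "K' > 0" using K(1) A by (simp add: K'_def)
 have bd: "(LINT x|snd s. w n x * rh x ^ (2 * i)) <= K' * S (i + 2 * c)" if n: "n >= n0" for n i
 proof -
  have "(LINT x|snd s. w n x * rh x ^ (2 * i)) <= (LINT x|snd s. (A + 2) ^ (2 * c) * (ep * x + A) ^ (i + 2 * c))"
  proof (rule integral_mono_AE)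
   show "integrable (snd s) (%x. w n x * rh x ^ (2 * i))" by (rule transform_pair.integ[OF tp[OF n]])
   show "integrable (snd s) (%x. (A + 2) ^ (2 * c) * (ep * x + A) ^ (i + 2 * c))"
    by (intro integrable_mult_right shift_integrable[OF gm ep A y1])
   show "AE x in snd s. w n x * rh x ^ (2 * i) <= (A + 2) ^ (2 * c) * (ep * x + A) ^ (i + 2 * c)"
    using gmeasD(6)[OF gm]
   proof eventually_elim
    case (elim x)
    define y where "y = ep * x + A"
    have y: "1 <= y" using y1[OF elim] by (simp add: y_def)
    have "abs x = abs (ep * x)" using ep by auto
    hence "1 + abs x <= y + A + 1" using y A by (auto simp: y_def)
    also have "... <= (A + 2) * y" using y A mult_left_mono[of 1 y "A + 1"] by (simp add: algebra_simps)
    finally have "(1 + abs x) ^ (2 * c) <= ((A + 2) * y) ^ (2 * c)" by (intro power_mono) auto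
    hence "w n x <= (A + 2) ^ (2 * c) * y ^ (2 * c)"
     using uh_upper[OF n, of x] by (simp add: w_def power_mult_distrib)
    hence "w n x * y ^ i <= (A + 2) ^ (2 * c) * y ^ (2 * c) * y ^ i" using y by (intro mult_right_mono) auto
    thus ?case using rh_pow[OF elim, of i] by (simp add: y_def power_add ac_simps)
   qed
  qed
  also have "... <= (A + 2) ^ (2 * c) * (K * S (i + 2 * c))" using K(2)[of "i + 2 * c"] A by (simp add: mult_left_mono)
  finally show ?thesis by (simp add: K'_def mult.assoc)
 qed
 have div: "\<not> summable (%i. sqrt (S (i + 2 * c) / S (Suc i + 2 * c)))"
  using S(3) summable_iff_shift[of "%i. sqrt (S i / S (Suc i))" "2 * c"] by simp
 have F_at: "norm (F n (cx (- ep * (A + a^2)))) = abs ((LINT x|snd s. w n x * qk a (rh x)) - (SUM y:Y n. La n y * qk a (rh y)))"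
  if a: "a > 0" and n: "n >= n0" for a n
 proof -
  define x0 where "x0 = - ep * (A + a^2)"
  have ep2: "ep * ep = 1" using ep by auto
  have x0_off: "x0 ~: Dl"
  proof
   assume "x0 : Dl"
   hence "1 <= ep * x0 + A" by (rule y1)
   also have "... = - (ep * ep) * (A + a^2) + A" by (simp add: x0_def)
   also have "... = - (a^2)" unfolding ep2 by simp
   finally show False using zero_le_power2[of a] by linarith
  qed
  have off: "cx x0 ~: cx ` Dl" using x0_off by (simp add: image_iff)
  have inv: "1 / (x0 - x) = - ep * qk a (rh x)" if "x : Dl" for x
  proof -
   have q: "a^2 + (rh x)^2 = a^2 + (ep * x + A)" using y1[OF that] by (simp add: rh2)
   have "x0 - x = - ep * (a^2 + (ep * x + A))" using ep unfolding x0_def by auto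
   moreover have "1 / (- ep * p) = - ep * (1 / p)" for p using ep by auto
   ultimately show ?thesis unfolding q by (simp only:)
  qed
  have 1: "ctr s (%x. cx (poly (u n) x * (poly (h n) x)^2)) (cx x0)
    = cx (- ep * fst s) * cx (LINT x|snd s. w n x * qk a (rh x))"
  proof -
   have "(LINT x|snd s. cx (poly (u n) x * (poly (h n) x)^2) / (cx x0 - cx x))
     = (LINT x|snd s. cx (- ep * (w n x * qk a (rh x))))"
   proof (rule integral_cong_AE)
    show "AE x in snd s. cx (poly (u n) x * (poly (h n) x)^2) / (cx x0 - cx x)
      = cx (- ep * (w n x * qk a (rh x)))" using gmeasD(6)[OF gm]
    proof eventually_elim
     case (elim x)
     have "cx (poly (u n) x * (poly (h n) x)^2) / (cx x0 - cx x)
       = cx (w n x * (1 / (x0 - x)))" by (simp add: w_eq[OF n elim])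
     also have "... = cx (- ep * (w n x * qk a (rh x)))" unfolding inv[OF elim] by (simp only: mult.left_commute)
     finally show ?case .
    qed
    show "(%x. cx (poly (u n) x * (poly (h n) x)^2) / (cx x0 - cx x)) : borel_measurable (snd s)"
     by (rule borel_measurable_integrable[OF tame_integrable[OF gm tame_cauchy_kernel[OF gmeasD(3)[OF gm] off tame_uh]]])
    show "(%x. cx (- ep * (w n x * qk a (rh x)))) : borel_measurable (snd s)"
     by (intro measurable_compose[OF _ borel_measurable_of_real] borel_measurable_times borel_measurable_const borel_measurable_divide borel_measurable_add borel_measurable_power meas)
   qed
   also have "... = cx (- ep * (LINT x|snd s. w n x * qk a (rh x)))"
    by (simp only: integral_complex_of_real integral_mult_right_zero)
   finally show ?thesis unfolding ctr_def sint_def by simp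
  qed
  have 2: "(SUM y:Y n. cx (La n y) / (cx x0 - cx y)) = cx (- ep) * cx (SUM y:Y n. La n y * qk a (rh y))"
  proof -
   have "cx (La n y) / (cx x0 - cx y) = cx (- ep) * cx (La n y * qk a (rh y))"
    if y: "y : Y n" for y
   proof -
    have "y : Dl" using y sets(4)[OF n] by blast
    have "cx (La n y) / (cx x0 - cx y) = cx (La n y * (1 / (x0 - y)))" by simp
    also have "... = cx (- ep) * cx (La n y * qk a (rh y))"
     unfolding inv[OF `y : Dl`] of_real_mult[symmetric] by (simp only: mult.left_commute)
    finally show ?thesis .
   qed
   hence "(SUM y:Y n. cx (La n y) / (cx x0 - cx y))
     = (SUM y:Y n. cx (- ep) * cx (La n y * qk a (rh y)))" by (rule sum.cong[OF refl])
   also have "... = cx (- ep) * (SUM y:Y n. cx (La n y * qk a (rh y)))"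
    by (rule sum_distrib_left[symmetric])
   finally show ?thesis unfolding of_real_sum .
  qed
  have "F n (cx x0) = cx (- ep * fst s) * cx ((LINT x|snd s. w n x * qk a (rh x)) - (SUM y:Y n. La n y * qk a (rh y)))"
  proof -
   have "F n (cx x0) = ctr s (%x. cx (poly (u n) x * (poly (h n) x)^2)) (cx x0)
     - cx (fst s) * (SUM y:Y n. cx (La n y) / (cx x0 - cx y))"
    unfolding hL(5)[OF n off, symmetric] using n by (simp add: F_def)
   also have "... = cx (- ep * fst s) * cx (LINT x|snd s. w n x * qk a (rh x))
     - cx (fst s) * (cx (- ep) * cx (SUM y:Y n. La n y * qk a (rh y)))" unfolding 1 2 ..
   also have "... = cx (- ep * fst s) * cx ((LINT x|snd s. w n x * qk a (rh x)) - (SUM y:Y n. La n y * qk a (rh y)))"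
   proof -
    have "(p * q) * x - q * (p * y) = (p * q) * (x - y)" for p q x y :: complex by (simp add: algebra_simps)
    thus ?thesis unfolding of_real_diff of_real_mult[of "- ep" "fst s"] .
   qed
   finally show ?thesis .
  qed
  hence "norm (F n (cx x0)) = abs (- ep * fst s) * abs ((LINT x|snd s. w n x * qk a (rh x)) - (SUM y:Y n. La n y * qk a (rh y)))"
   by (simp only: norm_mult norm_of_real)
  moreover have "abs (- ep * fst s) = 1" using ep gmeasD(1)[OF gm] by auto
  ultimately show ?thesis unfolding x0_def[symmetric] by (simp only: mult_1)
 qed
 have off: "cx (- ep * (A + a^2)) : - cx ` Dl" if "a > 0" for a
 proof -
  have "- ep * (A + a^2) ~: Dl"
  proof
   assume "- ep * (A + a^2) : Dl"
   hence "1 <= ep * (- ep * (A + a^2)) + A" by (rule y1)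
   also have "... = - (a^2)" using ep by auto
   finally show False using zero_le_power2[of a] by linarith
  qed
  thus ?thesis unfolding Compl_iff image_iff of_real_eq_iff by blast
 qed
 have g0: "g (cx (- ep * (A + a^2))) = 0" if a: "a > 0" for a
 proof -
  let ?z = "cx (- ep * (A + a^2))"
  have "(%n. F n ?z) ----> 0"
  proof (rule tendstoI)
   fix e :: real assume e: "e > 0"
   have "EX N. ALL n>=N. ALL M' g' rh' Y' wt. transform_pair M' g' rh' Y' wt -->
    (ALL i<=n. (LINT x|M'. g' x * rh' x ^ (2 * i)) = (SUM y:Y'. wt y * rh' y ^ (2 * i))) -->
    (ALL i. (LINT x|M'. g' x * rh' x ^ (2 * i)) <= K' * S (i + 2 * c)) -->
    abs ((LINT x|M'. g' x * qk a (rh' x)) - (SUM y:Y'. wt y * qk a (rh' y))) <= e / 2"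
    by (rule transform_convergence[of "%i. S (i + 2 * c)", OF _ _ div K' a]) (use S(1,2) e in auto)
   then obtain N where N: "ALL n>=N. ALL M' g' rh' Y' wt. transform_pair M' g' rh' Y' wt -->
    (ALL i<=n. (LINT x|M'. g' x * rh' x ^ (2 * i)) = (SUM y:Y'. wt y * rh' y ^ (2 * i))) -->
    (ALL i. (LINT x|M'. g' x * rh' x ^ (2 * i)) <= K' * S (i + 2 * c)) -->
    abs ((LINT x|M'. g' x * qk a (rh' x)) - (SUM y:Y'. wt y * qk a (rh' y))) <= e / 2" by (elim exE)
   show "EVN n. dist (F n ?z) 0 < e" using eventually_ge_at_top[of "n0 + N + 2 * c + 1"]
   proof eventually_elim
    case (elim n)
    hence n: "n >= n0" by simp
    \<comment> \<open>The estimate is invoked at its fixed index \<open>N\<close>, so only the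
      moments up to \<open>N\<close> have to agree, and for large \<open>n\<close> they do.\<close>
    have 1: "ALL i<=N. (LINT x|snd s. w n x * rh x ^ (2 * i)) = (SUM y:Y n. La n y * rh y ^ (2 * i))"
    proof (intro allI impI)
     fix i assume "i <= N"
     hence "i + c < M n" using elim card(1)[OF n] by linarith
     thus "(LINT x|snd s. w n x * rh x ^ (2 * i)) = (SUM y:Y n. La n y * rh y ^ (2 * i))" by (rule mom[OF n])
    qed
    have 2: "ALL i. (LINT x|snd s. w n x * rh x ^ (2 * i)) <= K' * S (i + 2 * c)" by (intro allI bd[OF n])
    note N' = N[THEN spec, THEN mp, OF order_refl, THEN spec, THEN spec, THEN spec, THEN spec, THEN spec, THEN mp, OF tp[OF n], THEN mp, OF 1, THEN mp, OF 2]
    have "norm (F n ?z) <= e / 2" unfolding F_at[OF a n] by (rule N')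
    thus ?case using e by simp
   qed
  qed
  hence "(%n. F (r n) ?z) ----> 0" using LIMSEQ_subseq_LIMSEQ[OF _ r, of "%n. F n ?z" 0] by (simp add: o_def)
  thus ?thesis using LIMSEQ_unique[OF lim[OF off[OF a]]] by blast
 qed
 \<comment> \<open>Points of the real half-line off \<open>Dl\<close>; they accumulate at the one
   with \<open>a = 1\<close>, so the identity theorem applies.\<close>
 define U where "U = (%a. cx (- ep * (A + a^2))) ` {0<..}"
 let ?\<xi> = "cx (- ep * (A + 1^2))"
 have lp: "?\<xi> islimpt U" unfolding islimpt_approachable
 proof (intro allI impI)
  fix e :: real assume e: "e > 0"
  define b where "b = sqrt (1 + e / 2)"
  have b: "b > 0" "b^2 = 1 + e / 2" using e by (auto simp: b_def)
  let ?w = "cx (- ep * (A + b^2))"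
  have "?w : U" using b(1) by (auto simp: U_def)
  moreover have "?w ~= ?\<xi>" using ep b(2) e by (auto simp: of_real_eq_iff simp del: of_real_mult of_real_minus of_real_add of_real_power)
  moreover have "dist ?w ?\<xi> < e"
  proof -
   have "dist ?w ?\<xi> = abs (- ep * (A + b^2) - - ep * (A + 1^2))" unfolding dist_norm of_real_diff[symmetric] norm_of_real ..
   also have "... = e / 2" unfolding b(2) using ep e by auto
   finally show ?thesis using e by simp
  qed
  ultimately show "EX x':U. x' ~= ?\<xi> & dist x' ?\<xi> < e" by blast
 qed
 have US: "U <= - cx ` Dl" using off by (auto simp: U_def)
 have \<xi>S: "?\<xi> : - cx ` Dl" by (rule off) simp
 have gU: "g z = 0" if "z : U" for z using that g0 by (auto simp: U_def)
 show ?thesis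
 proof
  fix z assume z: "z : - cx ` Dl"
  show "g z = 0" by (rule analytic_continuation[OF g complement US \<xi>S lp _ z]) (rule gU)
 qed
qed

text \<open>On \<open>K\<close> the factor \<open>h^2\<close> by which \<open>F\<close> differs from
  \<open>G\<close> has modulus at least \<open>kp^c\<close>, independently of
  \<open>n\<close>.\<close>

lemma G_uniform_limit_zero:
 assumes lim0: "!!r g. strict_mono r ==> g holomorphic_on - cx ` Dl ==>
   (!!z. z : - cx ` Dl ==> (%n. F (r n) z) ----> g z) ==> ALL z:- cx ` Dl. g z = 0"
  and K: "compact K" "K <= - cx ` Dl"
 shows "uniform_limit K G (%_. 0) sequentially"
proof -
 have FK: "uniform_limit K F (%_. 0) sequentially"
  by (rule vitali_zero[OF complement(1) F_holomorphic F_bounded lim0 K])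
 obtain kp where kp: "0 < kp" "kp <= 1" "!!z y. z : K ==> y : Dl ==> kp * (1 + abs y) <= norm (z - cx y)"
  using compact_kappa[OF K] by blast
 show ?thesis
 proof (rule uniform_limitI)
  fix e :: real assume e: "e > 0"
  have "e * kp ^ c > 0" using e kp(1) by simp
  from uniform_limitD[OF FK this] eventually_ge_at_top[of n0]
  show "EVN n. ALL z:K. dist (G n z) 0 < e"
  proof eventually_elim
   case (elim n)
   show ?case
   proof
    fix z assume z: "z : K"
    have "kp ^ c <= (norm (pc (h n) z))^2" by (rule hL(2)[OF elim(2) kp(1,2)]) (use kp(3)[OF z] in blast)
    hence "norm (G n z) * kp ^ c <= norm (G n z) * (norm (pc (h n) z))^2" by (intro mult_left_mono) auto
    also have "... = norm (F n z)" using elim(2) by (simp add: F_def norm_mult norm_power)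
    also have "... < e * kp ^ c" using elim(1) z by simp
    finally show "dist (G n z) 0 < e" using kp(1) by simp
   qed
  qed
 qed
qed

end

section \<open>Convergence of zeros\<close>

lemma order_sum_degree:
 fixes p :: "complex poly"
 assumes "p ~= 0"
 shows "(\<Sum>z | poly p z = 0. order z p) = degree p"
proof -
 have "degree p = degree (smult (lead_coeff p) (\<Prod>z|poly p z = 0. [:-z, 1:] ^ order z p))"
  by (simp only: complex_poly_decompose)
 also have "... = degree (\<Prod>z|poly p z = 0. [:-z, 1:] ^ order z p)" using assms by simp
 also have "... = (\<Sum>z|poly p z = 0. degree ([:-z, 1:] ^ order z p))"
  by (rule degree_prod_eq_sum_degree) auto
 also have "... = (\<Sum>z|poly p z = 0. order z p)" by (simp add: degree_power_eq)
 finally show ?thesis ..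
qed

lemma dvd_if_order_le:
 fixes p q :: "complex poly"
 assumes p: "p ~= 0" and q: "q ~= 0" and le: "!!z. poly p z = 0 ==> order z p <= order z q"
 shows "p dvd q"
proof -
 have sub: "{z. poly p z = 0} <= {z. poly q z = 0}"
 proof
  fix z assume z: "z : {z. poly p z = 0}"
  hence "order z p ~= 0" using p by (simp add: order_root)
  hence "order z q ~= 0" using le[of z] z by simp
  thus "z : {z. poly q z = 0}" using q by (simp add: order_root)
 qed
 have "(\<Prod>z|poly p z = 0. [:-z, 1:] ^ order z p) dvd (\<Prod>z|poly p z = 0. [:-z, 1:] ^ order z q)"
  using le by (intro prod_dvd_prod le_imp_power_dvd) auto
 also have "... dvd (\<Prod>z|poly q z = 0. [:-z, 1:] ^ order z q)"
  by (rule prod_dvd_prod_subset[OF poly_roots_finite[OF q] sub])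
 finally have "smult (lead_coeff p) (\<Prod>z|poly p z = 0. [:-z, 1:] ^ order z p) dvd smult (lead_coeff q) (\<Prod>z|poly q z = 0. [:-z, 1:] ^ order z q)"
  using p q by (simp add: smult_dvd_iff dvd_smult_iff)
 thus ?thesis by (simp only: complex_poly_decompose)
qed

lemma zorder_poly_times:
 assumes p: "p ~= 0" and V: "open S" "z : S" "V holomorphic_on S" "V z ~= 0"
 shows "zorder (%w. poly p w * V w) z = int (order z p)"
proof -
 obtain q where q: "p = [:-z, 1:] ^ order z p * q" "\<not> [:-z, 1:] dvd q" using order_decomp[OF p] by blast
 show ?thesis
 proof (rule zorder_eqI[OF V(1,2)])
  show "(%w. poly q w * V w) holomorphic_on S" by (intro holomorphic_intros V)
  show "poly q z * V z ~= 0" using q(2) V(4) by (simp add: poly_eq_0_iff_dvd)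
  fix w assume "w : S" "w ~= z"
  have "poly p w = (w - z) ^ order z p * poly q w" by (subst q(1)) (simp add: poly_power)
  thus "poly p w * V w = poly q w * V w * (w - z) powi int (order z p)" by simp
 qed
qed

text \<open>The factor \<open>V\<close> contributes no zeros and leaves the orders unchanged; zeros
  outside the circle have winding number \<open>0\<close>.\<close>

lemma winding_zero_count:
 assumes p: "p ~= 0" and r: "0 < r" "r < r'" and V: "V holomorphic_on ball ze r'" "!!z. z : ball ze r' ==> V z ~= 0"
  and sph: "!!z. z : sphere ze r ==> poly p z ~= 0"
 shows "(SUM w:{w\<in>ball ze r'. poly p w * V w = 0}. winding_number (circlepath ze r) w * zorder (%w. poly p w * V w) w)
  = of_nat (zero_count p (ball ze r))"
proof -
 let ?A = "{w\<in>ball ze r'. poly p w * V w = 0}" and ?B = "{z. z : ball ze r & poly p z = 0}"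
 have A: "?A = {w\<in>ball ze r'. poly p w = 0}" using V(2) by auto
 have fin: "finite ?A" unfolding A by (rule finite_subset[OF _ poly_roots_finite[OF p]]) auto
 have "(SUM w:?A. winding_number (circlepath ze r) w * zorder (%w. poly p w * V w) w)
   = (SUM w:?B. of_nat (order w p))"
 proof (rule sum.mono_neutral_cong_right[OF fin])
  show "?B <= ?A" using r unfolding A by auto
  show "ALL w:?A - ?B. winding_number (circlepath ze r) w * zorder (%w. poly p w * V w) w = 0"
  proof
   fix w assume w: "w : ?A - ?B"
   hence "w ~: sphere ze r" using sph unfolding A by auto
   hence "w ~: cball ze r" using w unfolding A by auto
   hence "winding_number (circlepath ze r) w = 0"
    using r by (intro winding_number_zero_outside[of _ "cball ze r"]) auto
   thus "winding_number (circlepath ze r) w * zorder (%w. poly p w * V w) w = 0" by simp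
  qed
  fix w assume w: "w : ?B"
  hence wb: "w : ball ze r'" using r by auto
  have "winding_number (circlepath ze r) w = 1"
   using w by (intro winding_number_circlepath) (simp add: dist_norm norm_minus_commute)
  moreover have "zorder (%w. poly p w * V w) w = int (order w p)"
   by (rule zorder_poly_times[OF p open_ball wb V(1) V(2)[OF wb]])
  ultimately show "winding_number (circlepath ze r) w * zorder (%w. poly p w * V w) w = of_nat (order w p)" by simp
 qed
 thus ?thesis by (simp add: zero_count_def)
qed

text \<open>Hurwitz's theorem by way of Rouche. The nonvanishing factors \<open>V n\<close> are
  present because the polynomials alone need not converge, only their quotients by the nodal
  polynomials.\<close>

lemma zero_count_limit:
 fixes q :: "nat => complex poly"
 assumes p: "p ~= 0" and r: "0 < r" "r < r'"
  and V: "EVN n. V n holomorphic_on ball ze r' & (ALL z:ball ze r'. V n z ~= 0)"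
  and Ps: "Ps holomorphic_on ball ze r'" "!!z. z : ball ze r' ==> Ps z ~= 0"
  and lim: "uniform_limit (sphere ze r) (%n z. poly (q n) z * V n z) (%z. poly p z * Ps z) sequentially"
  and sph: "!!z. z : sphere ze r ==> poly p z ~= 0"
 shows "EVN n. zero_count (q n) (ball ze r) = zero_count p (ball ze r)"
proof -
 have sub: "sphere ze r <= ball ze r'" using r by auto
 have cont: "continuous_on (sphere ze r) (%z. norm (poly p z * Ps z))"
  using holomorphic_on_imp_continuous_on[OF Ps(1)] sub by (intro continuous_intros) (auto intro: continuous_on_subset)
 obtain z0 where z0: "z0 : sphere ze r" "!!z. z : sphere ze r ==> norm (poly p z0 * Ps z0) <= norm (poly p z * Ps z)"
  using continuous_attains_inf[OF compact_sphere _ cont] r by auto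
 have dl: "norm (poly p z0 * Ps z0) > 0" using sph[OF z0(1)] Ps(2)[of z0] z0(1) sub by auto
 from uniform_limitD[OF lim dl] V show ?thesis
 proof eventually_elim
  case (elim n)
  have Vn: "V n holomorphic_on ball ze r'" "!!z. z : ball ze r' ==> V n z ~= 0" using elim(2) by auto
  have less: "norm (poly (q n) z * V n z - poly p z * Ps z) < norm (poly p z * Ps z)" if "z : sphere ze r" for z
   using elim(1) z0(2)[OF that] that by (fastforce simp: dist_norm)
  have sphq: "poly (q n) z ~= 0" if "z : sphere ze r" for z using less[OF that] by auto
  have qn: "q n ~= 0" using sphq[OF z0(1)] by auto
  let ?f = "%z. poly p z * Ps z" and ?g = "%z. poly (q n) z * V n z - poly p z * Ps z"
  have eq: "?f z + ?g z = poly (q n) z * V n z" for z by simp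
  have eq': "(%z. ?f z + ?g z) = (%z. poly (q n) z * V n z)" by (simp only: eq)
  have "(SUM w:{w\<in>ball ze r'. ?f w + ?g w = 0}. winding_number (circlepath ze r) w * zorder (%w. ?f w + ?g w) w)
    = (SUM w:{w\<in>ball ze r'. ?f w = 0}. winding_number (circlepath ze r) w * zorder ?f w)"
  proof (rule Rouche_theorem)
   have "{w : ball ze r'. ?f w + ?g w = 0} <= {w. poly (q n) w = 0}" unfolding eq using Vn(2) by auto
   thus "finite {w : ball ze r'. ?f w + ?g w = 0}" using poly_roots_finite[OF qn] by (rule finite_subset)
   have "{w : ball ze r'. ?f w = 0} <= {w. poly p w = 0}" using Ps(2) by auto
   thus "finite {w : ball ze r'. ?f w = 0}" using poly_roots_finite[OF p] by (rule finite_subset)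
   show "?f holomorphic_on ball ze r'" by (intro holomorphic_intros Ps)
   show "?g holomorphic_on ball ze r'" by (intro holomorphic_intros Ps Vn)
   show "path_image (circlepath ze r) <= ball ze r'" using r sub by simp
   show "ALL z:path_image (circlepath ze r). norm (?g z) < norm (?f z)" using less r by simp
   show "ALL z. z ~: ball ze r' --> winding_number (circlepath ze r) z = 0"
   proof (intro allI impI)
    fix z assume "z ~: ball ze r'"
    hence "z ~: cball ze r" using r by auto
    thus "winding_number (circlepath ze r) z = 0"
     using r by (intro winding_number_zero_outside[of _ "cball ze r"]) auto
   qed
  qed auto
  moreover have "(SUM w:{w\<in>ball ze r'. ?f w + ?g w = 0}. winding_number (circlepath ze r) w * zorder (%w. ?f w + ?g w) w) = of_nat (zero_count (q n) (ball ze r))"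
   unfolding eq by (rule winding_zero_count[OF qn r Vn sphq])
  moreover have "(SUM w:{w\<in>ball ze r'. ?f w = 0}. winding_number (circlepath ze r) w * zorder ?f w) = of_nat (zero_count p (ball ze r))"
   by (rule winding_zero_count[OF p r Ps sph])
  ultimately have "complex_of_nat (zero_count (q n) (ball ze r)) = of_nat (zero_count p (ball ze r))" by (simp only:)
  thus ?case by (simp only: of_nat_eq_iff)
 qed
qed

lemma zero_count_isolated:
 assumes "!!z. z : S ==> poly p z = 0 ==> z = ze" and "ze : S" and p: "p ~= 0"
 shows "zero_count p S = order ze p"
proof -
 have "z : {z. z : S & poly p z = 0} \<longleftrightarrow> z : (if poly p ze = 0 then {ze} else {})" for z
  by (cases "z = ze") (use assms(1)[of z] assms(2) in auto)
 hence "{z. z : S & poly p z = 0} = (if poly p ze = 0 then {ze} else {})" by (rule set_eqI)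
 thus ?thesis using p by (simp add: zero_count_def order_root)
qed

lemma common_convergent_subsequence:
 fixes b :: "nat => nat => real"
 assumes "!!n i. abs (b n i) <= B"
 shows "\<exists>r :: nat => nat. strict_mono r & (ALL i<D. convergent (%n. b (r n) i))"
proof (induction D)
 case 0
 show ?case by (intro exI[of _ id]) (simp add: strict_mono_def)
next
 case (Suc D)
 then obtain r :: "nat => nat" where r: "strict_mono r" "!!i. i < D ==> convergent (%n. b (r n) i)" by blast
 have "bounded (range (%n. b (r n) D))" using assms by (auto simp: bounded_iff)
 then obtain l r' where r': "strict_mono (r' :: nat => nat)" "((%n. b (r n) D) \<circ> r') ----> l"
  using bounded_imp_convergent_subsequence by blast
 have "convergent (%n. b (r (r' n)) i)" if "i < Suc D" for i
 proof (cases "i = D")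
  case True
  thus ?thesis using r'(2) by (auto simp: convergent_def o_def)
 next
  case False
  thus ?thesis using convergent_subseq_convergent[OF r(2) r'(1), of i] that by (simp add: o_def)
 qed
 moreover have "strict_mono (r \<circ> r')" using r(1) r'(1) by (rule strict_mono_o)
 ultimately show ?case by (intro exI[of _ "r \<circ> r'"]) (simp add: o_def)
qed

lemma poly_sum_upto:
 fixes p :: "'a :: comm_semiring_1 poly"
 assumes "degree p <= D" shows "poly p x = (SUM i<=D. coeff p i * x ^ i)"
 unfolding poly_altdef by (rule sum.mono_neutral_left) (use assms in \<open>auto simp: coeff_eq_0\<close>)

lemma poly_growth:
 fixes p :: "real poly"
 assumes "degree p <= D" shows "abs (poly p x) <= (SUM i<=D. abs (coeff p i)) * (1 + abs x) ^ D"
proof -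
 have "abs (poly p x) <= (SUM i<=D. abs (coeff p i) * (1 + abs x) ^ D)"
  unfolding poly_sum_upto[OF assms]
 proof (rule order_trans[OF sum_abs], rule sum_mono)
  fix i assume i: "i : {..D}"
  have "abs x ^ i <= (1 + abs x) ^ i" by (intro power_mono) auto
  also have "... <= (1 + abs x) ^ D" using i by (intro power_increasing) auto
  finally show "abs (coeff p i * x ^ i) <= abs (coeff p i) * (1 + abs x) ^ D"
   by (simp add: abs_mult power_abs mult_left_mono)
 qed
 thus ?thesis by (simp add: sum_distrib_right)
qed

lemma uniform_limit_cpoly:
 fixes u :: "nat => real poly"
 assumes d: "EVN n. degree (u n) <= D" "degree p <= D" and lim: "!!i. i <= D ==> (%n. coeff (u n) i) ----> coeff p i"
  and K: "compact K"
 shows "uniform_limit K (%n z. pc (u n) z) (%z. pc p z) sequentially"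
proof -
 obtain b where b: "b > 0" "!!z. z : K ==> norm z <= b" using compact_imp_bounded[OF K] bounded_pos by metis
 have "(%n. SUM i<=D. abs (coeff (u n) i - coeff p i) * b ^ i) ----> (SUM i<=D. abs (coeff p i - coeff p i) * b ^ i)"
  by (intro tendsto_intros lim) auto
 hence t: "(%n. SUM i<=D. abs (coeff (u n) i - coeff p i) * b ^ i) ----> 0" by simp
 show ?thesis
 proof (rule uniform_limitI)
  fix e :: real assume "e > 0"
  with t have "EVN n. (SUM i<=D. abs (coeff (u n) i - coeff p i) * b ^ i) < e" by (rule order_tendstoD)
  with d(1) show "EVN n. ALL z:K. dist (pc (u n) z) (pc p z) < e"
  proof eventually_elim
   case (elim n)
   show ?case
   proof
    fix z assume z: "z : K"
    have "pc (u n) z - pc p z = (SUM i<=D. cx (coeff (u n) i - coeff p i) * z ^ i)"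
     using elim(1) d(2) by (subst (1 2) poly_sum_upto[of _ D]) (auto simp: sum_subtractf left_diff_distrib coeff_map_poly)
    also have "norm ... <= (SUM i<=D. abs (coeff (u n) i - coeff p i) * b ^ i)"
    proof (rule sum_norm_le)
     fix i
     have "norm z ^ i <= b ^ i" using b(2)[OF z] by (intro power_mono) auto
     thus "norm (cx (coeff (u n) i - coeff p i) * z ^ i) <= abs (coeff (u n) i - coeff p i) * b ^ i"
      unfolding norm_mult norm_of_real norm_power by (intro mult_left_mono) auto
    qed
    finally show "dist (pc (u n) z) (pc p z) < e" using elim(2) by (simp add: dist_norm)
   qed
  qed
 qed
qed

lemma uniform_limit_zero_mult:
 fixes F :: "nat => complex => complex"
 assumes F: "uniform_limit K F (%_. 0) sequentially" and b: "!!z. z : K ==> norm (q z) <= b"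
 shows "uniform_limit K (%n z. q z * F n z) (%_. 0) sequentially"
proof (rule uniform_limitI)
 fix e :: real assume e: "e > 0"
 have "e / (abs b + 1) > 0" using e by (intro divide_pos_pos) auto
 from uniform_limitD[OF F this] show "EVN n. ALL z:K. dist (q z * F n z) 0 < e"
 proof eventually_elim
  case (elim n)
  show ?case
  proof
   fix z assume z: "z : K"
   have "norm (q z) <= abs b + 1" using b[OF z] by linarith
   hence "norm (q z * F n z) <= (abs b + 1) * norm (F n z)" unfolding norm_mult by (intro mult_right_mono) auto
   also have "... < e" using elim z by (auto simp: pos_less_divide_eq mult.commute)
   finally show "dist (q z * F n z) 0 < e" by simp
  qed
 qed
qed

lemma compact_continuous_bound:
 fixes q :: "complex => complex"
 assumes "compact K" "continuous_on K q"
 obtains b where "!!z. z : K ==> norm (q z) <= b"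
 using compact_imp_bounded[OF compact_continuous_image[OF assms(2,1)]] unfolding bounded_iff by auto

section \<open>Multi-level Hermite-Pade polynomials\<close>

locale nik_pade = nik_sys +
 fixes v t :: "nat => real poly" and T :: "real poly" and a :: "nat => nat => real poly"
 assumes T0: "T ~= 0" and tT: "!!k. 1 <= k ==> k <= m ==> t k dvd T"
  and hp: "!!n. n >= 1 ==> mlhp m sg v t n (a n)"
  and TDl1: "!!x. x : Dl 1 ==> poly T x ~= 0" and TDlm: "!!x. x : Dl m ==> poly T x ~= 0"
  and determinacy: "carleman (sg m) | bounded (Dl (m - 1))"
begin

abbreviation D :: nat where "D == degree T"

lemma mlhp_sys: "n >= 1 ==> D <= n ==> mlhp_sys m sg Dl v t T n (a n)"
 by (intro mlhp_sys.intro nik_sys_axioms mlhp_sys_axioms.intro) (use T0 tT hp TDl1 in auto)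

lemma g_last: "1 <= l ==> l <= m ==> gmeas (Dl m) (nik sg m l)" using gnik_down[of l m] by simp

lemma gs_last: "gmeas (Dl m) (sg m)" "gmeas (Dl (m - 1)) (sg (m - 1))"
 using gsg[of m] gsg[of "m - 1"] m2 by auto

lemma disj_last: "Dl m Int Dl (m - 1) = {}"
proof -
 have 1: "1 <= m - 1" "m - 1 < m" "Suc (m - 1) = m" using m2 by auto
 show ?thesis using disj[OF 1(1,2)] unfolding 1(3) by blast
qed

lemma interval_facts:
 "closed (Dl m)" "convex (Dl m)" "Dl m ~= {}" "closed (Dl (m - 1))" "convex (Dl (m - 1))" "Dl (m - 1) ~= {}"
 using gmeasD(3-5)[OF gs_last(1)] gmeasD(3-5)[OF gs_last(2)] by auto

text \<open>\<open>Dl m\<close> misses the nonempty interval \<open>Dl (m - 1)\<close> and so lies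
  on one side of it. The moment problem is thus one on a half-line, where the exponent
  \<open>1 / (2 * n)\<close> in Carleman's condition is the appropriate one.\<close>

lemma half_line:
 obtains ep A :: real where "ep = 1 | ep = -1" "A >= 1" "!!x. x : Dl m ==> 1 <= ep * x + A"
proof -
 obtain b where b: "b : Dl (m - 1)" using interval_facts(6) by blast
 consider "ALL x:Dl m. x < b" | "ALL x:Dl m. b < x"
  using convex_Int_lessThan_sep[OF interval_facts(2,5) disj_last] b by blast
 thus ?thesis
 proof cases
  case 1
  thus ?thesis by (intro that[of "-1" "1 + abs b"]) force+
 next
  case 2
  thus ?thesis by (intro that[of 1 "1 + abs b"]) force+
 qed
qed

text \<open>Up to sign the density of s_{m,l} with respect to \<open>sg m\<close> is the transform
  of s_{m-1,l}, bounded on \<open>Dl m\<close> because the neighbouring intervals have positive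
  distance. Carleman's condition on \<open>sg m\<close> thereby serves all measures s_{m,l}.\<close>

lemma integral_nik_le:
 assumes l: "1 <= l" "l <= m"
 shows "\<exists>K>0. \<forall>g :: real => real. g : bm --> integrable (snd (sg m)) g --> (ALL x:Dl m. 0 <= g x) -->
  (LINT x|snd (nik sg m l). g x) <= K * (LINT x|snd (sg m). g x)"
proof (cases "l = m")
 case True
 show ?thesis unfolding True nik_self by (intro exI[of _ 1]) simp
next
 case False
 define b where "b = nik sg (m - 1) l"
 have gb: "gmeas (Dl (m - 1)) b" using gnik_down[of l "m - 1"] l False by (simp add: b_def)
 have eq: "nik sg m l = mprod (sg m) b" using nik_down[of l m] l False by (simp add: b_def)
 obtain d where d: "d > 0" "!!x t. x : Dl m ==> t : Dl (m - 1) ==> d <= abs (x - t)"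
  using sep_closed_intervals[OF interval_facts(2,5) disj_last interval_facts(1,4)] by blast
 define K where "K = (LINT x|snd b. norm (1::complex)) / d + 1"
 have K: "K > 0"
 proof -
  have "(LINT x|snd b. norm (1::complex)) >= 0" by (intro integral_nonneg_AE) auto
  hence "(LINT x|snd b. norm (1::complex)) / d >= 0" using d(1) by (intro divide_nonneg_nonneg) auto
  thus ?thesis unfolding K_def by linarith
 qed
 have le: "abs (Re (cauchy b (cx x))) <= K" if x: "x : Dl m" for x
 proof -
  have "norm (ctr b (%_. 1) (cx x)) <= (LINT x|snd b. norm (1::complex)) / d"
  proof (rule ctr_bound_dist[OF gb tame_const d(1)])
   fix t assume "t : Dl (m - 1)"
   hence "d <= abs (x - t)" by (rule d(2)[OF x])
   thus "d <= norm (cx x - cx t)" unfolding of_real_diff[symmetric] norm_of_real .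
  qed
  thus ?thesis unfolding cauchy_eq_ctr K_def using abs_Re_le_cmod[of "ctr b (%_. 1) (cx x)"] by linarith
 qed
 have meas: "(%x. Re (cauchy b (cx x))) : bm"
 proof -
  have "ctr b (%_. 1) : bm" by (rule ctr_borel_measurable[OF gb]) auto
  hence "(%x. cauchy b (cx x)) : bm"
   unfolding cauchy_eq_ctr[abs_def] by (rule measurable_compose[OF borel_measurable_of_real])
  thus ?thesis by (rule measurable_compose[OF _ borel_measurable_Re])
 qed
 show ?thesis
 proof (intro exI[of _ K] conjI K allI impI)
  fix g :: "real => real"
  assume g: "g : bm" "integrable (snd (sg m)) g" "ALL x:Dl m. 0 <= g x"
  have "(LINT x|snd (nik sg m l). g x) = (LINT x|snd (sg m). abs (Re (cauchy b (cx x))) *\<^sub>R g x)"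
   unfolding eq mprod_def snd_conv
   by (rule integral_density) (auto intro!: gmeas_borel[OF gs_last(1)] g borel_measurable_abs meas)
  also have "... <= (LINT x|snd (sg m). K * g x)"
  proof (rule integral_mono_AE)
   have AE: "AE x in snd (sg m). abs (Re (cauchy b (cx x))) *\<^sub>R g x <= K * g x & 0 <= g x"
    using gmeasD(6)[OF gs_last(1)] by eventually_elim (use le g(3) in \<open>auto intro: mult_right_mono\<close>)
   thus "AE x in snd (sg m). abs (Re (cauchy b (cx x))) *\<^sub>R g x <= K * g x" by eventually_elim simp
   show i: "integrable (snd (sg m)) (%x. K * g x)" using g(2) by simp
   show "integrable (snd (sg m)) (%x. abs (Re (cauchy b (cx x))) *\<^sub>R g x)"
   proof (rule Bochner_Integration.integrable_bound[OF i])
    show "(%x. abs (Re (cauchy b (cx x))) *\<^sub>R g x) : borel_measurable (snd (sg m))"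
     by (intro gmeas_borel[OF gs_last(1)] borel_measurable_scaleR borel_measurable_abs meas g)
    show "AE x in snd (sg m). norm (abs (Re (cauchy b (cx x))) *\<^sub>R g x) <= norm (K * g x)"
     using AE
    proof eventually_elim
     case (elim x)
     hence "0 <= abs (Re (cauchy b (cx x))) *\<^sub>R g x" by simp
     thus ?case using elim K by (simp add: abs_mult)
    qed
   qed
  qed
  finally show "(LINT x|snd (nik sg m l). g x) <= K * (LINT x|snd (sg m). g x)" by simp
 qed
qed

lemma pade_seq_limit:
 assumes ps: "pade_seq (Dl m) (Dl (m - 1)) (nik sg m l) X Y u P M c n0" and l: "1 <= l" "l <= m"
  and K: "compact K" "K <= - cx ` Dl m"
 shows "uniform_limit K (%n z. pc (u n) z * cn l z
   - pc (P n) z / pc (nodal (Y n)) z) (%_. 0) sequentially"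
proof -
 interpret pade_seq "Dl m" "Dl (m - 1)" "nik sg m l" X Y u P M c n0 by (rule ps)
 have "uniform_limit K G (%_. 0) sequentially"
 proof (rule G_uniform_limit_zero[OF _ K])
  fix r :: "nat => nat" and g
  assume r: "strict_mono r" "g holomorphic_on - cx ` Dl m"
   "!!z. z : - cx ` Dl m ==> (%n. F (r n) z) ----> g z"
  show "ALL z:- cx ` Dl m. g z = 0"
  proof (cases "bounded (Dl (m - 1))")
   case True
   thus ?thesis by (rule limit_zero_bounded[OF _ r])
  next
   case False
   hence car: "carleman (sg m)" using determinacy by blast
   obtain ep A :: real where ep: "ep = 1 | ep = -1" and A: "A >= 1" and y1: "!!x. x : Dl m ==> 1 <= ep * x + A"
    using half_line by blast
   obtain K where K: "K > 0" "\<forall>g :: real => real. g : bm --> integrable (snd (sg m)) g --> (ALL x:Dl m. 0 <= g x) -->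
     (LINT x|snd (nik sg m l). g x) <= K * (LINT x|snd (sg m). g x)"
    using integral_nik_le[OF l] by blast
   show ?thesis
   \<comment> \<open>The comparison sequence consists of the shifted moments of \<open>sg m\<close>,
     to which Carleman's condition applies; those of s_{m,l} are only bounded by multiples of
     them.\<close>
   proof (rule limit_zero_carleman[where S = "%i. \<integral>x. (ep * x + A) ^ i \<partial>snd (sg m)" and ep = ep and A = A and K = K and r = r])
    show "0 < (LINT x|snd (sg m). (ep * x + A) ^ i)" for i by (rule shift_pos[OF gs_last(1) ep A y1])
    show "(LINT x|snd (sg m). (ep * x + A) ^ Suc i) * (LINT x|snd (sg m). (ep * x + A) ^ Suc i)
      <= (LINT x|snd (sg m). (ep * x + A) ^ i) * (LINT x|snd (sg m). (ep * x + A) ^ Suc (Suc i))" for i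
     by (rule shift_convex[OF gs_last(1) ep A y1])
    show "\<not> summable (%i. sqrt ((LINT x|snd (sg m). (ep * x + A) ^ i) / (LINT x|snd (sg m). (ep * x + A) ^ Suc i)))"
     by (rule ratio_divergence[OF gs_last(1) ep A y1 car])
    show "(LINT x|snd (nik sg m l). (ep * x + A) ^ i) <= K * (LINT x|snd (sg m). (ep * x + A) ^ i)" for i
    proof (rule K(2)[rule_format])
     show "(%x. (ep * x + A) ^ i) : bm" by (intro borel_measurable_continuous_onI continuous_intros)
     show "integrable (snd (sg m)) (%x. (ep * x + A) ^ i)" by (rule shift_integrable[OF gs_last(1) ep A y1])
     show "0 <= (ep * x + A) ^ i" if "x : Dl m" for x using y1[OF that] by simp
    qed
   qed (fact ep A y1 K(1) r)+
  qed
 qed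
 thus ?thesis by (simp only: G_def[abs_def])
qed

text \<open>The coefficient vector of \<open>u\<close> has sum norm \<open>1\<close>, so limits
  along subsequences exist and are not zero; nonnegativity on \<open>Dl m\<close> fixes their sign.
  \<open>al\<close> is the scalar that brings \<open>a n m\<close> to this form.\<close>

definition normalized :: "nat => real set => real poly => real => bool" where
 "normalized n Y u al \<longleftrightarrow> finite Y & Y <= interior (Dl m) & n - D <= card Y & card Y <= n & al ~= 0 &
   smult al (a n m) = nodal Y * u & u ~= 0 & card Y + degree u <= n & (SUM i<=D. abs (coeff u i)) = 1 & (ALL x:Dl m. 0 <= poly u x)"

lemma normalized_exists:
 assumes n: "n >= 1" "D <= n"
 shows "EX Y u al. normalized n Y u al"
proof -
 interpret S: mlhp_sys m sg Dl v t T n "a n" by (rule mlhp_sys[OF n])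
 obtain Y e where Y: "Y <= interior (Dl m)" "Y <= {x. poly (a n m) x = 0}" "finite Y" "n - D <= card Y"
  "e = 1 | e = -1" "!!x. x : Dl m ==> 0 <= e * poly (a n m) x * poly (nodal Y) x"
  using S.a_m_sign_changes by blast
 have "nodal Y dvd a n m" by (rule nodal_dvd[OF Y(3)]) (use Y(2) in auto)
 then obtain b where b: "a n m = nodal Y * b" by (rule dvdE)
 have b0: "b ~= 0" using S.a_m_nonzero b by auto
 have "degree (a n m) = card Y + degree b" unfolding b using b0 by (subst degree_mult_eq) auto
 moreover have "degree (a n m) <= n" using hp[OF n(1)] by (simp add: mlhp_def)
 ultimately have deg: "card Y + degree b <= n" by simp
 hence degD: "degree b <= D" using Y(4) by linarith
 define L where "L = (SUM i<=D. abs (coeff b i))"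
 have "0 < abs (coeff b (degree b))" using b0 by simp
 also have "... <= L" unfolding L_def using degD by (intro member_le_sum) auto
 finally have L: "L > 0" .
 \<comment> \<open>At the points of \<open>Y\<close> the sign follows by continuity, since these
   points are interior to \<open>Dl m\<close> and isolated in \<open>Y\<close>.\<close>
 have pos: "0 <= e * poly b x" if x: "x : Dl m" for x
 proof (cases "x : Y")
  case False
  have "0 <= e * poly b x * (poly (nodal Y) x)^2" using Y(6)[OF x] by (simp add: b power2_eq_square ac_simps)
  moreover have "(poly (nodal Y) x)^2 > 0" using False poly_nodal_eq_0_iff[OF Y(3)] by simp
  ultimately show ?thesis by (simp add: zero_le_mult_iff)
 next
  case True
  hence xi: "x : interior (Dl m)" using Y(1) by blast
  show ?thesis
  proof (rule ccontr)
   assume "\<not> ?thesis"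
   hence neg: "e * poly b x < 0" by simp
   have "isCont (%x. e * poly b x) x" by (intro continuous_intros)
   hence "\<forall>\<^sub>F y in at x. e * poly b y < 0"
    using order_tendstoD(2)[OF _ neg] unfolding isCont_def by blast
   moreover have "\<forall>\<^sub>F y in at x. y : interior (Dl m)" using xi by (intro eventually_at_in_open') auto
   moreover have "\<forall>\<^sub>F y in at x. y ~: Y"
   proof -
    have "open (- (Y - {x}))" using Y(3) by (intro open_Compl finite_imp_closed) simp
    hence "\<forall>\<^sub>F y in at x. y : - (Y - {x})" by (rule eventually_at_in_open') simp
    thus ?thesis using eventually_neq_at_within[of x x UNIV] by eventually_elim auto
   qed
   ultimately have "\<forall>\<^sub>F y in at x. False"
   proof eventually_elim
    case (elim y)
    have y: "y : Dl m" using elim(2) interior_subset by blast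
    have "0 <= e * poly b y * (poly (nodal Y) y)^2" using Y(6)[OF y] by (simp add: b power2_eq_square ac_simps)
    moreover have "(poly (nodal Y) y)^2 > 0" using elim(3) poly_nodal_eq_0_iff[OF Y(3)] by simp
    ultimately show ?case using mult_neg_pos[OF elim(1), of "(poly (nodal Y) y)^2"] by linarith
   qed
   thus False by simp
  qed
 qed
 have "normalized n Y (smult (e / L) b) (e / L)" unfolding normalized_def
 proof (intro conjI ballI)
  have "(SUM i<=D. abs (coeff (smult (e / L) b) i)) = (SUM i<=D. abs (coeff b i) / L)"
   using Y(5) L by (intro sum.cong refl) (auto simp: abs_mult)
  thus "(SUM i<=D. abs (coeff (smult (e / L) b) i)) = 1" using L by (simp add: sum_divide_distrib[symmetric] L_def)
  show "0 <= poly (smult (e / L) b) x" if "x : Dl m" for x using pos[OF that] L by simp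
  show "smult (e / L) (a n m) = nodal Y * smult (e / L) b" by (simp add: b)
 qed (use Y deg b0 L in auto)
 thus ?thesis by blast
qed

definition nrm :: "nat => real set \<times> real poly \<times> real" where
 "nrm n = (SOME p. normalized n (fst p) (fst (snd p)) (snd (snd p)))"

abbreviation Y :: "nat => real set" where "Y n == fst (nrm n)"
abbreviation u :: "nat => real poly" where "u n == fst (snd (nrm n))"
abbreviation al :: "nat => real" where "al n == snd (snd (nrm n))"
abbreviation W :: "nat => complex => complex" where "W n z == pc (nodal (Y n)) z"

lemma normalized:
 assumes "n >= 1" "D <= n"
 shows "normalized n (Y n) (u n) (al n)"
proof -
 have "EX p. normalized n (fst p) (fst (snd p)) (snd (snd p))" using normalized_exists[OF assms] by simp
 thus ?thesis unfolding nrm_def by (rule someI_ex)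
qed

lemma normalizedD:
 assumes "n >= 1" "D <= n"
 shows "finite (Y n)" "Y n <= interior (Dl m)" "n - D <= card (Y n)" "card (Y n) <= n" "al n ~= 0"
  "smult (al n) (a n m) = nodal (Y n) * u n" "u n ~= 0" "card (Y n) + degree (u n) <= n" "degree (u n) <= D"
  "(SUM i<=D. abs (coeff (u n) i)) = 1" "!!x. x : Dl m ==> 0 <= poly (u n) x"
 using normalized[OF assms] assms unfolding normalized_def by auto

lemma Y_sub: "n >= 1 ==> D <= n ==> Y n <= Dl m"
 using normalizedD(2) interior_subset by (meson order_trans)

lemma u_upper: "n >= 1 ==> D <= n ==> abs (poly (u n) x) <= (1 + abs x) ^ D"
 using poly_growth[OF normalizedD(9), of n x] normalizedD(10)[of n] by simp

end

lemma uniform_limit_zero_sum: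
 fixes F :: "'i => nat => complex => complex"
 assumes "!!i. i : I ==> uniform_limit K (F i) (%_. 0) sequentially"
 shows "uniform_limit K (%n z. SUM i:I. F i n z) (%_. 0) sequentially" using assms
proof (induction I rule: infinite_finite_induct)
 case (insert i I)
 hence "uniform_limit K (%n z. F i n z + (SUM i:I. F i n z)) (%_. 0 + 0) sequentially"
  by (intro uniform_limit_add) auto
 thus ?case using insert.hyps by simp
qed (auto intro: uniform_limit_const)

section \<open>Convergence of the remainders\<close>

context nik_pade
begin

text \<open>This is \<open>T f\<close> with the denominators cleared, and therefore holomorphic at
  the zeros of \<open>T\<close> as well.\<close>

definition ph :: "complex => complex" where
 "ph z = pc T z * cn 1 z
   - (SUM k=1..<m. (-1) ^ k * pc (v k * (T div t k)) z * cn (Suc k) z)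
   - (-1) ^ m * pc (v m * (T div t m)) z"

lemma W_nonzero: "n >= 1 ==> D <= n ==> z ~: cx ` Dl m ==> W n z ~= 0"
 using normalizedD(1) Y_sub by (auto simp: poly_cpoly_nodal_eq_0_iff)

lemma a_m_eq:
 assumes "n >= 1" "D <= n"
 shows "cx (al n) * pc (a n m) z = W n z * pc (u n) z"
proof -
 have "pc (smult (al n) (a n m)) z = pc (nodal (Y n) * u n) z" unfolding normalizedD(6)[OF assms] ..
 thus ?thesis by simp
qed

lemma remainder_pos:
 assumes j: "1 <= j" "j < m" and K: "compact K" "K <= - cx ` Dl m"
 shows "uniform_limit K (%n z. pc (u n) z * cn (Suc j) z
   - cx (al n) * pc (a n j) z / W n z) (%_. 0) sequentially"
proof -
 \<comment> \<open>By \<open>pade_pos\<close> the number of interpolation points falls short of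
   \<open>n\<close> by at most \<open>D + m\<close>.\<close>
 define c where "c = D + m"
 define n0 where "n0 = 2 * c + 1"
 define good where "good n X \<longleftrightarrow> finite X & X <= Dl (m - 1) & n <= card X + D + m &
   (ALL z. z ~: cx ` Dl m -->
    pc (a n m) z * cn (Suc j) z - pc (a n j) z
    = pc (nodal X) z * ctr (nik sg m (Suc j)) (%x. cx (poly (a n m) x / poly (nodal X) x)) z)
   & (ALL p. degree p < card X -->
    (LINT x|snd (nik sg m (Suc j)). poly p x * (poly (a n m) x / poly (nodal X) x)) = 0)" for n X
 define X where "X n = (SOME X. good n X)" for n
 have n1: "n >= 1" "D <= n" "D + m <= n + j" if "n >= n0" for n using that by (auto simp: n0_def c_def)
 have good: "good n (X n)" if n: "n >= n0" for n
 proof -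
  interpret S: mlhp_sys m sg Dl v t T n "a n" by (rule mlhp_sys[OF n1(1,2)[OF n]])
  have "EX X. good n X" unfolding good_def using S.pade_pos[OF j n1(3)[OF n]] by blast
  thus ?thesis unfolding X_def by (rule someI_ex)
 qed
 note gd = good[unfolded good_def]
 have ps: "pade_seq (Dl m) (Dl (m - 1)) (nik sg m (Suc j)) X Y u (%n. smult (al n) (a n j)) (%n. card (X n)) c n0"
 proof
  show "gmeas (Dl m) (nik sg m (Suc j))" using j by (intro g_last) auto
  show "abs (poly (u n) x) <= (1 + abs x) ^ c" if "n >= n0" for n x
   by (rule order_trans[OF u_upper[OF n1(1,2)[OF that]]]) (intro power_increasing, auto simp: c_def)
  show "card (Y n) <= card (X n) + c" if "n >= n0" for n
   using normalizedD(4)[OF n1(1,2)[OF that]] gd[OF that] by (auto simp: c_def)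
  fix n and p :: "real poly" assume n: "n >= n0" and p: "degree p < card (X n)"
  have "(LINT x|snd (nik sg m (Suc j)). poly p x * (poly (nodal (Y n) * u n) x / poly (nodal (X n)) x))
    = (LINT x|snd (nik sg m (Suc j)). al n * (poly p x * (poly (a n m) x / poly (nodal (X n)) x)))"
   unfolding normalizedD(6)[OF n1(1,2)[OF n], symmetric] by (intro Bochner_Integration.integral_cong refl) simp
  also have "... = al n * (LINT x|snd (nik sg m (Suc j)). poly p x * (poly (a n m) x / poly (nodal (X n)) x))"
   by (rule integral_mult_right_zero)
  also have "(LINT x|snd (nik sg m (Suc j)). poly p x * (poly (a n m) x / poly (nodal (X n)) x)) = 0" using gd[OF n] p by blast
  finally show "(LINT x|snd (nik sg m (Suc j)). poly p x * (poly (nodal (Y n) * u n) x / poly (nodal (X n)) x)) = 0" by simp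
 next
  fix n z assume n: "n >= n0" and z: "z ~: cx ` Dl m"
  have g: "gmeas (Dl m) (nik sg m (Suc j))" using j by (intro g_last) auto
  have "pc (nodal (Y n) * u n) z * cn (Suc j) z - pc (smult (al n) (a n j)) z
    = cx (al n) * (pc (a n m) z * cn (Suc j) z - pc (a n j) z)"
   unfolding normalizedD(6)[OF n1(1,2)[OF n], symmetric] by (simp add: algebra_simps)
  also have "... = pc (nodal (X n)) z * (cx (al n) * ctr (nik sg m (Suc j)) (%x. cx (poly (a n m) x / poly (nodal (X n)) x)) z)"
   using gd[OF n] z by simp
  also have "cx (al n) * ctr (nik sg m (Suc j)) (%x. cx (poly (a n m) x / poly (nodal (X n)) x)) z
    = ctr (nik sg m (Suc j)) (%x. cx (poly (nodal (Y n) * u n) x / poly (nodal (X n)) x)) z"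
   unfolding ctr_cmult[OF g, symmetric] normalizedD(6)[OF n1(1,2)[OF n], symmetric] by simp
  finally show "pc (nodal (Y n) * u n) z * cn (Suc j) z - pc (smult (al n) (a n j)) z
    = pc (nodal (X n)) z * ctr (nik sg m (Suc j)) (%x. cx (poly (nodal (Y n) * u n) x / poly (nodal (X n)) x)) z" .
 next
  show "closed (Dl (m - 1))" "convex (Dl (m - 1))" "Dl (m - 1) ~= {}" by (rule interval_facts)+
  show "Dl m Int Dl (m - 1) = {}" by (rule disj_last)
  show "2 * c < n0" by (simp add: n0_def)
  show "finite (X n)" "X n <= Dl (m - 1)" if "n >= n0" for n using gd[OF that] by blast+
  show "finite (Y n)" "Y n <= Dl m" if "n >= n0" for n
   by (rule normalizedD(1)[OF n1(1,2)[OF that]] Y_sub[OF n1(1,2)[OF that]])+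
  show "card (X n) <= card (X n) + c" if "n >= n0" for n using gd[OF that] by (auto simp: c_def)
  show "n <= card (X n) + c" if "n >= n0" for n using gd[OF that] by (auto simp: c_def)
  show "u n ~= 0" "!!x. x : Dl m ==> 0 <= poly (u n) x" if "n >= n0" for n
   by (rule normalizedD(7,11)[OF n1(1,2)[OF that]]; assumption)+
 qed
 have "uniform_limit K (%n z. pc (u n) z * cn (Suc j) z
   - pc (smult (al n) (a n j)) z / W n z) (%_. 0) sequentially"
  by (rule pade_seq_limit[OF ps _ _ K]) (use j in auto)
 thus ?thesis by simp
qed

text \<open>The scheme of \<open>remainder_pos\<close> with denominator \<open>T a_m\<close>.
  \<open>T\<close> has constant sign on \<open>Dl m\<close>, so \<open>T u_n\<close> becomes
  nonnegative after multiplication by \<open>e\<close>, and division by the coefficient sum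
  \<open>C\<close> restores the growth bound required in \<open>pade_seq\<close>.\<close>

lemma remainder_zero_aux:
 assumes K: "compact K" "K <= - cx ` Dl m"
 shows "uniform_limit K (%n z. pc (T * u n) z * cn 1 z
   - cx (al n) * pc (T * a n 0 + (SUM k=1..m. smult ((-1) ^ k) (a n k * (v k * (T div t k))))) z / W n z) (%_. 0) sequentially"
proof -
 define P0 where "P0 n = T * a n 0 + (SUM k=1..m. smult ((-1) ^ k) (a n k * (v k * (T div t k))))" for n
 define c where "c = 2 * D + 1 + m * (D + 2)"
 define n0 where "n0 = 2 * c + 1"
 define good where "good n X \<longleftrightarrow> finite X & X <= Dl (m - 1) & n <= card X + D + m * (D + 2) &
   (ALL z. z ~: cx ` Dl m -->
    pc (T * a n m) z * cn 1 z - pc (P0 n) z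
    = pc (nodal X) z * ctr (nik sg m 1) (%x. cx (poly (T * a n m) x / poly (nodal X) x)) z)
   & (ALL p. degree p < card X - (D + 1) -->
    (LINT x|snd (nik sg m 1). poly p x * (poly (T * a n m) x / poly (nodal X) x)) = 0)" for n X
 define X where "X n = (SOME X. good n X)" for n
 have n1: "n >= 1" "D <= n" "2 * D + m * (D + 2) + 1 <= n" if "n >= n0" for n using that by (auto simp: n0_def c_def)
 have good: "good n (X n)" if n: "n >= n0" for n
 proof -
  interpret S: mlhp_sys m sg Dl v t T n "a n" by (rule mlhp_sys[OF n1(1,2)[OF n]])
  have "EX X. good n X" unfolding good_def P0_def using S.pade_zero[OF n1(3)[OF n]] unfolding S.tr_def by blast
  thus ?thesis unfolding X_def by (rule someI_ex)
 qed
 note gd = good[unfolded good_def]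
 obtain e :: real where e: "e = 1 | e = -1" "!!x. x : Dl m ==> e * poly T x > 0"
  by (rule no_zero_sign[OF interval_facts(2), of "poly T"]) (use TDlm in \<open>auto intro!: continuous_intros\<close>)
 define C where "C = (SUM i<=D. abs (coeff T i))"
 have C: "C > 0"
 proof -
  have "0 < abs (coeff T D)" using T0 by simp
  also have "... <= C" unfolding C_def by (intro member_le_sum) auto
  finally show ?thesis .
 qed
 define \<beta> where "\<beta> n = e / C * al n" for n
 have g: "gmeas (Dl m) (nik sg m 1)" using m2 by (intro g_last) auto
 have Qeq: "nodal (Y n) * smult (e / C) (T * u n) = smult (\<beta> n) (T * a n m)" if n: "n >= n0" for n
 proof -
  have "nodal (Y n) * smult (e / C) (T * u n) = smult (e / C) (T * (nodal (Y n) * u n))" by (simp add: ac_simps)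
  also have "... = smult (\<beta> n) (T * a n m)" unfolding normalizedD(6)[OF n1(1,2)[OF n], symmetric] by (simp add: \<beta>_def)
  finally show ?thesis .
 qed
 have ps: "pade_seq (Dl m) (Dl (m - 1)) (nik sg m 1) X Y (%n. smult (e / C) (T * u n)) (%n. smult (\<beta> n) (P0 n)) (%n. card (X n) - (D + 1)) c n0"
 proof
  show "gmeas (Dl m) (nik sg m 1)" by (rule g)
  show "abs (poly (smult (e / C) (T * u n)) x) <= (1 + abs x) ^ c" if "n >= n0" for n x
  proof -
   have "abs (poly (smult (e / C) (T * u n)) x) = abs (poly T x) * abs (poly (u n) x) / C"
    using e(1) C by (auto simp: abs_mult)
   also have "... <= (C * (1 + abs x) ^ D) * (1 + abs x) ^ D / C"
    using poly_growth[of T D x] u_upper[OF n1(1,2)[OF that], of x] C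
    by (intro divide_right_mono mult_mono) (auto simp: C_def)
   also have "... = (1 + abs x) ^ (2 * D)" using C by (simp add: power_add[symmetric] mult_2)
   also have "... <= (1 + abs x) ^ c" by (intro power_increasing) (auto simp: c_def)
   finally show ?thesis .
  qed
  show "0 <= poly (smult (e / C) (T * u n)) x" if "n >= n0" "x : Dl m" for n x
  proof -
   have "poly (smult (e / C) (T * u n)) x = (e * poly T x) * poly (u n) x / C" by simp
   thus ?thesis using e(2)[OF that(2)] normalizedD(11)[OF n1(1,2)[OF that(1)] that(2)] C
    divide_nonneg_pos[OF mult_nonneg_nonneg[of "e * poly T x" "poly (u n) x"] C] by (simp only: less_imp_le)
  qed
  show "smult (e / C) (T * u n) ~= 0" if "n >= n0" for n
   using e(1) C T0 normalizedD(7)[OF n1(1,2)[OF that]] by auto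
  show "card (Y n) <= card (X n) - (D + 1) + c" if "n >= n0" for n
   using normalizedD(4)[OF n1(1,2)[OF that]] gd[OF that] by (auto simp: c_def)
  show "n <= card (X n) - (D + 1) + c" if "n >= n0" for n using gd[OF that] by (auto simp: c_def)
  fix n and p :: "real poly" assume n: "n >= n0" and p: "degree p < card (X n) - (D + 1)"
  have "(LINT x|snd (nik sg m 1). poly p x * (poly (nodal (Y n) * smult (e / C) (T * u n)) x / poly (nodal (X n)) x))
    = (LINT x|snd (nik sg m 1). \<beta> n * (poly p x * (poly (T * a n m) x / poly (nodal (X n)) x)))"
   unfolding Qeq[OF n] by (intro Bochner_Integration.integral_cong refl) simp
  also have "... = \<beta> n * (LINT x|snd (nik sg m 1). poly p x * (poly (T * a n m) x / poly (nodal (X n)) x))"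
   by (rule integral_mult_right_zero)
  also have "(LINT x|snd (nik sg m 1). poly p x * (poly (T * a n m) x / poly (nodal (X n)) x)) = 0" using gd[OF n] p by blast
  finally show "(LINT x|snd (nik sg m 1). poly p x * (poly (nodal (Y n) * smult (e / C) (T * u n)) x / poly (nodal (X n)) x)) = 0" by simp
 next
  fix n z assume n: "n >= n0" and z: "z ~: cx ` Dl m"
  have "pc (nodal (Y n) * smult (e / C) (T * u n)) z * cn 1 z - pc (smult (\<beta> n) (P0 n)) z
    = cx (\<beta> n) * (pc (T * a n m) z * cn 1 z - pc (P0 n) z)"
   unfolding Qeq[OF n] by (simp add: algebra_simps)
  also have "pc (T * a n m) z * cn 1 z - pc (P0 n) z
    = pc (nodal (X n)) z * ctr (nik sg m 1) (%x. cx (poly (T * a n m) x / poly (nodal (X n)) x)) z"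
   using gd[OF n] z by blast
  also have "cx (\<beta> n) * (pc (nodal (X n)) z * ctr (nik sg m 1) (%x. cx (poly (T * a n m) x / poly (nodal (X n)) x)) z)
    = pc (nodal (X n)) z * (cx (\<beta> n) * ctr (nik sg m 1) (%x. cx (poly (T * a n m) x / poly (nodal (X n)) x)) z)" by simp
  also have "cx (\<beta> n) * ctr (nik sg m 1) (%x. cx (poly (T * a n m) x / poly (nodal (X n)) x)) z
    = ctr (nik sg m 1) (%x. cx (poly (nodal (Y n) * smult (e / C) (T * u n)) x / poly (nodal (X n)) x)) z"
   unfolding ctr_cmult[OF g, symmetric] Qeq[OF n] by simp
  finally show "pc (nodal (Y n) * smult (e / C) (T * u n)) z * cn 1 z - pc (smult (\<beta> n) (P0 n)) z
    = pc (nodal (X n)) z * ctr (nik sg m 1) (%x. cx (poly (nodal (Y n) * smult (e / C) (T * u n)) x / poly (nodal (X n)) x)) z" .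
 next
  show "closed (Dl (m - 1))" "convex (Dl (m - 1))" "Dl (m - 1) ~= {}" by (rule interval_facts)+
  show "Dl m Int Dl (m - 1) = {}" by (rule disj_last)
  show "2 * c < n0" by (simp add: n0_def)
  show "finite (X n)" "X n <= Dl (m - 1)" if "n >= n0" for n using gd[OF that] by blast+
  show "finite (Y n)" "Y n <= Dl m" if "n >= n0" for n
   by (rule normalizedD(1)[OF n1(1,2)[OF that]] Y_sub[OF n1(1,2)[OF that]])+
  show "card (X n) <= card (X n) - (D + 1) + c" if "n >= n0" for n using gd[OF that] by (auto simp: c_def)
  show "n <= card (X n) + c" if "n >= n0" for n using gd[OF that] by (auto simp: c_def)
 qed
 have lim: "uniform_limit K (%n z. pc (smult (e / C) (T * u n)) z * cn 1 z
   - pc (smult (\<beta> n) (P0 n)) z / W n z) (%_. 0) sequentially"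
  by (rule pade_seq_limit[OF ps _ _ K]) (use m2 in auto)
 have "uniform_limit K (%n z. cx (C / e) * (pc (smult (e / C) (T * u n)) z * cn 1 z
   - pc (smult (\<beta> n) (P0 n)) z / W n z)) (%_. 0) sequentially"
  by (rule uniform_limit_zero_mult[OF lim, of _ "norm (cx (C / e))"]) simp
 moreover have "cx (C / e) * (pc (smult (e / C) (T * u n)) z * cn 1 z
   - pc (smult (\<beta> n) (P0 n)) z / W n z)
   = pc (T * u n) z * cn 1 z - cx (al n) * pc (P0 n) z / W n z" for n z
 proof -
  have ce: "cx (C / e) * cx (e / C) = 1" using C e(1) by (auto simp flip: of_real_mult)
  have "cx (C / e) * (pc (smult (e / C) (T * u n)) z * cn 1 z
    - pc (smult (\<beta> n) (P0 n)) z / W n z)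
   = (cx (C / e) * cx (e / C)) * (pc (T * u n) z * cn 1 z - cx (al n) * pc (P0 n) z / W n z)"
   by (simp add: \<beta>_def right_diff_distrib del: of_real_divide) (simp add: ac_simps)
  thus ?thesis unfolding ce by simp
 qed
 ultimately show ?thesis unfolding P0_def by simp
qed

text \<open>The remainder of level \<open>0\<close> contains the \<open>a_k\<close> multiplied by
  the numerators of \<open>T r_k\<close>. For \<open>1 <= k < m\<close> they are replaced by means
  of the remainders \<open>E k\<close>, for \<open>k = m\<close> by \<open>al a_m = W u\<close>;
  what multiplies \<open>u\<close> is then \<open>ph\<close>.\<close>

lemma remainder_zero:
 assumes K: "compact K" "K <= - cx ` Dl m"
 shows "uniform_limit K (%n z. cx (al n) * pc (T * a n 0) z / W n z - pc (u n) z * ph z) (%_. 0) sequentially"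
proof -
 define tr where "tr k = v k * (T div t k)" for k
 define E where "E j n z = pc (u n) z * cn (Suc j) z - cx (al n) * pc (a n j) z / W n z" for j n z
 define E0 where "E0 n z = pc (T * u n) z * cn 1 z
   - cx (al n) * pc (T * a n 0 + (SUM k=1..m. smult ((-1) ^ k) (a n k * tr k))) z / W n z" for n z
 have E0: "uniform_limit K E0 (%_. 0) sequentially"
  using remainder_zero_aux[OF K] unfolding E0_def[abs_def] tr_def .
 have Ej: "uniform_limit K (%n z. (-1) ^ k * pc (tr k) z * E k n z) (%_. 0) sequentially" if "k : {1..<m}" for k
 proof -
  have E: "uniform_limit K (E k) (%_. 0) sequentially"
   using remainder_pos[OF _ _ K, of k] that unfolding E_def[abs_def] by simp
  have "continuous_on K (%z. (-1) ^ k * pc (tr k) z)" by (intro continuous_intros)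
  then obtain b where b: "!!z. z : K ==> norm ((-1) ^ k * pc (tr k) z) <= b"
   using compact_continuous_bound[OF K(1)] by blast
  show ?thesis by (rule uniform_limit_zero_mult[OF E b])
 qed
 have "uniform_limit K (%n z. SUM k:{1..<m}. (-1) ^ k * pc (tr k) z * E k n z) (%_. 0) sequentially"
  by (rule uniform_limit_zero_sum[OF Ej])
 from uniform_limit_minus[OF this E0]
 have lim: "uniform_limit K (%n z. (SUM k:{1..<m}. (-1) ^ k * pc (tr k) z * E k n z) - E0 n z) (%z. 0) sequentially"
  by simp
 have eq: "(SUM k:{1..<m}. (-1) ^ k * pc (tr k) z * E k n z) - E0 n z
   = cx (al n) * pc (T * a n 0) z / W n z - pc (u n) z * ph z"
  if n: "n >= 1" "D <= n" and z: "z : K" for n z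
 proof -
  have Wz: "W n z ~= 0" using W_nonzero[OF n] z K(2) by blast
  let ?w = "cx (al n) / W n z"
  have um: "?w * pc (a n m) z = pc (u n) z" using a_m_eq[OF n, of z] Wz by (simp add: field_simps)
  have m: "{1..m} = insert m {1..<m}" using m2 by auto
  have "E0 n z = pc T z * pc (u n) z * cn 1 z - ?w * pc (T * a n 0) z
    - (SUM k=1..<m. (-1) ^ k * pc (tr k) z * (?w * pc (a n k) z))
    - (-1) ^ m * pc (tr m) z * (?w * pc (a n m) z)"
   unfolding E0_def m by (simp add: cpoly_sum poly_sum sum_distrib_left sum_divide_distrib algebra_simps add_divide_distrib)
  hence "E0 n z = pc T z * pc (u n) z * cn 1 z - ?w * pc (T * a n 0) z
    - (SUM k=1..<m. (-1) ^ k * pc (tr k) z * (?w * pc (a n k) z))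
    - (-1) ^ m * pc (tr m) z * pc (u n) z" unfolding um .
  moreover have "(SUM k:{1..<m}. (-1) ^ k * pc (tr k) z * E k n z)
    = pc (u n) z * (SUM k=1..<m. (-1) ^ k * pc (tr k) z * cn (Suc k) z)
     - (SUM k=1..<m. (-1) ^ k * pc (tr k) z * (?w * pc (a n k) z))"
   unfolding E_def by (simp add: right_diff_distrib sum_subtractf sum_distrib_left ac_simps)
  moreover have "pc (u n) z * ph z = pc T z * pc (u n) z * cn 1 z
    - pc (u n) z * (SUM k=1..<m. (-1) ^ k * pc (tr k) z * cn (Suc k) z)
    - (-1) ^ m * pc (tr m) z * pc (u n) z"
   unfolding ph_def tr_def[symmetric] right_diff_distrib by (simp only: ac_simps)
  moreover have "cx (al n) * pc (T * a n 0) z / W n z = ?w * pc (T * a n 0) z" by simp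
  ultimately show ?thesis by (simp only:) (simp add: algebra_simps)
 qed
 show ?thesis
 proof (rule uniform_limitI)
  fix e :: real assume "e > 0"
  from uniform_limitD[OF lim this] eventually_ge_at_top[of "max 1 D"]
  show "EVN n. ALL z:K. dist (cx (al n) * pc (T * a n 0) z / W n z - pc (u n) z * ph z) 0 < e"
  proof eventually_elim
   case (elim n)
   hence n: "n >= 1" "D <= n" by auto
   show ?case using elim(1) eq[OF n] by auto
  qed
 qed
qed

lemma ph_holomorphic: "ph holomorphic_on - cx ` Dl m"
proof -
 have "cn l holomorphic_on - cx ` Dl m" if "1 <= l" "l <= m" for l
  unfolding cauchy_eq_ctr[abs_def] by (rule ctr_holomorphic[OF g_last[OF that] tame_const])
 thus ?thesis unfolding ph_def[abs_def] using m2 by (intro holomorphic_intros) auto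
qed

end

section \<open>Poles of the limit function\<close>

context nik_pade
begin

abbreviation Z :: "complex set" where "Z == {z. pc T z = 0}"
abbreviation Dlc :: "complex set" where "Dlc == cx ` Dl m"
abbreviation f :: "complex => complex" where "f == limit_fun m sg v t"

lemma finite_Z: "finite Z" using poly_roots_finite[of "cpoly T"] T0 by simp

lemma Z_off: "z : Z ==> z ~: Dlc" using TDlm by auto

lemma open_c: "open (- Dlc)" by (intro open_Compl closed_of_real_image interval_facts)

lemma f_eq:
 assumes "pc T z ~= 0" shows "f z = ph z / pc T z"
proof -
 interpret S: mlhp_sys m sg Dl v t T "max 1 D" "a (max 1 D)" by (rule mlhp_sys) auto
 have r: "ratfun (v k) (t k) z * pc T z = pc (v k * (T div t k)) z" if "1 <= k" "k <= m" for k
  using S.T_ratfun[OF that assms] unfolding S.tr_def by (simp only: mult.commute)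
 have "f z * pc T z = ph z"
 proof -
  have "f z * pc T z = pc T z * cn 1 z
    - (SUM k=1..<m. (-1) ^ k * (ratfun (v k) (t k) z * pc T z) * cn (Suc k) z)
    - (-1) ^ m * (ratfun (v m) (t m) z * pc T z)"
   unfolding limit_fun_def left_diff_distrib sum_distrib_right by (simp only: ac_simps)
  also have "(SUM k=1..<m. (-1) ^ k * (ratfun (v k) (t k) z * pc T z) * cn (Suc k) z)
    = (SUM k=1..<m. (-1) ^ k * pc (v k * (T div t k)) z * cn (Suc k) z)"
   by (rule sum.cong[OF refl]) (subst r, auto)
  also have "ratfun (v m) (t m) z * pc T z = pc (v m * (T div t m)) z" by (rule r) (use m2 in auto)
  finally show ?thesis unfolding ph_def .
 qed
 thus ?thesis using assms by (simp add: field_simps)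
qed

text \<open>Near \<open>ze\<close> the function is \<open>ph / T\<close> with \<open>ph\<close>
  holomorphic, so clearing both denominators and letting the point tend to \<open>ze\<close>
  compares the orders. If they are equal, the same limit expresses \<open>ph ze\<close> as a product
  of two nonzero leading coefficients.\<close>

lemma pole_order_le:
 assumes ze: "ze ~: Dlc" and pole: "is_pole f ze"
 shows "pole_order f ze > 0" "pole_order f ze <= order ze (cpoly T)" "pole_order f ze = order ze (cpoly T) ==> ph ze ~= 0"
proof -
 define S where "S = - Dlc - (Z - {ze})"
 have S: "open S" "ze : S" unfolding S_def
  using open_c finite_Z ze by (auto intro: open_Diff finite_imp_closed)
 have hol: "f holomorphic_on S - {ze}"
 proof -
  have "(%z. ph z / pc T z) holomorphic_on S - {ze}"
   by (intro holomorphic_intros holomorphic_on_subset[OF ph_holomorphic]) (auto simp: S_def)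
  thus ?thesis by (rule holomorphic_transform) (auto simp: S_def f_eq)
 qed
 define p k where "p = pole_order f ze" and "k = order ze (cpoly T)"
 have ex: "zorder f ze < 0 & zor_poly f ze ze ~= 0 & (EX r. r > 0 & cball ze r <= S & zor_poly f ze holomorphic_on cball ze r
  & (ALL w:cball ze r - {ze}. f w = zor_poly f ze w / (w - ze) ^ nat (- zorder f ze) & zor_poly f ze w ~= 0))"
  by (rule zorder_exist_pole[OF hol S pole])
 define g where "g = zor_poly f ze"
 obtain r where r: "r > 0" "cball ze r <= S" "g holomorphic_on cball ze r"
  "ALL w:cball ze r - {ze}. f w = g w / (w - ze) ^ p" and g0: "g ze ~= 0" and neg: "zorder f ze < 0"
  using ex unfolding g_def p_def pole_order_def by blast
 show "pole_order f ze > 0" using neg by (simp add: pole_order_def)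
 hence p0: "p > 0" by (simp add: p_def)
 have "cpoly T ~= 0" using T0 by simp
 then obtain q where q: "cpoly T = [:-ze, 1:] ^ k * q" "\<not> [:-ze, 1:] dvd q" using order_decomp[of "cpoly T" ze] unfolding k_def by blast
 have q0: "poly q ze ~= 0" using q(2) by (simp add: poly_eq_0_iff_dvd)
 have Tw: "pc T w = (w - ze) ^ k * poly q w" for w by (subst q(1)) (simp add: poly_power)
 have eq: "ph w * (w - ze) ^ p = g w * poly q w * (w - ze) ^ k" if w: "w : cball ze r - {ze}" for w
 proof -
  have "w ~: Z" using w r(2) by (auto simp: S_def)
  hence T: "pc T w ~= 0" by simp
  have "ph w / pc T w = g w / (w - ze) ^ p" using f_eq[OF T] r(4) w by simp
  moreover have "(w - ze) ^ p ~= 0" using w by simp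
  ultimately have "ph w * (w - ze) ^ p = g w * pc T w" using T by (simp add: frac_eq_eq)
  thus ?thesis unfolding Tw by (simp add: ac_simps)
 qed
 have ev: "\<forall>\<^sub>F w in at ze. w : cball ze r - {ze}"
 proof -
  have "\<forall>\<^sub>F w in at ze. w : ball ze r - {ze}" using r(1) by (intro eventually_at_in_open) auto
  thus ?thesis by eventually_elim auto
 qed
 have phc: "(ph ---> ph ze) (at ze)"
 proof -
  have "isCont ph ze" using holomorphic_on_imp_continuous_on[OF ph_holomorphic] open_c ze by (simp add: continuous_on_eq_continuous_at)
  thus ?thesis by (simp add: isCont_def)
 qed
 have gc: "(g ---> g ze) (at ze)"
 proof -
  have "continuous_on (ball ze r) g" using holomorphic_on_imp_continuous_on[OF r(3)] by (rule continuous_on_subset) auto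
  hence "isCont g ze" using r(1) by (simp add: continuous_on_eq_continuous_at)
  thus ?thesis by (simp add: isCont_def)
 qed
 have qc: "((%w. poly q w) ---> poly q ze) (at ze)" by (intro tendsto_intros)
 have gq: "((%w. g w * poly q w) ---> g ze * poly q ze) (at ze)" by (intro tendsto_mult gc qc)
 have pk: "p <= k"
 proof (rule ccontr)
  assume "\<not> p <= k"
  hence d: "p - k > 0" "p = (p - k) + k" by auto
  have "\<forall>\<^sub>F w in at ze. ph w * (w - ze) ^ (p - k) = g w * poly q w" using ev
  proof eventually_elim
   case (elim w)
   have "ph w * (w - ze) ^ (p - k) * (w - ze) ^ k = g w * poly q w * (w - ze) ^ k"
    using eq[OF elim] d(2) by (metis power_add mult.assoc)
   thus ?case using elim by simp
  qed
  moreover have "((%w. ph w * (w - ze) ^ (p - k)) ---> ph ze * (ze - ze) ^ (p - k)) (at ze)" by (intro tendsto_intros phc)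
  ultimately have "((%w. g w * poly q w) ---> ph ze * (ze - ze) ^ (p - k)) (at ze)" by (rule Lim_transform_eventually[rotated])
  hence "g ze * poly q ze = ph ze * (ze - ze) ^ (p - k)" using gq tendsto_unique[OF trivial_limit_at] by blast
  thus False using g0 q0 by (simp add: zero_power[OF d(1)])
 qed
 thus "pole_order f ze <= order ze (cpoly T)" by (simp add: p_def k_def)
 assume "pole_order f ze = order ze (cpoly T)"
 hence pk: "p = k" by (simp add: p_def k_def)
 have "\<forall>\<^sub>F w in at ze. ph w = g w * poly q w" using ev
 proof eventually_elim
  case (elim w)
  thus ?case using eq[OF elim] pk by simp
 qed
 with phc have "((%w. g w * poly q w) ---> ph ze) (at ze)" by (rule Lim_transform_eventually)
 hence "g ze * poly q ze = ph ze" using gq tendsto_unique[OF trivial_limit_at] by blast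
 thus "ph ze ~= 0" using g0 q0 by auto
qed

end

locale nik_pade_poles = nik_pade +
 assumes pole_fin: "finite (pole_set f (- Dlc))" and pole_sum: "(SUM ze:pole_set f (- Dlc). pole_order f ze) = degree T"
begin

text \<open>The pole orders sum to \<open>D\<close> and are bounded by the orders of
  \<open>T\<close>, which also sum to \<open>D\<close>; so every zero of \<open>T\<close> is a pole
  and all orders agree.\<close>

lemma poles:
 shows "pole_set f (- Dlc) = Z" and "ze : Z ==> pole_order f ze = order ze (cpoly T)" and "ze : Z ==> ph ze ~= 0"
proof -
 let ?P = "pole_set f (- Dlc)"
 have T: "cpoly T ~= 0" using T0 by simp
 have P: "ze ~: Dlc" "is_pole f ze" if "ze : ?P" for ze using that by (auto simp: pole_set_def)
 have sub: "?P <= Z"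
 proof
  fix ze assume ze: "ze : ?P"
  have "order ze (cpoly T) > 0" using pole_order_le(1,2)[OF P[OF ze]] by linarith
  thus "ze : Z" using T by (simp add: order_root)
 qed
 have total: "(SUM ze:Z. order ze (cpoly T)) = D" using order_sum_degree[OF T] by simp
 have le: "(SUM ze:?P. pole_order f ze) <= (SUM ze:?P. order ze (cpoly T))"
  by (intro sum_mono pole_order_le(2) P)
 have split: "(SUM ze:Z. order ze (cpoly T)) = (SUM ze:Z - ?P. order ze (cpoly T)) + (SUM ze:?P. order ze (cpoly T))"
  by (rule sum.subset_diff[OF sub finite_Z])
 have "Z - ?P = {}"
 proof (rule ccontr)
  assume "Z - ?P ~= {}"
  then obtain ze where ze: "ze : Z - ?P" by blast
  have "order ze (cpoly T) > 0" using ze T by (simp add: order_root)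
  also have "order ze (cpoly T) <= (SUM ze:Z - ?P. order ze (cpoly T))" using ze finite_Z by (intro member_le_sum) auto
  finally show False using le split total pole_sum by linarith
 qed
 thus PZ: "?P = Z" using sub by blast
 show po: "pole_order f ze = order ze (cpoly T)" if ze: "ze : Z" for ze
 proof (rule ccontr)
  assume "pole_order f ze ~= order ze (cpoly T)"
  moreover have "pole_order f ze <= order ze (cpoly T)" using ze PZ P by (intro pole_order_le(2)) auto
  ultimately have "pole_order f ze < order ze (cpoly T)" by simp
  hence "(SUM ze:?P. pole_order f ze) < (SUM ze:?P. order ze (cpoly T))"
  proof (intro sum_strict_mono_ex1[OF pole_fin] ballI)
   fix x assume "x : ?P"
   thus "pole_order f x <= order x (cpoly T)" by (intro pole_order_le(2) P)
  next
   show "EX x:?P. pole_order f x < order x (cpoly T)" using ze PZ `pole_order f ze < _` by blast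
  qed
  thus False using PZ total pole_sum by simp
 qed
 show "ph ze ~= 0" if ze: "ze : Z" using ze PZ P po by (intro pole_order_le(3)) auto
qed

text \<open>Suppose that the limit \<open>p\<close> has a smaller order than \<open>T\<close> at a zero of \<open>T\<close>. Divide the holomorphic
 function \<open>al T a\<^sub>0 / W - p ph\<close>, small on a circle, by the common zeros of \<open>p\<close> and \<open>T\<close>: by the
 maximum modulus principle it is small at the center, where only the second term survives, and
 \<open>ph \<noteq> 0\<close> there.\<close>

lemma subsequence_limit:
 assumes r: "!!n. r n >= max 1 D" "filterlim r at_top sequentially"
  and lim: "!!i. i <= D ==> (%n. coeff (u (r n)) i) ----> l i"
 shows "EX c. ALL i<=D. l i = c * coeff T i"
proof -
 define p where "p = (SUM i<=D. monom (l i) i)"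
 have cp: "coeff p i = (if i <= D then l i else 0)" for i by (simp add: p_def coeff_sum)
 have dp: "degree p <= D" unfolding p_def by (intro degree_sum_le) (auto intro: order_trans[OF degree_monom_le])
 have n: "r n >= 1" "D <= r n" for n using r(1)[of n] by auto
 have T: "cpoly T ~= 0" using T0 by simp
 have uK: "uniform_limit K (%n z. pc (u (r n)) z) (%z. pc p z) sequentially" if "compact K" for K
  by (rule uniform_limit_cpoly[OF always_eventually dp _ that]) (use normalizedD(9)[OF n] lim cp in auto)
 have "(%n. SUM i<=D. abs (coeff (u (r n)) i)) ----> (SUM i<=D. abs (l i))" by (intro tendsto_intros lim) auto
 hence "(%n. 1) ----> (SUM i<=D. abs (l i))" using normalizedD(10)[OF n] by simp
 hence l1: "(SUM i<=D. abs (l i)) = 1" using LIMSEQ_unique[OF _ tendsto_const] by metis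
 have p0: "p ~= 0"
 proof
  assume "p = 0"
  hence "l i = 0" if "i <= D" for i using cp[of i] that by simp
  thus False using l1 by simp
 qed
 have "cpoly T dvd cpoly p"
 proof (rule dvd_if_order_le[OF T])
  show "cpoly p ~= 0" using p0 by simp
  fix ze assume "pc T ze = 0"
  hence zeZ: "ze : Z" by simp
  have ze: "ze : - Dlc" using Z_off[OF zeZ] by simp
  define k b where "k = order ze (cpoly T)" and "b = order ze (cpoly p)"
  have "b >= k"
  proof (rule ccontr)
   assume bk: "\<not> b >= k"
   obtain qT where qT: "cpoly T = [:-ze, 1:] ^ k * qT" using order_1[of ze "cpoly T"] unfolding k_def by (elim dvdE)
   have "cpoly p ~= 0" using p0 by simp
   then obtain q where q: "cpoly p = [:-ze, 1:] ^ b * q" "\<not> [:-ze, 1:] dvd q" using order_decomp[of "cpoly p" ze] unfolding b_def by blast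
   have q0: "poly q ze ~= 0" using q(2) by (simp add: poly_eq_0_iff_dvd)
   have Tw: "pc T w = (w - ze) ^ b * ((w - ze) ^ (k - b) * poly qT w)" for w
   proof -
    have "pc T w = (w - ze) ^ (b + (k - b)) * poly qT w" using bk by (subst qT) (simp add: poly_power)
    thus ?thesis by (simp only: power_add mult.assoc)
   qed
   have pw: "pc p w = (w - ze) ^ b * poly q w" for w by (subst q(1)) (simp add: poly_power)
   obtain rh where rh: "rh > 0" "cball ze rh <= - Dlc" using open_c ze open_contains_cball by blast
   have sK: "compact (sphere ze rh)" "sphere ze rh <= - Dlc" using rh(2) by auto
   define hn where "hn n z = cx (al (r n)) * pc (a (r n) 0) z / W (r n) z" for n z
   have L1: "uniform_limit (sphere ze rh) (%n z. pc T z * hn n z - pc (u (r n)) z * ph z) (%_. 0) sequentially"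
   proof -
    have "uniform_limit (sphere ze rh) (%n z. cx (al (r n)) * pc (T * a (r n) 0) z / W (r n) z - pc (u (r n)) z * ph z) (%_. 0) sequentially"
     using filterlim_compose[OF remainder_zero[OF sK] r(2)] .
    thus ?thesis by (simp add: hn_def mult.left_commute)
   qed
   have L2: "uniform_limit (sphere ze rh) (%n z. ph z * (pc (u (r n)) z - pc p z)) (%_. 0) sequentially"
   proof -
    have "uniform_limit (sphere ze rh) (%n z. pc (u (r n)) z - pc p z) (%z. pc p z - pc p z) sequentially"
     by (intro uniform_limit_minus uK[OF sK(1)] uniform_limit_const)
    hence 0: "uniform_limit (sphere ze rh) (%n z. pc (u (r n)) z - pc p z) (%_. 0) sequentially" by simp
    have "continuous_on (sphere ze rh) ph" using holomorphic_on_imp_continuous_on[OF ph_holomorphic] sK(2) by (rule continuous_on_subset)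
    then obtain B where "!!z. z : sphere ze rh ==> norm (ph z) <= B" using compact_continuous_bound[OF sK(1)] by blast
    thus ?thesis by (rule uniform_limit_zero_mult[OF 0])
   qed
   have L: "uniform_limit (sphere ze rh) (%n z. pc T z * hn n z - pc p z * ph z) (%_. 0) sequentially"
    using uniform_limit_add[OF L1 L2] by (simp add: algebra_simps)
   define \<eta> where "\<eta> = norm (poly q ze * ph ze)"
   have \<eta>: "\<eta> > 0" using q0 poles(3)[OF zeZ] by (simp add: \<eta>_def)
   have "\<eta> / 2 * rh ^ b > 0" using \<eta> rh(1) by simp
   \<comment> \<open>A single index \<open>n'\<close> suffices: smallness on one circle already
     contradicts the value at the center.\<close>
   from uniform_limitD[OF L this] obtain n' where n': "ALL z:sphere ze rh. dist (pc T z * hn n' z - pc p z * ph z) 0 < \<eta> / 2 * rh ^ b"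
    using eventually_happens'[OF sequentially_bot] by blast
   define Ph where "Ph z = (z - ze) ^ (k - b) * poly qT z * hn n' z - poly q z * ph z" for z
   have hol: "Ph holomorphic_on - Dlc"
    unfolding Ph_def[abs_def] hn_def by (intro holomorphic_intros ph_holomorphic) (use W_nonzero[OF n] in auto)
   have "norm (Ph ze) <= \<eta> / 2"
   proof (rule maximum_modulus_frontier[of Ph "cball ze rh"])
    show "Ph holomorphic_on interior (cball ze rh)" using hol rh(2) interior_subset by (meson holomorphic_on_subset order_trans)
    show "continuous_on (closure (cball ze rh)) Ph"
     using holomorphic_on_imp_continuous_on[OF hol] rh(2) by (auto intro: continuous_on_subset)
    show "ze : cball ze rh" using rh(1) by simp
    fix z assume "z : frontier (cball ze rh)"
    hence z: "z : sphere ze rh" using rh(1) by (simp add: frontier_cball)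
    hence nz: "norm (z - ze) = rh" by (simp add: dist_norm norm_minus_commute)
    have "pc T z * hn n' z - pc p z * ph z = (z - ze) ^ b * Ph z"
     unfolding Tw pw Ph_def by (simp add: algebra_simps)
    hence "norm (pc T z * hn n' z - pc p z * ph z) = rh ^ b * norm (Ph z)"
     by (simp add: norm_mult norm_power nz)
    moreover have "dist (pc T z * hn n' z - pc p z * ph z) 0 < \<eta> / 2 * rh ^ b" using n' z by blast
    ultimately have "rh ^ b * norm (Ph z) < \<eta> / 2 * rh ^ b" by (simp only: dist_norm diff_zero)
    thus "norm (Ph z) <= \<eta> / 2" using rh(1) by (simp add: mult.commute[of "rh ^ b"])
   qed auto
   moreover have "norm (Ph ze) = \<eta>" using bk by (simp add: Ph_def \<eta>_def zero_power norm_mult)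
   ultimately show False using \<eta> by linarith
  qed
  thus "order ze (cpoly T) <= order ze (cpoly p)" by (simp add: k_def b_def)
 qed
 then obtain g where g: "cpoly p = cpoly T * g" by (rule dvdE)
 hence g0: "g ~= 0" using p0 by auto
 have "degree (cpoly p) = degree (cpoly T) + degree g" unfolding g by (rule degree_mult_eq[OF T g0])
 hence "degree g = 0" using dp by simp
 then obtain \<gamma> where \<gamma>: "g = [:\<gamma>:]" using degree_eq_zeroE by blast
 have co: "cx (coeff p i) = \<gamma> * cx (coeff T i)" for i
 proof -
  have "coeff (cpoly p) i = coeff (smult \<gamma> (cpoly T)) i" unfolding g \<gamma> by simp
  thus ?thesis by (simp add: coeff_map_poly)
 qed
 define c where "c = coeff p D / coeff T D"
 have TD: "coeff T D ~= 0" using T0 by simp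
 have "\<gamma> = cx c" using co[of D] TD by (simp add: c_def field_simps)
 hence "cx (coeff p i) = cx (c * coeff T i)" for i using co[of i] by simp
 hence "coeff p i = c * coeff T i" for i by (simp only: of_real_eq_iff)
 thus ?thesis using cp by (intro exI[of _ c]) (metis (no_types, lifting))
qed

end

lemma common_radius:
 assumes "finite Z" "!!ze. ze : Z ==> \<exists>d>0. cball ze d <= S ze"
 shows "\<exists>d>0. ALL ze:Z. cball ze d <= S ze" using assms
proof (induction Z rule: finite_induct)
 case empty
 show ?case by (intro exI[of _ 1]) simp
next
 case (insert x Z)
 from insert.IH insert.prems obtain d where d: "d > 0" "ALL ze:Z. cball ze d <= S ze" by blast
 obtain d' where d': "d' > 0" "cball x d' <= S x" using insert.prems by blast
 have "cball ze (min d d') <= S ze" if "ze : insert x Z" for ze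
 proof (cases "ze = x")
  case True
  have "cball x (min d d') <= cball x d'" by (intro subset_cball) simp
  thus ?thesis using True d'(2) by blast
 next
  case False
  have "cball ze (min d d') <= cball ze d" by (intro subset_cball) simp
  thus ?thesis using False that d(2) by blast
 qed
 thus ?case using d(1) d'(1) by (intro exI[of _ "min d d'"]) simp
qed

lemma zero_count_mono:
 assumes "p ~= 0" "S <= S'" shows "zero_count p S <= zero_count p S'" unfolding zero_count_def
 by (rule sum_mono2) (use assms poly_roots_finite[OF assms(1)] in \<open>auto elim: rev_finite_subset\<close>)

lemma zero_count_le_degree:
 assumes "p ~= 0" shows "zero_count p S <= degree p"
 using zero_count_mono[OF assms, of S UNIV] order_sum_degree[OF assms] by (simp add: zero_count_def)

lemma zero_count_disjoint_balls:
 assumes p: "p ~= 0" and Z: "finite Z" and disj: "!!ze ze'. ze : Z ==> ze' : Z ==> ze ~= ze' ==> B ze Int B ze' = {}"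
  and sub: "!!ze. ze : Z ==> B ze <= S"
 shows "(SUM ze:Z. zero_count p (B ze)) <= zero_count p S"
proof -
 have fin: "finite {z. z : A & poly p z = 0}" for A by (rule finite_subset[OF _ poly_roots_finite[OF p]]) auto
 have "(SUM ze:Z. zero_count p (B ze)) = (SUM z:(\<Union>ze\<in>Z. {z. z : B ze & poly p z = 0}). order z p)"
  unfolding zero_count_def
  by (rule sum.UNION_disjoint[symmetric]) (use Z fin disj in \<open>auto simp: disjoint_iff\<close>)
 also have "... <= zero_count p S"
  unfolding zero_count_def by (rule sum_mono2[OF fin]) (use sub in auto)
 finally show ?thesis .
qed

section \<open>Limit of the normalized factors and its consequences for zeros\<close>

context nik_pade_poles
begin

lemma separating_radius:
 "\<exists>d>0. (ALL ze:Z. cball ze d <= - Dlc) & (ALL ze:Z. ALL z:cball ze d. z : Z --> z = ze) &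
  (ALL ze:Z. ALL ze':Z. ze ~= ze' --> ball ze (d / 2) Int ball ze' (d / 2) = {})"
proof -
 have "\<exists>d>0. ALL ze:Z. cball ze d <= - Dlc - (Z - {ze})"
 proof (rule common_radius[OF finite_Z])
  fix ze assume ze: "ze : Z"
  have "open (- Dlc - (Z - {ze}))" using finite_Z by (intro open_Diff open_c finite_imp_closed) simp
  moreover have "ze : - Dlc - (Z - {ze})" using Z_off[OF ze] by simp
  ultimately show "\<exists>d>0. cball ze d <= - Dlc - (Z - {ze})" unfolding open_contains_cball by blast
 qed
 then obtain d where d: "d > 0" "!!ze. ze : Z ==> cball ze d <= - Dlc - (Z - {ze})" by blast
 show ?thesis
 proof (intro exI[of _ d] conjI d(1) ballI impI)
  fix ze assume "ze : Z"
  thus "cball ze d <= - Dlc" using d(2)[of ze] by blast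
 next
  fix ze z assume "ze : Z" "z : cball ze d" "z : Z"
  thus "z = ze" using d(2)[of ze] by blast
 next
  fix ze ze' assume that: "ze : Z" "ze' : Z" "ze ~= ze'"
  show "ball ze (d / 2) Int ball ze' (d / 2) = {}"
  proof (rule ccontr)
   assume "ball ze (d / 2) Int ball ze' (d / 2) ~= {}"
   then obtain w where "dist ze w < d / 2" "dist ze' w < d / 2" by auto
   hence "dist ze ze' < d" by (intro dist_triangle_half_r[of w ze d ze']) (simp_all add: dist_commute)
   hence "ze' : cball ze d" by simp
   thus False using d(2)[OF that(1)] that by blast
  qed
 qed
qed

definition eT :: real where "eT = (SOME e. (e = 1 | e = -1) & (ALL x:Dl m. e * poly T x > 0))"
text \<open>The multiple of \<open>T\<close> that is positive on \<open>Dl m\<close> and has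
  coefficient vector of sum norm \<open>1\<close> is \<open>c0\<close> times \<open>T\<close>; the
  normalization admits no other limit.\<close>

definition c0 :: real where "c0 = eT / (SUM i<=D. abs (coeff T i))"

lemma eT: "eT = 1 | eT = -1" "!!x. x : Dl m ==> eT * poly T x > 0"
proof -
 obtain e :: real where "e = 1 | e = -1" "!!x. x : Dl m ==> e * poly T x > 0"
  by (rule no_zero_sign[OF interval_facts(2), of "poly T"]) (use TDlm in \<open>auto intro!: continuous_intros\<close>)
 hence "\<exists>e::real. (e = 1 | e = -1) & (ALL x:Dl m. e * poly T x > 0)" by (intro exI[of _ e] conjI ballI)
 hence "(eT = 1 | eT = -1) & (ALL x:Dl m. eT * poly T x > 0)" unfolding eT_def by (rule someI_ex)
 thus "eT = 1 | eT = -1" "!!x. x : Dl m ==> eT * poly T x > 0" by auto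
qed

lemma T_norm_pos: "(SUM i<=D. abs (coeff T i)) > 0"
proof -
 have "0 < abs (coeff T D)" using T0 by simp
 also have "... <= (SUM i<=D. abs (coeff T i))" by (intro member_le_sum) auto
 finally show ?thesis .
qed

lemma c0: "c0 ~= 0" using eT(1) T_norm_pos by (auto simp: c0_def)

lemma subsequence_limit_unique:
 assumes r: "!!n. r n >= max 1 D" "filterlim r at_top sequentially"
  and lim: "!!i. i <= D ==> (%n. coeff (u (r n)) i) ----> l i" and i: "i <= D"
 shows "l i = c0 * coeff T i"
proof -
 have n: "r n >= 1" "D <= r n" for n using r(1)[of n] by auto
 obtain c where c: "ALL i<=D. l i = c * coeff T i" using subsequence_limit[OF r lim] by blast
 have "(%n. SUM i<=D. abs (coeff (u (r n)) i)) ----> (SUM i<=D. abs (l i))" by (intro tendsto_intros lim) auto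
 hence "(%n. 1) ----> (SUM i<=D. abs (l i))" using normalizedD(10)[OF n] by simp
 hence "(SUM i<=D. abs (l i)) = 1" using LIMSEQ_unique[OF _ tendsto_const] by metis
 moreover have "(SUM i<=D. abs (l i)) = abs c * (SUM i<=D. abs (coeff T i))" using c by (simp add: sum_distrib_left abs_mult)
 ultimately have ac: "abs c * (SUM i<=D. abs (coeff T i)) = 1" by simp
 obtain x where x: "x : Dl m" using interval_facts(3) by blast
 have "(%n. SUM i<=D. coeff (u (r n)) i * x ^ i) ----> (SUM i<=D. l i * x ^ i)" by (intro tendsto_intros lim) auto
 hence "(%n. poly (u (r n)) x) ----> (SUM i<=D. l i * x ^ i)" by (simp add: poly_sum_upto[OF normalizedD(9)[OF n]])
 moreover have "(SUM i<=D. l i * x ^ i) = c * poly T x" using c by (simp add: poly_altdef sum_distrib_left mult.assoc)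
 ultimately have "(%n. poly (u (r n)) x) ----> c * poly T x" by simp
 hence cT: "0 <= c * poly T x" using normalizedD(11)[OF n x] by (intro LIMSEQ_le_const) auto
 have "c = eT * abs c"
 proof (rule ccontr)
  assume "c ~= eT * abs c"
  hence "eT * c < 0" using eT(1) by (auto simp: abs_if split: if_splits)
  moreover have "eT * poly T x > 0" by (rule eT(2)[OF x])
  ultimately have "(eT * c) * (eT * poly T x) < 0" by (rule mult_neg_pos)
  thus False using cT eT(1) by auto
 qed
 moreover have "abs c = 1 / (SUM i<=D. abs (coeff T i))" using ac T_norm_pos by (simp add: field_simps)
 ultimately have "c = c0" by (simp add: c0_def)
 thus ?thesis using c i by simp
qed

text \<open>A subsequence staying away from the claimed limit would, by compactness of the
  coefficient vectors, have a convergent subsequence, whose limit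
  \<open>subsequence_limit_unique\<close> identifies.\<close>

lemma u_coeff_limit:
 assumes i: "i <= D"
 shows "(%n. coeff (u n) i) ----> c0 * coeff T i"
proof (rule tendstoI, rule ccontr)
 fix e :: real assume e: "e > 0"
 assume "\<not> (EVN n. dist (coeff (u n) i) (c0 * coeff T i) < e)"
 hence "\<not> (EVN n. n >= max 1 D --> dist (coeff (u n) i) (c0 * coeff T i) < e)"
 proof (rule contrapos_nn)
  assume "EVN n. n >= max 1 D --> dist (coeff (u n) i) (c0 * coeff T i) < e"
  with eventually_ge_at_top[of "max 1 D"] show "EVN n. dist (coeff (u n) i) (c0 * coeff T i) < e"
   by eventually_elim (rule mp)
 qed
 hence "infinite {n. \<not> (n >= max 1 D --> dist (coeff (u n) i) (c0 * coeff T i) < e)}"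
  unfolding cofinite_eq_sequentially[symmetric] eventually_cofinite .
 then obtain r :: "nat => nat" where r: "strict_mono r" "!!n. r n : {n. \<not> (n >= max 1 D --> dist (coeff (u n) i) (c0 * coeff T i) < e)}"
  using infinite_enumerate by blast
 have rn: "r n >= max 1 D" "dist (coeff (u (r n)) i) (c0 * coeff T i) >= e" for n using r(2)[of n] by auto
 define b where "b n i = (if i <= D then coeff (u (r n)) i else 0)" for n i
 have "abs (b n i) <= 1" for n i
 proof (cases "i <= D")
  case True
  have "abs (coeff (u (r n)) i) <= (SUM i<=D. abs (coeff (u (r n)) i))" using True by (intro member_le_sum) auto
  thus ?thesis using normalizedD(10)[of "r n"] rn(1)[of n] True by (simp add: b_def)
 qed (simp add: b_def)
 then obtain q :: "nat => nat" where q: "strict_mono q" "!!i. i < Suc D ==> convergent (%n. b (q n) i)"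
  using common_convergent_subsequence[of b 1 "Suc D"] by blast
 define l where "l i = lim (%n. b (q n) i)" for i
 have l: "(%n. coeff (u (r (q n))) i) ----> l i" if "i <= D" for i
 proof -
  have "(%n. b (q n) i) ----> l i" unfolding l_def using q(2)[of i] that by (simp add: convergent_LIMSEQ_iff)
  thus ?thesis using that by (simp add: b_def)
 qed
 have "filterlim (%n. r (q n)) at_top sequentially"
  using filterlim_subseq[OF strict_mono_o[OF r(1) q(1)]] by (simp add: o_def)
 hence "l i = c0 * coeff T i" by (intro subsequence_limit_unique[OF rn(1) _ l i])
 hence "(%n. coeff (u (r (q n))) i) ----> c0 * coeff T i" using l[OF i] by simp
 hence "EVN n. dist (coeff (u (r (q n))) i) (c0 * coeff T i) < e" by (rule tendstoD[OF _ e])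
 then obtain n where "dist (coeff (u (r (q n))) i) (c0 * coeff T i) < e" using eventually_happens'[OF sequentially_bot] by blast
 thus False using rn(2)[of "q n"] by linarith
qed

lemma u_uniform_limit:
 assumes "compact K"
 shows "uniform_limit K (%n z. pc (u n) z) (%z. pc T z * cx c0) sequentially"
proof -
 have "EVN n. degree (u n) <= D"
  using eventually_ge_at_top[of "max 1 D"] by eventually_elim (auto intro: normalizedD(9))
 hence "uniform_limit K (%n z. pc (u n) z) (%z. pc (smult c0 T) z) sequentially"
  using assms by (intro uniform_limit_cpoly[where D = D]) (use u_coeff_limit in \<open>auto simp: degree_smult_le\<close>)
 thus ?thesis by (simp add: mult.commute)
qed

text \<open>Zeros are treated once for all sequences for which \<open>q n\<close> times
  \<open>V n\<close> tends to \<open>T Ps\<close> with \<open>Ps\<close> free of zeros. For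
  \<open>a m\<close> and \<open>u\<close> the factor \<open>Ps\<close> is \<open>c0\<close>; for
  \<open>a j\<close> it is \<open>c0\<close> times the transform of s_{m,j+1}, which vanishes
  nowhere off \<open>Dl m\<close>.\<close>

context
 fixes q :: "nat => real poly" and V :: "nat => complex => complex" and Ps :: "complex => complex"
 assumes V: "EVN n. V n holomorphic_on - Dlc & (ALL z. z ~: Dlc --> V n z ~= 0)"
  and Ps: "Ps holomorphic_on - Dlc" "!!z. z ~: Dlc ==> Ps z ~= 0"
  and lim: "!!K. compact K ==> K <= - Dlc ==>
   uniform_limit K (%n z. pc (q n) z * V n z) (%z. pc T z * Ps z) sequentially"
begin

lemma count_near_zero:
 assumes d: "cball ze d <= - Dlc" "!!z. z : cball ze d ==> z : Z ==> z = ze" and e: "0 < e" "e < d"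
 shows "EVN n. zero_count (cpoly (q n)) (ball ze e) = order ze (cpoly T)"
proof -
 have T: "cpoly T ~= 0" using T0 by simp
 have sub: "ball ze d <= - Dlc" using d(1) by (meson ball_subset_cball order_trans)
 have "EVN n. zero_count (cpoly (q n)) (ball ze e) = zero_count (cpoly T) (ball ze e)"
 proof (rule zero_count_limit[OF T e, of V ze Ps])
  show "EVN n. V n holomorphic_on ball ze d & (ALL z:ball ze d. V n z ~= 0)"
   using V by eventually_elim (use sub in \<open>auto intro: holomorphic_on_subset\<close>)
  show "Ps holomorphic_on ball ze d" by (rule holomorphic_on_subset[OF Ps(1) sub])
  show "Ps z ~= 0" if "z : ball ze d" for z using Ps(2) that sub by blast
  have "sphere ze e <= - Dlc" using sub e by auto
  thus "uniform_limit (sphere ze e) (%n z. pc (q n) z * V n z) (%z. pc T z * Ps z) sequentially"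
   by (intro lim) auto
  show "pc T z ~= 0" if z: "z : sphere ze e" for z
  proof
   assume "pc T z = 0"
   hence "z = ze" using d(2)[of z] z e by auto
   thus False using z e by auto
  qed
 qed
 moreover have "zero_count (cpoly T) (ball ze e) = order ze (cpoly T)"
  by (rule zero_count_isolated[OF _ _ T]) (use d(2) e in auto)
 ultimately show ?thesis by simp
qed

lemma attracts: "ze : Z ==> attracts_zeros (%n. cpoly (q n)) ze (order ze (cpoly T))"
 unfolding attracts_zeros_def
proof -
 assume ze: "ze : Z"
 obtain d where d0: "d > 0" "ALL ze:Z. cball ze d <= - Dlc" "ALL ze:Z. ALL z:cball ze d. z : Z --> z = ze"
  "ALL ze:Z. ALL ze':Z. ze ~= ze' --> ball ze (d / 2) Int ball ze' (d / 2) = {}"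
  using separating_radius by (elim exE conjE)
 note d = d0(1) d0(2)[THEN bspec] d0(3)[THEN bspec, THEN bspec, THEN mp] d0(4)[THEN bspec, THEN bspec, THEN mp]
 show "\<exists>ep0>0. ALL ep. 0 < ep & ep < ep0 --> (EVN n. zero_count (cpoly (q n)) (ball ze ep) = order ze (cpoly T))"
  using count_near_zero[OF d(2)[OF ze] d(3)[OF ze]] d(1) by (intro exI[of _ d] conjI allI impI) auto
qed

lemma nonzero_on_compact:
 assumes K: "compact K" "K <= - (Dlc Un Z)"
 shows "\<exists>dl>0. EVN n. ALL z:K. dl <= norm (pc (q n) z * V n z)"
proof (cases "K = {}")
 case False
 have sub: "K <= - Dlc" using K(2) by blast
 have cont: "continuous_on K (%z. norm (pc T z * Ps z))"
  using holomorphic_on_imp_continuous_on[OF Ps(1)] sub by (intro continuous_intros) (rule continuous_on_subset)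
 obtain z0 where z0: "z0 : K" "!!z. z : K ==> norm (pc T z0 * Ps z0) <= norm (pc T z * Ps z)"
  using continuous_attains_inf[OF K(1) False cont] by blast
 define \<eta> where "\<eta> = norm (pc T z0 * Ps z0)"
 have "z0 ~: Dlc" "z0 ~: Z" using z0(1) K(2) by auto
 hence \<eta>: "\<eta> > 0" using Ps(2)[of z0] by (simp add: \<eta>_def)
 have "\<eta> / 2 > 0" using \<eta> by simp
 from uniform_limitD[OF lim[OF K(1) sub] this]
 have "EVN n. ALL z:K. \<eta> / 2 <= norm (pc (q n) z * V n z)"
 proof eventually_elim
  case (elim n)
  show ?case
  proof
   fix z assume z: "z : K"
   have "dist (pc (q n) z * V n z) (pc T z * Ps z) < \<eta> / 2" using elim z by blast
   moreover have "\<eta> <= norm (pc T z * Ps z)" using z0(2)[OF z] by (simp add: \<eta>_def)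
   ultimately show "\<eta> / 2 <= norm (pc (q n) z * V n z)"
    using norm_triangle_ineq2[of "pc T z * Ps z" "pc (q n) z * V n z"]
    by (simp only: dist_norm norm_minus_commute)
  qed
 qed
 thus ?thesis using \<eta> by (intro exI[of _ "\<eta> / 2"]) simp
qed (auto intro: exI[of _ 1])

lemma count_off_interval:
 assumes "EVN n. q n ~= 0"
 shows "EVN n. D <= zero_count (cpoly (q n)) (- Dlc)"
proof -
 obtain d where d0: "d > 0" "ALL ze:Z. cball ze d <= - Dlc" "ALL ze:Z. ALL z:cball ze d. z : Z --> z = ze"
  "ALL ze:Z. ALL ze':Z. ze ~= ze' --> ball ze (d / 2) Int ball ze' (d / 2) = {}"
  using separating_radius by (elim exE conjE)
 note d = d0(1) d0(2)[THEN bspec] d0(3)[THEN bspec, THEN bspec, THEN mp] d0(4)[THEN bspec, THEN bspec, THEN mp]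
 have ev: "EVN n. ALL ze:Z. zero_count (cpoly (q n)) (ball ze (d / 2)) = order ze (cpoly T)"
 proof (rule eventually_ball_finite[OF finite_Z], rule ballI)
  fix ze assume ze: "ze : Z"
  show "EVN n. zero_count (cpoly (q n)) (ball ze (d / 2)) = order ze (cpoly T)"
   by (rule count_near_zero[OF d(2)[OF ze] d(3)[OF ze]]) (use d(1) in auto)
 qed
 have total: "(SUM ze:Z. order ze (cpoly T)) = D" using order_sum_degree[of "cpoly T"] T0 by simp
 from ev assms show ?thesis
 proof eventually_elim
  case (elim n)
  have "D = (SUM ze:Z. zero_count (cpoly (q n)) (ball ze (d / 2)))" using elim(1) total by simp
  also have "... <= zero_count (cpoly (q n)) (- Dlc)"
  proof (rule zero_count_disjoint_balls[OF _ finite_Z d(4)])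
   show "cpoly (q n) ~= 0" using elim(2) by simp
   show "ball ze (d / 2) <= - Dlc" if "ze : Z" for ze
   proof -
    have "ball ze (d / 2) <= cball ze d" using d(1) by auto
    thus ?thesis using d(2)[OF that] by blast
   qed
  qed
  finally show ?case .
 qed
qed

lemma others_accumulate: "other_zeros_accumulate (%n. cpoly (q n)) Z Dlc"
 unfolding other_zeros_accumulate_def
proof (intro allI impI)
 fix e :: real assume e: "e > 0"
 define K where "K = cball 0 (1 / e) Int {z. e <= infdist z Dlc} Int (\<Inter>ze\<in>Z. {z. e <= dist z ze})"
 have "closed {z. e <= infdist z Dlc}" by (intro closed_Collect_le continuous_intros)
 moreover have "closed {z. e <= dist z ze}" for ze :: complex by (intro closed_Collect_le continuous_intros)
 ultimately have "compact K" unfolding K_def by (intro compact_Int_closed closed_INT ballI) auto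
 moreover have "K <= - (Dlc Un Z)"
 proof
  fix z assume z: "z : K"
  have "z ~: Dlc" using z e by (auto simp: K_def)
  moreover have "z ~: Z" using z e by (auto simp: K_def)
  ultimately show "z : - (Dlc Un Z)" by blast
 qed
 ultimately obtain dl where dl: "dl > 0" "EVN n. ALL z:K. dl <= norm (pc (q n) z * V n z)"
  using nonzero_on_compact by blast
 from dl(2) show "EVN n. ALL z. pc (q n) z = 0 -->
    (EX ze:Z. dist z ze < e) | infdist z Dlc < e | cmod z > 1 / e"
 proof eventually_elim
  case (elim n)
  show ?case
  proof (intro allI impI)
   fix z assume z: "pc (q n) z = 0"
   show "(EX ze:Z. dist z ze < e) | infdist z Dlc < e | cmod z > 1 / e"
   proof (rule ccontr)
    assume "\<not> ?thesis"
    hence "z : K" unfolding K_def by (auto simp: not_less)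
    hence "dl <= norm (pc (q n) z * V n z)" using elim by blast
    thus False using z dl(1) by simp
   qed
  qed
 qed
qed

end

end

lemma order_nodal: "finite Y ==> x : Y ==> order x (nodal Y) = 1"
proof -
 assume Y: "finite Y" "x : Y"
 have ne: "[:- x, 1:] * nodal (Y - {x}) ~= 0" using nodal_nonzero[of Y] unfolding nodal_remove[OF Y] .
 have "order x (nodal Y) = order x [:- x, 1:] + order x (nodal (Y - {x}))"
  unfolding nodal_remove[OF Y] by (rule order_mult[OF ne])
 moreover have "order x [:- x, 1:] = 1" using order_power_n_n[of x 1] by simp
 moreover have "order x (nodal (Y - {x})) = 0" using Y by (intro order_0I) (simp add: poly_nodal_eq_0_iff)
 ultimately show ?thesis by simp
qed

section \<open>Conclusions for the polynomials and their quotients\<close>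

context nik_pade_poles
begin

abbreviation V :: "nat => complex => complex" where "V n z == cx (al n) / W n z"

lemma eventually_large: "EVN n. n >= 1 & D <= n"
 using eventually_ge_at_top[of "max 1 D"] by eventually_elim auto

lemma V_nonvanishing: "EVN n. V n holomorphic_on - Dlc & (ALL z. z ~: Dlc --> V n z ~= 0)"
 using eventually_large
proof eventually_elim
 case (elim n)
 hence n: "n >= 1" "D <= n" by auto
 show ?case using W_nonzero[OF n] normalizedD(5)[OF n] by (auto intro!: holomorphic_intros)
qed

lemma limit_last:
 assumes "compact K" "K <= - Dlc"
 shows "uniform_limit K (%n z. pc (a n m) z * V n z) (%z. pc T z * cx c0) sequentially"
proof (rule uniform_limit_cong[THEN iffD1, OF _ _ u_uniform_limit[OF assms(1)]])
 show "EVN n. ALL z:K. pc (u n) z = pc (a n m) z * V n z" using eventually_large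
 proof eventually_elim
  case (elim n)
  hence n: "n >= 1" "D <= n" by auto
  show ?case
  proof
   fix z assume "z : K"
   hence "W n z ~= 0" using W_nonzero[OF n] assms(2) by blast
   thus "pc (u n) z = pc (a n m) z * V n z" using a_m_eq[OF n, of z] by (simp add: field_simps)
  qed
 qed
qed auto

lemma cauchy_holomorphic: "1 <= l ==> l <= m ==> cn l holomorphic_on - Dlc"
 unfolding cauchy_eq_ctr[abs_def] by (rule ctr_holomorphic[OF g_last tame_const])

lemma limit_level:
 assumes j: "1 <= j" "j < m" and K: "compact K" "K <= - Dlc"
 shows "uniform_limit K (%n z. pc (a n j) z * V n z)
  (%z. pc T z * (cx c0 * cn (Suc j) z)) sequentially"
proof -
 let ?c = "cn (Suc j)"
 have "uniform_limit K (%n z. pc (u n) z - pc T z * cx c0) (%z. pc T z * cx c0 - pc T z * cx c0) sequentially"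
  by (intro uniform_limit_minus u_uniform_limit K uniform_limit_const)
 hence 0: "uniform_limit K (%n z. pc (u n) z - pc T z * cx c0) (%_. 0) sequentially" by simp
 have "?c holomorphic_on K" by (rule holomorphic_on_subset[OF cauchy_holomorphic K(2)]) (use j in auto)
 hence "continuous_on K ?c" by (rule holomorphic_on_imp_continuous_on)
 then obtain B where "!!z. z : K ==> norm (?c z) <= B" using compact_continuous_bound[OF K(1)] by blast
 hence 1: "uniform_limit K (%n z. ?c z * (pc (u n) z - pc T z * cx c0)) (%_. 0) sequentially"
  by (rule uniform_limit_zero_mult[OF 0])
 have "uniform_limit K (%n z. ?c z * (pc (u n) z - pc T z * cx c0)
   - (pc (u n) z * ?c z - cx (al n) * pc (a n j) z / W n z)
   + pc T z * (cx c0 * ?c z)) (%z. 0 - 0 + pc T z * (cx c0 * ?c z)) sequentially"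
  by (intro uniform_limit_add uniform_limit_minus 1 remainder_pos[OF j K] uniform_limit_const)
 thus ?thesis by (simp add: algebra_simps)
qed

lemma degree_u: "EVN n. degree (u n) = D"
proof -
 have "c0 * coeff T D ~= 0" using c0 T0 by simp
 hence "EVN n. coeff (u n) D ~= 0" using tendsto_imp_eventually_ne[OF u_coeff_limit[of D]] by simp
 with eventually_large show ?thesis
 proof eventually_elim
  case (elim n)
  have "D <= degree (u n)" using elim(2) by (rule le_degree)
  thus ?case using normalizedD(9)[of n] elim(1) by simp
 qed
qed

text \<open>For large \<open>n\<close> the factor \<open>u n\<close> has degree \<open>D\<close> and
  at least \<open>D\<close> zeros off \<open>Dl m\<close>, hence none on it. So the zeros of
  \<open>a n m\<close> on \<open>Dl m\<close> are the nodes \<open>Y n\<close>, all simple, and the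
  degree bound turns the lower bound for \<open>card (Y n)\<close> into an equality.\<close>

lemma last_polynomial:
 "EVN n. degree (a n m) = n & D <= n &
   card {x : interior (Dl m). poly (a n m) x = 0} = n - D &
   (ALL x:interior (Dl m). poly (a n m) x = 0 --> order x (a n m) = 1) &
   zero_count (cpoly (a n m)) (- Dlc) = D"
proof -
 have "EVN n. u n ~= 0" using eventually_large by eventually_elim (use normalizedD(7) in auto)
 hence cnt: "EVN n. D <= zero_count (cpoly (u n)) (- Dlc)"
 proof (rule count_off_interval[of "%_ _. 1" "%_. cx c0", rotated -1])
  show "uniform_limit K (%n z. pc (u n) z * 1) (%z. pc T z * cx c0) sequentially"
   if "compact K" for K using u_uniform_limit[OF that] by simp
 qed (use c0 in auto)
 from eventually_large degree_u cnt show ?thesis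
 proof eventually_elim
  case (elim n)
  hence n: "n >= 1" "D <= n" by auto
  note N = normalizedD[OF n]
  have cu: "cpoly (u n) ~= 0" using N(7) by simp
  have u_off: "pc (u n) z ~= 0" if "z : Dlc" for z
  proof
   assume z: "pc (u n) z = 0"
   have fin: "finite {z. z : - Dlc & pc (u n) z = 0}" by (rule finite_subset[OF _ poly_roots_finite[OF cu]]) auto
   have "D < order z (cpoly (u n)) + zero_count (cpoly (u n)) (- Dlc)" using elim(3) z cu order_root[of "cpoly (u n)" z] by simp
   also have "... = (SUM w:insert z {z. z : - Dlc & pc (u n) z = 0}. order w (cpoly (u n)))"
    using fin that by (simp add: zero_count_def)
   also have "... <= (\<Sum>w | pc (u n) w = 0. order w (cpoly (u n)))"
    by (rule sum_mono2[OF poly_roots_finite[OF cu]]) (use z in auto)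
   also have "... = D" using order_sum_degree[OF cu] elim(2) by simp
   finally show False by simp
  qed
  have zc: "zero_count (cpoly (u n)) (- Dlc) = D" using elim(2,3) zero_count_le_degree[OF cu, of "- Dlc"] by simp
  have cardY: "card (Y n) = n - D" using N(3,8) elim(2) n by linarith
  have am: "a n m ~= 0" using N(5,6,7) by auto
  have order_smult': "order x (a n m) = order x (nodal (Y n)) + order x (u n)" for x
  proof -
   have "order x (a n m) = order x (smult (al n) (a n m))" using N(5) by (simp add: order_smult)
   also have "... = order x (nodal (Y n)) + order x (u n)" unfolding N(6) by (rule order_mult) (use N(7) in simp)
   finally show ?thesis .
  qed
  have corder: "order z (cpoly (a n m)) = order z (cpoly (nodal (Y n))) + order z (cpoly (u n))" for z
  proof -
   have "order z (cpoly (a n m)) = order z (cpoly (smult (al n) (a n m)))" using N(5) by (simp add: order_smult)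
   also have "... = order z (cpoly (nodal (Y n)) * cpoly (u n))" unfolding N(6) by simp
   also have "... = order z (cpoly (nodal (Y n))) + order z (cpoly (u n))" by (rule order_mult) (use N(7) in simp)
   finally show ?thesis .
  qed
  have "degree (a n m) = degree (smult (al n) (a n m))" using N(5) by simp
  also have "... = card (Y n) + degree (u n)" unfolding N(6) using N(7) by (subst degree_mult_eq) auto
  finally have deg: "degree (a n m) = n" using cardY elim(2) n by simp
  have root: "poly (a n m) x = 0 \<longleftrightarrow> x : Y n" if x: "x : Dl m" for x
  proof -
   have "pc (u n) (cx x) ~= 0" using x by (intro u_off) auto
   hence "poly (u n) x ~= 0" by simp
   moreover have "al n * poly (a n m) x = poly (nodal (Y n)) x * poly (u n) x" using arg_cong[OF N(6), of "%p. poly p x"] by simp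
   ultimately show ?thesis using N(5) poly_nodal_eq_0_iff[OF N(1), of x] by (metis mult_eq_0_iff)
  qed
  have int: "interior (Dl m) <= Dl m" by (rule interior_subset)
  have Yeq: "{x : interior (Dl m). poly (a n m) x = 0} = Y n" using root N(2) int by blast
  have "zero_count (cpoly (a n m)) (- Dlc) = zero_count (cpoly (u n)) (- Dlc)"
  proof -
   have "order z (cpoly (nodal (Y n))) = 0" if "z ~: Dlc" for z
    using W_nonzero[OF n that] by (rule order_0I)
   hence o: "order z (cpoly (a n m)) = order z (cpoly (u n))" if "z : - Dlc" for z using corder[of z] that by simp
   have "pc (a n m) z = 0 \<longleftrightarrow> pc (u n) z = 0" if "z : - Dlc" for z
    using o[OF that] cu am order_root[of "cpoly (a n m)" z] order_root[of "cpoly (u n)" z] by simp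
   thus ?thesis unfolding zero_count_def using o by (intro sum.cong) auto
  qed
  moreover have "order x (a n m) = 1" if "x : interior (Dl m)" "poly (a n m) x = 0" for x
  proof -
   have x: "x : Y n" "x : Dl m" using that root int by auto
   have "pc (u n) (cx x) ~= 0" using x(2) by (intro u_off) auto
   hence "order x (u n) = 0" by (intro order_0I) simp
   thus ?thesis using order_smult'[of x] order_nodal[OF N(1) x(1)] by simp
  qed
  ultimately show ?case using deg n Yeq cardY zc by simp
 qed
qed

text \<open>Away from the zeros of \<open>T\<close> the factor \<open>u n\<close>, which is
  \<open>a n m\<close> times \<open>V n\<close>, is eventually bounded below, so the remainder may
  be divided by it.\<close>

lemma quotient_limit:
 assumes K: "compact K" "K <= - (Dlc Un Z)"
  and lim: "uniform_limit K (%n z. cx (al n) * pc (p n) z / W n z - pc (u n) z * g z) (%_. 0) sequentially"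
 shows "quotient_converges_on K (%n. cpoly (p n)) (%n. cpoly (a n m)) g"
proof -
 have "\<exists>dl>0. EVN n. ALL z:K. dl <= norm (pc (a n m) z * V n z)"
  by (rule nonzero_on_compact[OF V_nonvanishing _ _ limit_last K]) (use c0 in auto)
 then obtain dl where dl: "dl > 0" "EVN n. ALL z:K. dl <= norm (pc (a n m) z * V n z)" by blast
 show ?thesis unfolding quotient_converges_on_def
 proof
  show "EVN n. ALL z:K. pc (a n m) z ~= 0" using dl(2) by eventually_elim (use dl(1) in fastforce)
  show "uniform_limit K (%n z. pc (p n) z / pc (a n m) z) g sequentially"
  proof (rule uniform_limitI)
   fix e :: real assume e: "e > 0"
   have "e * dl > 0" using e dl(1) by simp
   from uniform_limitD[OF lim this] dl(2) eventually_large
   show "EVN n. ALL z:K. dist (pc (p n) z / pc (a n m) z) (g z) < e"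
   proof eventually_elim
    case (elim n)
    hence n: "n >= 1" "D <= n" by auto
    show ?case
    proof
     fix z assume z: "z : K"
     have Wz: "W n z ~= 0" using W_nonzero[OF n] z K(2) by blast
     let ?u = "pc (u n) z" and ?a = "pc (a n m) z" and ?p = "pc (p n) z"
     have ua: "?u = ?a * V n z" using a_m_eq[OF n, of z] Wz by (simp add: field_simps)
     have u: "dl <= norm ?u" using elim(2) z unfolding ua by blast
     hence u0: "?u ~= 0" using dl(1) by auto
     have "?p / ?a = (?p * V n z) / (?a * V n z)" using u0 unfolding ua by simp
     hence "?p / ?a - g z = (cx (al n) * ?p / W n z - ?u * g z) / ?u"
      using u0 unfolding ua[symmetric] by (simp add: diff_divide_distrib mult.commute)
     hence "norm (?p / ?a - g z) = norm (cx (al n) * ?p / W n z - ?u * g z) / norm ?u" by (simp only: norm_divide)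
     also have "... <= norm (cx (al n) * ?p / W n z - ?u * g z) / dl"
      using u dl(1) u0 by (intro divide_left_mono mult_pos_pos) auto
     also have "... < e"
     proof -
      have "dist (cx (al n) * ?p / W n z - ?u * g z) 0 < e * dl" using elim(1) z by blast
      thus ?thesis using dl(1) by (simp only: dist_norm diff_zero pos_divide_less_eq)
     qed
     finally show "dist (?p / ?a) (g z) < e" by (simp only: dist_norm)
    qed
   qed
  qed
 qed
qed

lemma quotient_level:
 assumes j: "1 <= j" "j < m" and K: "compact K" "K <= - (Dlc Un Z)"
 shows "quotient_converges_on K (%n. cpoly (a n j)) (%n. cpoly (a n m)) (cn (Suc j))"
proof (rule quotient_limit[OF K])
 have "K <= - Dlc" using K(2) by blast
 from uniform_limit_zero_mult[OF remainder_pos[OF j K(1) this], of "%_. - 1" 1]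
 show "uniform_limit K (%n z. cx (al n) * pc (a n j) z / W n z - pc (u n) z * cn (Suc j) z) (%_. 0) sequentially"
  by simp
qed

lemma quotient_zero:
 assumes K: "compact K" "K <= - (Dlc Un Z)"
 shows "quotient_converges_on K (%n. cpoly (a n 0)) (%n. cpoly (a n m)) f"
proof (rule quotient_limit[OF K])
 have sub: "K <= - Dlc" using K(2) by blast
 have Tz: "pc T z ~= 0" if "z : K" for z using that K(2) by blast
 have "continuous_on K (%z. 1 / pc T z)" by (intro continuous_intros) (use Tz in auto)
 then obtain B where "!!z. z : K ==> norm (1 / pc T z) <= B" using compact_continuous_bound[OF K(1)] by blast
 from uniform_limit_zero_mult[OF remainder_zero[OF K(1) sub] this]
 have "uniform_limit K (%n z. 1 / pc T z * (cx (al n) * pc (T * a n 0) z / W n z - pc (u n) z * ph z)) (%_. 0) sequentially" .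
 thus "uniform_limit K (%n z. cx (al n) * pc (a n 0) z / W n z - pc (u n) z * f z) (%_. 0) sequentially"
 proof (rule uniform_limit_cong'[THEN iffD1, rotated -1])
  fix n z assume z: "z : K"
  show "1 / pc T z * (cx (al n) * pc (T * a n 0) z / W n z - pc (u n) z * ph z)
    = cx (al n) * pc (a n 0) z / W n z - pc (u n) z * f z"
   using Tz[OF z] by (simp add: f_eq right_diff_distrib)
 qed simp
qed

lemma level_nonvanishing:
 assumes j: "1 <= j" "j < m" and z: "z ~: Dlc"
 shows "cx c0 * cn (Suc j) z ~= 0" using cauchy_nonzero[OF g_last z, of "Suc j"] j c0 by simp

lemma level_polynomial:
 assumes j: "1 <= j" "j < m"
 shows "EVN n. a n j ~= 0 & D + m <= n + j &
    sign_changes_at_least (a n j) (Dl m) (n + j - (D + m)) & zero_count (cpoly (a n j)) (- Dlc) >= D"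
proof -
 have hol: "(%z. cx c0 * cn (Suc j) z) holomorphic_on - Dlc"
  using j by (intro holomorphic_intros cauchy_holomorphic) auto
 have sc: "EVN n. a n j ~= 0 & D + m <= n + j & sign_changes_at_least (a n j) (Dl m) (n + j - (D + m))"
  using eventually_ge_at_top[of "D + m + 1"]
 proof eventually_elim
  case (elim n)
  hence n: "n >= 1" "D <= n" "D + m <= n + j" by auto
  interpret S: mlhp_sys m sg Dl v t T n "a n" by (rule mlhp_sys[OF n(1,2)])
  have alt: "alternates (poly (a n j)) (Dl m) (n + j - (D + m))" using S.pade_pos[OF j n(3)] by blast
  \<comment> \<open>One sign change excludes the zero polynomial; \<open>n >= D + m + 1\<close>
    guarantees it.\<close>
  have "a n j ~= 0"
  proof
   assume z: "a n j = 0"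
   obtain x where x: "ALL i<n + j - (D + m). x i < x (Suc i) & poly (a n j) (x i) * poly (a n j) (x (Suc i)) < 0"
    using alt unfolding alternates_def by blast
   have "0 < n + j - (D + m)" using elim j by linarith
   thus False using x z by (metis less_irrefl mult_zero_left poly_0)
  qed
  thus ?case using alt n(3) unfolding sign_changes_at_least_def alternates_def by blast
 qed
 have "EVN n. D <= zero_count (cpoly (a n j)) (- Dlc)"
  by (rule count_off_interval[OF V_nonvanishing hol level_nonvanishing[OF j] limit_level[OF j]])
   (use sc in \<open>auto elim: eventually_mono\<close>)
 with sc show ?thesis by eventually_elim blast
qed

lemma level_attracts:
 assumes j: "1 <= j" "j < m" and ze: "ze : Z"
 shows "attracts_zeros (%n. cpoly (a n j)) ze (order ze (cpoly T))"
proof (rule attracts[OF V_nonvanishing _ level_nonvanishing[OF j] limit_level[OF j] ze])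
 show "(%z. cx c0 * cn (Suc j) z) holomorphic_on - Dlc"
  using j by (intro holomorphic_intros cauchy_holomorphic) auto
qed

lemma level_others:
 assumes j: "1 <= j" "j < m"
 shows "other_zeros_accumulate (%n. cpoly (a n j)) Z Dlc"
proof (rule others_accumulate[OF V_nonvanishing _ level_nonvanishing[OF j] limit_level[OF j]])
 show "(%z. cx c0 * cn (Suc j) z) holomorphic_on - Dlc"
  using j by (intro holomorphic_intros cauchy_holomorphic) auto
qed

lemma last_attracts:
 assumes ze: "ze : Z"
 shows "attracts_zeros (%n. cpoly (a n m)) ze (pole_order f ze)" unfolding poles(2)[OF ze]
 by (rule attracts[OF V_nonvanishing _ _ limit_last ze]) (use c0 in auto)

end

theorem theorem1p1:
  fixes m D :: nat
    and \<sigma> :: "nat \<Rightarrow> smeasure"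
    and \<Delta> :: "nat \<Rightarrow> real set"
    and v t :: "nat \<Rightarrow> real poly"
    and T :: "real poly"
    and a :: "nat \<Rightarrow> nat \<Rightarrow> real poly"
    and f :: "complex \<Rightarrow> complex"
    and \<Delta>m Z :: "complex set"
  assumes "m \<ge> 2"
    and "nikishin_generators m \<sigma> \<Delta>"
    and "\<forall>k\<in>{1..m}. rational_data (v k) (t k)"
    and T_def: "T = Lcm (t ` {1..m})"
    and D_def: "D = degree T"
    and "\<forall>n\<ge>1. mlhp m \<sigma> v t n (a n)"
    and f_def: "f = limit_fun m \<sigma> v t"
    and \<Delta>m_def: "\<Delta>m = of_real ` \<Delta> m"
    and Z_def: "Z = {z. poly (cpoly T) z = 0}"
    and "Z \<inter> of_real ` (\<Delta> 1 \<union> \<Delta> m) = {}"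
    and "finite (pole_set f (- \<Delta>m))"
    and "(\<Sum>\<zeta>\<in>pole_set f (- \<Delta>m). pole_order f \<zeta>) = D"
    and "carleman (\<sigma> m) \<or> bounded (\<Delta> (m - 1))"
  shows "(\<forall>K. compact K \<and> K \<subseteq> - (\<Delta>m \<union> Z) \<longrightarrow>
            (\<forall>j\<in>{1..m-1}. quotient_converges_on K (\<lambda>n. cpoly (a n j)) (\<lambda>n. cpoly (a n m))
                              (cauchy (nik \<sigma> m (Suc j)))) \<and>
            quotient_converges_on K (\<lambda>n. cpoly (a n 0)) (\<lambda>n. cpoly (a n m)) f)
       \<and> (\<forall>\<^sub>F n in sequentially. degree (a n m) = n \<and> D \<le> n \<and>
            card {x \<in> interior (\<Delta> m). poly (a n m) x = 0} = n - D \<and>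
            (\<forall>x\<in>interior (\<Delta> m). poly (a n m) x = 0 \<longrightarrow> order x (a n m) = 1) \<and>
            zero_count (cpoly (a n m)) (- \<Delta>m) = D)
       \<and> (\<forall>\<zeta>\<in>pole_set f (- \<Delta>m). attracts_zeros (\<lambda>n. cpoly (a n m)) \<zeta> (pole_order f \<zeta>))
       \<and> (\<forall>j\<in>{1..m-1}.
            (\<forall>\<^sub>F n in sequentially. a n j \<noteq> 0 \<and> D + m \<le> n + j \<and>
               sign_changes_at_least (a n j) (\<Delta> m) (n + j - (D + m)) \<and>
               zero_count (cpoly (a n j)) (- \<Delta>m) \<ge> D) \<and>
            (\<forall>\<zeta>\<in>Z. attracts_zeros (\<lambda>n. cpoly (a n j)) \<zeta> (order \<zeta> (cpoly T))) \<and>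
            other_zeros_accumulate (\<lambda>n. cpoly (a n j)) Z \<Delta>m)"
proof -
 have t0: "t k ~= 0" if "k : {1..m}" for k
 proof -
  have "rational_data (v k) (t k)" using assms(3) that by blast
  thus ?thesis unfolding rational_data_def by auto
 qed
 have T0: "T ~= 0"
 proof -
  have "0 ~: t ` {1..m}" using t0 by (metis imageE)
  thus ?thesis unfolding T_def by (subst Lcm_0_iff) auto
 qed
 have zero_off: "poly T x ~= 0" if "x : \<Delta> 1 Un \<Delta> m" for x
 proof
  assume "poly T x = 0"
  hence "cx x : Z" by (simp add: Z_def)
  moreover have "cx x : cx ` (\<Delta> 1 Un \<Delta> m)" using that by blast
  ultimately show False using assms(10) by blast
 qed
 interpret S: nik_pade_poles m \<sigma> \<Delta> v t T a
 proof
  show "m >= 2" "nikishin_generators m \<sigma> \<Delta>" by fact+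
  show "T ~= 0" by (rule T0)
  show "t k dvd T" if "1 <= k" "k <= m" for k unfolding T_def using that by (intro dvd_Lcm) auto
  show "mlhp m \<sigma> v t n (a n)" if "n >= 1" for n using assms(6) that by blast
  show "poly T x ~= 0" if "x : \<Delta> 1" for x using zero_off that by blast
  show "poly T x ~= 0" if "x : \<Delta> m" for x using zero_off that by blast
  show "carleman (\<sigma> m) | bounded (\<Delta> (m - 1))" by fact
  show "finite (pole_set (limit_fun m \<sigma> v t) (- cx ` \<Delta> m))"
   using assms(11) unfolding f_def \<Delta>m_def .
  show "(SUM \<zeta>:pole_set (limit_fun m \<sigma> v t) (- cx ` \<Delta> m). pole_order (limit_fun m \<sigma> v t) \<zeta>) = degree T"
   using assms(12) unfolding f_def \<Delta>m_def D_def .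
 qed
 have j: "1 <= j & j < m" if "j : {1..m-1}" for j using that assms(1) by auto
 show ?thesis unfolding f_def \<Delta>m_def D_def Z_def
 proof (intro conjI allI impI ballI)
  fix K :: "complex set" and j
  assume K: "compact K & K <= - (cx ` \<Delta> m Un {z. pc T z = 0})" and "j : {1..m-1}"
  thus "quotient_converges_on K (%n. cpoly (a n j)) (%n. cpoly (a n m)) (cauchy (nik \<sigma> m (Suc j)))"
   using j[of j] by (intro S.quotient_level) auto
 next
  fix K :: "complex set"
  assume "compact K & K <= - (cx ` \<Delta> m Un {z. pc T z = 0})"
  thus "quotient_converges_on K (%n. cpoly (a n 0)) (%n. cpoly (a n m)) (limit_fun m \<sigma> v t)"
   by (intro S.quotient_zero) auto
 next
  show "EVN n. degree (a n m) = n & degree T <= n &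
      card {x : interior (\<Delta> m). poly (a n m) x = 0} = n - degree T &
      (ALL x:interior (\<Delta> m). poly (a n m) x = 0 --> order x (a n m) = 1) &
      zero_count (cpoly (a n m)) (- cx ` \<Delta> m) = degree T" by (rule S.last_polynomial)
 next
  fix \<zeta> assume "\<zeta> : pole_set (limit_fun m \<sigma> v t) (- cx ` \<Delta> m)"
  thus "attracts_zeros (%n. cpoly (a n m)) \<zeta> (pole_order (limit_fun m \<sigma> v t) \<zeta>)"
   unfolding S.poles(1) by (rule S.last_attracts)
 next
  fix j assume "j : {1..m-1}"
  thus "EVN n. a n j ~= 0 & degree T + m <= n + j &
        sign_changes_at_least (a n j) (\<Delta> m) (n + j - (degree T + m)) &
        degree T <= zero_count (cpoly (a n j)) (- cx ` \<Delta> m)"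
   using j[of j] by (intro S.level_polynomial) auto
 next
  fix j \<zeta> assume "j : {1..m-1}" "\<zeta> : {z. pc T z = 0}"
  thus "attracts_zeros (%n. cpoly (a n j)) \<zeta> (order \<zeta> (cpoly T))"
   using j[of j] by (intro S.level_attracts) auto
 next
  fix j assume "j : {1..m-1}"
  thus "other_zeros_accumulate (%n. cpoly (a n j)) {z. pc T z = 0} (cx ` \<Delta> m)"
   using j[of j] by (intro S.level_others) auto
 qed
qed

end
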